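(* Assume that either (i) $d\in\{2,3\}$, $r>3$, $q\in[3,r)$ and $\gamma<0$, or (ii) $d=r=3$, $\gamma=0$ and $2\beta\mu>1$. Let $\omega\subset\subset\mathbb{T}^d$ be a non-empty open subset, let $n\in\mathbb{N}$ and $\mathcal{K}=\mathrm{span}\{\boldsymbol{w}_k:k=1,\ldots,n\}\subset\mathbb{H}$, where $\boldsymbol{w}_k$ are eigenfunctions of the Stokes operator $\mathrm{A}$ forming part of an orthonormal basis of $\mathbb{H}$. Let $\boldsymbol{f}_e\in\mathbb{H}$ and let $\boldsymbol{y}_e\in\mathrm{D}(\mathrm{A})$ satisfy $\mu\mathrm{A}\boldsymbol{y}_e+\mathcal{B}(\boldsymbol{y}_e)+\alpha\boldsymbol{y}_e+\beta\mathcal{C}_1(\boldsymbol{y}_e)+\gamma\mathcal{C}_2(\boldsymbol{y}_e)=\boldsymbol{f}_e$. Assume also that $\boldsymbol{z}(0)=\boldsymbol{y}_0-\boldsymbol{y}_e\in\mathcal{K}$ with $\|\boldsymbol{z}(0)\|_{\mathbb{H}}<\rho$, for some $\rho>0$. Then for every $\delta>0$ there exists a linear continuous operator $\mathrm{R}:\mathcal{K}\to\mathrm{L}^2(\omega;\mathbb{R}^d)$ so that the problem $$\frac{\mathrm{d}\boldsymbol{z}(t)}{\mathrm{d}t}+\mu\mathrm{A}\boldsymbol{z}(t)+\widetilde{\mathcal{B}}(\boldsymbol{z}(t))+\alpha\boldsymbol{z}(t)+\beta\widetilde{\mathcal{C}}_1(\boldsymbol{z}(t))+\gamma\widetilde{\mathcal{C}}_2(\boldsymbol{z}(t))+\partial\mathrm{I}_{\mathcal{K}}(\boldsymbol{z}(t))-\mathcal{P}m\mathrm{R}(\mathrm{P}_{\mathcal{K}}\boldsymbol{z}(t))\ni\boldsymbol{0}\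 \text{ for a.e. } t>0,\qquad\boldsymbol{z}(0)=\boldsymbol{y}_0-\boldsymbol{y}_e,$$ has a unique weak solution $\boldsymbol{z}$ (in the sense defined in the context), satisfying $$\boldsymbol{z}\in\mathrm{C}([0,T];\mathbb{H})\cap\mathrm{L}^2(0,T;\mathbb{V})\cap\mathrm{L}^{r+1}(0,T;\widetilde{\mathbb{L}}^{r+1}),\qquad\frac{\mathrm{d}\boldsymbol{z}}{\mathrm{d}t}\in\mathrm{L}^{\frac{r+1}{r}}(\tau,T;\mathbb{V}'),$$ for any $0<\tau<T$. Furthermore, the local exponential stability condition $\lim_{t\to\infty}e^{\delta t}\|\boldsymbol{z}(t)\|_{\mathbb{H}}=0$ holds. Also, $\boldsymbol{z}(t)\in\mathcal{K}$ for all $t\in[0,T]$.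
   Context: Parameters: $\mu,\alpha,\beta>0$, $\gamma\in\mathbb{R}$, $r,q\in[1,\infty)$ with $r>q$. $\mathbb{T}^d=(\mathbb{R}/\mathrm{L}\mathbb{Z})^d$ with $\mathrm{L}>0$; $\mathrm{C}^\infty_{\mathrm p}$ and $\mathbb{H}^s_{\mathrm p}$ denote smooth, respectively Sobolev $\mathrm{H}^s$, $\mathbb{R}^d$-valued periodic functions on $\mathbb{T}^d$ (no zero-mean condition is imposed). Let $\mathcal{V}=\{\boldsymbol{y}\in\mathrm{C}^\infty_{\mathrm p}(\mathbb{T}^d;\mathbb{R}^d):\nabla\cdot\boldsymbol{y}=0\}$; $\mathbb{H}$, $\widetilde{\mathbb{L}}^p$ and $\mathbb{V}$ are the closures of $\mathcal{V}$ in $\mathrm{L}^2$, $\mathrm{L}^p$ ($p>2$) and $\mathrm{H}^1$ on $\mathbb{T}^d$ respectively, with norms $\|\boldsymbol{y}\|_{\mathbb{H}}=\|\boldsymbol{y}\|_{\mathrm{L}^2}$, $\|\boldsymbol{y}\|_{\widetilde{\mathbb{L}}^p}=\|\boldsymbol{y}\|_{\mathrm{L}^p}$, $\|\boldsymbol{y}\|_{\mathbb{V}}^2=\|\boldsymbol{y}\|_{\mathrm{L}^2}^2+\|\nabla\boldsymbol{y}\|_{\mathrm{L}^2}^2$; $\mathbb{V}'$ is the dual of $\mathbb{V}$ with $\mathbb{V}\subset\mathbb{H}\cong\mathbb{H}'\subset\mathbb{V}'$; $(\cdot,\cdot)$ is the $\mathrm{L}^2$ inner product (and the corresponding duality pairing).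 $\mathcal{P}$ is the Leray (Helmholtz–Hodge) projection. $\mathrm{A}\boldsymbol{y}=-\mathcal{P}\Delta\boldsymbol{y}=-\Delta\boldsymbol{y}$ with $\mathrm{D}(\mathrm{A})=\mathbb{V}\cap\mathbb{H}^2_{\mathrm p}(\mathbb{T}^d)$ is the Stokes operator. $\mathcal{B}(\boldsymbol{y})=\mathcal{P}[(\boldsymbol{y}\cdot\nabla)\boldsymbol{y}]$, $\mathcal{C}_1(\boldsymbol{y})=\mathcal{P}(|\boldsymbol{y}|^{r-1}\boldsymbol{y})$, $\mathcal{C}_2(\boldsymbol{y})=\mathcal{P}(|\boldsymbol{y}|^{q-1}\boldsymbol{y})$; $\widetilde{\mathcal{B}}(\boldsymbol{y})=\mathcal{B}(\boldsymbol{y}+\boldsymbol{y}_e)-\mathcal{B}(\boldsymbol{y}_e)$, $\widetilde{\mathcal{C}}_i(\boldsymbol{y})=\mathcal{C}_i(\boldsymbol{y}+\boldsymbol{y}_e)-\mathcal{C}_i(\boldsymbol{y}_e)$, $i=1,2$. $\mathrm{P}_{\mathcal{K}}$ is the orthogonal projection of $\mathbb{H}$ onto $\mathcal{K}$. The map $m:\mathrm{L}^2(\omega;\mathbb{R}^d)\to\mathrm{L}^2(\mathbb{T}^d;\mathbb{R}^d)$ is extension by zero outside $\omega$. $\mathrm{I}_{\mathcal{K}}:\mathbb{H}\to[0,+\infty]$ is the indicator function ($0$ on $\mathcal{K}$, $+\infty$ off $\mathcal{K}$) and $\partial\mathrm{I}_{\mathcal{K}}$ its subdifferential: $\partial\mathrm{I}_{\mathcal{K}}(\boldsymbol{x})=\{\boldsymbol{w}\in\mathbb{H}:(\boldsymbol{w},\boldsymbol{x}-\boldsymbol{u})\ge0\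 \forall\boldsymbol{u}\in\mathcal{K}\}$ for $\boldsymbol{x}\in\mathcal{K}$, and $\emptyset$ for $\boldsymbol{x}\notin\mathcal{K}$. Weak solution: with $\mathfrak{F}:=-\mathcal{P}m\mathrm{R}\mathrm{P}_{\mathcal{K}}$, a function $\boldsymbol{z}$ on $[0,\infty)$ such that, for every $T>0$, $\boldsymbol{z}\in\mathrm{C}([0,T];\mathbb{H})\cap\mathrm{L}^2(0,T;\mathbb{V})\cap\mathrm{L}^{r+1}(0,T;\widetilde{\mathbb{L}}^{r+1})$, $\frac{\mathrm{d}\boldsymbol{z}}{\mathrm{d}t}\in\mathrm{L}^{\frac{r+1}{r}}(\tau,T;\mathbb{H})$ for any $\tau\in(0,T)$, and for any such $\tau$ there exists $\xi(t)\in\partial\mathrm{I}_{\mathcal{K}}(\boldsymbol{z}(t))$ for a.e. $t\in[\tau,T]$ with $$-\int_\tau^t(\boldsymbol{z},\partial_s\boldsymbol{v})\,\mathrm{d}s+\mu\int_\tau^t(\nabla\boldsymbol{z},\nabla\boldsymbol{v})\,\mathrm{d}s+\alpha\int_\tau^t(\boldsymbol{z},\boldsymbol{v})\,\mathrm{d}s+\int_\tau^t(((\boldsymbol{z}+\boldsymbol{y}_e)\cdot\nabla)(\boldsymbol{z}+\boldsymbol{y}_e),\boldsymbol{v})\,\mathrm{d}s+\beta\int_\tau^t(|\boldsymbol{z}+\boldsymbol{y}_e|^{r-1}(\boldsymbol{z}+\boldsymbol{y}_e),\boldsymbol{v})\,\mathrm{d}s$$ $$+\gamma\int_\tau^t(|\boldsymbol{z}+\boldsymbol{y}_e|^{q-1}(\boldsymbol{z}+\boldsymbol{y}_e),\boldsymbol{v})\,\mathrm{d}s+\int_\tau^t(\mathfrak{F}\boldsymbol{z},\boldsymbol{v})\,\mathrm{d}s+\int_\tau^t(\xi,\boldsymbol{v})\,\mathrm{d}s$$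 $$=-(\boldsymbol{z}(t),\boldsymbol{v}(t))+(\boldsymbol{z}(\tau),\boldsymbol{v}(\tau))+\int_\tau^t((\boldsymbol{y}_e\cdot\nabla)\boldsymbol{y}_e,\boldsymbol{v})\,\mathrm{d}s+\beta\int_\tau^t(|\boldsymbol{y}_e|^{r-1}\boldsymbol{y}_e,\boldsymbol{v})\,\mathrm{d}s+\gamma\int_\tau^t(|\boldsymbol{y}_e|^{q-1}\boldsymbol{y}_e,\boldsymbol{v})\,\mathrm{d}s$$ for all $t\in[\tau,T]$ and all divergence-free $\boldsymbol{v}\in\mathrm{C}^\infty_{\mathrm p}(\mathbb{T}^d\times[\tau,T];\mathbb{R}^d)$ (periodic in space), and $\lim_{\tau\to0^+}\|\boldsymbol{z}(\tau)-(\boldsymbol{y}_0-\boldsymbol{y}_e)\|_{\mathbb{H}}=0$. *)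

theory Defs
  imports "HOL-Analysis.Analysis"
begin

(* Functions on the torus (R/LZ)^d, d = CARD('n), are L-periodic functions on real^'n, and subsets
   of the torus are L-periodic subsets of real^'n.  Elements of Lebesgue and Sobolev spaces are
   represented by functions, so identities between them are almost-everywhere identities. *)

type_synonym 'n vfield = "real^'n \<Rightarrow> real^'n"

section \<open>Smooth functions\<close>

(* On S = {a..b} \<times> UNIV the derivatives are one-sided at the end points of {a..b}. *)
primrec Ck_on :: "nat \<Rightarrow> 'a::euclidean_space set \<Rightarrow> ('a \<Rightarrow> 'b::real_normed_vector) \<Rightarrow> bool" where
  "Ck_on 0 S f \<longleftrightarrow> continuous_on S f"
| "Ck_on (Suc k) S f \<longleftrightarrow> f differentiable_on S \<and>
     (\<forall>b\<in>Basis. Ck_on k S (\<lambda>x. frechet_derivative f (at x within S) b))"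

definition smooth_on :: "'a::euclidean_space set \<Rightarrow> ('a \<Rightarrow> 'b::real_normed_vector) \<Rightarrow> bool" where
  "smooth_on S f \<longleftrightarrow> (\<forall>k. Ck_on k S f)"

section \<open>Lebesgue spaces on the torus\<close>

definition periodic_set :: "real \<Rightarrow> (real^'n) set \<Rightarrow> bool" where
  "periodic_set L S \<longleftrightarrow> (\<forall>x i. x + axis i L \<in> S \<longleftrightarrow> x \<in> S)"

definition periodic_on :: "real \<Rightarrow> (real^'n) set \<Rightarrow> (real^'n \<Rightarrow> 'b) \<Rightarrow> bool" where
  "periodic_on L S f \<longleftrightarrow> (\<forall>x\<in>S. \<forall>i. f (x + axis i L) = f x)"

(* Lebesgue measure of the torus, restricted to the periodic set S, computed on one period cell. *)
definition tmeas :: "real \<Rightarrow> (real^'n) set \<Rightarrow> (real^'n) measure" where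
  "tmeas L S = lebesgue_on (cbox 0 (\<chi> i. L) \<inter> S)"

abbreviation torus :: "real \<Rightarrow> (real^'n) measure" where
  "torus L \<equiv> tmeas L UNIV"

definition Lp_on :: "real \<Rightarrow> (real^'n) set \<Rightarrow> real \<Rightarrow> 'n vfield set" where
  "Lp_on L S p = {f. periodic_on L S f \<and> f \<in> borel_measurable (tmeas L S) \<and>
                     integrable (tmeas L S) (\<lambda>x. norm (f x) powr p)}"

definition norm_Lp_on :: "real \<Rightarrow> (real^'n) set \<Rightarrow> real \<Rightarrow> 'n vfield \<Rightarrow> real" where
  "norm_Lp_on L S p f = (LINT x|tmeas L S. norm (f x) powr p) powr (1 / p)"

abbreviation Lp :: "real \<Rightarrow> real \<Rightarrow> 'n::finite vfield set" where
  "Lp L \<equiv> Lp_on L UNIV"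

abbreviation norm_Lp :: "real \<Rightarrow> real \<Rightarrow> 'n::finite vfield \<Rightarrow> real" where
  "norm_Lp L \<equiv> norm_Lp_on L UNIV"

(* The L2 inner product, also used for the duality pairing of Lp and its dual. *)
definition ip :: "real \<Rightarrow> 'n::finite vfield \<Rightarrow> 'n vfield \<Rightarrow> real" where
  "ip L f g = (LINT x|torus L. f x \<bullet> g x)"

section \<open>Sobolev spaces on the torus\<close>

definition has_weak_partial :: "real \<Rightarrow> 'n::finite \<Rightarrow> 'n vfield \<Rightarrow> 'n vfield \<Rightarrow> bool" where
  "has_weak_partial L i f g \<longleftrightarrow>
     (\<forall>\<phi> :: real^'n \<Rightarrow> real. smooth_on UNIV \<phi> \<and> periodic_on L UNIV \<phi> \<longrightarrow>
        (LINT x|torus L. frechet_derivative \<phi> (at x) (axis i 1) *\<^sub>R f x) =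
        - (LINT x|torus L. \<phi> x *\<^sub>R g x))"

definition wpartial :: "real \<Rightarrow> 'n::finite \<Rightarrow> 'n vfield \<Rightarrow> 'n vfield" where
  "wpartial L i f = (SOME g. g \<in> Lp L 2 \<and> has_weak_partial L i f g)"

definition H1 :: "real \<Rightarrow> 'n::finite vfield set" where
  "H1 L = {f \<in> Lp L 2. \<forall>i. \<exists>g \<in> Lp L 2. has_weak_partial L i f g}"

definition H2 :: "real \<Rightarrow> 'n::finite vfield set" where
  "H2 L = {f \<in> H1 L. \<forall>i. wpartial L i f \<in> H1 L}"

definition grad_ip :: "real \<Rightarrow> 'n::finite vfield \<Rightarrow> 'n vfield \<Rightarrow> real" where
  "grad_ip L f g = (\<Sum>i\<in>UNIV. ip L (wpartial L i f) (wpartial L i g))"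

definition norm_H1 :: "real \<Rightarrow> 'n::finite vfield \<Rightarrow> real" where
  "norm_H1 L f = sqrt ((norm_Lp L 2 f)\<^sup>2 + (\<Sum>i\<in>UNIV. (norm_Lp L 2 (wpartial L i f))\<^sup>2))"

definition laplacian :: "real \<Rightarrow> 'n::finite vfield \<Rightarrow> 'n vfield" where
  "laplacian L f = (\<lambda>x. \<Sum>i\<in>UNIV. wpartial L i (wpartial L i f) x)"

section \<open>Solenoidal spaces\<close>

definition solenoidal_smooth :: "real \<Rightarrow> 'n::finite vfield set" where
  "solenoidal_smooth L = {y. smooth_on UNIV y \<and> periodic_on L UNIV y \<and>
     (\<forall>x. (\<Sum>i\<in>UNIV. frechet_derivative y (at x) (axis i 1) $ i) = 0)}"

definition closure_wrt :: "('x \<Rightarrow> 'y) set \<Rightarrow> (('x \<Rightarrow> 'y) \<Rightarrow> real) \<Rightarrow> ('x \<Rightarrow> 'y) set \<Rightarrow>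
    ('x \<Rightarrow> 'y::real_normed_vector) set" where
  "closure_wrt X N S =
     {f \<in> X. \<exists>s. (\<forall>k::nat. s k \<in> S) \<and> (\<lambda>k. N (\<lambda>x. f x - s k x)) \<longlonglongrightarrow> 0}"

definition Hsp :: "real \<Rightarrow> 'n::finite vfield set" where
  "Hsp L = closure_wrt (Lp L 2) (norm_Lp L 2) (solenoidal_smooth L)"

definition Lpsp :: "real \<Rightarrow> real \<Rightarrow> 'n::finite vfield set" where
  "Lpsp L p = closure_wrt (Lp L p) (norm_Lp L p) (solenoidal_smooth L)"

definition Vsp :: "real \<Rightarrow> 'n::finite vfield set" where
  "Vsp L = closure_wrt (H1 L) (norm_H1 L) (solenoidal_smooth L)"

definition Vdual :: "real \<Rightarrow> ('n::finite vfield \<Rightarrow> real) set" where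
  "Vdual L = {G. (\<forall>u\<in>Vsp L. \<forall>v\<in>Vsp L. \<forall>a b.
                    G (\<lambda>x. a *\<^sub>R u x + b *\<^sub>R v x) = a * G u + b * G v) \<and>
                 (\<exists>C. \<forall>u\<in>Vsp L. \<bar>G u\<bar> \<le> C * norm_H1 L u)}"

definition norm_Vdual :: "real \<Rightarrow> ('n::finite vfield \<Rightarrow> real) \<Rightarrow> real" where
  "norm_Vdual L G = (SUP u\<in>{u \<in> Vsp L. norm_H1 L u \<le> 1}. \<bar>G u\<bar>)"

section \<open>Operators\<close>

(* Orthogonal projection in L2 onto a closed subspace S, unique up to a.e. equality. *)
definition orth_proj :: "real \<Rightarrow> 'n::finite vfield set \<Rightarrow> 'n vfield \<Rightarrow> 'n vfield" where
  "orth_proj L S f = (SOME h. h \<in> S \<and> (\<forall>v\<in>S. ip L (\<lambda>x. f x - h x) v = 0))"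

definition leray :: "real \<Rightarrow> 'n::finite vfield \<Rightarrow> 'n vfield" where
  "leray L = orth_proj L (Hsp L)"

definition stokes_dom :: "real \<Rightarrow> 'n::finite vfield set" where
  "stokes_dom L = Vsp L \<inter> H2 L"

definition stokes :: "real \<Rightarrow> 'n::finite vfield \<Rightarrow> 'n vfield" where
  "stokes L y = (\<lambda>x. - leray L (laplacian L y) x)"

(* (y . nabla) y *)
definition advection :: "real \<Rightarrow> 'n::finite vfield \<Rightarrow> 'n vfield" where
  "advection L y = (\<lambda>x. \<Sum>i\<in>UNIV. (y x $ i) *\<^sub>R wpartial L i y x)"

(* |y|^(p-1) y *)
definition absorption :: "real \<Rightarrow> 'n::finite vfield \<Rightarrow> 'n vfield" where
  "absorption p y = (\<lambda>x. (norm (y x) powr (p - 1)) *\<^sub>R y x)"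

definition Bop :: "real \<Rightarrow> 'n::finite vfield \<Rightarrow> 'n vfield" where
  "Bop L y = leray L (advection L y)"

definition Cop :: "real \<Rightarrow> real \<Rightarrow> 'n::finite vfield \<Rightarrow> 'n vfield" where
  "Cop L p y = leray L (absorption p y)"

definition stationary_solution ::
    "real \<Rightarrow> real \<Rightarrow> real \<Rightarrow> real \<Rightarrow> real \<Rightarrow> real \<Rightarrow> real \<Rightarrow> 'n::finite vfield \<Rightarrow> 'n vfield \<Rightarrow> bool" where
  "stationary_solution L \<mu> \<alpha> \<beta> \<gamma> r q f y \<longleftrightarrow>
     (AE x in torus L. \<mu> *\<^sub>R stokes L y x + Bop L y x + \<alpha> *\<^sub>R y x
        + \<beta> *\<^sub>R Cop L r y x + \<gamma> *\<^sub>R Cop L q y x = f x)"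

section \<open>The finite-dimensional constraint and the feedback\<close>

(* w 1, w 2, ... *)
definition orthonormal_basis_H :: "real \<Rightarrow> (nat \<Rightarrow> 'n::finite vfield) \<Rightarrow> bool" where
  "orthonormal_basis_H L w \<longleftrightarrow>
     (\<forall>k\<ge>1. w k \<in> Hsp L) \<and>
     (\<forall>j\<ge>1. \<forall>k\<ge>1. ip L (w j) (w k) = (if j = k then 1 else 0)) \<and>
     (\<forall>h\<in>Hsp L. \<forall>\<epsilon>>0. \<exists>N c. norm_Lp L 2 (\<lambda>x. h x - (\<Sum>k=1..N. c k *\<^sub>R w k x)) < \<epsilon>)"

definition stokes_eigenfunction :: "real \<Rightarrow> 'n::finite vfield \<Rightarrow> bool" where
  "stokes_eigenfunction L u \<longleftrightarrow> u \<in> stokes_dom L \<and> \<not> (AE x in torus L. u x = 0) \<and>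
     (\<exists>\<kappa>::real. AE x in torus L. stokes L u x = \<kappa> *\<^sub>R u x)"

definition span_H :: "real \<Rightarrow> (nat \<Rightarrow> 'n::finite vfield) \<Rightarrow> nat \<Rightarrow> 'n vfield set" where
  "span_H L w n = {u \<in> Hsp L. \<exists>c. AE x in torus L. u x = (\<Sum>k=1..n. c k *\<^sub>R w k x)}"

definition subdiff_ind :: "real \<Rightarrow> 'n::finite vfield set \<Rightarrow> 'n vfield \<Rightarrow> 'n vfield set" where
  "subdiff_ind L K x =
     (if x \<in> K then {w \<in> Hsp L. \<forall>u\<in>K. ip L w (\<lambda>s. x s - u s) \<ge> 0} else {})"

definition ext_zero :: "(real^'n) set \<Rightarrow> 'n vfield \<Rightarrow> 'n vfield" where
  "ext_zero S g = (\<lambda>x. if x \<in> S then g x else 0)"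

(* Only the values of R u on \<omega> are meaningful.  Boundedness together with linearity makes R compatible
   with a.e. equality. *)
definition continuous_linear_feedback ::
    "real \<Rightarrow> (real^'n) set \<Rightarrow> 'n vfield set \<Rightarrow> ('n vfield \<Rightarrow> 'n vfield) \<Rightarrow> bool" where
  "continuous_linear_feedback L \<omega> K R \<longleftrightarrow>
     (\<forall>u\<in>K. R u \<in> Lp_on L \<omega> 2) \<and>
     (\<forall>u\<in>K. \<forall>v\<in>K. \<forall>a b. AE x in tmeas L \<omega>.
        R (\<lambda>s. a *\<^sub>R u s + b *\<^sub>R v s) x = a *\<^sub>R R u x + b *\<^sub>R R v x) \<and>
     (\<exists>C. \<forall>u\<in>K. norm_Lp_on L \<omega> 2 (R u) \<le> C * norm_Lp L 2 u)"

definition feedback_term ::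
    "real \<Rightarrow> (real^'n) set \<Rightarrow> 'n vfield set \<Rightarrow> ('n vfield \<Rightarrow> 'n vfield) \<Rightarrow> 'n vfield \<Rightarrow> 'n vfield" where
  "feedback_term L \<omega> K R u = (\<lambda>x. - leray L (ext_zero \<omega> (R (orth_proj L K u))) x)"

section \<open>Spaces of time-dependent functions\<close>

(* Below, X with the norm N is a normed space of (classes of) functions. *)

definition C_time :: "real \<Rightarrow> ('x \<Rightarrow> 'y) set \<Rightarrow> (('x \<Rightarrow> 'y::real_normed_vector) \<Rightarrow> real) \<Rightarrow>
    (real \<Rightarrow> 'x \<Rightarrow> 'y) set" where
  "C_time T X N = {f. \<forall>t\<in>{0..T}. f t \<in> X \<and>
     ((\<lambda>s. N (\<lambda>x. f s x - f t x)) \<longlongrightarrow> 0) (at t within {0..T})}"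

(* The Bochner space L^p(a,b;X); the second condition is strong measurability. *)
definition Lp_time :: "real \<Rightarrow> real \<Rightarrow> real \<Rightarrow> ('x \<Rightarrow> 'y) set \<Rightarrow>
    (('x \<Rightarrow> 'y::real_normed_vector) \<Rightarrow> real) \<Rightarrow> (real \<Rightarrow> 'x \<Rightarrow> 'y) set" where
  "Lp_time a b p X N = {f.
     (AE t in lebesgue_on {a<..<b}. f t \<in> X) \<and>
     (\<exists>s. (\<forall>k::nat. simple_function (lebesgue_on {a<..<b}) (s k) \<and> (\<forall>t. s k t \<in> X)) \<and>
          (AE t in lebesgue_on {a<..<b}. (\<lambda>k. N (\<lambda>x. f t x - s k t x)) \<longlonglongrightarrow> 0)) \<and>
     integrable (lebesgue_on {a<..<b}) (\<lambda>t. N (f t) powr p)}"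

(* F and G are functions of time with values in the dual of X, and G is the derivative of F on (a,b)
   in the sense of vector-valued distributions. *)
definition has_weak_time_derivative ::
    "real \<Rightarrow> real \<Rightarrow> 'v set \<Rightarrow> (real \<Rightarrow> 'v \<Rightarrow> real) \<Rightarrow> (real \<Rightarrow> 'v \<Rightarrow> real) \<Rightarrow> bool" where
  "has_weak_time_derivative a b X F G \<longleftrightarrow>
     (\<forall>v\<in>X. \<forall>\<phi> :: real \<Rightarrow> real.
        smooth_on UNIV \<phi> \<and> (\<exists>c d. a < c \<and> d < b \<and> (\<forall>s. s \<notin> {c..d} \<longrightarrow> \<phi> s = 0)) \<longrightarrow>
        (LINT s:{a..b}|lebesgue. deriv \<phi> s * F s v) =
        - (LINT s:{a..b}|lebesgue. \<phi> s * G s v))"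

(* H is identified with its dual by the L2 inner product. *)
definition time_derivative_in_Lp_H :: "real \<Rightarrow> real \<Rightarrow> real \<Rightarrow> real \<Rightarrow> (real \<Rightarrow> 'n::finite vfield) \<Rightarrow> bool" where
  "time_derivative_in_Lp_H L a b p z \<longleftrightarrow>
     (\<exists>g \<in> Lp_time a b p (Hsp L) (norm_Lp L 2).
        has_weak_time_derivative a b (Hsp L) (\<lambda>s. ip L (z s)) (\<lambda>s. ip L (g s)))"

definition time_derivative_in_Lp_Vdual :: "real \<Rightarrow> real \<Rightarrow> real \<Rightarrow> real \<Rightarrow> (real \<Rightarrow> 'n::finite vfield) \<Rightarrow> bool" where
  "time_derivative_in_Lp_Vdual L a b p z \<longleftrightarrow>
     (\<exists>G \<in> Lp_time a b p (Vdual L) (norm_Vdual L).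
        has_weak_time_derivative a b (Vsp L) (\<lambda>s. ip L (z s)) G)"

definition solenoidal_test :: "real \<Rightarrow> real \<Rightarrow> real \<Rightarrow> (real \<Rightarrow> 'n::finite vfield) \<Rightarrow> bool" where
  "solenoidal_test L \<tau> T v \<longleftrightarrow>
     smooth_on ({\<tau>..T} \<times> UNIV) (\<lambda>(s, x). v s x) \<and> (\<forall>s\<in>{\<tau>..T}. v s \<in> solenoidal_smooth L)"

section \<open>Weak solutions\<close>

definition regularity_class :: "real \<Rightarrow> real \<Rightarrow> real \<Rightarrow> (real \<Rightarrow> 'n::finite vfield) \<Rightarrow> bool" where
  "regularity_class L r T z \<longleftrightarrow>
     z \<in> C_time T (Hsp L) (norm_Lp L 2) \<and>
     z \<in> Lp_time 0 T 2 (Vsp L) (norm_H1 L) \<and>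
     z \<in> Lp_time 0 T (r + 1) (Lpsp L (r + 1)) (norm_Lp L (r + 1))"

(* The integrability of s \<mapsto> (\<xi>(s), v(s)) is required because the Isabelle integral is total. *)
definition weak_identity ::
    "real \<Rightarrow> real \<Rightarrow> real \<Rightarrow> real \<Rightarrow> real \<Rightarrow> real \<Rightarrow> real \<Rightarrow> (real^'n) set \<Rightarrow> 'n vfield set \<Rightarrow>
     ('n vfield \<Rightarrow> 'n vfield) \<Rightarrow> 'n vfield \<Rightarrow> real \<Rightarrow> real \<Rightarrow> (real \<Rightarrow> 'n vfield) \<Rightarrow> (real \<Rightarrow> 'n vfield) \<Rightarrow> bool" where
  "weak_identity L \<mu> \<alpha> \<beta> \<gamma> r q \<omega> K R ye \<tau> T z \<xi> \<longleftrightarrow>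
     (\<forall>v. solenoidal_test L \<tau> T v \<longrightarrow>
        set_integrable lebesgue {\<tau>..T} (\<lambda>s. ip L (\<xi> s) (v s)) \<and>
        (\<forall>t\<in>{\<tau>..T}.
           - (LINT s:{\<tau>..t}|lebesgue.
                ip L (z s) (\<lambda>x. vector_derivative (\<lambda>\<sigma>. v \<sigma> x) (at s within {\<tau>..T})))
           + \<mu> * (LINT s:{\<tau>..t}|lebesgue. grad_ip L (z s) (v s))
           + \<alpha> * (LINT s:{\<tau>..t}|lebesgue. ip L (z s) (v s))
           + (LINT s:{\<tau>..t}|lebesgue. ip L (advection L (\<lambda>x. z s x + ye x)) (v s))
           + \<beta> * (LINT s:{\<tau>..t}|lebesgue. ip L (absorption r (\<lambda>x. z s x + ye x)) (v s))
           + \<gamma> * (LINT s:{\<tau>..t}|lebesgue. ip L (absorption q (\<lambda>x. z s x + ye x)) (v s))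
           + (LINT s:{\<tau>..t}|lebesgue. ip L (feedback_term L \<omega> K R (z s)) (v s))
           + (LINT s:{\<tau>..t}|lebesgue. ip L (\<xi> s) (v s))
           = - ip L (z t) (v t) + ip L (z \<tau>) (v \<tau>)
           + (LINT s:{\<tau>..t}|lebesgue. ip L (advection L ye) (v s))
           + \<beta> * (LINT s:{\<tau>..t}|lebesgue. ip L (absorption r ye) (v s))
           + \<gamma> * (LINT s:{\<tau>..t}|lebesgue. ip L (absorption q ye) (v s))))"

definition weak_solution ::
    "real \<Rightarrow> real \<Rightarrow> real \<Rightarrow> real \<Rightarrow> real \<Rightarrow> real \<Rightarrow> real \<Rightarrow> (real^'n) set \<Rightarrow> 'n vfield set \<Rightarrow>
     ('n vfield \<Rightarrow> 'n vfield) \<Rightarrow> 'n vfield \<Rightarrow> 'n vfield \<Rightarrow> (real \<Rightarrow> 'n vfield) \<Rightarrow> bool" where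
  "weak_solution L \<mu> \<alpha> \<beta> \<gamma> r q \<omega> K R ye y0 z \<longleftrightarrow>
     (\<forall>T>0. regularity_class L r T z \<and>
        (\<forall>\<tau>. 0 < \<tau> \<and> \<tau> < T \<longrightarrow>
           time_derivative_in_Lp_H L \<tau> T ((r + 1) / r) z \<and>
           (\<exists>\<xi>. (AE t in lebesgue_on {\<tau>..T}. \<xi> t \<in> subdiff_ind L K (z t)) \<and>
                weak_identity L \<mu> \<alpha> \<beta> \<gamma> r q \<omega> K R ye \<tau> T z \<xi>))) \<and>
     ((\<lambda>\<tau>. norm_Lp L 2 (\<lambda>x. z \<tau> x - (y0 x - ye x))) \<longlongrightarrow> 0) (at_right 0)"

end

theory Submission
  imports Defs "HOL-Complex_Analysis.Complex_Analysis"
begin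

text \<open>
Stokes eigenfunctions on the torus are trigonometric polynomials, so \<open>K\<close> is a finite dimensional space of
smooth fields. A nonzero element of \<open>K\<close> is real analytic and cannot vanish on the open set \<open>\<omega>\<close>. Hence the Gram
matrix of the basis of \<open>K\<close> with respect to the inner product on \<open>\<omega>\<close> is invertible, and for every \<open>\<eta>\<close> there is a
feedback supported in \<open>\<omega>\<close> whose projection to \<open>K\<close> is multiplication by \<open>-\<eta>\<close>. The subdifferential at a
point of the subspace \<open>K\<close> is the orthogonal complement of \<open>K\<close>; it forces the solution to stay in \<open>K\<close> and
absorbs the component of the equation orthogonal to \<open>K\<close>. The problem is thus equivalent to a system of ordinary
differential equations \<open>c' = -G(c) - \<eta> c\<close> for the coefficients, with \<open>G(0) = 0\<close> and \<open>G\<close> locally Lipschitz, the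
latter because \<open>ye\<close> is bounded by the embedding of \<open>H\<^sup>2\<close> into \<open>L\<^sup>\<infinity>\<close> in dimension at most 3. If \<open>\<eta>\<close> is
large compared with the Lipschitz constant of \<open>G\<close> on a ball determined by the initial value, a contraction argument
in an exponentially weighted space gives a global solution with any prescribed decay rate.
\<close>

text \<open>Fields are functions up to null sets: \<open>wpartial\<close> and
  \<open>orth_proj\<close> are picked by \<open>SOME\<close>, and the given eigenfunctions are known
  only almost everywhere. They are therefore replaced once by trigonometric representatives, for
  which unique continuation and classical calculus are available. Global existence does not come
  from an energy estimate. The Lipschitz constant of \<open>G\<close> is taken on the ball of radius
  \<open>2 * A\<close>, where \<open>A\<close> is the sum of the moduli of the initial coefficients;
  the gain is chosen afterwards and dominates it. This order is possible because \<open>G\<close>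
  does not involve the gain, and it makes the feedback depend on the initial value. The difficulty
  in uniqueness is that a competing weak solution satisfies the inclusion only at almost every time
  and the identity only from positive starting times. Continuity in time puts it into
  \<open>K\<close> at all times. Testing with a basis field constant in time then removes the
  multiplier, which is orthogonal to \<open>K\<close>, and leaves an integral equation for the
  coefficients; the initial value enters through a limit.\<close>

no_notation fps_nth (infixl "$" 75)

section \<open>Integration on the torus\<close>

abbreviation cell :: "real \<Rightarrow> (real^'n) set" where
  "cell L \<equiv> cbox 0 (\<chi> i. L)"

lemma torus_eq: "torus L = lebesgue_on (cell L)"
  by (simp add: tmeas_def)

lemma space_torus [simp]: "space (torus L) = cell L"
  by (simp add: torus_eq)

lemma finite_measure_torus: "finite_measure (torus L)"
  unfolding torus_eq by (intro finite_measure_lebesgue_on lmeasurable_cbox)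

lemma borel_measurable_torus_continuous:
  fixes f :: "real^'n \<Rightarrow> 'b::euclidean_space"
  shows "continuous_on UNIV f \<Longrightarrow> f \<in> borel_measurable (torus L)"
  unfolding torus_eq
  by (intro continuous_imp_measurable_on_sets_lebesgue) (auto intro: continuous_on_subset)

lemma integrable_torus_bounded:
  fixes f :: "real^'n \<Rightarrow> 'b::euclidean_space"
  assumes "f \<in> borel_measurable (torus L)" "AE x in torus L. norm (f x) \<le> B"
  shows "integrable (torus L) f"
  by (rule finite_measure.integrable_const_bound[OF finite_measure_torus assms(2,1)])

lemma continuous_bounded_on_cell:
  fixes f :: "real^'n \<Rightarrow> 'b::euclidean_space"
  assumes "continuous_on UNIV f"
  obtains B where "B > 0" "\<And>x. x \<in> cell L \<Longrightarrow> norm (f x) \<le> B"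
proof -
  have "compact (f ` cell L)"
    by (intro compact_continuous_image continuous_on_subset[OF assms]) auto
  then show ?thesis
    using compact_imp_bounded bounded_pos that by (metis imageI)
qed

lemma integrable_torus_continuous:
  fixes f :: "real^'n \<Rightarrow> 'b::euclidean_space"
  assumes "continuous_on UNIV f"
  shows "integrable (torus L) f"
proof -
  obtain B where "\<And>x. x \<in> cell L \<Longrightarrow> norm (f x) \<le> B"
    using continuous_bounded_on_cell[OF assms] by metis
  then show ?thesis
    by (intro integrable_torus_bounded[of _ _ B] borel_measurable_torus_continuous assms) auto
qed

lemma integral_torus_eq_integral:
  fixes f :: "real^'n \<Rightarrow> 'b::euclidean_space"
  assumes "integrable (torus L) f"
  shows "integral\<^sup>L (torus L) f = integral (cell L) f"
  using assms lebesgue_integral_eq_integral[of "cell L" f] by (simp add: torus_eq)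

text \<open>Moving the cell by \<open>h\<close> along one axis drops the slab below height
  \<open>h\<close> and gains a slab above height \<open>L\<close>; periodicity carries the gained
  slab back onto the dropped one.\<close>

lemma integral_cell_shift:
  fixes f :: "real^'n \<Rightarrow> real"
  assumes cont: "continuous_on UNIV f" and per: "periodic_on L UNIV f" and h: "0 \<le> h" "h \<le> L"
  shows "integral (cell L) (\<lambda>x. f (x + axis i h)) = integral (cell L) f"
proof -
  let ?v = "\<chi> i. L" and ?e = "axis i h" and ?B = "axis i (1::real)"
  have B: "?B \<in> Basis" by simp
  have mem: "x \<in> cbox a b \<longleftrightarrow> (a $ i \<le> x $ i \<and> x $ i \<le> b $ i) \<and> (\<forall>j. j \<noteq> i \<longrightarrow> a $ j \<le> x $ j \<and> x $ j \<le> b $ j)"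
    for x a b :: "real^'n"
    unfolding mem_box_cart by metis
  have int: "f integrable_on cbox a b" for a b
    by (intro integrable_continuous continuous_on_subset[OF cont]) auto
  have in0: "x \<bullet> ?B = x $ i" for x by (simp add: inner_axis)
  have "integral (cell L) (\<lambda>x. f (x + ?e)) = integral (cbox ?e (?v + ?e)) f"
    using integral_shift_cbox_plus[of 0 ?v f ?e] by (simp add: o_def add.commute)
  also have "\<dots> = integral (cbox ?e (?v + ?e) \<inter> {x. x $ i \<le> L}) f +
                  integral (cbox ?e (?v + ?e) \<inter> {x. x $ i \<ge> L}) f"
    using integral_split[OF int B, of ?e "?v + ?e" L] by (simp add: in0)
  also have "cbox ?e (?v + ?e) \<inter> {x. x $ i \<le> L} = cell L \<inter> {x. x $ i \<ge> h}"
    using h by (auto simp: mem axis_def)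
  also have "cbox ?e (?v + ?e) \<inter> {x. x $ i \<ge> L} =
      cbox (0 + axis i L) ((\<chi> j. if j = i then h else L) + axis i L)"
    using h by (auto simp: mem axis_def)
  also have "integral \<dots> f = integral (cbox 0 (\<chi> j. if j = i then h else L)) f"
    using integral_shift_cbox_plus[of 0 "\<chi> j. if j = i then h else L" f "axis i L"] per
    by (simp add: o_def add.commute periodic_on_def)
  also have "cbox 0 (\<chi> j. if j = i then h else L) = cell L \<inter> {x. x $ i \<le> h}"
    using h by (auto simp: mem axis_def)
  also have "integral (cell L \<inter> {x. x $ i \<ge> h}) f + integral (cell L \<inter> {x. x $ i \<le> h}) f = integral (cell L) f"
    using integral_split[OF int B, of 0 ?v h] by (simp add: in0)
  finally show ?thesis .
qed

text \<open>By \<open>integral_cell_shift\<close> the integral of the translates of \<open>g\<close>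
  is constant in the shift \<open>h\<close>, and the partial derivative appears on differentiating
  under the integral sign. Shifts are confined to [0, L], so a one-sided derivative at 0 is
  used.\<close>

lemma integral_torus_partial_zero:
  fixes g :: "real^'n \<Rightarrow> real"
  assumes L: "L > 0" and der: "\<And>x. (g has_derivative g' x) (at x)"
    and cont: "continuous_on UNIV (\<lambda>x. g' x (axis i 1))" and per: "periodic_on L UNIV g"
  shows "(LINT x|torus L. g' x (axis i 1)) = 0"
proof -
  have cg: "continuous_on UNIV g"
    using has_derivative_continuous[OF der] by (simp add: continuous_on_eq_continuous_at)
  define F where "F h = integral (cell L) (\<lambda>x. g (x + axis i h))" for h
  have axm: "axis i h = h *\<^sub>R axis i (1::real)" for h
    by (simp add: vec_eq_iff axis_def)
  have "(F has_field_derivative integral (cell L) (\<lambda>x. g' (x + axis i 0) (axis i 1))) (at 0 within {0..L})"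
    unfolding F_def
  proof (rule leibniz_rule_field_derivative)
    show "((\<lambda>h. g (x + axis i h)) has_field_derivative g' (x + axis i h) (axis i 1)) (at h within {0..L})"
      for h x
    proof -
      have "((\<lambda>h. x + h *\<^sub>R axis i 1) has_derivative (\<lambda>h. h *\<^sub>R axis i 1)) (at h within {0..L})"
        by (auto intro!: derivative_eq_intros)
      from has_derivative_compose[OF this der]
      show ?thesis
        unfolding axm[of h] has_field_derivative_def
        by (subst axm) (simp add: o_def linear_cmul[OF has_derivative_linear[OF der]] mult.commute[of _ "g' _ _"])
    qed
    show "(\<lambda>x. g (x + axis i h)) integrable_on cell L" for h
      by (intro integrable_continuous continuous_on_compose2[OF cg] continuous_intros) auto
    have *: "(\<lambda>(h, x). g' (x + axis i h) (axis i 1)) = (\<lambda>p. g' (snd p + fst p *\<^sub>R axis i 1) (axis i 1))"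
      by (subst axm) auto
    show "continuous_on ({0..L} \<times> cell L) (\<lambda>(h, x). g' (x + axis i h) (axis i 1))"
      unfolding * by (intro continuous_on_compose2[OF cont] continuous_intros) auto
  qed (use L in auto)
  moreover have "(F has_field_derivative 0) (at 0 within {0..L})"
  proof (rule has_field_derivative_transform_within[of "\<lambda>_. F 0" _ _ _ 1])
    show "F 0 = F x" if "x \<in> {0..L}" for x
      using integral_cell_shift[OF cg per, of x i] integral_cell_shift[OF cg per, of 0 i] that
      by (simp add: F_def)
  qed (use L in auto)
  moreover have "at 0 within {0..L} \<noteq> bot"
    using L by (simp add: at_within_Icc_at_right)
  ultimately have "integral (cell L) (\<lambda>x. g' (x + axis i 0) (axis i 1)) = 0"
    by (rule has_field_derivative_unique)
  moreover have "axis i 0 = (0::real^'n)" by (simp add: axis_def vec_eq_iff)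
  ultimately show ?thesis
    using integral_torus_eq_integral[OF integrable_torus_continuous[OF cont], of L] by simp
qed

section \<open>Trigonometric polynomials\<close>

text \<open>The dual lattice of the torus in units of \<open>2 * pi / L\<close>; that factor sits in
  \<open>ee\<close>.\<close>

definition latt :: "(real^'n) set" where
  "latt = {\<xi>. \<forall>i. \<xi> $ i \<in> \<int>}"

lemma latt_0 [simp]: "0 \<in> latt"
  and latt_minus: "\<xi> \<in> latt \<Longrightarrow> - \<xi> \<in> latt"
  and latt_add: "\<xi> \<in> latt \<Longrightarrow> \<eta> \<in> latt \<Longrightarrow> \<xi> + \<eta> \<in> latt"
  and latt_diff: "\<xi> \<in> latt \<Longrightarrow> \<eta> \<in> latt \<Longrightarrow> \<xi> - \<eta> \<in> latt"
  and latt_axis [simp]: "axis i 1 \<in> latt"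
  by (auto simp: latt_def axis_def)

definition ee :: "real \<Rightarrow> real^'n \<Rightarrow> real^'n \<Rightarrow> complex" where
  "ee L \<xi> x = cis (2 * pi / L * (\<xi> \<bullet> x))"

lemma norm_ee [simp]: "norm (ee L \<xi> x) = 1"
  and ee_0 [simp]: "ee L 0 x = 1"
  and ee_mult: "ee L \<xi> x * ee L \<eta> x = ee L (\<xi> + \<eta>) x"
  and cnj_ee: "cnj (ee L \<xi> x) = ee L (- \<xi>) x"
  and ee_add: "ee L \<xi> (x + y) = ee L \<xi> x * ee L \<xi> y"
  by (simp_all add: ee_def cis_mult cis_cnj inner_simps algebra_simps add_divide_distrib)

lemma continuous_on_ee [continuous_intros]:
  "continuous_on S f \<Longrightarrow> continuous_on S (\<lambda>x. ee L \<xi> (f x))"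
  unfolding ee_def cis_conv_exp by (intro continuous_intros)

lemma ee_periodic:
  assumes "L \<noteq> 0" "\<xi> \<in> latt"
  shows "ee L \<xi> (x + axis i L) = ee L \<xi> x"
proof -
  obtain k where k: "\<xi> $ i = of_int k"
    using assms(2) by (auto simp: latt_def elim: Ints_cases)
  have "2 * pi / L * (\<xi> \<bullet> axis i L) = 2 * pi * of_int k"
    using assms(1) k by (simp add: inner_axis)
  then have "ee L \<xi> (axis i L) = 1"
    unfolding ee_def by (metis cis_multiple_2pi Ints_of_int)
  then show ?thesis by (simp add: ee_add)
qed

text \<open>An inductive description avoids carrying a finite set of frequencies along: products,
  conjugates and derivatives are handled by rule induction, and a finite spectrum is extracted only
  in \<open>tp_spectrum\<close>.\<close>

inductive tp :: "real \<Rightarrow> (real^'n \<Rightarrow> complex) \<Rightarrow> bool" for L where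
  base: "\<xi> \<in> latt \<Longrightarrow> tp L (\<lambda>x. c * ee L \<xi> x)"
| add: "tp L p \<Longrightarrow> tp L q \<Longrightarrow> tp L (\<lambda>x. p x + q x)"

lemma tp_const: "tp L (\<lambda>x. c)"
  using tp.base[of 0 L c] by simp

lemma tp_ee: "\<xi> \<in> latt \<Longrightarrow> tp L (ee L \<xi>)"
  using tp.base[of \<xi> L 1] by simp

lemma tp_mult:
  assumes "tp L p" "tp L q"
  shows "tp L (\<lambda>x. p x * q x)"
  using assms
proof (induction p)
  case (base \<xi> c)
  from base(2,1) show ?case
  proof (induction q)
    case (base \<eta> d)
    have "(\<lambda>x. (c * ee L \<xi> x) * (d * ee L \<eta> x)) = (\<lambda>x. (c * d) * ee L (\<xi> + \<eta>) x)"
      by (simp add: mult_ac flip: ee_mult)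
    then show ?case using tp.base[OF latt_add[OF \<open>\<xi> \<in> latt\<close> \<open>\<eta> \<in> latt\<close>], of L "c * d"] by metis
  qed (auto simp: distrib_left intro: tp.add)
qed (auto simp: distrib_right intro: tp.add)

lemma tp_cmult: "tp L p \<Longrightarrow> tp L (\<lambda>x. c * p x)"
  by (intro tp_mult tp_const)

lemma tp_sum: "(\<And>i. i \<in> I \<Longrightarrow> tp L (p i)) \<Longrightarrow> tp L (\<lambda>x. \<Sum>i\<in>I. p i x)"
  by (induction I rule: infinite_finite_induct) (auto intro: tp.add tp_const)

lemma tp_cnj: "tp L p \<Longrightarrow> tp L (\<lambda>x. cnj (p x))"
proof (induction rule: tp.induct)
  case (base \<xi> c)
  then show ?case using tp.base[OF latt_minus, of \<xi> L "cnj c"] by (simp add: cnj_ee)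
qed (auto intro: tp.add)

lemma tp_Re: "tp L p \<Longrightarrow> tp L (\<lambda>x. of_real (Re (p x)))"
proof -
  assume p: "tp L p"
  have "(\<lambda>x. complex_of_real (Re (p x))) = (\<lambda>x. (1/2) * (p x + cnj (p x)))"
    by (simp add: fun_eq_iff complex_eq_iff)
  then show ?thesis using tp_cmult[OF tp.add[OF p tp_cnj[OF p]], of "1/2"] by metis
qed

lemma tp_Im: "tp L p \<Longrightarrow> tp L (\<lambda>x. of_real (Im (p x)))"
  using tp_Re[OF tp_cmult[of L p "- \<i>"]] by simp

lemma tp_continuous: "tp L p \<Longrightarrow> continuous_on S p"
  by (induction rule: tp.induct) (auto intro!: continuous_intros)

lemma tp_periodic: "tp L p \<Longrightarrow> L \<noteq> 0 \<Longrightarrow> p (x + axis i L) = p x"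
  by (induction rule: tp.induct) (auto simp: ee_periodic)

lemma tp_derivative:
  "tp L p \<Longrightarrow> \<exists>p'. (\<forall>b. tp L (p' b)) \<and> (\<forall>x. (p has_derivative (\<lambda>b. p' b x)) (at x))"
proof (induction rule: tp.induct)
  case (base \<xi> c)
  define p' where "p' b x = (c * (\<i> * of_real (2 * pi / L * (\<xi> \<bullet> b)))) * ee L \<xi> x" for b x
  have "((\<lambda>x. c * ee L \<xi> x) has_derivative (\<lambda>b. p' b x)) (at x)" for x
  proof -
    have "((\<lambda>x. \<i> * of_real (2 * pi / L * (\<xi> \<bullet> x))) has_derivative
        (\<lambda>b. \<i> * of_real (2 * pi / L * (\<xi> \<bullet> b)))) (at x)"
      by (intro derivative_intros)
    from has_derivative_compose[OF this DERIV_exp[unfolded has_field_derivative_def]]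
    show ?thesis
      unfolding ee_def cis_conv_exp p'_def
      by (auto dest: has_derivative_mult_right[where x = c] simp: mult_ac)
  qed
  moreover have "tp L (p' b)" for b
    unfolding p'_def by (rule tp.base[OF base])
  ultimately show ?case by blast
next
  case (add p q)
  then obtain p' q' where "\<forall>b. tp L (p' b)" "\<forall>x. (p has_derivative (\<lambda>b. p' b x)) (at x)"
    "\<forall>b. tp L (q' b)" "\<forall>x. (q has_derivative (\<lambda>b. q' b x)) (at x)" by auto
  then show ?case
    by (intro exI[of _ "\<lambda>b x. p' b x + q' b x"]) (auto intro: tp.add has_derivative_add)
qed

text \<open>Real-valued trigonometric polynomials, tested through the euclidean basis so that one
  notion covers scalar functions and fields.\<close>

definition rtp :: "real \<Rightarrow> (real^'n \<Rightarrow> 'b::euclidean_space) \<Rightarrow> bool" where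
  "rtp L f \<longleftrightarrow> (\<forall>b\<in>Basis. tp L (\<lambda>x. of_real (f x \<bullet> b)))"

lemma rtp_real: "rtp L (f :: real^'n \<Rightarrow> real) \<longleftrightarrow> tp L (\<lambda>x. of_real (f x))"
  by (simp add: rtp_def)

lemma rtp_vec: "rtp L (f :: real^'n \<Rightarrow> real^'n) \<longleftrightarrow> (\<forall>i. rtp L (\<lambda>x. f x $ i))"
  by (auto simp: rtp_def Basis_vec_def inner_axis)

lemma rtp_continuous: "rtp L f \<Longrightarrow> continuous_on S f"
proof -
  assume f: "rtp L f"
  have "continuous_on S (\<lambda>x. f x \<bullet> b)" if "b \<in> Basis" for b
  proof -
    have "continuous_on S (\<lambda>x. Re (of_real (f x \<bullet> b)))"
      using f that by (intro continuous_intros tp_continuous) (auto simp: rtp_def)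
    then show ?thesis by simp
  qed
  then show ?thesis by (subst continuous_on_componentwise) auto
qed

lemma rtp_periodic: "L \<noteq> 0 \<Longrightarrow> rtp L f \<Longrightarrow> periodic_on L S f"
  unfolding periodic_on_def
proof (intro ballI allI, rule euclidean_eqI)
  fix x i and b :: 'b assume "L \<noteq> 0" "rtp L f" "b \<in> Basis"
  then show "f (x + axis i L) \<bullet> b = f x \<bullet> b"
    using tp_periodic[of L "\<lambda>x. of_real (f x \<bullet> b)" x i] by (simp add: rtp_def)
qed

lemma rtp_derivative:
  assumes "rtp L (f :: real^'n \<Rightarrow> 'b::euclidean_space)"
  obtains f' where "\<And>b. rtp L (f' b)" "\<And>x. (f has_derivative (\<lambda>b. f' b x)) (at x)"
proof -
  have "\<forall>c\<in>Basis. \<exists>p'. (\<forall>b. tp L (p' b)) \<and>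
      (\<forall>x. ((\<lambda>x. complex_of_real (f x \<bullet> c)) has_derivative (\<lambda>b. p' b x)) (at x))"
    using assms tp_derivative unfolding rtp_def by blast
  then obtain p' where p': "\<And>c b. c \<in> Basis \<Longrightarrow> tp L (p' c b)"
    "\<And>c x. c \<in> Basis \<Longrightarrow> ((\<lambda>x. complex_of_real (f x \<bullet> c)) has_derivative (\<lambda>b. p' c b x)) (at x)"
    by metis
  define f' where "f' b x = (\<Sum>c\<in>Basis. Re (p' c b x) *\<^sub>R c)" for b x
  have f'c: "f' b x \<bullet> c = Re (p' c b x)" if "c \<in> Basis" for b x c
    using that by (simp add: f'_def inner_sum_left inner_Basis if_distrib sum.delta cong: if_cong)
  have "rtp L (f' b)" for b
    unfolding rtp_def using p'(1) f'c by (auto intro: tp_Re)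
  moreover have "(f has_derivative (\<lambda>b. f' b x)) (at x)" for x
    unfolding has_derivative_componentwise_within[of f]
  proof
    fix c :: 'b assume c: "c \<in> Basis"
    from bounded_linear.has_derivative[OF bounded_linear_Re p'(2)[OF c]]
    show "((\<lambda>x. f x \<bullet> c) has_derivative (\<lambda>b. f' b x \<bullet> c)) (at x)"
      using f'c[OF c] by simp
  qed
  ultimately show ?thesis using that by blast
qed

text \<open>The map \<open>pr\<close> lets one induction serve functions on space (identity) and on
  a time interval times space (second projection). The condition on \<open>S\<close> says that every
  point can be approached inside \<open>S\<close> along each coordinate direction, which makes the
  derivative within \<open>S\<close> unique.\<close>

lemma Ck_on_rtp:
  fixes S :: "'a::euclidean_space set" and f :: "real^'n \<Rightarrow> 'b::euclidean_space"
  assumes pr: "bounded_linear pr"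
    and S: "\<And>x b e. x \<in> S \<Longrightarrow> b \<in> Basis \<Longrightarrow> e > 0 \<Longrightarrow> \<exists>d. 0 < \<bar>d\<bar> \<and> \<bar>d\<bar> < e \<and> x + d *\<^sub>R b \<in> S"
    and f: "rtp L f"
  shows "Ck_on k S (\<lambda>x. f (pr x))"
  using f
proof (induction k arbitrary: f)
  case 0
  then show ?case
    by (auto intro!: continuous_on_compose2[OF rtp_continuous[OF 0]] bounded_linear.continuous_on[OF pr])
next
  case (Suc k)
  obtain f' where f': "\<And>b. rtp L (f' b)" "\<And>x. (f has_derivative (\<lambda>b. f' b x)) (at x)"
    using rtp_derivative[OF Suc.prems] by blast
  have d: "((\<lambda>x. f (pr x)) has_derivative (\<lambda>b. f' (pr b) (pr x))) (at x within S)" for x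
    using has_derivative_compose[OF bounded_linear_imp_has_derivative[OF pr] f'(2)] .
  have fd: "frechet_derivative (\<lambda>x. f (pr x)) (at x within S) = (\<lambda>b. f' (pr b) (pr x))" if "x \<in> S" for x
    using frechet_derivative_unique_within[OF _ d S[OF that]] d
    by (metis frechet_derivative_works differentiableI)
  \<comment> \<open>\<open>Ck_on\<close> looks at functions only on \<open>S\<close>, and the
    formula \<open>fd\<close> for the derivative holds only there, hence a congruence on
    \<open>S\<close> instead of an equality of functions.\<close>
  have cong: "Ck_on k S g \<longleftrightarrow> Ck_on k S h" if "\<And>x. x \<in> S \<Longrightarrow> g x = h x" for k and g h :: "'a \<Rightarrow> 'b"
    using that
  proof (induction k arbitrary: g h)
    case (Suc k)
    have "(g has_derivative D) (at x within S) \<longleftrightarrow> (h has_derivative D) (at x within S)" if "x \<in> S" for x D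
      using Suc.prems that by (auto elim: has_derivative_transform[rotated 2])
    then have "g differentiable (at x within S) \<longleftrightarrow> h differentiable (at x within S)"
      "frechet_derivative g (at x within S) = frechet_derivative h (at x within S)" if "x \<in> S" for x
      using that by (auto simp: differentiable_def frechet_derivative_def)
    then show ?case
      using Suc.IH[of "\<lambda>x. frechet_derivative g (at x within S) b"
          "\<lambda>x. frechet_derivative h (at x within S) b" for b]
      by (auto simp: differentiable_on_def)
  qed (auto cong: continuous_on_cong)
  show ?case
    using d Suc.IH[OF f'(1)] cong[of "\<lambda>x. frechet_derivative (\<lambda>x. f (pr x)) (at x within S) b" "\<lambda>x. f' (pr b) (pr x)" k for b] fd
    by (auto simp: differentiable_on_def differentiable_def)
qed

lemma smooth_on_rtp: "rtp L f \<Longrightarrow> smooth_on UNIV (f :: real^'n \<Rightarrow> 'b::euclidean_space)"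
  unfolding smooth_on_def
proof
  fix k assume f: "rtp L f"
  show "Ck_on k UNIV f"
    by (rule Ck_on_rtp[OF bounded_linear_ident _ f]) (metis UNIV_I field_lbound_gt_zero abs_of_pos zero_less_one)
qed

lemma smooth_on_rtp_time:
  assumes f: "rtp L (f :: real^'n \<Rightarrow> 'b::euclidean_space)" and ab: "a < b"
  shows "smooth_on ({a..b} \<times> UNIV) (\<lambda>(s::real, x). f x)"
  unfolding smooth_on_def
proof
  fix k
  have "Ck_on k ({a..b} \<times> UNIV) (\<lambda>p::real \<times> (real^'n). f (snd p))"
  proof (rule Ck_on_rtp[OF bounded_linear_snd _ f])
    fix x c :: "real \<times> (real^'n)" and e :: real
    assume x: "x \<in> {a..b} \<times> UNIV" and c: "c \<in> Basis" and e: "e > 0"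
    from c consider "fst c = 0" | "fst c = 1"
      by (auto simp: Basis_prod_def)
    then show "\<exists>d. 0 < \<bar>d\<bar> \<and> \<bar>d\<bar> < e \<and> x + d *\<^sub>R c \<in> {a..b} \<times> UNIV"
    proof cases
      case 1
      then show ?thesis using x e by (intro exI[of _ "e/2"]) (cases x; cases c; auto)
    next
      case 2
      show ?thesis
      proof (cases "fst x < b")
        case True
        then show ?thesis using x e 2
          by (intro exI[of _ "min (e/2) (b - fst x)"]) (cases x; cases c; auto simp: min_def)
      next
        \<comment> \<open>At the right end point of the time interval only backward steps stay in
          the set.\<close>
        case False
        then show ?thesis using x e 2 ab
          by (intro exI[of _ "- min (e/2) (b - a)"]) (cases x; cases c; auto simp: min_def)
      qed
    qed
  qed
  then show "Ck_on k ({a..b} \<times> UNIV) (\<lambda>(s::real, x). f x)"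
    by (simp add: case_prod_beta')
qed

text \<open>The embedding of the torus into \<open>complex^'n\<close> as a product of circles. Real
  polynomials in its coordinates are trigonometric polynomials, so Stone-Weierstrass on a ball of
  \<open>complex^'n\<close> provides approximation on the torus.\<close>

definition EE :: "real \<Rightarrow> real^'n \<Rightarrow> complex^'n" where
  "EE L x = (\<chi> i. cis (2 * pi / L * x $ i))"

lemma EE_inner_Basis:
  assumes "b \<in> Basis"
  shows "tp L (\<lambda>x. of_real (EE L x \<bullet> b))"
proof -
  obtain i u where b: "b = axis i u" and u: "u = 1 \<or> u = \<i>"
    using assms by (auto simp: Basis_vec_def Basis_complex_def)
  have eq: "EE L x $ i = ee L (axis i 1) x" for x
    by (simp add: EE_def ee_def inner_axis' )
  have "tp L (\<lambda>x. of_real (Re (ee L (axis i 1) x)))" "tp L (\<lambda>x. of_real (Im (ee L (axis i 1) x)))"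
    by (intro tp_Re tp_Im tp_ee latt_axis)+
  then show ?thesis using u by (auto simp: b inner_axis eq inner_complex_def)
qed

lemma tp_real_polynomial_EE:
  "real_polynomial_function p \<Longrightarrow> rtp L (\<lambda>x. p (EE L x))"
  unfolding rtp_real
proof (induction rule: real_polynomial_function.induct)
  case (linear f)
  interpret bounded_linear f by fact
  have fz: "f z = (\<Sum>b\<in>Basis. (z \<bullet> b) * f b)" for z
  proof -
    have "f z = f (\<Sum>b\<in>Basis. (z \<bullet> b) *\<^sub>R b)" by (simp add: euclidean_representation)
    then show ?thesis by (simp add: sum scale)
  qed
  have *: "complex_of_real (f (EE L x)) = (\<Sum>b\<in>Basis. of_real (EE L x \<bullet> b) * of_real (f b))" for x
    by (subst fz) simp
  have "tp L (\<lambda>x. \<Sum>b\<in>Basis. of_real (EE L x \<bullet> b) * of_real (f b))"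
    by (rule tp_sum, rule tp_mult, erule EE_inner_Basis, rule tp_const)
  then show ?case by (simp only: *)
qed (auto intro: tp_const tp.add tp_mult)

section \<open>Fourier coefficients\<close>

text \<open>The integral of the square of \<open>u + t v\<close> is a nonnegative polynomial in
  \<open>t\<close> of degree at most 2; evaluating it at its minimum gives the bound.\<close>

lemma Cauchy_Schwarz_integral:
  fixes u v :: "'a \<Rightarrow> real"
  assumes [measurable]: "u \<in> borel_measurable M" "v \<in> borel_measurable M"
    and u2: "integrable M (\<lambda>x. (u x)\<^sup>2)" and v2: "integrable M (\<lambda>x. (v x)\<^sup>2)"
  shows "integrable M (\<lambda>x. u x * v x)"
    and "\<bar>LINT x|M. u x * v x\<bar> \<le> sqrt (LINT x|M. (u x)\<^sup>2) * sqrt (LINT x|M. (v x)\<^sup>2)"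
proof -
  show uv: "integrable M (\<lambda>x. u x * v x)"
  proof (rule Bochner_Integration.integrable_bound[OF Bochner_Integration.integrable_add[OF u2 v2]])
    have "\<bar>a * b\<bar> \<le> a\<^sup>2 + b\<^sup>2" for a b :: real
    proof -
      have "2 * (\<bar>a\<bar> * \<bar>b\<bar>) \<le> a\<^sup>2 + b\<^sup>2"
        using sum_squares_bound[of "\<bar>a\<bar>" "\<bar>b\<bar>"] by (simp add: mult.assoc)
      moreover have "0 \<le> \<bar>a\<bar> * \<bar>b\<bar>" by simp
      ultimately show ?thesis unfolding abs_mult by linarith
    qed
    then show "AE x in M. norm (u x * v x) \<le> norm ((u x)\<^sup>2 + (v x)\<^sup>2)" by simp
  qed simp
  define A B C where "A = (LINT x|M. (u x)\<^sup>2)" and "B = (LINT x|M. u x * v x)" and "C = (LINT x|M. (v x)\<^sup>2)"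
  have q: "0 \<le> A + 2 * t * B + t\<^sup>2 * C" for t
  proof -
    have "0 \<le> (LINT x|M. (u x + t * v x)\<^sup>2)" by (rule integral_nonneg_AE) simp
    also have "(\<lambda>x. (u x + t * v x)\<^sup>2) = (\<lambda>x. (u x)\<^sup>2 + (2 * t) * (u x * v x) + t\<^sup>2 * (v x)\<^sup>2)"
      by (simp add: fun_eq_iff power2_eq_square algebra_simps)
    also have "(LINT x|M. \<dots> x) = A + 2 * t * B + t\<^sup>2 * C"
      unfolding A_def B_def C_def using u2 v2 uv by simp
    finally show ?thesis .
  qed
  have A0: "A \<ge> 0" and C0: "C \<ge> 0" unfolding A_def C_def by (auto intro!: integral_nonneg_AE)
  have "B\<^sup>2 \<le> A * C"
  proof (cases "C = 0")
    case True
    have "B = 0"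
    proof (rule ccontr)
      assume "B \<noteq> 0"
      \<comment> \<open>With \<open>C = 0\<close> the polynomial is \<open>A + 2 * t * B\<close>,
        and this \<open>t\<close> gives it the value -1.\<close>
      then show False using q[of "- (A + 1) / (2 * B)"] True A0 by (simp add: field_simps)
    qed
    then show ?thesis using True by simp
  next
    case False
    then have "C > 0" using C0 by simp
    then show ?thesis using q[of "- B / C"] by (simp add: field_simps power2_eq_square)
  qed
  then have "sqrt (B\<^sup>2) \<le> sqrt (A * C)" by (rule real_sqrt_le_mono)
  then show "\<bar>LINT x|M. u x * v x\<bar> \<le> sqrt (LINT x|M. (u x)\<^sup>2) * sqrt (LINT x|M. (v x)\<^sup>2)"
    by (simp add: A_def B_def C_def real_sqrt_mult)
qed

lemma AE_torus_iff: "(AE x in torus L. P x) \<longleftrightarrow> (AE x in lebesgue. x \<in> cell L \<longrightarrow> P x)"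
  unfolding torus_eq by (rule AE_restrict_space_iff) simp

text \<open>The closed cell contains opposite faces, which \<open>EE\<close> identifies; discarding
  the null set of faces leaves the part on which points are separated.\<close>

lemma AE_torus_box: "AE x in torus L. x \<in> box 0 (\<chi> i. L)"
proof -
  have "AE x in lebesgue. x \<notin> cell L - box 0 (\<chi> i. L)"
    by (rule AE_not_in) (simp add: negligible_iff_null_sets[symmetric] negligible_frontier_interval)
  then show ?thesis unfolding AE_torus_iff by eventually_elim auto
qed

lemma integrable_torus_mult_continuous:
  fixes f p :: "real^'n \<Rightarrow> 'b::{euclidean_space,real_normed_field}"
  assumes f: "integrable (torus L) f" and p: "continuous_on UNIV p"
  shows "integrable (torus L) (\<lambda>x. f x * p x)"
proof -
  obtain B where B: "B > 0" "\<And>x. x \<in> cell L \<Longrightarrow> norm (p x) \<le> B"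
    using continuous_bounded_on_cell[OF p] by metis
  show ?thesis
  proof (rule Bochner_Integration.integrable_bound[OF integrable_mult_right[OF integrable_norm[OF f], of B]])
    show "(\<lambda>x. f x * p x) \<in> borel_measurable (torus L)"
      using f p borel_measurable_torus_continuous[OF p] by measurable
    show "AE x in torus L. norm (f x * p x) \<le> norm (B * norm (f x))"
      using B by (intro AE_I2) (auto simp: norm_mult mult.commute[of B] intro: mult_left_mono)
  qed
qed

lemma norm_EE_le: "norm (EE L (x::real^'n)) \<le> CARD('n)"
proof -
  have "norm (EE L x) \<le> (\<Sum>i\<in>UNIV. norm (EE L x $ i))"
    unfolding norm_vec_def by (rule L2_set_le_sum) simp
  then show ?thesis by (simp add: EE_def)
qed

lemma continuous_on_EE: "continuous_on S (EE L)"
  unfolding EE_def cis_conv_exp by (intro continuous_intros)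

text \<open>Equal images mean that the coordinates agree modulo \<open>L\<close>. A point of the
  closed cell and one of the open cell differ by less than \<open>L\<close> in each coordinate, so
  the multiple of \<open>L\<close> is 0.\<close>

lemma EE_eqD:
  assumes L: "L > 0" and eq: "EE L x = EE L y" and x: "x \<in> cell L" and y: "y \<in> box 0 (\<chi> i. L)"
  shows "x = y"
proof -
  have "x $ i = y $ i" for i
  proof -
    have "cis (2 * pi / L * x $ i) = cis (2 * pi / L * y $ i)"
      using eq by (simp add: EE_def vec_eq_iff)
    then have "cis (2 * pi / L * x $ i) * cnj (cis (2 * pi / L * y $ i)) = 1"
      by (simp add: cis_cnj cis_mult)
    then have "cis (2 * pi / L * x $ i - 2 * pi / L * y $ i) = 1"
      by (simp add: cis_cnj cis_mult)
    then have "cos (2 * pi / L * x $ i - 2 * pi / L * y $ i) = 1"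
      by (metis Re_complex_of_real cis.sel(1) of_real_1)
    then obtain k :: int where "2 * pi / L * x $ i - 2 * pi / L * y $ i = of_int k * 2 * pi"
      unfolding cos_one_2pi_int by blast
    then have "2 * pi * ((x $ i - y $ i) / L) = 2 * pi * of_int k"
      by (simp add: diff_divide_distrib right_diff_distrib)
    then have "(x $ i - y $ i) / L = of_int k" by (simp only: mult_cancel_left) simp
    then have k: "x $ i - y $ i = L * of_int k" using L by (simp add: field_simps)
    have "\<bar>x $ i - y $ i\<bar> < L * 1" using x y by (auto simp: mem_box_cart) (smt (verit))
    then have "\<bar>of_int k :: real\<bar> < 1" unfolding k using L by (simp add: abs_mult)
    then have "k = 0" by linarith
    then show ?thesis using k by simp
  qed
  then show ?thesis by (simp add: vec_eq_iff)
qed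

lemma le_epsilon_mult:
  fixes a b c :: real
  assumes "\<And>e. e > 0 \<Longrightarrow> a \<le> b + e * c" "c \<ge> 0"
  shows "a \<le> b"
proof (rule field_le_epsilon)
  fix e :: real assume "e > 0"
  then have "a \<le> b + e / (c + 1) * c" using assms(2) by (intro assms(1)) simp
  also have "\<dots> \<le> b + e" using \<open>e > 0\<close> assms(2) by (simp add: field_simps)
  finally show "a \<le> b + e" .
qed

section \<open>Pointwise bounds from integrals against trigonometric polynomials\<close>

context
  fixes L S :: real and f :: "real^'n \<Rightarrow> real"
  assumes L: "L > 0" and f: "integrable (torus L) f" and S: "S \<ge> 0"
    and dom: "\<And>p. rtp L p \<Longrightarrow> (LINT x|torus L. f x * p x) \<le> S * (LINT x|torus L. \<bar>p x\<bar>)"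
begin

text \<open>First extension of the domination \<open>dom\<close>: from trigonometric polynomials to
  continuous functions of \<open>EE\<close>. The image of \<open>EE\<close> lies in a ball of radius
  \<open>CARD('n)\<close>, on which Stone-Weierstrass gives a uniform approximation.\<close>

lemma trig_dominated_EE:
  assumes G: "continuous_on UNIV (G :: complex^'n \<Rightarrow> real)"
  shows "(LINT x|torus L. f x * G (EE L x)) \<le> S * (LINT x|torus L. \<bar>G (EE L x)\<bar>)"
proof (rule le_epsilon_mult)
  \<comment> \<open>An approximation error \<open>e\<close> costs \<open>e\<close> times the
    integral of the modulus of \<open>f\<close> on the left and \<open>S * e\<close> times the
    volume of the cell on the right.\<close>
  let ?c = "S * measure lebesgue (cell L :: (real^'n) set) + (LINT x|torus L. \<bar>f x\<bar>)"
  show "?c \<ge> 0" using S by (simp add: integral_nonneg_AE)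
  fix e :: real assume e: "e > 0"
  obtain g where g: "polynomial_function g" "\<And>z. z \<in> cball 0 (real CARD('n)) \<Longrightarrow> norm (G z - g z) < e"
    using Stone_Weierstrass_polynomial_function[OF compact_cball continuous_on_subset[OF G subset_UNIV] e] by metis
  let ?g = "\<lambda>x. g (EE L x)" and ?G = "\<lambda>x. G (EE L x)"
  have ge: "\<bar>?G x - ?g x\<bar> < e" for x using g(2)[of "EE L x"] norm_EE_le[of L x] by simp
  have r: "rtp L ?g"
    by (rule tp_real_polynomial_EE) (use g(1) in \<open>simp add: real_polynomial_function_eq\<close>)
  have cg: "continuous_on UNIV ?g" using rtp_continuous[OF r] .
  have cG: "continuous_on UNIV ?G" by (rule continuous_on_compose2[OF G continuous_on_EE]) auto
  have ifg: "integrable (torus L) (\<lambda>x. f x * ?g x)" and ifG: "integrable (torus L) (\<lambda>x. f x * ?G x)"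
    by (intro integrable_torus_mult_continuous f cg cG)+
  have iag: "integrable (torus L) (\<lambda>x. \<bar>?g x\<bar>)" and iaG: "integrable (torus L) (\<lambda>x. \<bar>?G x\<bar>)"
    using integrable_abs integrable_torus_continuous[OF cg] integrable_torus_continuous[OF cG] by blast+
  have iaf: "integrable (torus L) (\<lambda>x. \<bar>f x\<bar>)" using f by (rule integrable_abs)
  have ic: "integrable (torus L) (\<lambda>x. c)" for c :: real
    by (rule finite_measure.integrable_const[OF finite_measure_torus])
  have "(LINT x|torus L. f x * ?G x) \<le> (LINT x|torus L. f x * ?g x + e * \<bar>f x\<bar>)"
  proof (rule integral_mono[OF ifG])
    show "integrable (torus L) (\<lambda>x. f x * ?g x + e * \<bar>f x\<bar>)" using ifg iaf by simp
    fix x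
    have "f x * (?G x - ?g x) \<le> \<bar>f x\<bar> * \<bar>?G x - ?g x\<bar>" by (metis abs_ge_self abs_mult)
    also have "\<dots> \<le> \<bar>f x\<bar> * e" using ge[of x] by (intro mult_left_mono) auto
    finally show "f x * ?G x \<le> f x * ?g x + e * \<bar>f x\<bar>" by (simp add: algebra_simps)
  qed
  also have "\<dots> = (LINT x|torus L. f x * ?g x) + e * (LINT x|torus L. \<bar>f x\<bar>)"
    using ifg iaf by simp
  also have "\<dots> \<le> S * (LINT x|torus L. \<bar>?g x\<bar>) + e * (LINT x|torus L. \<bar>f x\<bar>)"
    using dom[OF r] by simp
  finally have 1: "(LINT x|torus L. f x * ?G x) \<le> S * (LINT x|torus L. \<bar>?g x\<bar>) + e * (LINT x|torus L. \<bar>f x\<bar>)" .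
  have "(LINT x|torus L. \<bar>?g x\<bar>) \<le> (LINT x|torus L. \<bar>?G x\<bar> + e)"
  proof (rule integral_mono[OF iag])
    show "integrable (torus L) (\<lambda>x. \<bar>?G x\<bar> + e)" by (intro Bochner_Integration.integrable_add iaG ic)
    show "\<bar>?g x\<bar> \<le> \<bar>?G x\<bar> + e" for x using ge[of x] by linarith
  qed
  also have "(LINT x|torus L. \<bar>?G x\<bar> + e) = (LINT x|torus L. \<bar>?G x\<bar>) + e * measure lebesgue (cell L :: (real^'n) set)"
    using Bochner_Integration.integral_add[OF iaG ic[of e]] by (simp add: torus_eq measure_restrict_space)
  finally have "S * (LINT x|torus L. \<bar>?g x\<bar>) \<le> S * ((LINT x|torus L. \<bar>?G x\<bar>) + e * measure lebesgue (cell L :: (real^'n) set))"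
    using S by (rule mult_left_mono)
  with 1 show "(LINT x|torus L. f x * ?G x) \<le> S * (LINT x|torus L. \<bar>?G x\<bar>) + e * ?c"
    by (simp add: algebra_simps)
qed

text \<open>The cut-offs \<open>G m\<close> shrink to the indicator of the image of
  \<open>T\<close>. The set \<open>T\<close> has to lie in the open cell: if it touched a face, the
  cut-offs would also converge to 1 at the identified points of the opposite face.\<close>

lemma trig_dominated_compact:
  assumes T: "compact T" "T \<subseteq> box 0 (\<chi> i. L)"
  shows "(LINT x|torus L. f x * indicator T x) \<le> S * (LINT x|torus L. indicator T x)"
proof (cases "T = {}")
  case False
  define G where "G m z = max 0 (1 - real m * infdist z (EE L ` T))" for m and z :: "complex^'n"
  have cG: "continuous_on UNIV (G m)" for m
    unfolding G_def by (intro continuous_intros)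
  have cGE: "continuous_on UNIV (\<lambda>x. G m (EE L x))" for m
    by (rule continuous_on_compose2[OF cG continuous_on_EE]) auto
  have cl: "closed (EE L ` T)"
    by (intro compact_imp_closed compact_continuous_image continuous_on_EE T)
  have G01: "0 \<le> G m z" "G m z \<le> 1" for m z by (auto simp: G_def infdist_nonneg)
  have lim: "(\<lambda>m. G m (EE L x)) \<longlonglongrightarrow> indicator T x" if x: "x \<in> cell L" for x
  proof (cases "x \<in> T")
    case True
    then show ?thesis by (simp add: G_def)
  next
    case False
    then have "EE L x \<notin> EE L ` T" using EE_eqD[OF L _ x] T(2) by blast
    then have d: "infdist (EE L x) (EE L ` T) > 0"
      using infdist_pos_not_in_closed[OF cl] \<open>T \<noteq> {}\<close> by blast
    obtain N :: nat where N: "1 / infdist (EE L x) (EE L ` T) < real N" using reals_Archimedean2 by blast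
    have "G m (EE L x) = 0" if "m \<ge> N" for m
    proof -
      have "1 / infdist (EE L x) (EE L ` T) < real m" using N that by linarith
      then show ?thesis using d by (simp add: G_def field_simps)
    qed
    then have "\<forall>\<^sub>F m in sequentially. G m (EE L x) = indicator T x"
      using False by (auto simp: eventually_sequentially)
    then show ?thesis by (rule tendsto_eventually)
  qed
  have mT: "indicator T \<in> borel_measurable (torus L)"
    unfolding torus_eq using T(1)
    by (intro measurable_restrict_space1 borel_measurable_indicator) (auto simp: compact_imp_closed)
  have mG: "(\<lambda>x. G m (EE L x)) \<in> borel_measurable (torus L)" for m
    by (intro borel_measurable_torus_continuous cGE)
  have mf: "f \<in> borel_measurable (torus L)" using f by simp
  have "(\<lambda>m. LINT x|torus L. f x * G m (EE L x)) \<longlonglongrightarrow> (LINT x|torus L. f x * indicator T x)"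
  proof (rule integral_dominated_convergence[OF _ _ integrable_norm[OF f]])
    show "AE x in torus L. (\<lambda>m. f x * G m (EE L x)) \<longlonglongrightarrow> f x * indicator T x"
      using lim by (intro AE_I2 tendsto_intros) simp
    show "AE x in torus L. norm (f x * G m (EE L x)) \<le> norm (f x)" for m
      using G01 by (intro AE_I2) (auto simp: abs_mult intro: mult_left_le)
  qed (use mf mT mG in measurable)
  moreover have "(\<lambda>m. LINT x|torus L. \<bar>G m (EE L x)\<bar>) \<longlonglongrightarrow> (LINT x|torus L. indicator T x)"
  proof (rule integral_dominated_convergence[of _ _ _ "\<lambda>_. 1::real"])
    show "AE x in torus L. (\<lambda>m. \<bar>G m (EE L x)\<bar>) \<longlonglongrightarrow> indicator T x"
      using lim G01 by (intro AE_I2) simp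
    show "AE x in torus L. norm \<bar>G m (EE L x)\<bar> \<le> 1" for m using G01 by simp
    show "integrable (torus L) (\<lambda>_. 1::real)" by (rule finite_measure.integrable_const[OF finite_measure_torus])
  qed (use mf mT mG in measurable)
  ultimately show ?thesis
    using trig_dominated_EE[OF cG] by (intro LIMSEQ_le[OF _ tendsto_mult[OF tendsto_const]]) auto
qed simp

text \<open>On a compact subset \<open>T\<close> of the set where \<open>f > S\<close>, the integral
  of \<open>f - S\<close> is nonnegative by the choice of \<open>T\<close> and nonpositive by
  domination, so \<open>T\<close> is null. Inner regularity extends this to the whole set.\<close>

lemma trig_dominated_AE: "AE x in torus L. f x \<le> S"
proof -
  define A where "A = {x \<in> box 0 (\<chi> i. L). f x > S}"
  have mf: "f \<in> borel_measurable (torus L)" using f by simp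
  have "{x \<in> space (torus L). f x > S} \<in> sets (torus L)" using mf by measurable
  then have "{x \<in> cell L. f x > S} \<in> sets lebesgue"
    by (simp add: torus_eq sets_restrict_space_iff)
  then have "{x \<in> cell L. f x > S} \<inter> box 0 (\<chi> i. L) \<in> sets lebesgue" by (intro sets.Int) auto
  also have "{x \<in> cell L. f x > S} \<inter> box 0 (\<chi> i. L) = A"
    unfolding A_def using box_subset_cbox by blast
  finally have A: "A \<in> sets lebesgue" .
  have eps: "emeasure lebesgue A \<le> ennreal e" if e: "e > 0" for e
  proof -
    obtain T where T: "closed T" "T \<subseteq> A" "A - T \<in> lmeasurable" "emeasure lebesgue (A - T) < ennreal e"
      using sets_lebesgue_inner_closed[OF A e] by metis
    have Tb: "T \<subseteq> box 0 (\<chi> i. L)" using T(2) by (auto simp: A_def)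
    then have cT: "compact T"
      using T(1) bounded_box bounded_subset compact_eq_bounded_closed by blast
    have Tl: "T \<in> sets lebesgue" using T(1) by auto
    have mT: "indicator T \<in> borel_measurable (torus L)"
      unfolding torus_eq using Tl by (intro measurable_restrict_space1 borel_measurable_indicator)
    have i1: "integrable (torus L) (\<lambda>x. indicator T x :: real)"
      by (rule integrable_torus_bounded[OF mT, of 1]) (auto simp: indicator_def)
    have i2: "integrable (torus L) (\<lambda>x. f x * indicator T x)"
    proof (rule Bochner_Integration.integrable_bound[OF f])
      show "(\<lambda>x. f x * indicator T x) \<in> borel_measurable (torus L)" using mf mT by measurable
    qed (auto simp: indicator_def)
    have i3: "integrable (torus L) (\<lambda>x. (f x - S) * indicator T x)"
      using i1 i2 by (simp add: left_diff_distrib)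
    have nn: "AE x in torus L. 0 \<le> (f x - S) * indicator T x"
      using T(2) by (intro AE_I2) (auto simp: A_def indicator_def)
    have "(LINT x|torus L. (f x - S) * indicator T x) \<le> 0"
      using trig_dominated_compact[OF cT Tb] i1 i2 by (simp add: left_diff_distrib)
    then have "(LINT x|torus L. (f x - S) * indicator T x) = 0"
      using integral_nonneg_AE[OF nn] by simp
    then have "AE x in torus L. (f x - S) * indicator T x = 0"
      using integral_nonneg_eq_0_iff_AE[OF i3 nn] by simp
    then have "AE x in lebesgue. x \<notin> T"
      unfolding AE_torus_iff
    proof eventually_elim
      case (elim x)
      then show ?case using T(2) Tb box_subset_cbox[of 0 "\<chi> i. L"] by (auto simp: A_def indicator_def)
    qed
    then have "emeasure lebesgue T = 0"
      using Tl by (simp add: AE_iff_measurable[of T])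
    then show ?thesis
      using T(4) emeasure_Diff_null_set[of T lebesgue A] A Tl by (auto simp: null_sets_def)
  qed
  have "emeasure lebesgue A \<le> 0"
    by (rule ennreal_le_epsilon) (simp add: eps)
  then have "A \<in> null_sets lebesgue" using A by (simp add: null_sets_def)
  then have "AE x in lebesgue. x \<notin> A" by (rule AE_not_in)
  with AE_torus_box[of L, unfolded AE_torus_iff] show ?thesis unfolding AE_torus_iff
    by eventually_elim (simp add: A_def linorder_not_less)
qed

end

lemma trig_dominated_abs_AE:
  fixes f :: "real^'n \<Rightarrow> real"
  assumes L: "L > 0" and f: "integrable (torus L) f" and S: "S \<ge> 0"
    and dom: "\<And>p. rtp L p \<Longrightarrow> \<bar>LINT x|torus L. f x * p x\<bar> \<le> S * (LINT x|torus L. \<bar>p x\<bar>)"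
  shows "AE x in torus L. \<bar>f x\<bar> \<le> S"
proof -
  have "AE x in torus L. f x \<le> S"
    by (rule trig_dominated_AE[OF L f S]) (use dom in \<open>meson abs_le_D1\<close>)
  moreover have "AE x in torus L. - f x \<le> S"
  proof (rule trig_dominated_AE[OF L _ S])
    show "integrable (torus L) (\<lambda>x. - f x)" using f by simp
    show "(LINT x|torus L. - f x * p x) \<le> S * (LINT x|torus L. \<bar>p x\<bar>)" if "rtp L p" for p
      using dom[OF that] by simp
  qed
  ultimately show ?thesis by eventually_elim linarith
qed

text \<open>\<open>F\<close> collects the frequencies occurring in \<open>p\<close>. Only the
  vanishing of integrals is asserted, which survives addition without any uniqueness of the
  representation as a sum.\<close>

lemma tp_spectrum:
  fixes p :: "real^'n \<Rightarrow> complex"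
  assumes "tp L p"
  shows "\<exists>F. finite F \<and> F \<subseteq> latt \<and> (\<forall>g. integrable (torus L) g \<longrightarrow>
    (\<forall>\<xi>\<in>F. (LINT x|torus L. g x * ee L \<xi> x) = 0) \<longrightarrow> (LINT x|torus L. g x * p x) = 0)"
  using assms
proof (induction rule: tp.induct)
  case (base \<xi> c)
  have eq: "(LINT x|torus L. g x * (c * ee L \<xi> x)) = c * (LINT x|torus L. g x * ee L \<xi> x)" for g
  proof -
    have "(\<lambda>x. g x * (c * ee L \<xi> x)) = (\<lambda>x. c * (g x * ee L \<xi> x))"
      by (intro ext) (rule mult.left_commute)
    then show ?thesis by (simp only: Bochner_Integration.integral_mult_right_zero)
  qed
  show ?case
  proof (intro exI[of _ "{\<xi>}"] conjI allI impI)
    fix g :: "real^'n \<Rightarrow> complex" assume "\<forall>\<eta>\<in>{\<xi>}. (LINT x|torus L. g x * ee L \<eta> x) = 0"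
    then have "(LINT x|torus L. g x * ee L \<xi> x) = 0" by blast
    then show "(LINT x|torus L. g x * (c * ee L \<xi> x)) = 0" by (metis eq mult_zero_right)
  qed (use base in auto)
next
  case (add p q)
  let ?Q = "\<lambda>F p. \<forall>g. integrable (torus L) g \<longrightarrow> (\<forall>\<xi>\<in>F. (LINT x|torus L. g x * ee L \<xi> x) = 0) \<longrightarrow> (LINT x|torus L. g x * p x) = 0"
  obtain F where F: "finite F" "F \<subseteq> latt" "?Q F p"
    using add.IH(1) by (elim exE conjE)
  obtain G where G: "finite G" "G \<subseteq> latt" "?Q G q"
    using add.IH(2) by (elim exE conjE)
  have "(LINT x|torus L. g x * (p x + q x)) = 0"
    if g: "integrable (torus L) g" and 0: "\<forall>\<xi>\<in>F \<union> G. (LINT x|torus L. g x * ee L \<xi> x) = 0" for g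
  proof -
    have "(LINT x|torus L. g x * (p x + q x)) = (LINT x|torus L. g x * p x) + (LINT x|torus L. g x * q x)"
      unfolding distrib_left
      by (intro Bochner_Integration.integral_add integrable_torus_mult_continuous g tp_continuous[OF add.hyps(1)] tp_continuous[OF add.hyps(2)])
    moreover have "(LINT x|torus L. g x * p x) = 0" "(LINT x|torus L. g x * q x) = 0"
      using F(3) G(3) g 0 by blast+
    ultimately show ?thesis by simp
  qed
  then show ?case using F(1,2) G(1,2) by (intro exI[of _ "F \<union> G"]) blast
qed

text \<open>The case \<open>S = 0\<close> of the domination principle: if all coefficients vanish,
  so do the integrals of the real and imaginary parts against every trigonometric
  polynomial.\<close>

lemma trig_complete:
  fixes f :: "real^'n \<Rightarrow> complex"
  assumes L: "L > 0" and f: "integrable (torus L) f"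
    and 0: "\<And>\<xi>. \<xi> \<in> latt \<Longrightarrow> (LINT x|torus L. f x * ee L \<xi> x) = 0"
  shows "AE x in torus L. f x = 0"
proof -
  have p0: "(LINT x|torus L. f x * of_real (p x)) = 0" if "rtp L p" for p
    using tp_spectrum[of L "\<lambda>x. of_real (p x)"] that f 0 by (auto simp: rtp_real subset_iff)
  have int: "integrable (torus L) (\<lambda>x. f x * of_real (p x))" if "rtp L p" for p
    using that by (intro integrable_torus_mult_continuous f tp_continuous) (simp add: rtp_real)
  have "AE x in torus L. \<bar>Re (f x)\<bar> \<le> 0"
  proof (rule trig_dominated_abs_AE[OF L])
    show "\<bar>LINT x|torus L. Re (f x) * p x\<bar> \<le> 0 * (LINT x|torus L. \<bar>p x\<bar>)" if "rtp L p" for p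
      using integral_Re[OF int[OF that]] p0[OF that] by simp
  qed (use f in auto)
  moreover have "AE x in torus L. \<bar>Im (f x)\<bar> \<le> 0"
  proof (rule trig_dominated_abs_AE[OF L])
    show "\<bar>LINT x|torus L. Im (f x) * p x\<bar> \<le> 0 * (LINT x|torus L. \<bar>p x\<bar>)" if "rtp L p" for p
      using integral_Im[OF int[OF that]] p0[OF that] by simp
  qed (use f in auto)
  ultimately show ?thesis by eventually_elim (simp add: complex_eq_iff)
qed

lemma measure_cell_pos: "L > 0 \<Longrightarrow> measure lebesgue (cell L :: (real^'n) set) > 0"
  using content_pos_lt_eq[of 0 "(\<chi> i. L) :: real^'n"]
  by (simp add: measure_completion) (auto simp: Basis_vec_def inner_axis)

text \<open>If component \<open>i\<close> of the frequency is nonzero, the real and imaginary parts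
  are, up to the factor \<open>?k\<close> and a sign, partial derivatives of each other in direction
  \<open>i\<close>, and such derivatives integrate to 0.\<close>

lemma integral_ee:
  fixes \<xi> :: "real^'n"
  assumes L: "L > 0" and \<xi>: "\<xi> \<in> latt"
  shows "(LINT x|torus L. ee L \<xi> x) = (if \<xi> = 0 then of_real (measure lebesgue (cell L :: (real^'n) set)) else 0)"
proof (cases "\<xi> = 0")
  case True
  have "(LINT x|torus L. ee L (0::real^'n) x) = measure (torus L) (cell L :: (real^'n) set) *\<^sub>R (1 :: complex)"
    by (simp add: lebesgue_integral_const)
  then show ?thesis using True by (simp add: torus_eq measure_restrict_space scaleR_conv_of_real)
next
  case False
  then obtain i where i: "\<xi> $ i \<noteq> 0" by (auto simp: vec_eq_iff)
  let ?k = "2 * pi / L * \<xi> $ i"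
  have k: "?k \<noteq> 0" using i L by simp
  have cont: "continuous_on UNIV (ee L \<xi>)" by (rule continuous_on_ee) simp
  have r: "rtp L (\<lambda>x. Re (ee L \<xi> x))" "rtp L (\<lambda>x. Im (ee L \<xi> x))"
    using \<xi> by (auto simp: rtp_real intro!: tp_Re tp_Im tp_ee)
  have dR: "((\<lambda>x. Re (ee L \<xi> x)) has_derivative (\<lambda>b. - (2 * pi / L * (\<xi> \<bullet> b)) * Im (ee L \<xi> x))) (at x)"
    and dI: "((\<lambda>x. Im (ee L \<xi> x)) has_derivative (\<lambda>b. (2 * pi / L * (\<xi> \<bullet> b)) * Re (ee L \<xi> x))) (at x)" for x
    unfolding ee_def cis.sel using L by (auto intro!: derivative_eq_intros simp: mult_ac)
  have "(LINT x|torus L. - ?k * Im (ee L \<xi> x)) = 0"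
    using integral_torus_partial_zero[OF L dR _ rtp_periodic[OF _ r(1)], of i] L
    by (simp add: inner_axis continuous_intros cont)
  then have 1: "(LINT x|torus L. Im (ee L \<xi> x)) = 0" using k by simp
  have "(LINT x|torus L. ?k * Re (ee L \<xi> x)) = 0"
    using integral_torus_partial_zero[OF L dI _ rtp_periodic[OF _ r(2)], of i] L
    by (simp add: inner_axis continuous_intros cont)
  then have 2: "(LINT x|torus L. Re (ee L \<xi> x)) = 0" using k by simp
  have "integrable (torus L) (ee L \<xi>)" by (rule integrable_torus_continuous[OF cont])
  then show ?thesis using False 1 2 by (simp add: complex_eq_iff)
qed

lemma trig_parseval:
  fixes a :: "real^'n \<Rightarrow> complex"
  assumes L: "L > 0" and F: "finite F" "F \<subseteq> latt"
  shows "(LINT x|torus L. (norm (\<Sum>\<xi>\<in>F. a \<xi> * ee L \<xi> x))\<^sup>2) = measure lebesgue (cell L :: (real^'n) set) * (\<Sum>\<xi>\<in>F. (norm (a \<xi>))\<^sup>2)"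
proof -
  let ?V = "measure lebesgue (cell L :: (real^'n) set)"
  have eq: "complex_of_real ((norm (\<Sum>\<xi>\<in>F. a \<xi> * ee L \<xi> x))\<^sup>2) =
     (\<Sum>\<xi>\<in>F. \<Sum>\<eta>\<in>F. (a \<xi> * cnj (a \<eta>)) * ee L (\<xi> - \<eta>) x)" for x
  proof -
    have "complex_of_real ((norm z)\<^sup>2) = z * cnj z" for z by (rule complex_norm_square)
    then have "complex_of_real ((norm (\<Sum>\<xi>\<in>F. a \<xi> * ee L \<xi> x))\<^sup>2) =
        (\<Sum>\<xi>\<in>F. a \<xi> * ee L \<xi> x) * (\<Sum>\<eta>\<in>F. cnj (a \<eta>) * ee L (- \<eta>) x)"
      by (simp add: cnj_ee)
    also have "\<dots> = (\<Sum>\<xi>\<in>F. \<Sum>\<eta>\<in>F. (a \<xi> * cnj (a \<eta>)) * (ee L \<xi> x * ee L (- \<eta>) x))"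
      by (simp add: sum_product mult_ac)
    finally show ?thesis by (simp add: ee_mult)
  qed
  have ci: "integrable (torus L) (\<lambda>x. c * ee L \<xi> x)" for c and \<xi> :: "real^'n"
    by (intro integrable_torus_continuous continuous_intros)
  have "complex_of_real (LINT x|torus L. (norm (\<Sum>\<xi>\<in>F. a \<xi> * ee L \<xi> x))\<^sup>2) =
     (LINT x|torus L. (\<Sum>\<xi>\<in>F. \<Sum>\<eta>\<in>F. (a \<xi> * cnj (a \<eta>)) * ee L (\<xi> - \<eta>) x))"
    by (simp only: integral_complex_of_real[symmetric] eq)
  also have "\<dots> = (\<Sum>\<xi>\<in>F. \<Sum>\<eta>\<in>F. (a \<xi> * cnj (a \<eta>)) * (LINT x|torus L. ee L (\<xi> - \<eta>) x))"
    by (simp add: Bochner_Integration.integral_sum ci Bochner_Integration.integrable_sum)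
  also have "\<dots> = (\<Sum>\<xi>\<in>F. \<Sum>\<eta>\<in>F. if \<xi> = \<eta> then a \<xi> * cnj (a \<eta>) * of_real ?V else 0)"
    using F(2) by (intro sum.cong refl) (auto simp: integral_ee[OF L] latt_diff subset_iff)
  also have "\<dots> = (\<Sum>\<xi>\<in>F. a \<xi> * cnj (a \<xi>) * of_real ?V)"
    using F(1) by (simp add: sum.delta')
  also have "\<dots> = of_real (?V * (\<Sum>\<xi>\<in>F. (norm (a \<xi>))\<^sup>2))"
    by (simp only: sum_distrib_left of_real_sum of_real_mult complex_norm_square) (simp add: mult_ac)
  finally show ?thesis by (simp only: of_real_eq_iff)
qed

text \<open>Coefficients are integrals against \<open>ee L \<xi>\<close> without conjugation, so the
  mode that reproduces the coefficient at \<open>\<xi>\<close> carries the frequency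
  \<open>- \<xi>\<close>.\<close>

lemma trig_coefficient:
  fixes c :: "real^'n \<Rightarrow> complex"
  assumes L: "L > 0" and F: "finite F" "F \<subseteq> latt" and \<xi>: "\<xi> \<in> latt"
  shows "(LINT x|torus L. (\<Sum>\<eta>\<in>F. c \<eta> * ee L (- \<eta>) x) * ee L \<xi> x) =
    (if \<xi> \<in> F then c \<xi> * of_real (measure lebesgue (cell L :: (real^'n) set)) else 0)"
proof -
  let ?V = "measure lebesgue (cell L :: (real^'n) set)"
  have eq: "(\<Sum>\<eta>\<in>F. c \<eta> * ee L (- \<eta>) x) * ee L \<xi> x = (\<Sum>\<eta>\<in>F. c \<eta> * ee L (\<xi> - \<eta>) x)" for x
    by (simp add: sum_distrib_right mult.assoc ee_mult)
  have ci: "integrable (torus L) (\<lambda>x. c * ee L \<xi> x)" for c and \<xi> :: "real^'n"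
    by (intro integrable_torus_continuous continuous_intros)
  have "(LINT x|torus L. (\<Sum>\<eta>\<in>F. c \<eta> * ee L (- \<eta>) x) * ee L \<xi> x) = (\<Sum>\<eta>\<in>F. c \<eta> * (LINT x|torus L. ee L (\<xi> - \<eta>) x))"
    unfolding eq by (simp add: Bochner_Integration.integral_sum ci)
  also have "\<dots> = (\<Sum>\<eta>\<in>F. if \<xi> = \<eta> then c \<eta> * of_real ?V else 0)"
    using F(2) \<xi> by (intro sum.cong refl) (auto simp: integral_ee[OF L] latt_diff subset_iff)
  also have "\<dots> = (if \<xi> \<in> F then c \<xi> * of_real ?V else 0)"
    using F(1) by (simp add: sum.delta')
  finally show ?thesis .
qed

section \<open>Lattice sums and boundedness from the decay of Fourier coefficients\<close>

lemma latt_finite_bounded: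
  assumes "B \<subseteq> (latt :: (real^'n) set)" "bounded B"
  obtains N :: int where "B \<subseteq> (\<lambda>k. \<chi> i. real_of_int (k i)) ` (PiE UNIV (\<lambda>_. {-N..N}))" "N \<ge> 0"
proof -
  obtain M where M: "M > 0" "\<And>x. x \<in> B \<Longrightarrow> norm x \<le> M" using assms(2) bounded_pos by metis
  define N where "N = \<lceil>M\<rceil>"
  have "\<xi> \<in> (\<lambda>k. \<chi> i. real_of_int (k i)) ` (PiE UNIV (\<lambda>_. {-N..N}))" if "\<xi> \<in> B" for \<xi>
  proof (rule image_eqI[of _ _ "\<lambda>i. \<lfloor>\<xi> $ i\<rfloor>"])
    have int: "real_of_int \<lfloor>\<xi> $ i\<rfloor> = \<xi> $ i" for i
      using assms(1) that by (auto simp: latt_def elim!: Ints_cases)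
    show "\<xi> = (\<chi> i. real_of_int \<lfloor>\<xi> $ i\<rfloor>)" by (simp add: int vec_eq_iff)
    have "\<bar>\<xi> $ i\<bar> \<le> M" for i
      using component_le_norm_cart[of \<xi> i] M(2)[OF that] by linarith
    then have "- real_of_int N \<le> real_of_int \<lfloor>\<xi> $ i\<rfloor> \<and> real_of_int \<lfloor>\<xi> $ i\<rfloor> \<le> real_of_int N" for i
      unfolding int N_def by (smt (verit) le_of_int_ceiling)
    then show "(\<lambda>i. \<lfloor>\<xi> $ i\<rfloor>) \<in> UNIV \<rightarrow>\<^sub>E {- N..N}" by (auto simp flip: of_int_minus)
  qed
  then show ?thesis by (intro that[of N] subsetI) (use M(1) in \<open>auto simp: N_def\<close>)
qed

lemma finite_latt_bounded: "B \<subseteq> latt \<Longrightarrow> bounded B \<Longrightarrow> finite B"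
  by (erule (1) latt_finite_bounded) (erule finite_subset, intro finite_imageI finite_PiE, auto)

text \<open>The sum is reduced to one dimension: each of the at most 3 coordinates receives the
  power -2/3 of the bracket, which together do not exceed the available power -2. The
  one-dimensional terms then decay like the power -4/3 of the index and are summable.\<close>

lemma latt_sum_bound:
  assumes d: "CARD('n) \<le> 3" and a: "a > 0"
  shows "\<exists>C. \<forall>F. finite F \<longrightarrow> F \<subseteq> (latt :: (real^'n) set) \<longrightarrow> (\<Sum>\<xi>\<in>F. 1 / (1 + a * (norm \<xi>)\<^sup>2)\<^sup>2) \<le> C"
proof -
  define f where "f t = (1 + a * t\<^sup>2) powr (- (2/3))" for t :: real
  have f0: "0 \<le> f t" for t by (simp add: f_def)
  have sm: "summable (\<lambda>m::nat. f (real m))"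
  proof (rule summable_comparison_test_ev)
    show "summable (\<lambda>m. a powr (- (2/3)) * real m powr (-(4/3)))"
      by (intro summable_mult) (simp add: summable_real_powr_iff)
    show "\<forall>\<^sub>F m in sequentially. norm (f (real m)) \<le> a powr (- (2/3)) * real m powr (-(4/3))"
      using eventually_gt_at_top[of 0]
    proof eventually_elim
      case (elim m)
      have "(1 + a * (real m)\<^sup>2) powr (- (2/3)) \<le> (a * (real m)\<^sup>2) powr (- (2/3))"
        using a elim by (intro powr_mono2') auto
      also have "\<dots> = a powr (- (2/3)) * ((real m)\<^sup>2) powr (- (2/3))"
        using a by (simp add: powr_mult)
      also have "((real m)\<^sup>2) powr (- (2/3)) = real m powr (-(4/3))"
        using elim by (simp add: powr_powr flip: powr_numeral)
      finally show ?case by (simp add: f_def)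
    qed
  qed
  define C1 where "C1 = 2 * (\<Sum>m. f (real m))"
  have C1: "(\<Sum>k\<in>{-N..N}. f (real_of_int k)) \<le> C1" for N :: int
  proof -
    \<comment> \<open>Zero is covered twice, which is harmless in an upper bound for nonnegative
      terms.\<close>
    have "{-N..N} \<subseteq> int ` {..nat N} \<union> (\<lambda>m. - int m) ` {..nat N}"
    proof
      fix k assume "k \<in> {-N..N}"
      then show "k \<in> int ` {..nat N} \<union> (\<lambda>m. - int m) ` {..nat N}"
        by (cases "k \<ge> 0") (auto intro!: image_eqI[of _ int "nat k"] image_eqI[of _ "\<lambda>m. - int m" "nat (-k)"])
    qed
    then have "(\<Sum>k\<in>{-N..N}. f (real_of_int k)) \<le> (\<Sum>k\<in>int ` {..nat N} \<union> (\<lambda>m. - int m) ` {..nat N}. f (real_of_int k))"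
      by (intro sum_mono2) (auto simp: f0)
    also have "\<dots> \<le> (\<Sum>k\<in>int ` {..nat N}. f (real_of_int k)) + (\<Sum>k\<in>(\<lambda>m. - int m) ` {..nat N}. f (real_of_int k))"
      by (subst sum.union_inter[symmetric]) (auto simp: f0 intro!: sum_nonneg)
    also have "\<dots> = 2 * (\<Sum>m\<le>nat N. f (real m))"
      by (subst (1 2) sum.reindex) (auto simp: inj_on_def f_def)
    also have "(\<Sum>m\<le>nat N. f (real m)) \<le> (\<Sum>m. f (real m))"
      by (intro sum_le_suminf sm) (auto simp: f0)
    finally show ?thesis by (simp add: C1_def)
  qed
  have "(\<Sum>\<xi>\<in>F. 1 / (1 + a * (norm \<xi>)\<^sup>2)\<^sup>2) \<le> C1 ^ CARD('n)" if F: "finite F" "F \<subseteq> latt" for F :: "(real^'n) set"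
  proof -
    let ?v = "\<lambda>k. (\<chi> i. real_of_int (k i)) :: real^'n"
    obtain N where N: "F \<subseteq> ?v ` (PiE UNIV (\<lambda>_. {-N..N}))"
      using latt_finite_bounded[OF F(2) finite_imp_bounded[OF F(1)]] by metis
    have inj: "inj ?v" by (auto simp: inj_def vec_eq_iff)
    have le: "1 / (1 + a * (norm \<xi>)\<^sup>2)\<^sup>2 \<le> (\<Prod>i\<in>UNIV. f (\<xi> $ i))" for \<xi> :: "real^'n"
    proof -
      let ?b = "1 + a * (norm \<xi>)\<^sup>2"
      have b1: "?b \<ge> 1" using a by simp
      have "1 / ?b\<^sup>2 = ?b powr (-2)"
        using b1 by (simp add: powr_minus powr_numeral divide_inverse)
      also have "\<dots> \<le> ?b powr (- (2/3) * CARD('n))"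
        using d b1 by (intro powr_mono) auto
      also have "\<dots> = (\<Prod>i\<in>(UNIV::'n set). ?b powr (- (2/3)))"
        using b1 by (simp add: powr_powr flip: powr_realpow)
      also have "\<dots> \<le> (\<Prod>i\<in>UNIV. f (\<xi> $ i))"
      proof (rule prod_mono)
        fix i :: 'n
        have "(\<xi> $ i)\<^sup>2 \<le> (norm \<xi>)\<^sup>2"
          using component_le_norm_cart[of \<xi> i] by (metis abs_le_square_iff abs_norm_cancel)
        then have "1 + a * (\<xi> $ i)\<^sup>2 \<le> ?b" using a by simp
        moreover have "0 < 1 + a * (\<xi> $ i)\<^sup>2" using a by (simp add: add_pos_nonneg)
        ultimately show "0 \<le> ?b powr (- (2/3)) \<and> ?b powr (- (2/3)) \<le> f (\<xi> $ i)"
          unfolding f_def by (intro conjI powr_mono2') auto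
      qed
      finally show ?thesis .
    qed
    have "(\<Sum>\<xi>\<in>F. 1 / (1 + a * (norm \<xi>)\<^sup>2)\<^sup>2) \<le> (\<Sum>\<xi>\<in>?v ` (PiE UNIV (\<lambda>_. {-N..N})). 1 / (1 + a * (norm \<xi>)\<^sup>2)\<^sup>2)"
      by (intro sum_mono2 N finite_imageI finite_PiE) auto
    also have "\<dots> \<le> (\<Sum>\<xi>\<in>?v ` (PiE UNIV (\<lambda>_. {-N..N})). \<Prod>i\<in>UNIV. f (\<xi> $ i))"
      by (intro sum_mono le)
    also have "\<dots> = (\<Sum>k\<in>PiE UNIV (\<lambda>_. {-N..N}). \<Prod>i\<in>(UNIV::'n set). f (real_of_int (k i)))"
      by (subst sum.reindex) (use inj in \<open>auto simp: inj_on_def inj_def\<close>)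
    also have "\<dots> = (\<Prod>i\<in>(UNIV::'n set). \<Sum>k\<in>{-N..N}. f (real_of_int k))"
      by (rule prod_sum_PiE[symmetric]) auto
    also have "\<dots> \<le> (\<Prod>i\<in>(UNIV::'n set). C1)"
      by (intro prod_mono conjI C1 sum_nonneg f0)
    finally show ?thesis by simp
  qed
  then show ?thesis by blast
qed

text \<open>The hypothesis says that \<open>h\<close> is \<open>f\<close> minus its Laplacian. The
  partial Fourier sums of \<open>f\<close> are bounded uniformly in the frequency set
  \<open>F\<close>, by Cauchy-Schwarz between \<open>h\<close> and the lattice sum. Their
  convergence is not studied: a trigonometric polynomial sees only finitely many modes, so the bound
  passes to \<open>f\<close> by duality.\<close>

lemma bounded_of_trig_coefficients:
  fixes f h :: "real^'n \<Rightarrow> real"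
  assumes L: "L > 0" and d: "CARD('n) \<le> 3"
    and f: "integrable (torus L) f" and h: "integrable (torus L) h"
    and h2: "integrable (torus L) (\<lambda>x. (h x)\<^sup>2)"
    and coef: "\<And>\<xi>. \<xi> \<in> latt \<Longrightarrow> of_real (1 + (2 * pi / L)\<^sup>2 * (norm \<xi>)\<^sup>2) * (LINT x|torus L. of_real (f x) * ee L \<xi> x)
        = (LINT x|torus L. of_real (h x) * ee L \<xi> x)"
  shows "\<exists>C. AE x in torus L. \<bar>f x\<bar> \<le> C"
proof -
  define V where "V = measure lebesgue (cell L :: (real^'n) set)"
  have V: "V > 0" unfolding V_def by (rule measure_cell_pos[OF L])
  define a where "a = (2 * pi / L)\<^sup>2"
  have a: "a > 0" using L by (simp add: a_def)
  define b where "b \<eta> = 1 / (1 + a * (norm \<eta>)\<^sup>2)" for \<eta> :: "real^'n"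
  have b: "1 + a * (norm \<eta>)\<^sup>2 > 0" for \<eta> :: "real^'n" using a by (simp add: add_pos_nonneg)
  obtain C where C: "\<And>F. finite F \<Longrightarrow> F \<subseteq> (latt :: (real^'n) set) \<Longrightarrow> (\<Sum>\<xi>\<in>F. 1 / (1 + a * (norm \<xi>)\<^sup>2)\<^sup>2) \<le> C"
    using latt_sum_bound[OF d a] by blast
  define S where "S = sqrt (LINT x|torus L. (h x)\<^sup>2) * sqrt (V * C) / V"
  define fh where "fh \<xi> = (LINT x|torus L. of_real (f x) * ee L \<xi> x)" for \<xi>
  have C0: "C \<ge> 0" using C[of "{}"] by simp
  have S0: "S \<ge> 0" using V C0 by (simp add: S_def integral_nonneg_AE)
  define PF where "PF F x = (\<Sum>\<eta>\<in>F. (fh \<eta> / of_real V) * ee L (- \<eta>) x)" for F x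
  have PF_le: "norm (PF F x) \<le> S" if F: "finite F" "F \<subseteq> latt" for F x
  proof -
    \<comment> \<open>A kernel such that \<open>V * PF F x\<close> is the integral of
      \<open>h\<close> against \<open>Q\<close>. Parseval computes the norm of \<open>Q\<close>, so
      that no inequality for the coefficients of \<open>h\<close> enters.\<close>
    define Q where "Q y = (\<Sum>\<eta>\<in>F. (of_real (b \<eta>) * ee L (- \<eta>) x) * ee L \<eta> y)" for y
    have cQ: "continuous_on UNIV Q" unfolding Q_def by (intro continuous_intros)
    have cQ2: "continuous_on UNIV (\<lambda>x. (norm (Q x))\<^sup>2)" by (intro continuous_intros cQ)
    have ch: "integrable (torus L) (\<lambda>x. complex_of_real (h x))" using h by simp
    have int: "integrable (torus L) (\<lambda>y. of_real (h y) * ((of_real (b \<eta>) * ee L (- \<eta>) x) * ee L \<eta> y))" for \<eta>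
      by (intro integrable_torus_mult_continuous ch continuous_intros)
    have "of_real V * PF F x = (\<Sum>\<eta>\<in>F. (of_real (b \<eta>) * ee L (- \<eta>) x) * (LINT y|torus L. of_real (h y) * ee L \<eta> y))"
      unfolding PF_def sum_distrib_left
    proof (rule sum.cong[OF refl])
      fix \<eta> assume "\<eta> \<in> F"
      then have c: "(LINT x|torus L. of_real (h x) * ee L \<eta> x) = of_real (1 + a * (norm \<eta>)\<^sup>2) * fh \<eta>"
        using coef[of \<eta>] F(2) by (auto simp: fh_def a_def)
      have "complex_of_real (b \<eta>) * of_real (1 + a * (norm \<eta>)\<^sup>2) = 1"
        using b[of \<eta>] unfolding of_real_mult[symmetric] by (simp add: b_def del: of_real_mult)
      then have "complex_of_real (b \<eta>) * (of_real (1 + a * (norm \<eta>)\<^sup>2) * z) = z" for z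
        by (simp only: mult.assoc[symmetric] mult_1_left)
      then show "of_real V * (fh \<eta> / of_real V * ee L (- \<eta>) x) =
          of_real (b \<eta>) * ee L (- \<eta>) x * (LINT y|torus L. of_real (h y) * ee L \<eta> y)"
        unfolding c using V by (simp add: mult_ac)
    qed
    also have "\<dots> = (\<Sum>\<eta>\<in>F. (LINT y|torus L. of_real (h y) * ((of_real (b \<eta>) * ee L (- \<eta>) x) * ee L \<eta> y)))"
      by (intro sum.cong refl) (simp add: mult_ac flip: Bochner_Integration.integral_mult_right_zero)
    also have "\<dots> = (LINT y|torus L. of_real (h y) * Q y)"
      unfolding Q_def sum_distrib_left by (rule Bochner_Integration.integral_sum[symmetric]) (rule int)
    finally have "V * norm (PF F x) = norm (LINT y|torus L. of_real (h y) * Q y)"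
      using V by (metis norm_mult norm_of_real abs_of_pos)
    also have "\<dots> \<le> (LINT y|torus L. norm (of_real (h y) * Q y))"
      by (rule integral_norm_bound)
    also have "\<dots> = (LINT y|torus L. \<bar>h y\<bar> * norm (Q y))"
      by (simp add: norm_mult)
    also have "\<dots> \<le> \<bar>LINT y|torus L. \<bar>h y\<bar> * norm (Q y)\<bar>" by simp
    also have "\<dots> \<le> sqrt (LINT y|torus L. \<bar>h y\<bar>\<^sup>2) * sqrt (LINT y|torus L. (norm (Q y))\<^sup>2)"
    proof (rule Cauchy_Schwarz_integral(2))
      show "(\<lambda>y. \<bar>h y\<bar>) \<in> borel_measurable (torus L)" using h by simp
      show "(\<lambda>y. norm (Q y)) \<in> borel_measurable (torus L)"
        by (intro borel_measurable_torus_continuous continuous_intros cQ)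
      show "integrable (torus L) (\<lambda>y. \<bar>h y\<bar>\<^sup>2)" using h2 by simp
      show "integrable (torus L) (\<lambda>y. (norm (Q y))\<^sup>2)" by (intro integrable_torus_continuous cQ2)
    qed
    also have "(LINT y|torus L. (norm (Q y))\<^sup>2) = V * (\<Sum>\<eta>\<in>F. (norm (of_real (b \<eta>) * ee L (- \<eta>) x))\<^sup>2)"
      unfolding Q_def V_def by (rule trig_parseval[OF L F])
    also have "(\<Sum>\<eta>\<in>F. (norm (of_real (b \<eta>) * ee L (- \<eta>) x))\<^sup>2) = (\<Sum>\<eta>\<in>F. 1 / (1 + a * (norm \<eta>)\<^sup>2)\<^sup>2)"
      by (simp add: norm_mult) (simp add: b_def power_divide)
    finally have *: "V * norm (PF F x) \<le> sqrt (LINT y|torus L. (h y)\<^sup>2) * sqrt (V * (\<Sum>\<eta>\<in>F. 1 / (1 + a * (norm \<eta>)\<^sup>2)\<^sup>2))"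
      by simp
    also have "\<dots> \<le> sqrt (LINT y|torus L. (h y)\<^sup>2) * sqrt (V * C)"
      using C[OF F] V by (intro mult_left_mono real_sqrt_le_mono) (auto simp: integral_nonneg_AE)
    finally show ?thesis using V by (simp add: S_def field_simps)
  qed
  have "AE x in torus L. \<bar>f x\<bar> \<le> S"
  proof (rule trig_dominated_abs_AE[OF L f S0])
    fix p :: "real^'n \<Rightarrow> real" assume p: "rtp L p"
    let ?p = "\<lambda>x. complex_of_real (p x)"
    have tp: "tp L ?p" using p by (simp add: rtp_real)
    have cp: "continuous_on UNIV ?p" using tp_continuous[OF tp] .
    let ?Q = "\<lambda>F p. \<forall>g. integrable (torus L) g \<longrightarrow> (\<forall>\<xi>\<in>F. (LINT x|torus L. g x * ee L \<xi> x) = 0) \<longrightarrow> (LINT x|torus L. g x * p x) = 0"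
    obtain F where F: "finite F" "F \<subseteq> latt" "?Q F ?p"
      using tp_spectrum[OF tp] by (elim exE conjE)
    have cPF: "continuous_on UNIV (PF F)" unfolding PF_def by (intro continuous_intros)
    have cf: "integrable (torus L) (\<lambda>x. complex_of_real (f x))" using f by simp
    note iPF = integrable_torus_continuous[OF cPF, of L]
    \<comment> \<open>\<open>F\<close> contains all frequencies that \<open>p\<close> can detect,
      and on \<open>F\<close> the coefficients of \<open>f\<close> and of its partial sum
      coincide.\<close>
    have "(LINT x|torus L. (of_real (f x) - PF F x) * ?p x) = 0"
    proof (rule F(3)[rule_format])
      show "integrable (torus L) (\<lambda>x. of_real (f x) - PF F x)" using cf iPF by simp
      fix \<xi> assume \<xi>: "\<xi> \<in> F"
      have "(LINT x|torus L. (of_real (f x) - PF F x) * ee L \<xi> x) =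
          (LINT x|torus L. of_real (f x) * ee L \<xi> x) - (LINT x|torus L. PF F x * ee L \<xi> x)"
        unfolding left_diff_distrib
        by (intro Bochner_Integration.integral_diff integrable_torus_mult_continuous cf iPF continuous_intros)
      also have "(LINT x|torus L. PF F x * ee L \<xi> x) = fh \<xi>"
        unfolding PF_def using trig_coefficient[OF L F(1,2), of \<xi> "\<lambda>\<eta>. fh \<eta> / of_real V"] \<xi> F(2) V by (auto simp flip: V_def)
      finally show "(LINT x|torus L. (of_real (f x) - PF F x) * ee L \<xi> x) = 0" by (simp add: fh_def)
    qed
    moreover have "(LINT x|torus L. (of_real (f x) - PF F x) * ?p x) =
          (LINT x|torus L. of_real (f x) * ?p x) - (LINT x|torus L. PF F x * ?p x)"
      unfolding left_diff_distrib
      by (intro Bochner_Integration.integral_diff integrable_torus_mult_continuous cf iPF cp)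
    ultimately have eq: "(LINT x|torus L. of_real (f x * p x)) = (LINT x|torus L. PF F x * ?p x)" by simp
    have "\<bar>LINT x|torus L. f x * p x\<bar> = norm (LINT x|torus L. complex_of_real (f x * p x))"
      by (simp only: integral_complex_of_real norm_of_real)
    also have "\<dots> \<le> (LINT x|torus L. norm (PF F x * ?p x))"
      unfolding eq by (rule integral_norm_bound)
    also have "\<dots> \<le> (LINT x|torus L. S * \<bar>p x\<bar>)"
    proof (rule integral_mono)
      show "integrable (torus L) (\<lambda>x. norm (PF F x * ?p x))"
        by (intro integrable_norm integrable_torus_mult_continuous iPF cp)
      show "integrable (torus L) (\<lambda>x. S * \<bar>p x\<bar>)"
        by (intro integrable_torus_continuous continuous_intros rtp_continuous[OF p])
      show "norm (PF F x * ?p x) \<le> S * \<bar>p x\<bar>" for x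
        using PF_le[OF F(1,2), of x] by (simp add: norm_mult mult_right_mono)
    qed
    finally show "\<bar>LINT x|torus L. f x * p x\<bar> \<le> S * (LINT x|torus L. \<bar>p x\<bar>)" by simp
  qed
  then show ?thesis by blast
qed

section \<open>Unique continuation of trigonometric polynomials\<close>

lemma tp_line_holomorphic:
  assumes "tp L p"
  shows "\<exists>g. g holomorphic_on UNIV \<and> (\<forall>t::real. p (x + t *\<^sub>R v) = g (of_real t))"
  using assms
proof (induction rule: tp.induct)
  case (base \<xi> c)
  define g where "g z = (c * ee L \<xi> x) * exp (\<i> * of_real (2 * pi / L * (\<xi> \<bullet> v)) * z)" for z
  have "g holomorphic_on UNIV" unfolding g_def by (intro holomorphic_intros)
  moreover have "c * ee L \<xi> (x + t *\<^sub>R v) = g (of_real t)" for t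
  proof -
    have "ee L \<xi> (t *\<^sub>R v) = exp (\<i> * of_real (2 * pi / L * (\<xi> \<bullet> v)) * of_real t)"
      by (simp add: ee_def cis_conv_exp mult_ac)
    then show ?thesis by (simp add: g_def ee_add)
  qed
  ultimately show ?case by blast
next
  case (add p q)
  then obtain g h where "g holomorphic_on UNIV" "\<forall>t::real. p (x + t *\<^sub>R v) = g (of_real t)"
    "h holomorphic_on UNIV" "\<forall>t::real. q (x + t *\<^sub>R v) = h (of_real t)" by auto
  then show ?case by (intro exI[of _ "\<lambda>z. g z + h z"]) (auto intro: holomorphic_intros)
qed

text \<open>Along the line from a point \<open>x\<close> of \<open>U\<close> to \<open>y\<close> the
  polynomial is the restriction of an entire function. This function vanishes on a short real
  interval at 0, hence everywhere, in particular at parameter 1.\<close>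

lemma tp_unique_continuation:
  assumes p: "tp L p" and U: "open U" "U \<noteq> {}" and 0: "\<And>x. x \<in> U \<Longrightarrow> p x = 0"
  shows "p y = 0"
proof -
  obtain x e where xe: "e > 0" "ball x e \<subseteq> U" using U openE by blast
  obtain g where g: "g holomorphic_on UNIV" "\<And>t::real. p (x + t *\<^sub>R (y - x)) = g (of_real t)"
    using tp_line_holomorphic[OF p] by blast
  \<comment> \<open>For parameters below \<open>r\<close> the point on the line stays in the ball
    around \<open>x\<close>. Adding 1 in the denominator covers the case
    \<open>y = x\<close>.\<close>
  define r where "r = e / (norm (y - x) + 1)"
  have r: "r > 0" using xe by (simp add: r_def add_nonneg_pos)
  have "g 1 = 0"
  proof (rule analytic_continuation[OF g(1)])
    show "complex_of_real ` {0<..<r} \<subseteq> UNIV" by simp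
    show "0 islimpt complex_of_real ` {0<..<r}"
      unfolding islimpt_approachable
    proof (intro allI impI)
      fix d :: real assume "d > 0"
      then show "\<exists>x'\<in>complex_of_real ` {0<..<r}. x' \<noteq> 0 \<and> dist x' 0 < d"
        using r by (intro bexI[of _ "of_real (min r d / 2)"] imageI) (auto simp: min_def)
    qed
    fix z assume "z \<in> complex_of_real ` {0<..<r}"
    then obtain t where t: "z = of_real t" "0 < t" "t < r" by auto
    have "norm (t *\<^sub>R (y - x)) \<le> t * (norm (y - x) + 1)" using t by simp
    also have "\<dots> < r * (norm (y - x) + 1)" using t by (intro mult_strict_right_mono) (auto simp: add_nonneg_pos)
    also have "\<dots> = e" by (simp add: r_def add_nonneg_eq_0_iff)
    finally have "x + t *\<^sub>R (y - x) \<in> U" using xe(2) by (auto simp: dist_norm)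
    then show "g z = 0" using 0 g(2) t(1) by metis
  qed auto
  then show ?thesis using g(2)[of 1] by simp
qed

section \<open>The Lebesgue space \<open>L\<^sup>2\<close> and weak derivatives\<close>

lemma Lp2_iff: "f \<in> Lp L 2 \<longleftrightarrow> periodic_on L UNIV f \<and> f \<in> borel_measurable (torus L) \<and>
    integrable (torus L) (\<lambda>x. (norm (f x))\<^sup>2)"
  by (simp add: Lp_on_def)

lemma Lp2_measurable [measurable_dest]: "f \<in> Lp L 2 \<Longrightarrow> f \<in> borel_measurable (torus L)"
  by (simp add: Lp2_iff)

lemma Lp2_integrable_ip:
  assumes "f \<in> Lp L 2" "g \<in> Lp L 2"
  shows "integrable (torus L) (\<lambda>x. f x \<bullet> g x)"
    and "\<bar>ip L f g\<bar> \<le> norm_Lp L 2 f * norm_Lp L 2 g"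
proof -
  have [measurable]: "f \<in> borel_measurable (torus L)" "g \<in> borel_measurable (torus L)"
    using assms by (simp_all add: Lp2_iff)
  have CS: "integrable (torus L) (\<lambda>x. norm (f x) * norm (g x))"
    "\<bar>LINT x|torus L. norm (f x) * norm (g x)\<bar> \<le> sqrt (LINT x|torus L. (norm (f x))\<^sup>2) * sqrt (LINT x|torus L. (norm (g x))\<^sup>2)"
    using assms by (intro Cauchy_Schwarz_integral; simp add: Lp2_iff)+
  show i: "integrable (torus L) (\<lambda>x. f x \<bullet> g x)"
    by (rule Bochner_Integration.integrable_bound[OF CS(1)]) (simp_all add: Cauchy_Schwarz_ineq2)
  have "\<bar>ip L f g\<bar> \<le> (LINT x|torus L. norm (f x \<bullet> g x))"
    unfolding ip_def using integral_norm_bound[of "torus L" "\<lambda>x. f x \<bullet> g x"] by simp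
  also have "\<dots> \<le> (LINT x|torus L. norm (f x) * norm (g x))"
    by (intro integral_mono CS(1) integrable_norm i) (simp add: Cauchy_Schwarz_ineq2)
  also have "\<dots> \<le> norm_Lp L 2 f * norm_Lp L 2 g"
    using CS(2) by (simp add: norm_Lp_on_def powr_half_sqrt integral_nonneg_AE)
  finally show "\<bar>ip L f g\<bar> \<le> norm_Lp L 2 f * norm_Lp L 2 g" .
qed

lemma ip_self: "ip L f f = (norm_Lp L 2 f)\<^sup>2"
  by (simp add: ip_def norm_Lp_on_def dot_square_norm powr_half_sqrt integral_nonneg_AE)

lemma norm_Lp2_eq: "norm_Lp L 2 f = sqrt (ip L f f)"
  unfolding ip_self by (simp add: norm_Lp_on_def)

lemma norm_Lp_nonneg: "norm_Lp L p f \<ge> 0"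
  by (simp add: norm_Lp_on_def)

lemma Lp2_zero: "(\<lambda>x. 0) \<in> Lp L 2"
  by (simp add: Lp2_iff periodic_on_def)

lemma Lp2_scaleR: "f \<in> Lp L 2 \<Longrightarrow> (\<lambda>x. c *\<^sub>R f x) \<in> Lp L 2"
  by (auto simp: Lp2_iff periodic_on_def power_mult_distrib intro: borel_measurable_scaleR)

lemma Lp2_add:
  assumes "f \<in> Lp L 2" "g \<in> Lp L 2"
  shows "(\<lambda>x. f x + g x) \<in> Lp L 2"
proof -
  have "integrable (torus L) (\<lambda>x. (norm (f x))\<^sup>2 + 2 * (f x \<bullet> g x) + (norm (g x))\<^sup>2)"
    using assms Lp2_integrable_ip(1)[OF assms] by (simp add: Lp2_iff)
  also have "(\<lambda>x. (norm (f x))\<^sup>2 + 2 * (f x \<bullet> g x) + (norm (g x))\<^sup>2) = (\<lambda>x. (norm (f x + g x))\<^sup>2)"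
    by (simp add: fun_eq_iff power2_norm_eq_inner inner_simps inner_commute)
  finally show ?thesis using assms by (auto simp: Lp2_iff periodic_on_def)
qed

lemma Lp2_diff: "f \<in> Lp L 2 \<Longrightarrow> g \<in> Lp L 2 \<Longrightarrow> (\<lambda>x. f x - g x) \<in> Lp L 2"
  using Lp2_add[OF _ Lp2_scaleR[of g L "-1"], of f] by simp

lemma Lp2_minus: "f \<in> Lp L 2 \<Longrightarrow> (\<lambda>x. - f x) \<in> Lp L 2"
  using Lp2_scaleR[of f L "-1"] by simp

lemma Lp2_sum: "(\<And>i. i \<in> I \<Longrightarrow> f i \<in> Lp L 2) \<Longrightarrow> (\<lambda>x. \<Sum>i\<in>I. f i x) \<in> Lp L 2"
  by (induction I rule: infinite_finite_induct) (auto intro: Lp2_add Lp2_zero)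

lemma Lp2_bounded:
  assumes "periodic_on L UNIV f" "f \<in> borel_measurable (torus L)" "AE x in torus L. norm (f x) \<le> B"
  shows "f \<in> Lp L 2"
proof -
  have "integrable (torus L) (\<lambda>x. (norm (f x))\<^sup>2)"
  proof (rule integrable_torus_bounded)
    show "AE x in torus L. norm ((norm (f x))\<^sup>2) \<le> B\<^sup>2"
      using assms(3) by eventually_elim (simp add: power_mono)
  qed (use assms in measurable)
  then show ?thesis using assms by (simp add: Lp2_iff)
qed

lemma Lp2_continuous:
  assumes "periodic_on L UNIV f" "continuous_on UNIV f"
  shows "f \<in> Lp L 2"
proof -
  obtain B where "\<And>x. x \<in> cell L \<Longrightarrow> norm (f x) \<le> B"
    using continuous_bounded_on_cell[OF assms(2)] by metis
  then show ?thesis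
    by (intro Lp2_bounded[of _ _ B] assms borel_measurable_torus_continuous AE_I2) auto
qed

lemma Lp2_integrable_norm:
  assumes "f \<in> Lp L 2"
  shows "integrable (torus L) f"
proof -
  have *: "integrable (torus L) (\<lambda>x. 1 * norm (f x))"
    using assms by (intro Cauchy_Schwarz_integral(1)) (auto simp: Lp2_iff finite_measure.integrable_const[OF finite_measure_torus])
  show ?thesis
    by (rule Bochner_Integration.integrable_bound[OF *]) (use assms in \<open>auto simp: Lp2_iff\<close>)
qed

lemma ip_commute: "ip L f g = ip L g f"
  by (simp add: ip_def inner_commute)

lemma ip_add_left: "f \<in> Lp L 2 \<Longrightarrow> g \<in> Lp L 2 \<Longrightarrow> h \<in> Lp L 2 \<Longrightarrow> ip L (\<lambda>x. f x + g x) h = ip L f h + ip L g h"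
  by (simp add: ip_def inner_add_left Lp2_integrable_ip)

lemma ip_diff_left: "f \<in> Lp L 2 \<Longrightarrow> g \<in> Lp L 2 \<Longrightarrow> h \<in> Lp L 2 \<Longrightarrow> ip L (\<lambda>x. f x - g x) h = ip L f h - ip L g h"
  by (simp add: ip_def inner_diff_left Lp2_integrable_ip)

lemma ip_scaleR_left: "ip L (\<lambda>x. c *\<^sub>R f x) h = c * ip L f h"
  by (simp add: ip_def)

lemma ip_minus_left: "ip L (\<lambda>x. - f x) h = - ip L f h"
  by (simp add: ip_def)

lemma ip_zero_left: "ip L (\<lambda>x. 0) h = 0"
  by (simp add: ip_def)

lemma ip_sum_left: "(\<And>i. i \<in> I \<Longrightarrow> f i \<in> Lp L 2) \<Longrightarrow> h \<in> Lp L 2 \<Longrightarrow> ip L (\<lambda>x. \<Sum>i\<in>I. f i x) h = (\<Sum>i\<in>I. ip L (f i) h)"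
  by (induction I rule: infinite_finite_induct) (simp_all add: ip_zero_left ip_add_left Lp2_sum)

lemma ip_add_right: "f \<in> Lp L 2 \<Longrightarrow> g \<in> Lp L 2 \<Longrightarrow> h \<in> Lp L 2 \<Longrightarrow> ip L h (\<lambda>x. f x + g x) = ip L h f + ip L h g"
  and ip_diff_right: "f \<in> Lp L 2 \<Longrightarrow> g \<in> Lp L 2 \<Longrightarrow> h \<in> Lp L 2 \<Longrightarrow> ip L h (\<lambda>x. f x - g x) = ip L h f - ip L h g"
  and ip_scaleR_right: "ip L h (\<lambda>x. c *\<^sub>R f x) = c * ip L h f"
  and ip_sum_right: "(\<And>i. i \<in> I \<Longrightarrow> k i \<in> Lp L 2) \<Longrightarrow> h \<in> Lp L 2 \<Longrightarrow> ip L h (\<lambda>x. \<Sum>i\<in>I. k i x) = (\<Sum>i\<in>I. ip L h (k i))"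
  unfolding ip_commute[of L h]
  by (simp_all add: ip_add_left ip_diff_left ip_scaleR_left ip_sum_left)

lemma ip_cong_AE:
  assumes "f \<in> borel_measurable (torus L)" "f' \<in> borel_measurable (torus L)" "g \<in> borel_measurable (torus L)" "g' \<in> borel_measurable (torus L)"
    "AE x in torus L. f x = f' x" "AE x in torus L. g x = g' x"
  shows "ip L f g = ip L f' g'"
  unfolding ip_def
proof (rule integral_cong_AE)
  show "AE x in torus L. f x \<bullet> g x = f' x \<bullet> g' x" using assms(5,6) by eventually_elim simp
qed (use assms in measurable)

lemma norm_Lp2_zero_iff:
  assumes "f \<in> Lp L 2"
  shows "norm_Lp L 2 f = 0 \<longleftrightarrow> (AE x in torus L. f x = 0)"
proof -
  have "norm_Lp L 2 f = 0 \<longleftrightarrow> (LINT x|torus L. (norm (f x))\<^sup>2) = 0"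
    by (simp add: norm_Lp2_eq ip_def dot_square_norm)
  also have "\<dots> \<longleftrightarrow> (AE x in torus L. (norm (f x))\<^sup>2 = 0)"
    using assms by (intro integral_nonneg_eq_0_iff_AE) (auto simp: Lp2_iff)
  finally show ?thesis by simp
qed

lemma norm_Lp2_scaleR: "norm_Lp L 2 (\<lambda>x. c *\<^sub>R f x) = \<bar>c\<bar> * norm_Lp L 2 f"
  unfolding norm_Lp2_eq ip_scaleR_left ip_scaleR_right by (simp add: real_sqrt_mult flip: mult.assoc)

lemma norm_Lp2_triangle:
  assumes f: "f \<in> Lp L 2" and g: "g \<in> Lp L 2"
  shows "norm_Lp L 2 (\<lambda>x. f x + g x) \<le> norm_Lp L 2 f + norm_Lp L 2 g"
proof (rule power2_le_imp_le)
  have "(norm_Lp L 2 (\<lambda>x. f x + g x))\<^sup>2 = (norm_Lp L 2 f)\<^sup>2 + 2 * ip L f g + (norm_Lp L 2 g)\<^sup>2"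
    unfolding ip_self[symmetric] using f g
    by (simp add: ip_add_left ip_add_right Lp2_add ip_commute)
  also have "\<dots> \<le> (norm_Lp L 2 f)\<^sup>2 + 2 * (norm_Lp L 2 f * norm_Lp L 2 g) + (norm_Lp L 2 g)\<^sup>2"
    using Lp2_integrable_ip(2)[OF f g] by simp
  also have "\<dots> = (norm_Lp L 2 f + norm_Lp L 2 g)\<^sup>2" by (simp add: power2_sum)
  finally show "(norm_Lp L 2 (\<lambda>x. f x + g x))\<^sup>2 \<le> (norm_Lp L 2 f + norm_Lp L 2 g)\<^sup>2" .
qed (simp add: norm_Lp_nonneg)

lemma norm_Lp2_triangle_diff:
  assumes "f \<in> Lp L 2" "g \<in> Lp L 2" "h \<in> Lp L 2"
  shows "norm_Lp L 2 (\<lambda>x. f x - h x) \<le> norm_Lp L 2 (\<lambda>x. f x - g x) + norm_Lp L 2 (\<lambda>x. g x - h x)"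
  using norm_Lp2_triangle[OF Lp2_diff[OF assms(1,2)] Lp2_diff[OF assms(2,3)]] by simp

lemma norm_Lp2_sum:
  "(\<And>i. i \<in> I \<Longrightarrow> f i \<in> Lp L 2) \<Longrightarrow> norm_Lp L 2 (\<lambda>x. \<Sum>i\<in>I. f i x) \<le> (\<Sum>i\<in>I. norm_Lp L 2 (f i))"
proof (induction I rule: infinite_finite_induct)
  case (insert i I)
  have "norm_Lp L 2 (\<lambda>x. f i x + (\<Sum>i\<in>I. f i x)) \<le> norm_Lp L 2 (f i) + norm_Lp L 2 (\<lambda>x. \<Sum>i\<in>I. f i x)"
    using insert by (intro norm_Lp2_triangle Lp2_sum) auto
  then show ?case using insert by simp
qed (simp_all add: norm_Lp2_eq ip_zero_left)

text \<open>Completeness for sequences with geometrically small increments, which is what the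
  minimizing sequence in \<open>L2_projection\<close> delivers. The rate makes the sum of the
  increments finite almost everywhere, without passing to a subsequence.\<close>

lemma Lp2_complete:
  fixes f :: "nat \<Rightarrow> 'n::finite vfield"
  assumes f: "\<And>k. f k \<in> Lp L 2"
    and C: "\<And>k. norm_Lp L 2 (\<lambda>x. f (Suc k) x - f k x) \<le> (1/2) ^ k"
  obtains g where "g \<in> Lp L 2" "(\<lambda>k. norm_Lp L 2 (\<lambda>x. g x - f k x)) \<longlonglongrightarrow> 0"
proof -
  define d where "d k x = norm (f (Suc k) x - f k x)" for k x
  have fm [measurable]: "f k \<in> borel_measurable (torus L)" for k using f by (simp add: Lp2_iff)
  have dm [measurable]: "d k \<in> borel_measurable (torus L)" for k unfolding d_def by measurable
  define V where "V = measure lebesgue (cell L :: (real^'n) set)"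
  have fdiff: "(\<lambda>x. f (Suc k) x - f k x) \<in> Lp L 2" for k by (intro Lp2_diff f)
  have dint: "integrable (torus L) (d k)" for k
    unfolding d_def using Lp2_integrable_norm[OF fdiff] by (rule integrable_norm)
  have dle: "(LINT x|torus L. d k x) \<le> sqrt V * (1/2) ^ k" for k
  proof -
    have "(LINT x|torus L. d k x) \<le> \<bar>LINT x|torus L. 1 * d k x\<bar>" by simp
    also have "\<dots> \<le> sqrt (LINT x::real^'n|torus L. 1\<^sup>2) * sqrt (LINT x|torus L. (d k x)\<^sup>2)"
      using fdiff[of k] by (intro Cauchy_Schwarz_integral(2))
        (auto simp: Lp2_iff d_def finite_measure.integrable_const[OF finite_measure_torus])
    also have "(LINT x::real^'n|torus L. 1\<^sup>2) = V"
      by (simp add: torus_eq measure_restrict_space V_def)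
    also have "sqrt (LINT x|torus L. (d k x)\<^sup>2) = norm_Lp L 2 (\<lambda>x. f (Suc k) x - f k x)"
      by (simp add: norm_Lp2_eq ip_def dot_square_norm d_def)
    also have "sqrt V * \<dots> \<le> sqrt V * (1/2) ^ k"
      by (intro mult_left_mono C) (simp add: V_def)
    finally show ?thesis .
  qed
  have d0: "0 \<le> d k x" for k x by (simp add: d_def)
  have "(\<integral>\<^sup>+x. (\<Sum>k. ennreal (d k x)) \<partial>torus L) = (\<Sum>k. \<integral>\<^sup>+x. ennreal (d k x) \<partial>torus L)"
    by (intro nn_integral_suminf) measurable
  also have "\<dots> = (\<Sum>k. ennreal (LINT x|torus L. d k x))"
    by (intro suminf_cong nn_integral_eq_integral dint AE_I2 d0)
  also have "\<dots> \<le> (\<Sum>k. ennreal (sqrt V * (1/2) ^ k))"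
    by (intro suminf_le ennreal_leI dle) auto
  also have "\<dots> < \<infinity>"
    by (subst suminf_ennreal2) (auto simp: V_def intro!: summable_mult summable_geometric)
  finally have "AE x in torus L. (\<Sum>k. ennreal (d k x)) \<noteq> \<infinity>"
    by (intro nn_integral_PInf_AE) auto
  then have sm: "AE x in torus L. summable (\<lambda>k. d k x)"
    by eventually_elim (auto intro!: summable_suminf_not_top simp: d0)
  have conv: "AE x in torus L. convergent (\<lambda>k. f k x)"
    using sm
  proof eventually_elim
    case (elim x)
    have "summable (\<lambda>k. f (Suc k) x - f k x)"
      by (rule summable_norm_cancel) (use elim in \<open>simp add: d_def\<close>)
    then have "convergent (\<lambda>n. \<Sum>k<n. f (Suc k) x - f k x)" by (simp add: summable_iff_convergent)
    then have "convergent (\<lambda>n. (f n x - f 0 x) + f 0 x)"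
      unfolding sum_lessThan_telescope[of "\<lambda>k. f k x" for x] by (intro convergent_add convergent_const)
    then show ?case by simp
  qed
  \<comment> \<open>The limit is taken at every point, including points of divergence where
    \<open>lim\<close> has an arbitrary value. Since each \<open>f k\<close> is exactly periodic,
    \<open>g\<close> is exactly periodic too.\<close>
  define g where "g x = lim (\<lambda>k. f k x)" for x
  have gm [measurable]: "g \<in> borel_measurable (torus L)" unfolding g_def by measurable
  have gper: "periodic_on L UNIV g"
    using f by (auto simp: periodic_on_def g_def Lp2_iff)
  have lim: "AE x in torus L. (\<lambda>k. f k x) \<longlonglongrightarrow> g x"
    using conv by eventually_elim (simp add: g_def convergent_LIMSEQ_iff)
  have tail: "norm_Lp L 2 (\<lambda>x. f (k + m) x - f k x) \<le> 2 * (1/2) ^ k" for k m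
  proof -
    have "norm_Lp L 2 (\<lambda>x. f (k + m) x - f k x) \<le> (\<Sum>j<m. (1/2) ^ (k + j))"
    proof (induction m)
      case (Suc m)
      have "norm_Lp L 2 (\<lambda>x. f (k + Suc m) x - f k x) \<le>
          norm_Lp L 2 (\<lambda>x. f (k + Suc m) x - f (k + m) x) + norm_Lp L 2 (\<lambda>x. f (k + m) x - f k x)"
        by (intro norm_Lp2_triangle_diff f)
      then show ?case using C[of "k + m"] Suc by simp
    qed (simp add: norm_Lp2_eq ip_zero_left)
    also have "\<dots> = (1/2) ^ k * (\<Sum>j<m. (1/2::real) ^ j)" by (simp add: power_add sum_distrib_left)
    also have "(\<Sum>j<m. (1/2::real) ^ j) \<le> 2" by (simp add: sum_gp_strict)
    finally show ?thesis by simp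
  qed
  \<comment> \<open>Fatou's lemma applied to \<open>m\<close> tending to infinity in the estimate
    \<open>tail\<close>.\<close>
  have nnf: "(\<integral>\<^sup>+x. ennreal ((norm (g x - f k x))\<^sup>2) \<partial>torus L) \<le> ennreal ((2 * (1/2) ^ k)\<^sup>2)" for k
  proof -
    have "(\<integral>\<^sup>+x. ennreal ((norm (g x - f k x))\<^sup>2) \<partial>torus L) =
        (\<integral>\<^sup>+x. liminf (\<lambda>m. ennreal ((norm (f (k + m) x - f k x))\<^sup>2)) \<partial>torus L)"
    proof (rule nn_integral_cong_AE)
      show "AE x in torus L. ennreal ((norm (g x - f k x))\<^sup>2) = liminf (\<lambda>m. ennreal ((norm (f (k + m) x - f k x))\<^sup>2))"
        using lim
      proof eventually_elim
        case (elim x)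
        have "(\<lambda>m. f (k + m) x) \<longlonglongrightarrow> g x" using LIMSEQ_ignore_initial_segment[OF elim, of k] by (simp add: add.commute)
        then have "(\<lambda>m. ennreal ((norm (f (k + m) x - f k x))\<^sup>2)) \<longlonglongrightarrow> ennreal ((norm (g x - f k x))\<^sup>2)"
          by (intro tendsto_ennrealI tendsto_intros)
        then show ?case by (intro lim_imp_Liminf[symmetric]) auto
      qed
    qed
    also have "\<dots> \<le> liminf (\<lambda>m. \<integral>\<^sup>+x. ennreal ((norm (f (k + m) x - f k x))\<^sup>2) \<partial>torus L)"
      by (intro nn_integral_liminf) measurable
    also have "\<dots> \<le> ennreal ((2 * (1/2) ^ k)\<^sup>2)"
    proof (intro Liminf_le always_eventually allI)
      fix m
      have "(\<lambda>x. f (k + m) x - f k x) \<in> Lp L 2" by (intro Lp2_diff f)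
      then have "(\<integral>\<^sup>+x. ennreal ((norm (f (k + m) x - f k x))\<^sup>2) \<partial>torus L) =
          ennreal (LINT x|torus L. (norm (f (k + m) x - f k x))\<^sup>2)"
        by (intro nn_integral_eq_integral) (auto simp: Lp2_iff)
      also have "(LINT x|torus L. (norm (f (k + m) x - f k x))\<^sup>2) = (norm_Lp L 2 (\<lambda>x. f (k + m) x - f k x))\<^sup>2"
        unfolding ip_self[symmetric] by (simp add: ip_def dot_square_norm)
      also have "\<dots> \<le> (2 * (1/2) ^ k)\<^sup>2"
        by (intro power_mono tail norm_Lp_nonneg)
      finally show "(\<integral>\<^sup>+x. ennreal ((norm (f (k + m) x - f k x))\<^sup>2) \<partial>torus L) \<le> ennreal ((2 * (1/2) ^ k)\<^sup>2)"
        by (simp add: ennreal_leI)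
    qed auto
    finally show ?thesis .
  qed
  have gf: "(\<lambda>x. g x - f k x) \<in> Lp L 2" for k
    unfolding Lp2_iff
  proof (intro conjI)
    show "periodic_on L UNIV (\<lambda>x. g x - f k x)" using gper f[of k] by (auto simp: periodic_on_def Lp2_iff)
    show "integrable (torus L) (\<lambda>x. (norm (g x - f k x))\<^sup>2)"
      by (rule integrableI_bounded) (use nnf[of k] in \<open>auto simp: le_less_trans[OF nnf]\<close>)
  qed measurable
  have le: "norm_Lp L 2 (\<lambda>x. g x - f k x) \<le> 2 * (1/2) ^ k" for k
  proof (rule power2_le_imp_le)
    have "ennreal ((norm_Lp L 2 (\<lambda>x. g x - f k x))\<^sup>2) = (\<integral>\<^sup>+x. ennreal ((norm (g x - f k x))\<^sup>2) \<partial>torus L)"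
      unfolding ip_self[symmetric] ip_def dot_square_norm
      using gf[of k] by (intro nn_integral_eq_integral[symmetric]) (auto simp: Lp2_iff)
    also note nnf[of k]
    finally show "(norm_Lp L 2 (\<lambda>x. g x - f k x))\<^sup>2 \<le> (2 * (1/2) ^ k)\<^sup>2"
      by (simp add: ennreal_le_iff)
  qed simp
  have "g \<in> Lp L 2" using Lp2_add[OF gf[of 0] f[of 0]] by simp
  moreover have "(\<lambda>k. norm_Lp L 2 (\<lambda>x. g x - f k x)) \<longlonglongrightarrow> 0"
  proof (rule tendsto_sandwich[OF _ _ tendsto_const])
    show "(\<lambda>k. 2 * (1/2) ^ k) \<longlonglongrightarrow> (0::real)"
      using tendsto_mult[OF tendsto_const[of "2::real"] LIMSEQ_power_zero[of "1/2::real"]] by simp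
  qed (auto intro!: always_eventually norm_Lp_nonneg le)
  ultimately show ?thesis using that by blast
qed

section \<open>Smooth functions, integration by parts and weak derivatives\<close>

lemma Ck_on_add: "Ck_on k UNIV f \<Longrightarrow> Ck_on k UNIV g \<Longrightarrow> Ck_on k UNIV (\<lambda>x. f x + g x)"
proof (induction k arbitrary: f g)
  case (Suc k)
  have d: "f differentiable at x" "g differentiable at x" for x
    using Suc.prems by (auto simp: differentiable_on_def)
  have "frechet_derivative (\<lambda>x. f x + g x) (at x) = (\<lambda>b. frechet_derivative f (at x) b + frechet_derivative g (at x) b)" for x
    using d[of x] by (intro frechet_derivative_at[symmetric] has_derivative_add) (auto simp: frechet_derivative_works)
  then show ?case using Suc d by (auto simp: differentiable_on_def)
qed (auto intro: continuous_on_add)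

lemma Ck_on_scaleR: "Ck_on k UNIV f \<Longrightarrow> Ck_on k UNIV (\<lambda>x. c *\<^sub>R f x)"
proof (induction k arbitrary: f)
  case (Suc k)
  have d: "f differentiable at x" for x
    using Suc.prems by (auto simp: differentiable_on_def)
  have "frechet_derivative (\<lambda>x. c *\<^sub>R f x) (at x) = (\<lambda>b. c *\<^sub>R frechet_derivative f (at x) b)" for x
    using d[of x] by (intro frechet_derivative_at[symmetric] has_derivative_scaleR_right) (auto simp: frechet_derivative_works)
  then show ?case using Suc d by (auto simp: differentiable_on_def)
qed (auto intro: continuous_on_scaleR)

lemma smooth_on_UNIV:
  assumes "smooth_on UNIV f"
  shows smooth_has_derivative: "(f has_derivative frechet_derivative f (at x)) (at x)"
    and smooth_continuous: "continuous_on S f"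
    and smooth_partial: "b \<in> Basis \<Longrightarrow> smooth_on UNIV (\<lambda>x. frechet_derivative f (at x) b)"
proof -
  have 1: "Ck_on (Suc k) UNIV f" for k using assms by (auto simp: smooth_on_def simp del: Ck_on.simps)
  show "(f has_derivative frechet_derivative f (at x)) (at x)"
    using 1[of 0] by (auto simp: differentiable_on_def frechet_derivative_works)
  have "Ck_on 0 UNIV f" using assms by (simp add: smooth_on_def del: Ck_on.simps)
  then show "continuous_on S f" by (auto intro: continuous_on_subset)
  show "smooth_on UNIV (\<lambda>x. frechet_derivative f (at x) b)" if "b \<in> Basis"
    unfolding smooth_on_def using 1 that by auto
qed

lemma periodic_partial:
  fixes f :: "real^'n \<Rightarrow> 'b::real_normed_vector"
  assumes f: "smooth_on UNIV f" "periodic_on L UNIV f"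
  shows "periodic_on L UNIV (\<lambda>x. frechet_derivative f (at x) b)"
  unfolding periodic_on_def
proof (intro ballI allI)
  fix x and i :: 'n
  have "((\<lambda>x. x + axis i L) has_derivative (\<lambda>h. h)) (at x)" by (auto intro!: derivative_eq_intros)
  from has_derivative_compose[OF this smooth_has_derivative[OF f(1)]]
  have "(f has_derivative frechet_derivative f (at (x + axis i L))) (at x)"
    using f(2) by (simp add: periodic_on_def)
  then show "frechet_derivative f (at (x + axis i L)) b = frechet_derivative f (at x) b"
    using frechet_derivative_at by metis
qed

lemma integral_by_parts_torus:
  fixes \<phi> u :: "real^'n \<Rightarrow> real"
  assumes L: "L > 0" and \<phi>: "smooth_on UNIV \<phi>" "periodic_on L UNIV \<phi>"
    and u: "\<And>x. (u has_derivative u' x) (at x)" "continuous_on UNIV (\<lambda>x. u' x (axis i 1))" "periodic_on L UNIV u"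
  shows "(LINT x|torus L. frechet_derivative \<phi> (at x) (axis i 1) * u x) = - (LINT x|torus L. \<phi> x * u' x (axis i 1))"
proof -
  let ?d = "\<lambda>x. frechet_derivative \<phi> (at x)"
  have ax: "axis i (1::real) \<in> Basis" by simp
  note c\<phi> = smooth_continuous[OF \<phi>(1)] smooth_continuous[OF smooth_partial[OF \<phi>(1) ax]]
  have cu: "continuous_on UNIV u"
    using has_derivative_continuous[OF u(1)] by (simp add: continuous_on_eq_continuous_at)
  have "(LINT x|torus L. \<phi> x * u' x (axis i 1) + ?d x (axis i 1) * u x) = 0"
    by (rule integral_torus_partial_zero[OF L has_derivative_mult[OF smooth_has_derivative[OF \<phi>(1)] u(1)]])
      (use \<phi>(2) u(3) in \<open>auto intro!: continuous_intros c\<phi> cu u(2) simp: periodic_on_def\<close>)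
  moreover have "(LINT x|torus L. \<phi> x * u' x (axis i 1) + ?d x (axis i 1) * u x) =
     (LINT x|torus L. \<phi> x * u' x (axis i 1)) + (LINT x|torus L. ?d x (axis i 1) * u x)"
    by (intro Bochner_Integration.integral_add integrable_torus_continuous continuous_intros c\<phi> cu u(2))
  ultimately show ?thesis by linarith
qed

lemma integral_torus_component:
  fixes f :: "real^'n \<Rightarrow> real^'m"
  assumes "integrable (torus L) f"
  shows "(LINT x|torus L. f x) $ j = (LINT x|torus L. f x $ j)"
  using integral_inner_left[of "axis j 1" "torus L" f] assms by (simp add: inner_axis)

lemma integrable_torus_scaleR_continuous:
  fixes f :: "real^'n \<Rightarrow> 'b::euclidean_space"
  assumes f: "integrable (torus L) f" and p: "continuous_on UNIV (p :: real^'n \<Rightarrow> real)"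
  shows "integrable (torus L) (\<lambda>x. p x *\<^sub>R f x)"
proof -
  obtain B where B: "B > 0" "\<And>x. x \<in> cell L \<Longrightarrow> norm (p x) \<le> B"
    using continuous_bounded_on_cell[OF p] by metis
  show ?thesis
  proof (rule Bochner_Integration.integrable_bound[OF integrable_mult_right[OF integrable_norm[OF f], of B]])
    show "(\<lambda>x. p x *\<^sub>R f x) \<in> borel_measurable (torus L)"
      using f borel_measurable_torus_continuous[OF p] by measurable
    show "AE x in torus L. norm (p x *\<^sub>R f x) \<le> norm (B * norm (f x))"
      using B by (intro AE_I2) (auto intro: mult_right_mono)
  qed
qed

lemma has_weak_partial_smooth:
  fixes f :: "'n::finite vfield"
  assumes L: "L > 0" and f: "smooth_on UNIV f" "periodic_on L UNIV f"
  shows "has_weak_partial L i f (\<lambda>x. frechet_derivative f (at x) (axis i 1))"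
    and "(\<lambda>x. frechet_derivative f (at x) (axis i 1)) \<in> Lp L 2"
proof -
  have ax: "axis i (1::real) \<in> Basis" by simp
  let ?d = "\<lambda>x. frechet_derivative f (at x)"
  note cf = smooth_continuous[OF f(1)] smooth_continuous[OF smooth_partial[OF f(1) ax]]
  show "(\<lambda>x. ?d x (axis i 1)) \<in> Lp L 2"
    by (intro Lp2_continuous periodic_partial f cf)
  show "has_weak_partial L i f (\<lambda>x. ?d x (axis i 1))"
    unfolding has_weak_partial_def
  proof (intro allI impI, elim conjE, subst vec_eq_iff, intro allI)
    fix \<phi> :: "real^'n \<Rightarrow> real" and j
    assume \<phi>: "smooth_on UNIV \<phi>" "periodic_on L UNIV \<phi>"
    note c\<phi> = smooth_continuous[OF \<phi>(1)] smooth_continuous[OF smooth_partial[OF \<phi>(1) ax]]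
    have fj: "((\<lambda>x. f x $ j) has_derivative (\<lambda>h. ?d x h $ j)) (at x)" for x
      using bounded_linear.has_derivative[OF bounded_linear_vec_nth smooth_has_derivative[OF f(1)]] .
    have "(LINT x|torus L. frechet_derivative \<phi> (at x) (axis i 1) * f x $ j) = - (LINT x|torus L. \<phi> x * ?d x (axis i 1) $ j)"
      by (rule integral_by_parts_torus[OF L \<phi> fj])
         (use f(2) in \<open>auto intro!: continuous_intros cf simp: periodic_on_def\<close>)
    then show "(LINT x|torus L. frechet_derivative \<phi> (at x) (axis i 1) *\<^sub>R f x) $ j = (- (LINT x|torus L. \<phi> x *\<^sub>R ?d x (axis i 1))) $ j"
      by (simp add: integral_torus_component integrable_torus_continuous continuous_intros c\<phi> cf)
  qed
qed

lemma rtp_smooth_periodic: "L > 0 \<Longrightarrow> rtp L f \<Longrightarrow> smooth_on UNIV f \<and> periodic_on L UNIV f"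
  by (auto intro: smooth_on_rtp rtp_periodic)

text \<open>Test functions are real, so a complex Fourier coefficient is recovered from two real
  tests, the factor \<open>c\<close> being 1 for the real part and minus the imaginary unit for the
  imaginary part.\<close>

lemma rtp_Re_ee: "\<xi> \<in> latt \<Longrightarrow> rtp L (\<lambda>x. Re (c * ee L \<xi> x))"
  by (auto simp: rtp_real intro!: tp_Re[of L "\<lambda>x. c * ee L \<xi> x", simplified] tp.base)

lemma rtp_zero_AE:
  fixes g :: "'n::finite vfield"
  assumes L: "L > 0" and g: "integrable (torus L) g" and 0: "\<And>\<phi> :: real^'n \<Rightarrow> real. rtp L \<phi> \<Longrightarrow> (LINT x|torus L. \<phi> x *\<^sub>R g x) = 0"
  shows "AE x in torus L. g x = 0"
proof -
  have "AE x in torus L. complex_of_real (g x $ j) = 0" for j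
  proof (rule trig_complete[OF L])
    have gj: "integrable (torus L) (\<lambda>x. g x $ j)"
      using integrable_inner_left[of "axis j 1" "torus L" g] g by (simp add: inner_axis)
    then show gj': "integrable (torus L) (\<lambda>x. complex_of_real (g x $ j))" by simp
    fix \<xi> :: "real^'n" assume \<xi>: "\<xi> \<in> latt"
    have int: "integrable (torus L) (\<lambda>x. of_real (g x $ j) * ee L \<xi> x)"
      by (intro integrable_torus_mult_continuous gj' continuous_intros)
    have z: "(LINT x|torus L. Re (c * ee L \<xi> x) * g x $ j) = 0" for c
    proof -
      have "integrable (torus L) (\<lambda>x. Re (c * ee L \<xi> x) *\<^sub>R g x)"
        by (intro integrable_torus_scaleR_continuous g rtp_continuous[OF rtp_Re_ee] \<xi>)
      from integral_torus_component[OF this, of j] show ?thesis using 0[OF rtp_Re_ee[OF \<xi>, of L c]] by simp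
    qed
    have "Re (LINT x|torus L. of_real (g x $ j) * ee L \<xi> x) = (LINT x|torus L. Re (1 * ee L \<xi> x) * g x $ j)"
      unfolding integral_Re[OF int, symmetric] by (simp add: mult.commute)
    then have "Re (LINT x|torus L. of_real (g x $ j) * ee L \<xi> x) = 0" using z by metis
    moreover have "Im (LINT x|torus L. of_real (g x $ j) * ee L \<xi> x) = (LINT x|torus L. Re (- \<i> * ee L \<xi> x) * g x $ j)"
      unfolding integral_Im[OF int, symmetric] by (simp add: mult.commute)
    then have "Im (LINT x|torus L. of_real (g x $ j) * ee L \<xi> x) = 0" using z by metis
    ultimately show "(LINT x|torus L. of_real (g x $ j) * ee L \<xi> x) = 0"
      by (simp add: complex_eq_iff)
  qed
  then have "AE x in torus L. \<forall>j. g x $ j = 0" by (simp add: AE_all_countable)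
  then show ?thesis by eventually_elim (simp add: vec_eq_iff)
qed

lemma has_weak_partial_unique:
  assumes L: "L > 0" and g: "g \<in> Lp L 2" "has_weak_partial L i f g"
    and h: "h \<in> Lp L 2" "has_weak_partial L i f h"
  shows "AE x in torus L. g x = h x"
proof -
  have "AE x in torus L. g x - h x = 0"
  proof (rule rtp_zero_AE[OF L])
    have gi: "integrable (torus L) g" "integrable (torus L) h" using g h by (simp_all add: Lp2_integrable_norm)
    then show "integrable (torus L) (\<lambda>x. g x - h x)" by simp
    fix \<phi> :: "real^'a \<Rightarrow> real" assume \<phi>: "rtp L \<phi>"
    have "(LINT x|torus L. \<phi> x *\<^sub>R (g x - h x)) = (LINT x|torus L. \<phi> x *\<^sub>R g x) - (LINT x|torus L. \<phi> x *\<^sub>R h x)"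
      unfolding scaleR_diff_right
      by (intro Bochner_Integration.integral_diff integrable_torus_scaleR_continuous gi rtp_continuous[OF \<phi>])
    also have "\<dots> = 0" using g(2) h(2) rtp_smooth_periodic[OF L \<phi>] unfolding has_weak_partial_def
      by (metis (no_types, lifting) add.inverse_inverse diff_self)
    finally show "(LINT x|torus L. \<phi> x *\<^sub>R (g x - h x)) = 0" .
  qed
  then show ?thesis by simp
qed

lemma H1_wpartial:
  assumes "f \<in> H1 L"
  shows "wpartial L i f \<in> Lp L 2" "has_weak_partial L i f (wpartial L i f)"
proof -
  have "\<exists>g. g \<in> Lp L 2 \<and> has_weak_partial L i f g" using assms by (auto simp: H1_def)
  from someI_ex[OF this] show "wpartial L i f \<in> Lp L 2" "has_weak_partial L i f (wpartial L i f)"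
    by (auto simp: wpartial_def)
qed

lemma wpartial_AE_eq:
  assumes "L > 0" "f \<in> H1 L" "g \<in> Lp L 2" "has_weak_partial L i f g"
  shows "AE x in torus L. wpartial L i f x = g x"
  using has_weak_partial_unique[OF assms(1) H1_wpartial[OF assms(2)] assms(3,4)] .

text \<open>Functions that agree almost everywhere have the same weak derivatives as a predicate.
  The \<open>SOME\<close> in \<open>wpartial\<close> then picks the same function for both, which
  gives an exact equality.\<close>

lemma wpartial_cong_AE:
  fixes f g :: "'n::finite vfield"
  assumes [measurable]: "f \<in> borel_measurable (torus L)" "g \<in> borel_measurable (torus L)"
    and AE: "AE x in torus L. f x = g x"
  shows "has_weak_partial L i f = has_weak_partial L i g" "wpartial L i f = wpartial L i g"
proof -
  have "(LINT x|torus L. frechet_derivative \<phi> (at x) (axis i 1) *\<^sub>R f x) = (LINT x|torus L. frechet_derivative \<phi> (at x) (axis i 1) *\<^sub>R g x)"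
    if "smooth_on UNIV \<phi>" for \<phi> :: "real^'n \<Rightarrow> real"
  proof (rule integral_cong_AE)
    have [measurable]: "(\<lambda>x. frechet_derivative \<phi> (at x) (axis i 1)) \<in> borel_measurable (torus L)"
      by (intro borel_measurable_torus_continuous smooth_continuous smooth_partial that) simp
    show "(\<lambda>x. frechet_derivative \<phi> (at x) (axis i 1) *\<^sub>R f x) \<in> borel_measurable (torus L)"
      "(\<lambda>x. frechet_derivative \<phi> (at x) (axis i 1) *\<^sub>R g x) \<in> borel_measurable (torus L)" by measurable
    show "AE x in torus L. frechet_derivative \<phi> (at x) (axis i 1) *\<^sub>R f x = frechet_derivative \<phi> (at x) (axis i 1) *\<^sub>R g x"
      using AE by eventually_elim simp
  qed
  then show *: "has_weak_partial L i f = has_weak_partial L i g"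
    by (auto simp: has_weak_partial_def fun_eq_iff)
  show "wpartial L i f = wpartial L i g" by (simp add: wpartial_def *)
qed

lemma has_weak_partial_add:
  fixes f g :: "'n::finite vfield"
  assumes "f \<in> Lp L 2" "g \<in> Lp L 2" "f' \<in> Lp L 2" "g' \<in> Lp L 2" "has_weak_partial L i f f'" "has_weak_partial L i g g'"
  shows "has_weak_partial L i (\<lambda>x. f x + g x) (\<lambda>x. f' x + g' x)"
  unfolding has_weak_partial_def
proof (intro allI impI, elim conjE)
  fix \<phi> :: "real^'n \<Rightarrow> real" assume \<phi>: "smooth_on UNIV \<phi>" "periodic_on L UNIV \<phi>"
  have ax: "axis i (1::real) \<in> Basis" by simp
  note c\<phi> = smooth_continuous[OF \<phi>(1)] smooth_continuous[OF smooth_partial[OF \<phi>(1) ax]]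
  have "(LINT x|torus L. frechet_derivative \<phi> (at x) (axis i 1) *\<^sub>R (f x + g x)) =
    (LINT x|torus L. frechet_derivative \<phi> (at x) (axis i 1) *\<^sub>R f x) + (LINT x|torus L. frechet_derivative \<phi> (at x) (axis i 1) *\<^sub>R g x)"
    unfolding scaleR_add_right
    by (intro Bochner_Integration.integral_add integrable_torus_scaleR_continuous Lp2_integrable_norm assms c\<phi>)
  moreover have "(LINT x|torus L. \<phi> x *\<^sub>R (f' x + g' x)) = (LINT x|torus L. \<phi> x *\<^sub>R f' x) + (LINT x|torus L. \<phi> x *\<^sub>R g' x)"
    unfolding scaleR_add_right
    by (intro Bochner_Integration.integral_add integrable_torus_scaleR_continuous Lp2_integrable_norm assms c\<phi>)
  ultimately show "(LINT x|torus L. frechet_derivative \<phi> (at x) (axis i 1) *\<^sub>R (f x + g x)) = - (LINT x|torus L. \<phi> x *\<^sub>R (f' x + g' x))"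
    using assms(5,6) \<phi> by (simp add: has_weak_partial_def)
qed

lemma has_weak_partial_scaleR:
  assumes "has_weak_partial L i f f'"
  shows "has_weak_partial L i (\<lambda>x. c *\<^sub>R f x) (\<lambda>x. c *\<^sub>R f' x)"
proof -
  have comm: "a *\<^sub>R c *\<^sub>R v = c *\<^sub>R a *\<^sub>R v" for a and v :: "real^'a" by simp
  show ?thesis
    using assms by (simp add: has_weak_partial_def comm del: scaleR_scaleR)
qed

lemma has_weak_partial_zero: "has_weak_partial L i (\<lambda>x. 0) (\<lambda>x. 0)"
  by (simp add: has_weak_partial_def)

lemma has_weak_partial_sum:
  "(\<And>j. j \<in> J \<Longrightarrow> f j \<in> Lp L 2 \<and> f' j \<in> Lp L 2 \<and> has_weak_partial L i (f j) (f' j)) \<Longrightarrow>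
   has_weak_partial L i (\<lambda>x. \<Sum>j\<in>J. c j *\<^sub>R f j x) (\<lambda>x. \<Sum>j\<in>J. c j *\<^sub>R f' j x)"
  by (induction J rule: infinite_finite_induct)
    (auto intro!: has_weak_partial_zero has_weak_partial_add has_weak_partial_scaleR Lp2_sum Lp2_scaleR)

lemma H1I: "f \<in> Lp L 2 \<Longrightarrow> (\<And>i. f' i \<in> Lp L 2) \<Longrightarrow> (\<And>i. has_weak_partial L i f (f' i)) \<Longrightarrow> f \<in> H1 L"
  by (auto simp: H1_def)

lemma H1_Lp2: "f \<in> H1 L \<Longrightarrow> f \<in> Lp L 2"
  by (simp add: H1_def)

lemma H1_smooth:
  assumes "L > 0" "smooth_on UNIV f" "periodic_on L UNIV f"
  shows "f \<in> H1 L"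
  using assms by (intro H1I[OF _ has_weak_partial_smooth(2,1)] Lp2_continuous smooth_continuous)

text \<open>Both weak derivatives are moved to the test function, one after the other; a partial
  derivative of a smooth periodic function is again an admissible test function.\<close>

lemma laplacian_test:
  fixes \<phi> :: "real^'n \<Rightarrow> real"
  assumes u: "u \<in> H2 L" and \<phi>: "smooth_on UNIV \<phi>" "periodic_on L UNIV \<phi>"
  shows "(LINT x|torus L. \<phi> x *\<^sub>R laplacian L u x) =
    (\<Sum>i\<in>UNIV. LINT x|torus L. frechet_derivative (\<lambda>x. frechet_derivative \<phi> (at x) (axis i 1)) (at x) (axis i 1) *\<^sub>R u x)"
proof -
  have u1: "u \<in> H1 L" and u2: "wpartial L i u \<in> H1 L" for i using u by (auto simp: H2_def)
  have ax: "axis i (1::real) \<in> Basis" for i :: 'n by simp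
  have "(LINT x|torus L. \<phi> x *\<^sub>R laplacian L u x) = (\<Sum>i\<in>UNIV. LINT x|torus L. \<phi> x *\<^sub>R wpartial L i (wpartial L i u) x)"
    unfolding laplacian_def scaleR_sum_right
    by (intro Bochner_Integration.integral_sum integrable_torus_scaleR_continuous Lp2_integrable_norm H1_wpartial u2 smooth_continuous \<phi>)
  also have "\<dots> = (\<Sum>i\<in>UNIV. LINT x|torus L. frechet_derivative (\<lambda>x. frechet_derivative \<phi> (at x) (axis i 1)) (at x) (axis i 1) *\<^sub>R u x)"
  proof (rule sum.cong[OF refl])
    fix i
    have "(LINT x|torus L. \<phi> x *\<^sub>R wpartial L i (wpartial L i u) x) = - (LINT x|torus L. frechet_derivative \<phi> (at x) (axis i 1) *\<^sub>R wpartial L i u x)"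
      using H1_wpartial(2)[OF u2, of i i] \<phi> by (simp add: has_weak_partial_def)
    also have "\<dots> = (LINT x|torus L. frechet_derivative (\<lambda>x. frechet_derivative \<phi> (at x) (axis i 1)) (at x) (axis i 1) *\<^sub>R u x)"
      using H1_wpartial(2)[OF u1, of i] smooth_partial[OF \<phi>(1) ax] periodic_partial[OF \<phi>] by (simp add: has_weak_partial_def)
    finally show "(LINT x|torus L. \<phi> x *\<^sub>R wpartial L i (wpartial L i u) x) =
      (LINT x|torus L. frechet_derivative (\<lambda>x. frechet_derivative \<phi> (at x) (axis i 1)) (at x) (axis i 1) *\<^sub>R u x)" .
  qed
  finally show ?thesis .
qed

lemma laplacian_Lp2: "u \<in> H2 L \<Longrightarrow> laplacian L u \<in> Lp L 2"
  unfolding laplacian_def by (intro Lp2_sum H1_wpartial) (simp add: H2_def)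

section \<open>The Leray projection\<close>

lemma solenoidal_smoothD:
  assumes "f \<in> solenoidal_smooth L"
  shows "smooth_on UNIV f" "periodic_on L UNIV f" "f \<in> Lp L 2"
    "(\<Sum>i\<in>UNIV. frechet_derivative f (at x) (axis i 1) $ i) = 0"
  using assms by (auto simp: solenoidal_smooth_def intro!: Lp2_continuous smooth_continuous)

lemma solenoidal_smooth_add:
  assumes "f \<in> solenoidal_smooth L" "g \<in> solenoidal_smooth L"
  shows "(\<lambda>x. f x + g x) \<in> solenoidal_smooth L"
proof -
  have fd: "frechet_derivative (\<lambda>x. f x + g x) (at x) = (\<lambda>h. frechet_derivative f (at x) h + frechet_derivative g (at x) h)" for x
    using assms by (intro frechet_derivative_at[symmetric] has_derivative_add smooth_has_derivative solenoidal_smoothD)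
  have "smooth_on UNIV (\<lambda>x. f x + g x)"
    using assms by (auto simp: smooth_on_def solenoidal_smooth_def intro: Ck_on_add)
  then show ?thesis using assms
    by (auto simp: solenoidal_smooth_def periodic_on_def fd sum.distrib)
qed

lemma solenoidal_smooth_scaleR:
  assumes "f \<in> solenoidal_smooth L"
  shows "(\<lambda>x. c *\<^sub>R f x) \<in> solenoidal_smooth L"
proof -
  have fd: "frechet_derivative (\<lambda>x. c *\<^sub>R f x) (at x) = (\<lambda>h. c *\<^sub>R frechet_derivative f (at x) h)" for x
    using assms by (intro frechet_derivative_at[symmetric] has_derivative_scaleR_right smooth_has_derivative solenoidal_smoothD)
  have "smooth_on UNIV (\<lambda>x. c *\<^sub>R f x)"
    using assms by (auto simp: smooth_on_def solenoidal_smooth_def intro: Ck_on_scaleR)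
  then show ?thesis using assms
    by (auto simp: solenoidal_smooth_def periodic_on_def fd simp flip: sum_distrib_left)
qed

lemma solenoidal_smooth_zero: "(\<lambda>x. 0) \<in> (solenoidal_smooth L :: 'n::finite vfield set)"
proof -
  have "Ck_on k UNIV (\<lambda>x::real^'n. 0::real^'n)" for k by (induction k) auto
  then show ?thesis by (simp add: solenoidal_smooth_def smooth_on_def periodic_on_def)
qed

lemma solenoidal_smooth_sum:
  "(\<And>i. i \<in> I \<Longrightarrow> f i \<in> solenoidal_smooth L) \<Longrightarrow> (\<lambda>x. \<Sum>i\<in>I. f i x) \<in> solenoidal_smooth L"
  by (induction I rule: infinite_finite_induct) (auto intro: solenoidal_smooth_zero solenoidal_smooth_add)

lemma ip_tendsto_left:
  assumes h: "h \<in> Lp L 2" and s: "\<And>k. s k \<in> Lp L 2" and v: "v \<in> Lp L 2"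
    and lim: "((\<lambda>k. norm_Lp L 2 (\<lambda>x. h x - s k x)) \<longlongrightarrow> 0) F"
  shows "((\<lambda>k. ip L (s k) v) \<longlongrightarrow> ip L h v) F"
proof (rule Lim_transform[OF tendsto_const])
  show "((\<lambda>k. ip L (s k) v - ip L h v) \<longlongrightarrow> 0) F"
  proof (rule Lim_null_comparison)
    show "\<forall>\<^sub>F k in F. norm (ip L (s k) v - ip L h v) \<le> norm_Lp L 2 (\<lambda>x. h x - s k x) * norm_Lp L 2 v"
      using Lp2_integrable_ip(2)[OF Lp2_diff[OF h s] v] by (simp add: ip_diff_left h s v abs_minus_commute)
    show "((\<lambda>k. norm_Lp L 2 (\<lambda>x. h x - s k x) * norm_Lp L 2 v) \<longlongrightarrow> 0) F"
      using tendsto_mult[OF lim tendsto_const] by simp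
  qed
qed

lemma ip_parallelogram:
  assumes m: "p \<in> Lp L 2" "q \<in> Lp L 2"
  shows "ip L (\<lambda>x. (1/2) *\<^sub>R (p x + q x)) (\<lambda>x. (1/2) *\<^sub>R (p x + q x)) =
    ip L p p / 2 + ip L q q / 2 - ip L (\<lambda>x. q x - p x) (\<lambda>x. q x - p x) / 4"
  unfolding ip_scaleR_left ip_scaleR_right
  by (simp add: ip_add_left[OF m] ip_add_right[OF m] ip_diff_left[OF m(2,1)] ip_diff_right[OF m(2,1)]
     Lp2_add[OF m] Lp2_diff[OF m(2,1)] m ip_commute[of L q p] field_simps)

lemma ip_diff_self:
  assumes m: "p \<in> Lp L 2" "q \<in> Lp L 2"
  shows "ip L (\<lambda>x. p x - q x) (\<lambda>x. p x - q x) = ip L p p - 2 * ip L p q + ip L q q"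
  by (simp add: ip_diff_left[OF m] ip_diff_right[OF m] Lp2_diff[OF m] m ip_commute[of L q p])

text \<open>The classical minimizing sequence for the distance to \<open>S\<close>. The
  parallelogram identity turns near-minimality into small increments, and varying along
  \<open>v\<close> gives orthogonality. The set \<open>S\<close> need not be closed: the result is a
  limit \<open>g\<close> of elements of \<open>S\<close>.\<close>

lemma L2_projection:
  fixes S :: "'n::finite vfield set"
  assumes S: "S \<subseteq> Lp L 2" and ne: "S \<noteq> {}" and add: "\<And>f g. f \<in> S \<Longrightarrow> g \<in> S \<Longrightarrow> (\<lambda>x. f x + g x) \<in> S"
    and sc: "\<And>c f. f \<in> S \<Longrightarrow> (\<lambda>x. c *\<^sub>R f x) \<in> S" and f: "f \<in> Lp L 2"
  obtains g s where "g \<in> Lp L 2" "\<And>k. s k \<in> S" "(\<lambda>k::nat. norm_Lp L 2 (\<lambda>x. g x - s k x)) \<longlonglongrightarrow> 0"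
    "\<And>v. v \<in> S \<Longrightarrow> ip L (\<lambda>x. f x - g x) v = 0"
proof -
  define Q where "Q h = ip L (\<lambda>x. f x - h x) (\<lambda>x. f x - h x)" for h
  define d where "d = Inf (Q ` S)"
  have SL: "h \<in> S \<Longrightarrow> h \<in> Lp L 2" for h using S by blast
  have bdd: "bdd_below (Q ` S)" by (intro bdd_belowI[of _ 0]) (auto simp: Q_def ip_self)
  have dle: "d \<le> Q h" if "h \<in> S" for h unfolding d_def by (intro cInf_lower bdd imageI that)
  \<comment> \<open>Small enough that \<open>2 * e (Suc k) + 2 * e k\<close> is at most the square
    of \<open>(1/2) ^ k\<close>, the increment that \<open>Lp2_complete\<close> asks for.\<close>
  define e :: "nat \<Rightarrow> real" where "e k = ((1/2) ^ k)\<^sup>2 / 8" for k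
  have e: "e k > 0" for k by (simp add: e_def)
  have "\<exists>h\<in>S. Q h < d + e k" for k
    using cInf_lessD[of "Q ` S" "d + e k"] ne e[of k] by (auto simp: d_def)
  then obtain s where s: "\<And>k. s k \<in> S" "\<And>k. Q (s k) < d + e k" by metis
  have polar: "Q (\<lambda>x. (1/2) *\<^sub>R (h x + k x)) = Q h / 2 + Q k / 2 - ip L (\<lambda>x. h x - k x) (\<lambda>x. h x - k x) / 4"
    if "h \<in> S" "k \<in> S" for h k
  proof -
    have eq: "(\<lambda>x. f x - (1/2) *\<^sub>R (h x + k x)) = (\<lambda>x. (1/2) *\<^sub>R ((f x - h x) + (f x - k x)))"
      by (simp add: fun_eq_iff vec_eq_iff field_simps)
    have m: "(\<lambda>x. f x - h x) \<in> Lp L 2" "(\<lambda>x. f x - k x) \<in> Lp L 2" using f SL that by (auto intro: Lp2_diff)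
    show ?thesis
      unfolding Q_def eq by (subst ip_parallelogram[OF m]) simp
  qed
  have C: "norm_Lp L 2 (\<lambda>x. s (Suc k) x - s k x) \<le> (1/2) ^ k" for k
  proof (rule power2_le_imp_le)
    have "(\<lambda>x. (1/2) *\<^sub>R (s (Suc k) x + s k x)) \<in> S" by (intro sc add s)
    from dle[OF this] polar[OF s(1)[of "Suc k"] s(1)[of k]]
    have "ip L (\<lambda>x. s (Suc k) x - s k x) (\<lambda>x. s (Suc k) x - s k x) \<le> 2 * Q (s (Suc k)) + 2 * Q (s k) - 4 * d"
      by simp
    also have "\<dots> \<le> 2 * e (Suc k) + 2 * e k" using s(2)[of k] s(2)[of "Suc k"] by simp
    also have "\<dots> \<le> ((1/2) ^ k)\<^sup>2" by (simp add: e_def power2_eq_square)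
    finally show "(norm_Lp L 2 (\<lambda>x. s (Suc k) x - s k x))\<^sup>2 \<le> ((1/2) ^ k)\<^sup>2" by (simp add: ip_self)
  qed simp
  obtain g where g: "g \<in> Lp L 2" "(\<lambda>k. norm_Lp L 2 (\<lambda>x. g x - s k x)) \<longlonglongrightarrow> 0"
    using Lp2_complete[OF SL[OF s(1)] C] by blast
  have "ip L (\<lambda>x. f x - g x) v = 0" if v: "v \<in> S" for v
  proof -
    have vL: "v \<in> Lp L 2" using v SL by blast
    define B where "B k = ip L (\<lambda>x. f x - s k x) v" for k
    have "(\<lambda>k. ip L f v - ip L (s k) v) \<longlonglongrightarrow> ip L f v - ip L g v"
      by (intro tendsto_intros ip_tendsto_left[OF g(1) SL[OF s(1)] vL g(2)])
    then have Blim: "B \<longlonglongrightarrow> ip L (\<lambda>x. f x - g x) v"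
      unfolding B_def by (simp add: ip_diff_left f g(1) SL s(1) vL)
    have ineq: "0 \<le> e k - 2 * t * B k + t\<^sup>2 * ip L v v" for k t
    proof -
      have m: "(\<lambda>x. f x - s k x) \<in> Lp L 2" "(\<lambda>x. t *\<^sub>R v x) \<in> Lp L 2" by (intro Lp2_diff Lp2_scaleR f SL s vL)+
      have "d \<le> Q (\<lambda>x. s k x + t *\<^sub>R v x)" by (intro dle add sc s v)
      also have "\<dots> = ip L (\<lambda>x. (f x - s k x) - t *\<^sub>R v x) (\<lambda>x. (f x - s k x) - t *\<^sub>R v x)"
        by (simp add: Q_def algebra_simps)
      also have "\<dots> = Q (s k) - 2 * t * B k + t\<^sup>2 * ip L v v"
        unfolding Q_def B_def
        by (subst ip_diff_self[OF m]) (simp add: ip_scaleR_left ip_scaleR_right power2_eq_square)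
      finally show ?thesis using s(2)[of k] by simp
    qed
    have e0: "e \<longlonglongrightarrow> 0"
    proof -
      have "(\<lambda>k. (1/4) ^ k / 8) \<longlonglongrightarrow> (0::real)"
        using tendsto_divide[OF LIMSEQ_power_zero[of "1/4::real"] tendsto_const[of 8]] by simp
      then show ?thesis unfolding e_def by (simp add: power2_eq_square flip: power_mult_distrib)
    qed
    let ?B = "ip L (\<lambda>x. f x - g x) v"
    have lim: "0 \<le> - 2 * t * ?B + t\<^sup>2 * ip L v v" for t
    proof (rule LIMSEQ_le_const)
      have "(\<lambda>k. e k - 2 * t * B k + t\<^sup>2 * ip L v v) \<longlonglongrightarrow> 0 - 2 * t * ?B + t\<^sup>2 * ip L v v"
        by (intro tendsto_intros e0 Blim)
      then show "(\<lambda>k. e k - 2 * t * B k + t\<^sup>2 * ip L v v) \<longlonglongrightarrow> - 2 * t * ?B + t\<^sup>2 * ip L v v" by simp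
    qed (use ineq in auto)
    \<comment> \<open>The step \<open>?B / c\<close> almost minimizes the quadratic in
      \<open>t\<close>. Adding 1 keeps the division meaningful when \<open>v\<close> has norm
      0.\<close>
    define c where "c = ip L v v + 1"
    have "ip L v v \<ge> 0" by (simp add: ip_self)
    then have c: "c > 0" by (simp add: c_def)
    have "0 \<le> - 2 * (?B / c) * ?B + (?B / c)\<^sup>2 * c"
      using lim[of "?B / c"] by (rule order_trans) (auto simp: c_def intro!: mult_left_mono)
    also have "\<dots> = - (?B\<^sup>2 / c)" using c by (simp add: field_simps power2_eq_square)
    finally have "?B\<^sup>2 / c \<le> 0" by simp
    then show "?B = 0" using c by (simp add: divide_le_0_iff)
  qed
  with g s(1) show ?thesis using that by blast
qed

lemma solenoidal_smooth_Hsp: "f \<in> solenoidal_smooth L \<Longrightarrow> f \<in> Hsp L"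
  unfolding Hsp_def closure_wrt_def
  by (auto intro!: solenoidal_smoothD exI[of _ "\<lambda>_. f"] simp: norm_Lp2_eq ip_zero_left)

lemma Hsp_Lp2: "f \<in> Hsp L \<Longrightarrow> f \<in> Lp L 2"
  by (simp add: Hsp_def closure_wrt_def)

lemma HspE:
  assumes "f \<in> Hsp L"
  obtains s where "\<And>k::nat. s k \<in> solenoidal_smooth L" "(\<lambda>k. norm_Lp L 2 (\<lambda>x. f x - s k x)) \<longlonglongrightarrow> 0"
  using assms by (auto simp: Hsp_def closure_wrt_def)

lemma Hsp_add:
  assumes "f \<in> Hsp L" "g \<in> Hsp L"
  shows "(\<lambda>x. f x + g x) \<in> Hsp L"
proof -
  obtain s t where s: "\<And>k::nat. s k \<in> solenoidal_smooth L" "(\<lambda>k. norm_Lp L 2 (\<lambda>x. f x - s k x)) \<longlonglongrightarrow> 0"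
    and t: "\<And>k::nat. t k \<in> solenoidal_smooth L" "(\<lambda>k. norm_Lp L 2 (\<lambda>x. g x - t k x)) \<longlonglongrightarrow> 0"
    using assms by (elim HspE) blast
  have "(\<lambda>k. norm_Lp L 2 (\<lambda>x. (f x + g x) - (s k x + t k x))) \<longlonglongrightarrow> 0"
  proof (rule Lim_null_comparison)
    have "norm_Lp L 2 (\<lambda>x. (f x - s k x) + (g x - t k x)) \<le> norm_Lp L 2 (\<lambda>x. f x - s k x) + norm_Lp L 2 (\<lambda>x. g x - t k x)" for k
      by (intro norm_Lp2_triangle Lp2_diff Hsp_Lp2 assms solenoidal_smoothD(3) s t)
    then show "\<forall>\<^sub>F k in sequentially. norm (norm_Lp L 2 (\<lambda>x. (f x + g x) - (s k x + t k x))) \<le>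
        norm_Lp L 2 (\<lambda>x. f x - s k x) + norm_Lp L 2 (\<lambda>x. g x - t k x)"
      by (simp add: norm_Lp_nonneg add_diff_add)
    show "(\<lambda>k. norm_Lp L 2 (\<lambda>x. f x - s k x) + norm_Lp L 2 (\<lambda>x. g x - t k x)) \<longlonglongrightarrow> 0"
      using tendsto_add[OF s(2) t(2)] by simp
  qed
  then show ?thesis using s(1) t(1) assms
    by (auto simp: Hsp_def closure_wrt_def intro!: Lp2_add exI[of _ "\<lambda>k x. s k x + t k x"] solenoidal_smooth_add)
qed

lemma Hsp_scaleR:
  assumes "f \<in> Hsp L"
  shows "(\<lambda>x. c *\<^sub>R f x) \<in> Hsp L"
proof -
  obtain s where s: "\<And>k::nat. s k \<in> solenoidal_smooth L" "(\<lambda>k. norm_Lp L 2 (\<lambda>x. f x - s k x)) \<longlonglongrightarrow> 0"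
    using assms by (elim HspE) blast
  have "(\<lambda>k. norm_Lp L 2 (\<lambda>x. c *\<^sub>R f x - c *\<^sub>R s k x)) \<longlonglongrightarrow> 0"
    using tendsto_mult[OF tendsto_const[of "\<bar>c\<bar>"] s(2)]
    by (simp add: norm_Lp2_scaleR flip: scaleR_diff_right)
  then show ?thesis using s(1) assms
    by (auto simp: Hsp_def closure_wrt_def intro!: Lp2_scaleR exI[of _ "\<lambda>k x. c *\<^sub>R s k x"] solenoidal_smooth_scaleR)
qed

text \<open>Projecting onto the smooth solenoidal fields already produces a limit in
  \<open>Hsp\<close>, so closedness of \<open>Hsp\<close> is not an issue; orthogonality extends to
  all of \<open>Hsp\<close> by continuity of the inner product. This provides the witness for the
  \<open>SOME\<close> in \<open>orth_proj\<close>.\<close>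

lemma leray_works:
  assumes f: "f \<in> Lp L 2"
  shows leray_Hsp: "leray L f \<in> Hsp L" and ip_leray: "v \<in> Hsp L \<Longrightarrow> ip L (leray L f) v = ip L f v"
proof -
  have ne: "solenoidal_smooth L \<noteq> {}" using solenoidal_smooth_zero by blast
  have sub: "solenoidal_smooth L \<subseteq> Lp L 2" using solenoidal_smoothD(3) by blast
  obtain g s where g: "g \<in> Lp L 2" "\<And>k. s k \<in> solenoidal_smooth L" "(\<lambda>k::nat. norm_Lp L 2 (\<lambda>x. g x - s k x)) \<longlonglongrightarrow> 0"
    "\<And>v. v \<in> solenoidal_smooth L \<Longrightarrow> ip L (\<lambda>x. f x - g x) v = 0"
    by (rule L2_projection[OF sub ne solenoidal_smooth_add solenoidal_smooth_scaleR f]) (assumption | rule that)+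
  have gH: "g \<in> Hsp L" using g(1-3) by (auto simp: Hsp_def closure_wrt_def)
  have "ip L (\<lambda>x. f x - g x) v = 0" if v: "v \<in> Hsp L" for v
  proof -
    obtain t where t: "\<And>k::nat. t k \<in> solenoidal_smooth L" "(\<lambda>k. norm_Lp L 2 (\<lambda>x. v x - t k x)) \<longlonglongrightarrow> 0"
      using v by (elim HspE) blast
    have fg: "(\<lambda>x. f x - g x) \<in> Lp L 2" by (intro Lp2_diff f g)
    have "(\<lambda>k. ip L (t k) (\<lambda>x. f x - g x)) \<longlonglongrightarrow> ip L v (\<lambda>x. f x - g x)"
      by (rule ip_tendsto_left[OF Hsp_Lp2[OF v] solenoidal_smoothD(3)[OF t(1)] fg t(2)])
    moreover have "ip L (t k) (\<lambda>x. f x - g x) = 0" for k using g(4)[OF t(1)] by (simp add: ip_commute)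
    ultimately have "ip L v (\<lambda>x. f x - g x) = 0" by (simp add: LIMSEQ_const_iff)
    then show ?thesis by (simp add: ip_commute)
  qed
  with gH have "\<exists>h. h \<in> Hsp L \<and> (\<forall>v\<in>Hsp L. ip L (\<lambda>x. f x - h x) v = 0)" by blast
  from someI_ex[OF this] have *: "leray L f \<in> Hsp L" "\<And>v. v \<in> Hsp L \<Longrightarrow> ip L (\<lambda>x. f x - leray L f x) v = 0"
    by (auto simp: leray_def orth_proj_def)
  then show "leray L f \<in> Hsp L" by blast
  show "ip L (leray L f) v = ip L f v" if "v \<in> Hsp L"
    using *(2)[OF that] by (simp add: ip_diff_left f Hsp_Lp2 that *(1))
qed

text \<open>For a smooth solenoidal field, integration by parts moves the derivatives onto the field
  and produces its divergence. The identity is preserved under \<open>L2\<close> limits.\<close>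

lemma Hsp_orthogonal_gradient:
  fixes w :: "'n::finite vfield"
  assumes L: "L > 0" and w: "w \<in> Hsp L" and \<phi>: "smooth_on UNIV \<phi>" "periodic_on L UNIV \<phi>"
  shows "ip L w (\<lambda>x. \<chi> i. frechet_derivative \<phi> (at x) (axis i 1)) = 0"
proof -
  have ax: "axis i (1::real) \<in> Basis" for i :: 'n by simp
  let ?G = "(\<lambda>x. \<chi> i. frechet_derivative \<phi> (at x) (axis i 1))"
  note c\<phi> = smooth_continuous[OF \<phi>(1)] smooth_continuous[OF smooth_partial[OF \<phi>(1) ax]]
  have G: "?G \<in> Lp L 2"
    using periodic_partial[OF \<phi>] by (intro Lp2_continuous continuous_intros c\<phi>) (simp add: periodic_on_def)
  have s0: "ip L s ?G = 0" if s: "s \<in> solenoidal_smooth L" for s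
  proof -
    note sd = solenoidal_smoothD[OF s]
    let ?d = "\<lambda>x. frechet_derivative s (at x)"
    note cs = smooth_continuous[OF sd(1)] smooth_continuous[OF smooth_partial[OF sd(1) ax]]
    have "ip L s ?G = (LINT x|torus L. (\<Sum>i\<in>UNIV. frechet_derivative \<phi> (at x) (axis i 1) * s x $ i))"
      by (simp add: ip_def inner_vec_def mult.commute)
    also have "\<dots> = (\<Sum>i\<in>UNIV. LINT x|torus L. frechet_derivative \<phi> (at x) (axis i 1) * s x $ i)"
      by (intro Bochner_Integration.integral_sum integrable_torus_continuous continuous_intros c\<phi> cs)
    also have "\<dots> = (\<Sum>i\<in>UNIV. - (LINT x|torus L. \<phi> x * ?d x (axis i 1) $ i))"
    proof (intro sum.cong refl integral_by_parts_torus[OF L \<phi>])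
      fix i x show "((\<lambda>x. s x $ i) has_derivative (\<lambda>h. ?d x h $ i)) (at x)"
        using bounded_linear.has_derivative[OF bounded_linear_vec_nth smooth_has_derivative[OF sd(1)]] .
    qed (use sd(2) in \<open>auto intro!: continuous_intros cs simp: periodic_on_def\<close>)
    also have "\<dots> = - (LINT x|torus L. (\<Sum>i\<in>UNIV. \<phi> x * ?d x (axis i 1) $ i))"
      unfolding sum_negf
      by (subst Bochner_Integration.integral_sum) (intro integrable_torus_continuous continuous_intros c\<phi> cs, simp)
    also have "\<dots> = 0" using sd(4) by (simp flip: sum_distrib_left)
    finally show ?thesis .
  qed
  obtain s where s: "\<And>k::nat. s k \<in> solenoidal_smooth L" "(\<lambda>k. norm_Lp L 2 (\<lambda>x. w x - s k x)) \<longlonglongrightarrow> 0"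
    using w by (elim HspE) blast
  have "(\<lambda>k. ip L (s k) ?G) \<longlonglongrightarrow> ip L w ?G"
    by (rule ip_tendsto_left[OF Hsp_Lp2[OF w] solenoidal_smoothD(3)[OF s(1)] G s(2)])
  then show ?thesis using s0[OF s(1)] by (simp add: LIMSEQ_const_iff)
qed

lemma Vsp_Hsp:
  assumes "f \<in> Vsp L"
  shows "f \<in> Hsp L"
proof -
  obtain s where f: "f \<in> H1 L" and s: "\<And>k::nat. s k \<in> solenoidal_smooth L" "(\<lambda>k. norm_H1 L (\<lambda>x. f x - s k x)) \<longlonglongrightarrow> 0"
    using assms by (auto simp: Vsp_def closure_wrt_def)
  have "(\<lambda>k. norm_Lp L 2 (\<lambda>x. f x - s k x)) \<longlonglongrightarrow> 0"
  proof (rule Lim_null_comparison[OF _ s(2)])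
    have "norm_Lp L 2 g \<le> norm_H1 L g" for g :: "'a vfield"
      unfolding norm_H1_def by (intro real_le_rsqrt) (auto intro: sum_nonneg)
    then show "\<forall>\<^sub>F k in sequentially. norm (norm_Lp L 2 (\<lambda>x. f x - s k x)) \<le> norm_H1 L (\<lambda>x. f x - s k x)"
      by (simp add: norm_Lp_nonneg)
  qed
  then show ?thesis using s(1) H1_Lp2[OF f] by (auto simp: Hsp_def closure_wrt_def)
qed

lemma Re_ee_derivative:
  "((\<lambda>x. Re (c * ee L \<xi> x)) has_derivative (\<lambda>h. Re ((c * \<i> * of_real (2 * pi / L * (\<xi> \<bullet> h))) * ee L \<xi> x))) (at x)"
proof -
  have "((\<lambda>x. \<i> * of_real (2 * pi / L * (\<xi> \<bullet> x))) has_derivative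
      (\<lambda>b. \<i> * of_real (2 * pi / L * (\<xi> \<bullet> b)))) (at x)"
    by (intro derivative_intros)
  from has_derivative_compose[OF this DERIV_exp[unfolded has_field_derivative_def]]
  have "((\<lambda>x. c * ee L \<xi> x) has_derivative (\<lambda>h. (c * \<i> * of_real (2 * pi / L * (\<xi> \<bullet> h))) * ee L \<xi> x)) (at x)"
    unfolding ee_def cis_conv_exp by (auto dest: has_derivative_mult_right[where x = c] simp: mult_ac)
  from bounded_linear.has_derivative[OF bounded_linear_Re this] show ?thesis .
qed

lemma frechet_derivative_Re_ee:
  "frechet_derivative (\<lambda>x. Re (c * ee L \<xi> x)) (at x) h = Re ((c * \<i> * of_real (2 * pi / L * (\<xi> \<bullet> h))) * ee L \<xi> x)"
  using frechet_derivative_at[OF Re_ee_derivative] by metis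

lemma laplacian_Re_ee:
  fixes u :: "'n::finite vfield"
  assumes L: "L > 0" and u: "u \<in> H2 L" and \<xi>: "\<xi> \<in> latt"
  shows "(LINT x|torus L. Re (c * ee L \<xi> x) *\<^sub>R laplacian L u x) =
    - ((2 * pi / L)\<^sup>2 * (norm \<xi>)\<^sup>2) *\<^sub>R (LINT x|torus L. Re (c * ee L \<xi> x) *\<^sub>R u x)"
proof -
  let ?k = "2 * pi / L"
  note sp = rtp_smooth_periodic[OF L rtp_Re_ee[OF \<xi>, of L c]]
  have "Re (c * \<i> * of_real (?k * (\<xi> \<bullet> axis i 1)) * \<i> * of_real (?k * (\<xi> \<bullet> axis i 1)) * ee L \<xi> x)
     = - (?k\<^sup>2 * (\<xi> $ i)\<^sup>2) * Re (c * ee L \<xi> x)" for i x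
  proof -
    have "Re (c * \<i> * of_real a * \<i> * of_real a * z) = - (a\<^sup>2) * Re (c * z)" for a z
      by (simp add: power2_eq_square algebra_simps)
    from this[of "?k * \<xi> $ i"] show ?thesis by (simp add: inner_axis power_mult_distrib power_divide)
  qed
  then have "(LINT x|torus L. Re (c * ee L \<xi> x) *\<^sub>R laplacian L u x) =
    (\<Sum>i\<in>UNIV. LINT x|torus L. (- (?k\<^sup>2 * (\<xi> $ i)\<^sup>2) * Re (c * ee L \<xi> x)) *\<^sub>R u x)"
    unfolding laplacian_test[OF u conjunct1[OF sp] conjunct2[OF sp]] frechet_derivative_Re_ee by simp
  also have "\<dots> = (\<Sum>i\<in>UNIV. (- (?k\<^sup>2 * (\<xi> $ i)\<^sup>2)) *\<^sub>R (LINT x|torus L. Re (c * ee L \<xi> x) *\<^sub>R u x))"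
    by (simp only: scaleR_scaleR[symmetric] integral_scaleR_right)
  also have "\<dots> = (- (?k\<^sup>2 * (norm \<xi>)\<^sup>2)) *\<^sub>R (LINT x|torus L. Re (c * ee L \<xi> x) *\<^sub>R u x)"
  proof -
    have "(norm \<xi>)\<^sup>2 = (\<Sum>i\<in>UNIV. (\<xi> $ i)\<^sup>2)"
      unfolding power2_norm_eq_inner inner_vec_def by (simp add: power2_eq_square)
    then show ?thesis by (simp only: scaleR_left.sum[symmetric] sum_negf sum_distrib_left)
  qed
  finally show ?thesis .
qed

lemma ee_coefficient_component:
  fixes g :: "'n::finite vfield"
  assumes g: "integrable (torus L) g"
  shows "(LINT x|torus L. of_real (g x $ j) * ee L \<xi> x) =
    Complex ((LINT x|torus L. Re (1 * ee L \<xi> x) *\<^sub>R g x) $ j) ((LINT x|torus L. Re (- \<i> * ee L \<xi> x) *\<^sub>R g x) $ j)"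
proof -
  have gj: "integrable (torus L) (\<lambda>x. complex_of_real (g x $ j))"
    using integrable_inner_left[of "axis j 1" "torus L" g] g by (simp add: inner_axis)
  have int: "integrable (torus L) (\<lambda>x. of_real (g x $ j) * ee L \<xi> x)"
    by (intro integrable_torus_mult_continuous gj continuous_intros)
  have i: "integrable (torus L) (\<lambda>x. Re (c * ee L \<xi> x) *\<^sub>R g x)" for c
    by (intro integrable_torus_scaleR_continuous g continuous_intros)
  show ?thesis
    unfolding integral_torus_component[OF i] complex_eq_iff integral_Re[OF int, symmetric] integral_Im[OF int, symmetric]
    by (simp add: mult.commute)
qed

text \<open>Each component of \<open>u - laplacian L u\<close> has the coefficients that
  \<open>bounded_of_trig_coefficients\<close> asks for, because the Laplacian multiplies a mode by
  minus its squared frequency.\<close>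

lemma H2_bounded:
  fixes u :: "'n::finite vfield"
  assumes L: "L > 0" and d: "CARD('n) \<le> 3" and u: "u \<in> H2 L"
  shows "\<exists>C. AE x in torus L. norm (u x) \<le> C"
proof -
  have u2: "u \<in> Lp L 2" using u by (simp add: H2_def H1_Lp2)
  note lu = laplacian_Lp2[OF u]
  have comp: "integrable (torus L) (\<lambda>x. g x $ j)" if "integrable (torus L) g" for g :: "'n vfield" and j
    using integrable_inner_left[of "axis j 1" "torus L" g] that by (simp add: inner_axis)
  have "\<exists>C. AE x in torus L. \<bar>u x $ j\<bar> \<le> C" for j
  proof (rule bounded_of_trig_coefficients[OF L d])
    let ?h = "\<lambda>x. u x - laplacian L u x"
    have h: "?h \<in> Lp L 2" by (intro Lp2_diff u2 lu)
    show "integrable (torus L) (\<lambda>x. u x $ j)" "integrable (torus L) (\<lambda>x. ?h x $ j)"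
      by (intro comp Lp2_integrable_norm u2 h)+
    have [measurable]: "?h \<in> borel_measurable (torus L)" using h by (simp add: Lp2_iff)
    show "integrable (torus L) (\<lambda>x. (?h x $ j)\<^sup>2)"
    proof (rule Bochner_Integration.integrable_bound)
      show "integrable (torus L) (\<lambda>x. (norm (?h x))\<^sup>2)" using h by (simp add: Lp2_iff)
      show "AE x in torus L. norm ((?h x $ j)\<^sup>2) \<le> norm ((norm (?h x))\<^sup>2)"
        by (intro AE_I2) (simp only: real_norm_def abs_power2 abs_le_square_iff[symmetric] abs_norm_cancel component_le_norm_cart)
      have "(\<lambda>x. ?h x $ j) \<in> borel_measurable (torus L)"
        using comp[OF Lp2_integrable_norm[OF h], of j] by (rule borel_measurable_integrable)
      then show "(\<lambda>x. (?h x $ j)\<^sup>2) \<in> borel_measurable (torus L)" by measurable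
    qed
    fix \<xi> :: "real^'n" assume \<xi>: "\<xi> \<in> latt"
    have diff: "(LINT x|torus L. Re (c * ee L \<xi> x) *\<^sub>R ?h x) = (1 + (2 * pi / L)\<^sup>2 * (norm \<xi>)\<^sup>2) *\<^sub>R (LINT x|torus L. Re (c * ee L \<xi> x) *\<^sub>R u x)" for c
    proof -
      have "(LINT x|torus L. Re (c * ee L \<xi> x) *\<^sub>R ?h x) = (LINT x|torus L. Re (c * ee L \<xi> x) *\<^sub>R u x) - (LINT x|torus L. Re (c * ee L \<xi> x) *\<^sub>R laplacian L u x)"
        unfolding scaleR_diff_right
        by (intro Bochner_Integration.integral_diff integrable_torus_scaleR_continuous Lp2_integrable_norm u2 lu continuous_intros)
      then show ?thesis unfolding laplacian_Re_ee[OF L u \<xi>] by (simp add: scaleR_add_left)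
    qed
    show "of_real (1 + (2 * pi / L)\<^sup>2 * (norm \<xi>)\<^sup>2) * (LINT x|torus L. of_real (u x $ j) * ee L \<xi> x) =
       (LINT x|torus L. of_real (?h x $ j) * ee L \<xi> x)"
      unfolding ee_coefficient_component[OF Lp2_integrable_norm[OF u2]] ee_coefficient_component[OF Lp2_integrable_norm[OF h]] diff
      by (simp add: complex_eq_iff)
  qed
  then obtain C where C: "\<And>j. AE x in torus L. \<bar>u x $ j\<bar> \<le> C j" by metis
  then have "AE x in torus L. \<forall>j. \<bar>u x $ j\<bar> \<le> C j" by (simp add: AE_all_countable)
  then have "AE x in torus L. norm (u x) \<le> (\<Sum>j\<in>UNIV. C j)"
  proof eventually_elim
    case (elim x)
    then show ?case using norm_le_l1_cart[of "u x"] by (meson order_trans sum_mono)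
  qed
  then show ?thesis by blast
qed

section \<open>Stokes eigenfunctions\<close>

lemma integrable_torus_component:
  fixes f :: "real^'n \<Rightarrow> real^'m"
  assumes "integrable (torus L) f"
  shows "integrable (torus L) (\<lambda>x. f x $ j)"
  using integrable_inner_left[of "axis j 1" "torus L" f] assms by (simp add: inner_axis)

lemma ip_continuous_components:
  fixes p g :: "'n::finite vfield"
  assumes p: "continuous_on UNIV p" and g: "integrable (torus L) g"
  shows "ip L g p = (\<Sum>j\<in>UNIV. (LINT x|torus L. p x $ j *\<^sub>R g x) $ j)"
proof -
  have i: "integrable (torus L) (\<lambda>x. p x $ j *\<^sub>R g x)" for j
    by (intro integrable_torus_scaleR_continuous g continuous_intros p)
  have "ip L g p = (LINT x|torus L. (\<Sum>j\<in>UNIV. (p x $ j *\<^sub>R g x) $ j))"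
    by (simp add: ip_def inner_vec_def mult.commute)
  also have "\<dots> = (\<Sum>j\<in>UNIV. LINT x|torus L. (p x $ j *\<^sub>R g x) $ j)"
    by (intro Bochner_Integration.integral_sum integrable_torus_component i)
  finally show ?thesis by (simp only: integral_torus_component[OF i])
qed

lemma smooth_on_component:
  fixes v :: "real^'n \<Rightarrow> real^'m"
  assumes "smooth_on UNIV v"
  shows "smooth_on UNIV (\<lambda>x. v x $ j)"
proof -
  have "Ck_on k UNIV v \<Longrightarrow> Ck_on k UNIV (\<lambda>x. v x $ j)" for k and v :: "real^'n \<Rightarrow> real^'m"
  proof (induction k arbitrary: v)
    case (Suc k)
    have d: "v differentiable at x" for x using Suc.prems by (auto simp: differentiable_on_def)
    have hd: "((\<lambda>x. v x $ j) has_derivative (\<lambda>h. frechet_derivative v (at x) h $ j)) (at x)" for x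
      using bounded_linear.has_derivative[OF bounded_linear_vec_nth d[unfolded frechet_derivative_works]] .
    then have "frechet_derivative (\<lambda>x. v x $ j) (at x) = (\<lambda>h. frechet_derivative v (at x) h $ j)" for x
      by (rule frechet_derivative_at[symmetric])
    then show ?case using Suc hd by (auto simp: differentiable_on_def differentiable_def)
  qed (auto intro: continuous_on_component)
  then show ?thesis using assms by (auto simp: smooth_on_def)
qed
text \<open>In the open cell the set where \<open>f\<close> is nonzero is open and null, hence
  empty. Unique continuation covers the points outside the cell.\<close>

lemma rtp_AE_zero:
  fixes f :: "real^'n \<Rightarrow> real"
  assumes L: "L > 0" and f: "rtp L f" and AE: "AE x in torus L. f x = 0"
  shows "f x = 0"
proof -
  let ?B = "box 0 (\<chi> i. L) :: (real^'n) set"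
  have cf: "continuous_on UNIV f" by (rule rtp_continuous[OF f])
  have o: "open (?B \<inter> f -` (- {0}))"
    using continuous_open_preimage[OF continuous_on_subset[OF cf subset_UNIV] open_box, of "- {0}"] by auto
  have "negligible (?B \<inter> f -` (- {0}))"
  proof -
    have "AE x in lebesgue. x \<notin> ?B \<inter> f -` (- {0})"
      by (rule AE_mp[OF AE[unfolded AE_torus_iff]], rule AE_I2)
        (use box_subset_cbox[of 0 "(\<chi> i. L) :: real^'n"] in auto)
    then show ?thesis
      unfolding negligible_iff_null_sets
      by (subst AE_iff_null_sets) (intro sets_completionI_sets, simp add: o)
  qed
  with o have e: "?B \<inter> f -` (- {0}) = {}" using open_not_negligible by blast
  have ne: "?B \<noteq> {}" using L by (simp add: box_ne_empty Basis_vec_def inner_axis)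
  have "complex_of_real (f x) = 0"
    using tp_unique_continuation[OF _ open_box ne, of L "\<lambda>x. of_real (f x)" x] f e by (auto simp: rtp_real)
  then show ?thesis by simp
qed

lemma rtp_scaleR_const:
  assumes "rtp L (\<theta> :: real^'n \<Rightarrow> real)"
  shows "rtp L (\<lambda>x. \<theta> x *\<^sub>R (a :: real^'n))"
  unfolding rtp_vec using assms tp_mult[OF _ tp_const] by (auto simp: rtp_real)

lemma rtp_sum:
  "(\<And>i. i \<in> I \<Longrightarrow> rtp L (f i :: real^'n \<Rightarrow> 'b::euclidean_space)) \<Longrightarrow> rtp L (\<lambda>x. \<Sum>i\<in>I. f i x)"
  unfolding rtp_def by (simp add: inner_sum_left tp_sum)

lemma rtp_scaleR: "rtp L f \<Longrightarrow> rtp L (\<lambda>x. c *\<^sub>R f x)"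
  unfolding rtp_def by (auto intro: tp_cmult)

lemma stokes_dom_Hsp: "w \<in> stokes_dom L \<Longrightarrow> w \<in> Hsp L"
  by (simp add: stokes_dom_def Vsp_Hsp)

lemma stokes_dom_H2: "w \<in> stokes_dom L \<Longrightarrow> w \<in> H2 L"
  by (simp add: stokes_dom_def)

text \<open>The Leray projection inside \<open>stokes\<close> disappears when the equation is tested
  with a field of \<open>Hsp\<close>.\<close>

lemma eigen_laplacian:
  assumes w: "w \<in> stokes_dom L" and eig: "AE x in torus L. stokes L w x = \<kappa> *\<^sub>R w x" and v: "v \<in> Hsp L"
  shows "ip L (laplacian L w) v = - \<kappa> * ip L w v"
proof -
  note l2 = laplacian_Lp2[OF stokes_dom_H2[OF w]]
  note lw = leray_Hsp[OF l2, THEN Hsp_Lp2]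
  have [measurable]: "leray L (laplacian L w) \<in> borel_measurable (torus L)" "w \<in> borel_measurable (torus L)" "v \<in> borel_measurable (torus L)"
    using lw Hsp_Lp2[OF v] Hsp_Lp2[OF stokes_dom_Hsp[OF w]] by (simp_all add: Lp2_iff)
  have "ip L (laplacian L w) v = ip L (leray L (laplacian L w)) v" by (rule ip_leray[OF l2 v, symmetric])
  also have "\<dots> = ip L (\<lambda>x. - \<kappa> *\<^sub>R w x) v"
  proof (rule ip_cong_AE)
    show "AE x in torus L. leray L (laplacian L w) x = - \<kappa> *\<^sub>R w x"
      using eig by eventually_elim (simp add: stokes_def minus_equation_iff eq_commute[of "- _"])
  qed measurable
  finally show ?thesis by (simp add: ip_minus_left ip_scaleR_left)
qed

lemma grad_ip_laplacian:
  assumes L: "L > 0" and w: "w \<in> H2 L" and v: "smooth_on UNIV v" "periodic_on L UNIV v"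
  shows "grad_ip L w v = - ip L (laplacian L w) v"
proof -
  have ax: "axis i (1::real) \<in> Basis" for i :: 'a by simp
  note cv = smooth_continuous[OF v(1)] smooth_continuous[OF smooth_partial[OF v(1) ax]]
  have w1: "w \<in> H1 L" and w2: "wpartial L i w \<in> H1 L" for i using w by (auto simp: H2_def)
  have v2: "v \<in> Lp L 2" by (intro Lp2_continuous v cv)
  have vH: "v \<in> H1 L" by (rule H1_smooth[OF L v])
  let ?d = "\<lambda>x. frechet_derivative v (at x)"
  have eq: "ip L (wpartial L i w) (wpartial L i v) = - ip L (wpartial L i (wpartial L i w)) v" for i
  proof -
    note m = H1_wpartial(1)[OF w1, of i] H1_wpartial(1)[OF w2, of i i] has_weak_partial_smooth(2)[OF L v, of i] H1_wpartial(1)[OF vH, of i]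
    have "ip L (wpartial L i w) (wpartial L i v) = ip L (wpartial L i w) (\<lambda>x. ?d x (axis i 1))"
      by (rule ip_cong_AE) (use m wpartial_AE_eq[OF L vH has_weak_partial_smooth(2,1)[OF L v]] in \<open>auto simp: Lp2_iff\<close>)
    also have "\<dots> = (\<Sum>j\<in>UNIV. (LINT x|torus L. ?d x (axis i 1) $ j *\<^sub>R wpartial L i w x) $ j)"
      by (intro ip_continuous_components cv Lp2_integrable_norm m)
    also have "\<dots> = (\<Sum>j\<in>UNIV. - (LINT x|torus L. v x $ j *\<^sub>R wpartial L i (wpartial L i w) x) $ j)"
    proof (rule sum.cong[OF refl])
      fix j
      have fd: "frechet_derivative (\<lambda>x. v x $ j) (at x) = (\<lambda>h. ?d x h $ j)" for x
        using bounded_linear.has_derivative[OF bounded_linear_vec_nth smooth_has_derivative[OF v(1)]]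
        by (rule frechet_derivative_at[symmetric])
      show "(LINT x|torus L. ?d x (axis i 1) $ j *\<^sub>R wpartial L i w x) $ j = - (LINT x|torus L. v x $ j *\<^sub>R wpartial L i (wpartial L i w) x) $ j"
        using H1_wpartial(2)[OF w2, of i i, unfolded has_weak_partial_def, rule_format, of "\<lambda>x. v x $ j"] smooth_on_component[OF v(1)] v(2)
        by (simp add: fd periodic_on_def)
    qed
    also have "\<dots> = - ip L (wpartial L i (wpartial L i w)) v"
      by (simp add: ip_continuous_components[OF cv(1) Lp2_integrable_norm[OF m(2)]] sum_negf)
    finally show ?thesis .
  qed
  show ?thesis
    unfolding grad_ip_def eq laplacian_def
    by (subst ip_sum_left) (simp_all add: sum_negf H1_wpartial w2 v2)
qed

text \<open>Testing with divergence-free modes shows that the part of a coefficient across its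
  frequency vanishes unless the frequency lies on a sphere fixed by the eigenvalue. The part along
  the frequency vanishes because \<open>Hsp\<close> is orthogonal to gradients. The sphere contains
  finitely many lattice points, so \<open>w\<close> agrees almost everywhere with a trigonometric
  polynomial.\<close>

lemma stokes_eigenfunction_trig:
  fixes w :: "'n::finite vfield"
  assumes L: "L > 0" and ef: "stokes_eigenfunction L w"
  obtains W \<kappa> where "rtp L W" "W \<in> solenoidal_smooth L" "AE x in torus L. w x = W x"
    "\<And>v. smooth_on UNIV v \<Longrightarrow> periodic_on L UNIV v \<Longrightarrow> v \<in> Hsp L \<Longrightarrow> grad_ip L w v = \<kappa> * ip L w v"
proof -
  obtain \<kappa> where w: "w \<in> stokes_dom L" and eig: "AE x in torus L. stokes L w x = \<kappa> *\<^sub>R w x"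
    using ef by (auto simp: stokes_eigenfunction_def)
  note wH = stokes_dom_Hsp[OF w] and wH2 = stokes_dom_H2[OF w]
  have w2: "w \<in> Lp L 2" using wH by (rule Hsp_Lp2)
  note wi = Lp2_integrable_norm[OF w2]
  let ?k = "2 * pi / L"
  have k0: "?k > 0" using L by simp
  define I where "I c \<xi> = (LINT x|torus L. Re (c * ee L \<xi> x) *\<^sub>R w x)" for c and \<xi> :: "real^'n"
  have int: "integrable (torus L) (\<lambda>x. Re (c * ee L \<xi> x) *\<^sub>R g x)" if "integrable (torus L) g" for c \<xi> and g :: "'n vfield"
    by (intro integrable_torus_scaleR_continuous that continuous_intros)
  have ipI: "ip L g (\<lambda>x. Re (c * ee L \<xi> x) *\<^sub>R a) = (LINT x|torus L. Re (c * ee L \<xi> x) *\<^sub>R g x) \<bullet> a"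
    if "integrable (torus L) g" for g :: "'n vfield" and c \<xi> a
    using integral_inner_left[of a "torus L", OF int[OF that]] by (simp add: ip_def)
  have I0: "I c \<xi> = 0" if \<xi>: "\<xi> \<in> latt" and ne: "?k\<^sup>2 * (norm \<xi>)\<^sup>2 \<noteq> \<kappa>" for c \<xi>
  proof -
    have perp: "I c \<xi> \<bullet> a = 0" if a: "\<xi> \<bullet> a = 0" for a
    proof -
      define v where "v x = Re (c * ee L \<xi> x) *\<^sub>R a" for x
      have rv: "rtp L v" unfolding v_def by (intro rtp_scaleR_const rtp_Re_ee \<xi>)
      have dv: "frechet_derivative v (at x) = (\<lambda>h. Re ((c * \<i> * of_real (?k * (\<xi> \<bullet> h))) * ee L \<xi> x) *\<^sub>R a)" for x
        unfolding v_def by (rule frechet_derivative_at[symmetric]) (rule has_derivative_scaleR_left[OF Re_ee_derivative])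
      have "(\<Sum>i\<in>UNIV. frechet_derivative v (at x) (axis i 1) $ i) = 0" for x
      proof -
        have "Re ((c * \<i> * of_real (?k * t)) * z) = t * Re (c * \<i> * of_real ?k * z)" for t z
          by (simp add: algebra_simps)
        then have "(\<Sum>i\<in>UNIV. frechet_derivative v (at x) (axis i 1) $ i) = (\<Sum>i\<in>UNIV. Re (c * \<i> * of_real ?k * ee L \<xi> x) * (\<xi> $ i * a $ i))"
          unfolding dv by (simp only: inner_axis vector_scaleR_component real_scaleR_def) (simp add: inner_axis mult_ac)
        also have "\<dots> = Re (c * \<i> * of_real ?k * ee L \<xi> x) * (\<xi> \<bullet> a)"
          by (simp only: inner_vec_def inner_real_def sum_distrib_left)
        finally show ?thesis using a by simp
      qed
      then have vs: "v \<in> solenoidal_smooth L"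
        using rtp_smooth_periodic[OF L rv] by (simp add: solenoidal_smooth_def)
      have 1: "ip L (laplacian L w) v = - (?k\<^sup>2 * (norm \<xi>)\<^sup>2) * (I c \<xi> \<bullet> a)"
        unfolding v_def ipI[OF Lp2_integrable_norm[OF laplacian_Lp2[OF wH2]]] laplacian_Re_ee[OF L wH2 \<xi>] I_def by simp
      have 2: "ip L w v = I c \<xi> \<bullet> a"
        unfolding v_def ipI[OF wi] I_def by simp
      have "(\<kappa> - ?k\<^sup>2 * (norm \<xi>)\<^sup>2) * (I c \<xi> \<bullet> a) = 0"
        using eigen_laplacian[OF w eig solenoidal_smooth_Hsp[OF vs]] unfolding 1 2 by (simp only: left_diff_distrib mult_minus_left)
      then show ?thesis using ne by simp
    qed
    have par: "I c \<xi> \<bullet> \<xi> = 0"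
    proof -
      \<comment> \<open>Chosen so that the gradient of \<open>Re (c' * ee L \<xi> x)\<close> is
        \<open>Re (c * ee L \<xi> x)\<close> times \<open>\<xi>\<close>.\<close>
      define c' where "c' = - \<i> * c / of_real ?k"
      have c': "c' * \<i> * of_real (?k * t) = of_real t * c" for t
        using L by (simp add: c'_def) (simp add: complex_eq_iff)
      note sp = rtp_smooth_periodic[OF L rtp_Re_ee[OF \<xi>, of L c']]
      have "Re (of_real t * c * z) = t * Re (c * z)" for t z by (simp add: mult.assoc)
      then have "(\<lambda>x. \<chi> i. frechet_derivative (\<lambda>x. Re (c' * ee L \<xi> x)) (at x) (axis i 1)) = (\<lambda>x. Re (c * ee L \<xi> x) *\<^sub>R \<xi>)"
        unfolding frechet_derivative_Re_ee c' by (simp add: fun_eq_iff vec_eq_iff inner_axis)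
      then show ?thesis
        using Hsp_orthogonal_gradient[OF L wH conjunct1[OF sp] conjunct2[OF sp]] unfolding I_def by (simp only: ipI[OF wi])
    qed
    have "I c \<xi> \<bullet> a = 0" for a
    proof -
      \<comment> \<open>Removes the component of \<open>a\<close> along the frequency. For
        \<open>\<xi> = 0\<close> the quotient is 0 and \<open>b = a\<close>.\<close>
      define b where "b = a - ((\<xi> \<bullet> a) / (\<xi> \<bullet> \<xi>)) *\<^sub>R \<xi>"
      have "\<xi> \<bullet> b = 0" by (cases "\<xi> = 0") (simp_all add: b_def inner_diff_right)
      then have "I c \<xi> \<bullet> b = 0" by (rule perp)
      moreover have "a = b + ((\<xi> \<bullet> a) / (\<xi> \<bullet> \<xi>)) *\<^sub>R \<xi>" by (simp add: b_def)
      ultimately show ?thesis using par by (metis add.right_neutral inner_add_right inner_scaleR_right mult_zero_right)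
    qed
    then show ?thesis using inner_eq_zero_iff by blast
  qed
  define F where "F = {\<xi> \<in> latt. ?k\<^sup>2 * (norm \<xi>)\<^sup>2 = \<kappa>} \<inter> (latt :: (real^'n) set)"
  have "bounded F"
  proof (rule boundedI)
    fix \<xi> assume "\<xi> \<in> F"
    then have "(norm \<xi>)\<^sup>2 = \<kappa> / ?k\<^sup>2" using k0 by (auto simp: F_def field_simps)
    then show "norm \<xi> \<le> sqrt (\<kappa> / ?k\<^sup>2)" by (metis norm_ge_zero order_refl real_sqrt_unique)
  qed
  then have F: "finite F" "F \<subseteq> latt" by (auto intro: finite_latt_bounded simp: F_def)
  define V where "V = measure lebesgue (cell L :: (real^'n) set)"
  have V: "V > 0" unfolding V_def by (rule measure_cell_pos[OF L])
  define c where "c j \<eta> = (LINT x|torus L. of_real (w x $ j) * ee L \<eta> x) / of_real V" for j \<eta>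
  define p where "p j x = (\<Sum>\<eta>\<in>F. c j \<eta> * ee L (- \<eta>) x)" for j x
  have tpp: "tp L (p j)" for j
    unfolding p_def using F(2) by (intro tp_sum tp.base latt_minus) auto
  have wj: "AE x in torus L. of_real (w x $ j) - p j x = 0" for j
  proof (rule trig_complete[OF L])
    have wij: "integrable (torus L) (\<lambda>x. complex_of_real (w x $ j))"
      using integrable_torus_component[OF wi] by simp
    note ip = integrable_torus_continuous[OF tp_continuous[OF tpp[of j]], of L]
    show "integrable (torus L) (\<lambda>x. of_real (w x $ j) - p j x)" using wij ip by simp
    fix \<xi> :: "real^'n" assume \<xi>: "\<xi> \<in> latt"
    have "(LINT x|torus L. (of_real (w x $ j) - p j x) * ee L \<xi> x) =
        (LINT x|torus L. of_real (w x $ j) * ee L \<xi> x) - (LINT x|torus L. p j x * ee L \<xi> x)"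
      unfolding left_diff_distrib
      by (intro Bochner_Integration.integral_diff integrable_torus_mult_continuous wij ip continuous_intros)
    also have "(LINT x|torus L. p j x * ee L \<xi> x) = (if \<xi> \<in> F then c j \<xi> * of_real V else 0)"
      unfolding p_def V_def by (rule trig_coefficient[OF L F \<xi>])
    also have "\<dots> = (LINT x|torus L. of_real (w x $ j) * ee L \<xi> x)"
    proof (cases "\<xi> \<in> F")
      case False
      then have "I c \<xi> = 0" for c using I0[OF \<xi>] \<xi> by (auto simp: F_def)
      then have "(LINT x|torus L. of_real (w x $ j) * ee L \<xi> x) = 0"
        unfolding ee_coefficient_component[OF wi] I_def[symmetric] by (simp only: zero_index zero_complex.code)
      then show ?thesis using False by simp
    qed (use V in \<open>simp add: c_def\<close>)
    finally show "(LINT x|torus L. (of_real (w x $ j) - p j x) * ee L \<xi> x) = 0" by simp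
  qed
  define W where "W x = (\<chi> j. Re (p j x))" for x
  have "AE x in torus L. \<forall>j. of_real (w x $ j) - p j x = 0" using wj by (simp add: AE_all_countable)
  then have wW: "AE x in torus L. w x = W x"
  proof eventually_elim
    case (elim x)
    then have "Re (complex_of_real (w x $ j)) = Re (p j x)" for j by simp
    then show ?case by (simp add: W_def vec_eq_iff)
  qed
  have rW: "rtp L W" unfolding rtp_vec rtp_real W_def using tp_Re[OF tpp] by simp
  note sW = rtp_smooth_periodic[OF L rW]
  have W2: "W \<in> Lp L 2" using sW by (intro Lp2_continuous smooth_continuous) auto
  \<comment> \<open>The divergence of \<open>W\<close>. Since \<open>w\<close> is orthogonal to the
    gradient of \<open>D\<close> and agrees with \<open>W\<close> almost everywhere, integration by
    parts shows that the integral of the square of \<open>D\<close> is 0. Being a trigonometric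
    polynomial, \<open>D\<close> then vanishes at every point.\<close>
  define D where "D x = (\<Sum>i\<in>UNIV. frechet_derivative W (at x) (axis i 1) $ i)" for x
  obtain W' where W': "\<And>b. rtp L (W' b)" "\<And>x. (W has_derivative (\<lambda>b. W' b x)) (at x)"
    using rtp_derivative[OF rW] by blast
  have "frechet_derivative W (at x) = (\<lambda>b. W' b x)" for x
    using frechet_derivative_at[OF W'(2)] by simp
  then have "D = (\<lambda>x. \<Sum>i\<in>UNIV. W' (axis i 1) x $ i)" by (simp add: D_def fun_eq_iff)
  then have rD: "rtp L D" using W'(1) rtp_vec by (auto intro!: rtp_sum)
  note sD = rtp_smooth_periodic[OF L rD]
  have ax: "axis i (1::real) \<in> Basis" for i :: 'n by simp
  have cD: "continuous_on UNIV D" and cDi: "\<And>i. continuous_on UNIV (\<lambda>x. frechet_derivative D (at x) (axis i 1))"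
    using sD by (auto intro!: smooth_continuous smooth_partial)
  have cW: "continuous_on UNIV W" and cWi: "\<And>i. continuous_on UNIV (\<lambda>x. frechet_derivative W (at x) (axis i 1))"
    using sW by (auto intro!: smooth_continuous smooth_partial)
  have mG: "(\<lambda>x. \<chi> i. frechet_derivative D (at x) (axis i 1)) \<in> borel_measurable (torus L)"
    by (intro borel_measurable_torus_continuous continuous_intros cDi)
  have "ip L W (\<lambda>x. \<chi> i. frechet_derivative D (at x) (axis i 1)) = ip L w (\<lambda>x. \<chi> i. frechet_derivative D (at x) (axis i 1))"
    by (rule ip_cong_AE) (use w2 W2 mG wW in \<open>auto simp: Lp2_iff\<close>)
  also have "\<dots> = 0" using sD by (intro Hsp_orthogonal_gradient[OF L wH]) auto
  finally have "0 = ip L W (\<lambda>x. \<chi> i. frechet_derivative D (at x) (axis i 1))" by simp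
  also have "\<dots> = (LINT x|torus L. (\<Sum>i\<in>UNIV. frechet_derivative D (at x) (axis i 1) * W x $ i))"
    by (simp add: ip_def inner_vec_def mult.commute)
  also have "\<dots> = (\<Sum>i\<in>UNIV. LINT x|torus L. frechet_derivative D (at x) (axis i 1) * W x $ i)"
    by (intro Bochner_Integration.integral_sum integrable_torus_continuous continuous_intros cDi cW)
  also have "\<dots> = (\<Sum>i\<in>UNIV. - (LINT x|torus L. D x * frechet_derivative W (at x) (axis i 1) $ i))"
  proof (intro sum.cong refl integral_by_parts_torus[OF L])
    fix i x show "((\<lambda>x. W x $ i) has_derivative (\<lambda>h. frechet_derivative W (at x) h $ i)) (at x)"
      using bounded_linear.has_derivative[OF bounded_linear_vec_nth smooth_has_derivative[OF conjunct1[OF sW]]] .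
  qed (use sD sW in \<open>auto intro!: continuous_intros cWi simp: periodic_on_def\<close>)
  also have "\<dots> = - (LINT x|torus L. (\<Sum>i\<in>UNIV. D x * frechet_derivative W (at x) (axis i 1) $ i))"
    unfolding sum_negf
    by (subst Bochner_Integration.integral_sum) (intro integrable_torus_continuous continuous_intros cD cWi, simp)
  also have "\<dots> = - (LINT x|torus L. D x * D x)"
    by (simp add: D_def sum_distrib_left)
  finally have "(LINT x|torus L. D x * D x) = 0" by simp
  then have "AE x in torus L. D x * D x = 0"
    by (subst (asm) integral_nonneg_eq_0_iff_AE) (auto intro!: integrable_torus_continuous continuous_intros cD)
  then have "AE x in torus L. D x = 0" by simp
  then have "D x = 0" for x by (rule rtp_AE_zero[OF L rD])
  then have Ws: "W \<in> solenoidal_smooth L" using sW by (simp add: solenoidal_smooth_def D_def)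
  have G: "grad_ip L w v = \<kappa> * ip L w v" if "smooth_on UNIV v" "periodic_on L UNIV v" "v \<in> Hsp L" for v
    unfolding grad_ip_laplacian[OF L wH2 that(1,2)] eigen_laplacian[OF w eig that(3)] by simp
  show ?thesis by (rule that[OF rW Ws wW G])
qed

section \<open>Damped ordinary differential equations\<close>

text \<open>Coefficient vectors are total functions on \<open>nat\<close>. The estimate involves the
  entries 1 to \<open>n\<close> only, so for \<open>k\<close> in this range it also forces
  \<open>G a k\<close> to depend on these entries alone.\<close>

definition locally_lipschitz_coeffs :: "nat \<Rightarrow> ((nat \<Rightarrow> real) \<Rightarrow> nat \<Rightarrow> real) \<Rightarrow> bool" where
  "locally_lipschitz_coeffs n G \<longleftrightarrow> (\<forall>M. \<exists>\<Lambda>\<ge>0. \<forall>a b. (\<forall>j\<in>{1..n}. \<bar>a j\<bar> \<le> M \<and> \<bar>b j\<bar> \<le> M) \<longrightarrow>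
     (\<forall>k\<in>{1..n}. \<bar>G a k - G b k\<bar> \<le> \<Lambda> * (\<Sum>j=1..n. \<bar>a j - b j\<bar>)))"

lemma locally_lipschitz_coeffsE:
  assumes "locally_lipschitz_coeffs n G"
  obtains \<Lambda> where "\<Lambda> \<ge> 0" "\<And>a b k. (\<And>j. j \<in> {1..n} \<Longrightarrow> \<bar>a j\<bar> \<le> M \<and> \<bar>b j\<bar> \<le> M) \<Longrightarrow> k \<in> {1..n} \<Longrightarrow>
    \<bar>G a k - G b k\<bar> \<le> \<Lambda> * (\<Sum>j=1..n. \<bar>a j - b j\<bar>)"
proof -
  obtain \<Lambda> where "\<Lambda> \<ge> 0" and *: "\<forall>a b. (\<forall>j\<in>{1..n}. \<bar>a j\<bar> \<le> M \<and> \<bar>b j\<bar> \<le> M) \<longrightarrow>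
     (\<forall>k\<in>{1..n}. \<bar>G a k - G b k\<bar> \<le> \<Lambda> * (\<Sum>j=1..n. \<bar>a j - b j\<bar>))"
    using assms[unfolded locally_lipschitz_coeffs_def, THEN spec, of M] by (elim exE conjE)
  then show thesis by (intro that[of \<Lambda>] *[rule_format]) auto
qed

lemma continuous_on_lipschitz_coeffs:
  fixes a :: "real \<Rightarrow> nat \<Rightarrow> real"
  assumes lip: "\<And>a b k. (\<And>j. j \<in> {1..n} \<Longrightarrow> \<bar>a j\<bar> \<le> M \<and> \<bar>b j\<bar> \<le> M) \<Longrightarrow> k \<in> {1..n} \<Longrightarrow>
      \<bar>G a k - G b k\<bar> \<le> \<Lambda> * (\<Sum>j=1..n. \<bar>a j - b j\<bar>)"
    and a: "\<And>j. j \<in> {1..n} \<Longrightarrow> continuous_on S (\<lambda>t. a t j)"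
    and M: "\<And>j t. j \<in> {1..n} \<Longrightarrow> t \<in> S \<Longrightarrow> \<bar>a t j\<bar> \<le> M" and k: "k \<in> {1..n}"
  shows "continuous_on S (\<lambda>t. G (a t) k)"
  unfolding continuous_on_def
proof
  fix t assume t: "t \<in> S"
  have "((\<lambda>s. G (a s) k - G (a t) k) \<longlongrightarrow> 0) (at t within S)"
  proof (rule Lim_null_comparison)
    show "\<forall>\<^sub>F s in at t within S. norm (G (a s) k - G (a t) k) \<le> \<Lambda> * (\<Sum>j=1..n. \<bar>a s j - a t j\<bar>)"
      unfolding eventually_at_filter using lip[of "a _" "a t" k] M t k by (auto intro!: always_eventually)
    have "((\<lambda>s. \<Lambda> * (\<Sum>j=1..n. \<bar>a s j - a t j\<bar>)) \<longlongrightarrow> \<Lambda> * (\<Sum>j=1..n. \<bar>a t j - a t j\<bar>)) (at t within S)"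
      using a t by (intro tendsto_intros) (auto simp: continuous_on_def)
    then show "((\<lambda>s. \<Lambda> * (\<Sum>j=1..n. \<bar>a s j - a t j\<bar>)) \<longlongrightarrow> 0) (at t within S)" by simp
  qed
  then show "((\<lambda>s. G (a s) k) \<longlongrightarrow> G (a t) k) (at t within S)" by (rule LIM_zero_cancel)
qed

text \<open>The dimension \<open>n\<close> is a term and not a type, so a curve with
  \<open>n\<close> components is encoded as one function on \<open>nat \<times> real\<close>. On the
  discrete factor continuity is automatic.\<close>

lemma continuous_on_nat_times:
  fixes f :: "nat \<Rightarrow> 'a::t2_space \<Rightarrow> 'b::t2_space"
  assumes "\<And>k. continuous_on UNIV (f k)"
  shows "continuous_on UNIV (\<lambda>(k, t). f k t)"
proof (rule continuous_at_imp_continuous_on)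
  show "\<forall>p\<in>UNIV. isCont (\<lambda>(k, t). f k t) p"
  proof
    fix p :: "nat \<times> 'a"
    obtain k t where p: "p = (k, t)" by (cases p)
    have "(f k \<longlongrightarrow> f k t) (nhds t)"
      using assms[of k] by (simp add: continuous_on_eq_continuous_at isCont_def tendsto_nhds_iff)
    then have "((\<lambda>q. f k (snd q)) \<longlongrightarrow> f k t) (nhds p)"
      unfolding p by (rule filterlim_compose) (metis nhds_prod filterlim_snd)
    moreover have "\<forall>\<^sub>F q in nhds p. f k (snd q) = (\<lambda>(k, t). f k t) q"
      unfolding p nhds_prod nhds_discrete eventually_prod_filter
      by (intro exI[of _ "\<lambda>j. j = k"] exI[of _ "\<lambda>_. True"]) (auto simp: eventually_principal)
    ultimately have "((\<lambda>(k, t). f k t) \<longlongrightarrow> f k t) (nhds p)"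
      by (rule Lim_transform_eventually)
    then show "isCont (\<lambda>(k, t). f k t) p"
      unfolding isCont_def p by (auto intro: filterlim_mono at_within_le_nhds)
  qed
qed

lemma complete_bcontfun:
  fixes S :: "('a::topological_space \<Rightarrow>\<^sub>C 'b::complete_space) set"
  assumes "closed S"
  shows "complete S"
  unfolding complete_def
proof (intro allI impI, elim conjE)
  fix f :: "nat \<Rightarrow> 'a \<Rightarrow>\<^sub>C 'b" assume f: "\<forall>n. f n \<in> S" "Cauchy f"
  have "uniformly_Cauchy_on UNIV (\<lambda>n. apply_bcontfun (f n))"
    unfolding uniformly_Cauchy_on_def
  proof (intro allI impI)
    fix e :: real assume "e > 0"
    then obtain N where "\<And>m n. m \<ge> N \<Longrightarrow> n \<ge> N \<Longrightarrow> dist (f m) (f n) < e"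
      using f(2) unfolding Cauchy_def by blast
    then show "\<exists>M. \<forall>x\<in>UNIV. \<forall>m\<ge>M. \<forall>n\<ge>M. dist (f m x) (f n x) < e"
      using dist_bounded le_less_trans by blast
  qed
  then have "uniformly_convergent_on UNIV (\<lambda>n. apply_bcontfun (f n))"
    by (rule Cauchy_uniformly_convergent)
  then obtain g where "uniform_limit UNIV (\<lambda>n. apply_bcontfun (f n)) g sequentially"
    by (auto simp: uniformly_convergent_on_def)
  then obtain l where "f \<longlonglongrightarrow> l"
    by (rule uniform_limit_bcontfunE) auto
  moreover from this have "l \<in> S"
    by (rule closed_sequentially[OF assms f(1)[rule_format]])
  ultimately show "\<exists>l\<in>S. f \<longlonglongrightarrow> l" by blast
qed

lemma integral_exp_le:
  fixes \<sigma> s :: real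
  assumes "\<sigma> > 0" "0 \<le> s"
  shows "integral {0..s} (\<lambda>r. exp (\<sigma> * r)) \<le> exp (\<sigma> * s) / \<sigma>" "(\<lambda>r. exp (\<sigma> * r)) integrable_on {0..s}"
proof -
  have "((\<lambda>r. exp (\<sigma> * r)) has_integral (exp (\<sigma> * s) / \<sigma> - exp (\<sigma> * 0) / \<sigma>)) {0..s}"
  proof (rule fundamental_theorem_of_calculus[where f = "\<lambda>r. exp (\<sigma> * r) / \<sigma>"])
    show "((\<lambda>r. exp (\<sigma> * r) / \<sigma>) has_vector_derivative exp (\<sigma> * r)) (at r within {0..s})" for r
      unfolding has_real_derivative_iff_has_vector_derivative[symmetric]
      using assms by (auto intro!: derivative_eq_intros)
  qed (use assms in simp)
  then show "integral {0..s} (\<lambda>r. exp (\<sigma> * r)) \<le> exp (\<sigma> * s) / \<sigma>" "(\<lambda>r. exp (\<sigma> * r)) integrable_on {0..s}"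
    using assms by (auto dest: integral_unique)
qed

text \<open>Writing \<open>c k t = exp (- \<theta> * t) * u (k, t)\<close> leaves the damping
  \<open>\<sigma>\<close> and a nonlinearity \<open>g\<close> whose Lipschitz constant is uniform in
  time, because the two exponentials cancel. Variation of constants gives a fixed point problem for
  \<open>u\<close> among bounded functions on the whole half line: the solution is global at once,
  and the decay is the weight.\<close>

lemma damped_ode_exists:
  fixes G :: "(nat \<Rightarrow> real) \<Rightarrow> nat \<Rightarrow> real"
  assumes G: "locally_lipschitz_coeffs n G" and G0: "\<And>k. k \<in> {1..n} \<Longrightarrow> G (\<lambda>_. 0) k = 0" and \<theta>: "\<theta> > 0"
  obtains \<eta> c C where "\<And>k. k \<in> {1..n} \<Longrightarrow> c k 0 = c0 k"
    "\<And>k t. k \<in> {1..n} \<Longrightarrow> t \<ge> 0 \<Longrightarrow> (c k has_real_derivative (- G (\<lambda>j. c j t) k - \<eta> * c k t)) (at t within {0..})"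
    "\<And>k t. k \<in> {1..n} \<Longrightarrow> t \<ge> 0 \<Longrightarrow> \<bar>c k t\<bar> \<le> C * exp (- \<theta> * t)"
proof -
  define A where "A = (\<Sum>j=1..n. \<bar>c0 j\<bar>)"
  \<comment> \<open>The fixed point map sends 0 to a function bounded by \<open>A\<close> and has
    contraction factor 1/2, so the ball of radius \<open>2 * A\<close> is mapped into
    itself.\<close>
  define \<rho> where "\<rho> = 2 * A"
  have c0A: "\<bar>c0 k\<bar> \<le> A" if "k \<in> {1..n}" for k
    unfolding A_def using that by (intro member_le_sum) auto
  have A0: "A \<ge> 0" unfolding A_def by (intro sum_nonneg) auto
  obtain \<Lambda> where \<Lambda>: "\<Lambda> \<ge> 0" and lip: "\<And>a b k. (\<And>j. j \<in> {1..n} \<Longrightarrow> \<bar>a j\<bar> \<le> \<rho> \<and> \<bar>b j\<bar> \<le> \<rho>) \<Longrightarrow> k \<in> {1..n} \<Longrightarrow>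
    \<bar>G a k - G b k\<bar> \<le> \<Lambda> * (\<Sum>j=1..n. \<bar>a j - b j\<bar>)"
    using locally_lipschitz_coeffsE[OF G] by blast
  \<comment> \<open>Integrating against the damping gives the contraction factor
    \<open>real n * \<Lambda> / \<sigma>\<close>, which this choice keeps at most 1/2; the summand 1
    makes \<open>\<sigma>\<close> positive even if \<open>\<Lambda>\<close> is 0. The gain is this
    damping plus the prescribed decay rate.\<close>
  define \<sigma> where "\<sigma> = 2 * (real n * \<Lambda>) + 1"
  define \<eta> where "\<eta> = \<theta> + \<sigma>"
  have \<sigma>: "\<sigma> > 0" using \<Lambda> by (simp add: \<sigma>_def add_nonneg_pos)
  \<comment> \<open>The nonlinearity in the variable \<open>u\<close>. For \<open>r \<ge> 0\<close>
    its argument stays in the ball of radius \<open>\<rho>\<close>, on which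
    \<open>\<Lambda>\<close> was fixed.\<close>
  define g where "g u k r = exp (\<theta> * r) * G (\<lambda>j. exp (- \<theta> * r) * u (j, r)) k" for u :: "nat \<times> real \<Rightarrow> real" and k r
  define P where "P u k s = integral {0..s} (\<lambda>r. exp (\<sigma> * r) * g u k r)" for u k s
  define Q where "Q u k s = exp (- \<sigma> * s) * (c0 k - P u k s)" for u k s
  let ?S = "cball 0 \<rho> :: ((nat \<times> real) \<Rightarrow>\<^sub>C real) set"
  have uS: "\<bar>u p\<bar> \<le> \<rho>" if "u \<in> ?S" for u p
    using norm_bounded[of u p] that by (simp add: dist_norm)
  have exp1: "exp (- \<theta> * r) \<le> 1" if "r \<ge> 0" for r using that \<theta> by simp
  have euS: "\<bar>exp (- \<theta> * r) * u (j, r)\<bar> \<le> \<rho>" if "u \<in> ?S" "r \<ge> 0" for u :: "(nat \<times> real) \<Rightarrow>\<^sub>C real" and j r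
  proof -
    have "exp (- \<theta> * r) * \<bar>u (j, r)\<bar> \<le> 1 * \<rho>"
      using exp1[OF that(2)] uS[OF that(1)] by (intro mult_mono) auto
    then show ?thesis by (simp add: abs_mult)
  qed
  have gdiff: "\<bar>g u k r - g v k r\<bar> \<le> real n * \<Lambda> * dist u v"
    if "u \<in> ?S" "v \<in> ?S" "r \<ge> 0" "k \<in> {1..n}" for u v :: "(nat \<times> real) \<Rightarrow>\<^sub>C real" and k r
  proof -
    have "\<bar>g u k r - g v k r\<bar> = exp (\<theta> * r) * \<bar>G (\<lambda>j. exp (- \<theta> * r) * u (j, r)) k - G (\<lambda>j. exp (- \<theta> * r) * v (j, r)) k\<bar>"
      unfolding g_def right_diff_distrib[symmetric] abs_mult by simp
    also have "\<dots> \<le> exp (\<theta> * r) * (\<Lambda> * (\<Sum>j=1..n. \<bar>exp (- \<theta> * r) * u (j, r) - exp (- \<theta> * r) * v (j, r)\<bar>))"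
      using euS that by (intro mult_left_mono lip) auto
    also have "\<dots> = exp (\<theta> * r) * (\<Lambda> * (exp (- \<theta> * r) * (\<Sum>j=1..n. \<bar>u (j, r) - v (j, r)\<bar>)))"
      by (simp only: right_diff_distrib[symmetric] abs_mult abs_exp_cancel sum_distrib_left)
    also have "\<dots> = \<Lambda> * (\<Sum>j=1..n. \<bar>u (j, r) - v (j, r)\<bar>)"
      by (simp add: exp_minus field_simps)
    finally have 1: "\<bar>g u k r - g v k r\<bar> \<le> \<Lambda> * (\<Sum>j=1..n. \<bar>u (j, r) - v (j, r)\<bar>)" .
    have "(\<Sum>j=1..n. \<bar>u (j, r) - v (j, r)\<bar>) \<le> (\<Sum>j=1..n. dist u v)"
      using dist_bounded[of u _ v] by (intro sum_mono) (simp add: dist_real_def)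
    then have "\<Lambda> * (\<Sum>j=1..n. \<bar>u (j, r) - v (j, r)\<bar>) \<le> \<Lambda> * (real n * dist u v)"
      using \<Lambda> by (intro mult_left_mono) auto
    with 1 show ?thesis by (simp add: mult_ac)
  qed
  have g0: "g (0 :: (nat \<times> real) \<Rightarrow>\<^sub>C real) k r = 0" if "k \<in> {1..n}" for k r using G0[OF that] by (simp add: g_def)
  have zS: "0 \<in> ?S" using A0 by (simp add: \<rho>_def)
  have gle: "\<bar>g u k r\<bar> \<le> real n * \<Lambda> * norm u" if "u \<in> ?S" "r \<ge> 0" "k \<in> {1..n}" for u :: "(nat \<times> real) \<Rightarrow>\<^sub>C real" and k r
    using gdiff[OF that(1) zS that(2,3)] g0[OF that(3)] by (simp add: dist_norm)
  have gcont: "continuous_on {0..} (g u k)" if "u \<in> ?S" "k \<in> {1..n}" for u :: "(nat \<times> real) \<Rightarrow>\<^sub>C real" and k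
  proof -
    have "continuous_on {0..} (\<lambda>t. G (\<lambda>j. exp (- \<theta> * t) * u (j, t)) k)"
    proof (rule continuous_on_lipschitz_coeffs[OF lip])
      fix j
      show "continuous_on {0..} (\<lambda>t. exp (- \<theta> * t) * u (j, t))"
        by (intro continuous_intros continuous_on_compose2[OF continuous_on_apply_bcontfun]) auto
      show "\<bar>exp (- \<theta> * t) * u (j, t)\<bar> \<le> \<rho>" if "t \<in> {0..}" for t using euS[OF \<open>u \<in> ?S\<close>] that by simp
    qed (use that in auto)
    then show ?thesis unfolding g_def by (intro continuous_intros)
  qed
  have gcont': "continuous_on {0..s} (\<lambda>r. exp (\<sigma> * r) * g u k r)" if "u \<in> ?S" "k \<in> {1..n}" for u :: "(nat \<times> real) \<Rightarrow>\<^sub>C real" and k s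
    by (intro continuous_intros continuous_on_subset[OF gcont[OF that]]) auto
  have Pder: "(P u k has_real_derivative exp (\<sigma> * s) * g u k s) (at s within {0..})"
    if "u \<in> ?S" "k \<in> {1..n}" "s \<ge> 0" for u :: "(nat \<times> real) \<Rightarrow>\<^sub>C real" and k s
  proof -
    have "(P u k has_real_derivative exp (\<sigma> * s) * g u k s) (at s within {0..s+1})"
      unfolding P_def using that by (intro integral_has_real_derivative gcont') auto
    also have "at s within {0..s+1} = at s within {0..}"
      by (rule at_within_nhd[of _ "{..<s+1}"]) auto
    finally show ?thesis .
  qed
  have Pdiff: "\<bar>P u k s - P v k s\<bar> \<le> real n * \<Lambda> * dist u v * (exp (\<sigma> * s) / \<sigma>)"
    if "u \<in> ?S" "v \<in> ?S" "s \<ge> 0" "k \<in> {1..n}" for u v :: "(nat \<times> real) \<Rightarrow>\<^sub>C real" and k s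
  proof -
    have "P u k s - P v k s = integral {0..s} (\<lambda>r. exp (\<sigma> * r) * g u k r - exp (\<sigma> * r) * g v k r)"
      unfolding P_def using that by (intro Henstock_Kurzweil_Integration.integral_diff[symmetric] integrable_continuous_real gcont')
    also have "norm \<dots> \<le> integral {0..s} (\<lambda>r. (real n * \<Lambda> * dist u v) * exp (\<sigma> * r))"
    proof (rule integral_norm_bound_integral)
      show "(\<lambda>r. exp (\<sigma> * r) * g u k r - exp (\<sigma> * r) * g v k r) integrable_on {0..s}"
        using that by (intro integrable_continuous_real continuous_on_diff gcont')
      show "(\<lambda>r. (real n * \<Lambda> * dist u v) * exp (\<sigma> * r)) integrable_on {0..s}"
        by (intro integrable_continuous_real continuous_intros)
      show "norm (exp (\<sigma> * r) * g u k r - exp (\<sigma> * r) * g v k r) \<le> real n * \<Lambda> * dist u v * exp (\<sigma> * r)" if "r \<in> {0..s}" for r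
        unfolding right_diff_distrib[symmetric] norm_mult using gdiff[OF \<open>u \<in> ?S\<close> \<open>v \<in> ?S\<close> _ \<open>k \<in> {1..n}\<close>, of r] that
        by (simp add: mult.commute mult_right_mono)
    qed
    also have "\<dots> = (real n * \<Lambda> * dist u v) * integral {0..s} (\<lambda>r. exp (\<sigma> * r))" by simp
    also have "\<dots> \<le> (real n * \<Lambda> * dist u v) * (exp (\<sigma> * s) / \<sigma>)"
      using \<Lambda> by (intro mult_left_mono integral_exp_le \<sigma> that) auto
    finally show ?thesis by simp
  qed
  have half: "real n * \<Lambda> / \<sigma> \<le> 1/2" using \<sigma> by (simp add: field_simps) (simp add: \<sigma>_def)
  have Qdiff: "\<bar>Q u k s - Q v k s\<bar> \<le> 1/2 * dist u v"
    if "u \<in> ?S" "v \<in> ?S" "s \<ge> 0" "k \<in> {1..n}" for u v :: "(nat \<times> real) \<Rightarrow>\<^sub>C real" and k s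
  proof -
    have "\<bar>Q u k s - Q v k s\<bar> = exp (- \<sigma> * s) * \<bar>P u k s - P v k s\<bar>"
      unfolding Q_def right_diff_distrib[symmetric] abs_mult by (simp add: abs_minus_commute)
    also have "\<dots> \<le> exp (- \<sigma> * s) * (real n * \<Lambda> * dist u v * (exp (\<sigma> * s) / \<sigma>))"
      by (intro mult_left_mono Pdiff that) auto
    also have "\<dots> = (real n * \<Lambda> / \<sigma>) * dist u v" by (simp add: exp_minus field_simps)
    also have "\<dots> \<le> 1/2 * dist u v" by (intro mult_right_mono half) auto
    finally show ?thesis .
  qed
  have Q0: "\<bar>Q (0 :: (nat \<times> real) \<Rightarrow>\<^sub>C real) k s\<bar> \<le> A" if "s \<ge> 0" "k \<in> {1..n}" for k s
  proof -
    have "Q (0 :: (nat \<times> real) \<Rightarrow>\<^sub>C real) k s = exp (- \<sigma> * s) * c0 k"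
      using g0[OF that(2)] by (simp add: Q_def P_def)
    moreover have "exp (- \<sigma> * s) * \<bar>c0 k\<bar> \<le> 1 * A"
      using \<sigma> that c0A[OF that(2)] by (intro mult_mono) auto
    ultimately show ?thesis by (simp add: abs_mult)
  qed
  have Qle: "\<bar>Q u k s\<bar> \<le> \<rho>" if "u \<in> ?S" "s \<ge> 0" "k \<in> {1..n}" for u :: "(nat \<times> real) \<Rightarrow>\<^sub>C real" and k s
  proof -
    have "norm u \<le> 2 * A" using that(1) by (simp add: \<rho>_def)
    then show ?thesis
      using Qdiff[OF that(1) zS that(2,3)] Q0[OF that(2,3)] unfolding \<rho>_def dist_norm diff_0_right by linarith
  qed
  have Qcont: "continuous_on {0..} (Q u k)" if "u \<in> ?S" "k \<in> {1..n}" for u :: "(nat \<times> real) \<Rightarrow>\<^sub>C real" and k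
  proof -
    have "continuous_on {0..} (P u k)"
      by (rule DERIV_continuous_on) (rule Pder[OF that], simp)
    then show ?thesis unfolding Q_def by (intro continuous_intros)
  qed
  \<comment> \<open>Bounded continuous functions are defined on a whole type, so negative times are
    folded to 0 by \<open>max 0 t\<close> and indices outside 1 to \<open>n\<close> get the value
    0.\<close>
  define \<Phi>0 where "\<Phi>0 u = (\<lambda>(k, t). if k \<in> {1..n} then Q u k (max 0 t) else 0)" for u :: "(nat \<times> real) \<Rightarrow>\<^sub>C real"
  have \<Phi>0: "\<Phi>0 u \<in> bcontfun" if "u \<in> ?S" for u
  proof (rule bcontfun_normI)
    show "continuous_on UNIV (\<Phi>0 u)"
      unfolding \<Phi>0_def
    proof (rule continuous_on_nat_times)
      show "continuous_on UNIV (\<lambda>t. if k \<in> {1..n} then Q u k (max 0 t) else 0)" for k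
      proof (cases "k \<in> {1..n}")
        case True
        have "continuous_on UNIV (\<lambda>t::real. max 0 t)"
          by (intro continuous_on_max continuous_on_const continuous_on_id)
        then have "continuous_on UNIV (\<lambda>t. Q u k (max 0 t))"
          by (rule continuous_on_compose2[OF Qcont[OF that True]]) auto
        then show ?thesis using True by simp
      qed auto
    qed
    show "norm (\<Phi>0 u p) \<le> \<rho>" for p
      using Qle[OF that] A0 by (auto simp: \<Phi>0_def \<rho>_def split: prod.split)
  qed
  define \<Phi> where "\<Phi> u = Bcontfun (\<Phi>0 u)" for u
  have ap: "apply_bcontfun (\<Phi> u) = \<Phi>0 u" if "u \<in> ?S" for u
    unfolding \<Phi>_def by (rule Bcontfun_inverse[OF \<Phi>0[OF that]])
  have "\<exists>!u\<in>?S. \<Phi> u = u"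
  proof (rule Banach_fix)
    show "\<Phi> ` ?S \<subseteq> ?S"
    proof
      fix v assume "v \<in> \<Phi> ` ?S"
      then obtain u where u: "u \<in> ?S" "v = \<Phi> u" by blast
      have "norm (\<Phi> u) \<le> \<rho>"
        by (rule norm_bound) (use Qle[OF u(1)] A0 in \<open>auto simp: ap[OF u(1)] \<Phi>0_def \<rho>_def split: prod.split\<close>)
      then show "v \<in> ?S" using u by simp
    qed
    show "dist (\<Phi> u) (\<Phi> v) \<le> 1/2 * dist u v" if "u \<in> ?S" "v \<in> ?S" for u v
      by (rule dist_bound) (use Qdiff[OF that] in \<open>auto simp: ap[OF that(1)] ap[OF that(2)] \<Phi>0_def dist_real_def split: prod.split\<close>)
    show "?S \<noteq> {}" using zS by blast
    show "complete ?S" by (rule complete_bcontfun[OF closed_cball])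
  qed auto
  then obtain u where u: "u \<in> ?S" "\<Phi> u = u" by blast
  have uQ: "u (k, t) = Q u k t" if "k \<in> {1..n}" "t \<ge> 0" for k t
    using fun_cong[OF ap[OF u(1), unfolded u(2)], of "(k, t)"] that by (simp add: \<Phi>0_def)
  define c where "c k t = exp (- \<eta> * t) * (c0 k - P u k t)" for k t
  have cu: "c k t = exp (- \<theta> * t) * u (k, t)" if "k \<in> {1..n}" "t \<ge> 0" for k t
    unfolding uQ[OF that] c_def Q_def \<eta>_def mult.assoc[symmetric] exp_add[symmetric] by (simp add: algebra_simps)
  show ?thesis
  proof (rule that[of c \<eta> \<rho>])
    fix k assume k: "k \<in> {1..n}"
    show "c k 0 = c0 k" by (simp add: c_def P_def)
    fix t :: real assume t: "t \<ge> 0"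
    show "\<bar>c k t\<bar> \<le> \<rho> * exp (- \<theta> * t)"
      using uS[OF u(1), of "(k, t)"] by (simp add: cu[OF k t] abs_mult mult.commute mult_right_mono)
    have "(c k has_real_derivative (- \<eta> * exp (- \<eta> * t)) * (c0 k - P u k t) + (0 - exp (\<sigma> * t) * g u k t) * exp (- \<eta> * t)) (at t within {0..})"
    proof -
      have "((\<lambda>t. exp (- \<eta> * t)) has_real_derivative - \<eta> * exp (- \<eta> * t)) (at t within {0..})"
        by (auto intro!: derivative_eq_intros)
      from DERIV_mult[OF this DERIV_diff[OF DERIV_const Pder[OF u(1) k t]]]
      show ?thesis unfolding c_def[abs_def] .
    qed
    moreover have "exp (\<sigma> * t) * g u k t * exp (- \<eta> * t) = G (\<lambda>j. c j t) k"
    proof -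
      \<comment> \<open>The two arguments agree only at the indices 1 to \<open>n\<close>; the
        Lipschitz estimate turns this into equality of the values of \<open>G\<close>.\<close>
      have eq: "G (\<lambda>j. exp (- \<theta> * t) * u (j, t)) k = G (\<lambda>j. c j t) k"
      proof -
        have "\<bar>G (\<lambda>j. exp (- \<theta> * t) * u (j, t)) k - G (\<lambda>j. c j t) k\<bar> \<le> \<Lambda> * (\<Sum>j=1..n. \<bar>exp (- \<theta> * t) * u (j, t) - c j t\<bar>)"
          by (intro lip k) (use euS[OF u(1) t] cu[OF _ t] in auto)
        also have "\<dots> = 0" using cu[OF _ t] by simp
        finally show ?thesis by simp
      qed
      have "exp (\<sigma> * t) * exp (\<theta> * t) * exp (- \<eta> * t) = 1"
        by (simp add: \<eta>_def exp_add[symmetric] algebra_simps)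
      then have "exp (\<sigma> * t) * (exp (\<theta> * t) * x) * exp (- \<eta> * t) = x" for x
        by (metis (no_types, opaque_lifting) mult.assoc mult.commute mult_1)
      then show ?thesis unfolding g_def eq by simp
    qed
    ultimately show "(c k has_real_derivative - G (\<lambda>j. c j t) k - \<eta> * c k t) (at t within {0..})"
      by (simp add: c_def algebra_simps)
  qed
qed

text \<open>Gronwall's argument: the sum \<open>d\<close> of the squared differences satisfies
  \<open>d' \<le> C * d\<close>, so \<open>exp (- C * t) * d t\<close> decreases from 0. Compactness
  of the time interval supplies the ball on which the Lipschitz estimate is used. Derivatives are
  taken at interior times only.\<close>

lemma damped_ode_unique:
  fixes G :: "(nat \<Rightarrow> real) \<Rightarrow> nat \<Rightarrow> real"
  assumes G: "locally_lipschitz_coeffs n G" and T: "T \<ge> 0"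
    and a: "\<And>k. k \<in> {1..n} \<Longrightarrow> continuous_on {0..T} (a k)" and b: "\<And>k. k \<in> {1..n} \<Longrightarrow> continuous_on {0..T} (b k)"
    and da: "\<And>k t. k \<in> {1..n} \<Longrightarrow> 0 < t \<Longrightarrow> t < T \<Longrightarrow> (a k has_real_derivative - G (\<lambda>j. a j t) k - \<eta> * a k t) (at t)"
    and db: "\<And>k t. k \<in> {1..n} \<Longrightarrow> 0 < t \<Longrightarrow> t < T \<Longrightarrow> (b k has_real_derivative - G (\<lambda>j. b j t) k - \<eta> * b k t) (at t)"
    and init: "\<And>k. k \<in> {1..n} \<Longrightarrow> a k 0 = b k 0" and k: "k \<in> {1..n}"
  shows "a k T = b k T"
proof (cases "T = 0")
  case False
  then have T: "T > 0" using T by simp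
  have "\<exists>M. \<forall>t\<in>{0..T}. \<bar>f t\<bar> \<le> M" if "continuous_on {0..T} f" for f :: "real \<Rightarrow> real"
  proof -
    have "bounded (f ` {0..T})" by (intro compact_imp_bounded compact_continuous_image that) auto
    then show ?thesis by (auto simp: bounded_iff)
  qed
  then have "\<forall>k\<in>{1..n}. \<exists>M. \<forall>t\<in>{0..T}. \<bar>a k t\<bar> \<le> M" "\<forall>k\<in>{1..n}. \<exists>M. \<forall>t\<in>{0..T}. \<bar>b k t\<bar> \<le> M" using a b by blast+
  then obtain Ma Mb where M: "\<And>k t. k \<in> {1..n} \<Longrightarrow> t \<in> {0..T} \<Longrightarrow> \<bar>a k t\<bar> \<le> Ma k"
    "\<And>k t. k \<in> {1..n} \<Longrightarrow> t \<in> {0..T} \<Longrightarrow> \<bar>b k t\<bar> \<le> Mb k" by metis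
  define M where "M = (\<Sum>k=1..n. \<bar>Ma k\<bar> + \<bar>Mb k\<bar>)"
  have Mk: "\<bar>Ma k\<bar> + \<bar>Mb k\<bar> \<le> M" if "k \<in> {1..n}" for k
    unfolding M_def using that by (intro member_le_sum) auto
  have Mab: "\<bar>a k t\<bar> \<le> M \<and> \<bar>b k t\<bar> \<le> M" if "k \<in> {1..n}" "t \<in> {0..T}" for k t
    using M[OF that] Mk[OF that(1)] by linarith
  obtain \<Lambda> where \<Lambda>: "\<Lambda> \<ge> 0" and lip: "\<And>a b k. (\<And>j. j \<in> {1..n} \<Longrightarrow> \<bar>a j\<bar> \<le> M \<and> \<bar>b j\<bar> \<le> M) \<Longrightarrow> k \<in> {1..n} \<Longrightarrow>
    \<bar>G a k - G b k\<bar> \<le> \<Lambda> * (\<Sum>j=1..n. \<bar>a j - b j\<bar>)"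
    using locally_lipschitz_coeffsE[OF G] by blast
  define x where "x k t = a k t - b k t" for k t
  define d where "d t = (\<Sum>k=1..n. (x k t)\<^sup>2)" for t
  \<comment> \<open>Summing the bound \<open>\<Lambda> * ((x k t)\<^sup>2 + (x j t)\<^sup>2)\<close>
    over both indices gives \<open>2 * \<Lambda> * n\<close> times \<open>d\<close>. The sign of the
    gain is unknown, hence its modulus.\<close>
  define C where "C = 2 * (\<Lambda> * n) + 2 * \<bar>\<eta>\<bar>"
  define d' where "d' t = (\<Sum>k=1..n. 2 * x k t * (- (G (\<lambda>j. a j t) k - G (\<lambda>j. b j t) k) - \<eta> * x k t))" for t
  have dd: "(d has_real_derivative d' t) (at t)" if "0 < t" "t < T" for t
  proof -
    have "(x k has_real_derivative - (G (\<lambda>j. a j t) k - G (\<lambda>j. b j t) k) - \<eta> * x k t) (at t)" if "k \<in> {1..n}" for k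
      using DERIV_diff[OF da db, OF that \<open>0 < t\<close> \<open>t < T\<close> that \<open>0 < t\<close> \<open>t < T\<close>]
      unfolding x_def[abs_def] by (simp add: algebra_simps)
    then have "((\<lambda>t. (x k t)\<^sup>2) has_real_derivative 2 * x k t * (- (G (\<lambda>j. a j t) k - G (\<lambda>j. b j t) k) - \<eta> * x k t)) (at t)"
      if "k \<in> {1..n}" for k
      using DERIV_power[of "x k" _ t UNIV 2] that by (fastforce simp: mult_ac)
    then show ?thesis unfolding d_def[abs_def] d'_def by (intro DERIV_sum) auto
  qed
  have d'le: "d' t \<le> C * d t" if t: "0 < t" "t < T" for t
  proof -
    have "2 * x k t * (- (G (\<lambda>j. a j t) k - G (\<lambda>j. b j t) k) - \<eta> * x k t) \<le>
        (\<Sum>j=1..n. \<Lambda> * ((x k t)\<^sup>2 + (x j t)\<^sup>2)) + 2 * \<bar>\<eta>\<bar> * (x k t)\<^sup>2" if k: "k \<in> {1..n}" for k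
    proof -
      let ?D = "G (\<lambda>j. a j t) k - G (\<lambda>j. b j t) k"
      have 1: "\<bar>?D\<bar> \<le> \<Lambda> * (\<Sum>j=1..n. \<bar>x j t\<bar>)"
        unfolding x_def by (intro lip k) (use Mab t in auto)
      have "2 * x k t * (- ?D) \<le> 2 * (\<bar>x k t\<bar> * \<bar>?D\<bar>)"
        using abs_ge_self[of "x k t * (- ?D)"] by (simp add: abs_mult abs_minus_commute)
      also have "\<dots> \<le> 2 * (\<bar>x k t\<bar> * (\<Lambda> * (\<Sum>j=1..n. \<bar>x j t\<bar>)))"
        by (intro mult_left_mono 1) auto
      also have "\<dots> = (\<Sum>j=1..n. \<Lambda> * (2 * \<bar>x k t\<bar> * \<bar>x j t\<bar>))"
        by (simp add: sum_distrib_left mult_ac)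
      also have "\<dots> \<le> (\<Sum>j=1..n. \<Lambda> * ((x k t)\<^sup>2 + (x j t)\<^sup>2))"
        using sum_squares_bound[of "\<bar>x k t\<bar>" "\<bar>x _ t\<bar>"] \<Lambda> by (intro sum_mono mult_left_mono) auto
      finally have 2: "2 * x k t * (- ?D) \<le> (\<Sum>j=1..n. \<Lambda> * ((x k t)\<^sup>2 + (x j t)\<^sup>2))" .
      have "- \<eta> * (x k t)\<^sup>2 \<le> \<bar>\<eta>\<bar> * (x k t)\<^sup>2" by (intro mult_right_mono) auto
      then have 3: "2 * x k t * (- (\<eta> * x k t)) \<le> 2 * \<bar>\<eta>\<bar> * (x k t)\<^sup>2" by (simp add: power2_eq_square mult_ac)
      have "2 * x k t * (- ?D - \<eta> * x k t) = 2 * x k t * (- ?D) + 2 * x k t * (- (\<eta> * x k t))" by (simp add: algebra_simps)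
      then show ?thesis using 2 3 by linarith
    qed
    then have "d' t \<le> (\<Sum>k=1..n. (\<Sum>j=1..n. \<Lambda> * ((x k t)\<^sup>2 + (x j t)\<^sup>2)) + 2 * \<bar>\<eta>\<bar> * (x k t)\<^sup>2)"
      unfolding d'_def by (rule sum_mono)
    also have "\<dots> = C * d t"
      by (simp add: C_def d_def sum.distrib sum_distrib_left distrib_right distrib_left flip: sum_distrib_left)
    finally show ?thesis .
  qed
  have "exp (- C * T) * d T \<le> exp (- C * 0) * d 0"
  proof (rule DERIV_nonpos_imp_decreasing_open[OF less_imp_le[OF T]])
    fix t assume t: "0 < t" "t < T"
    have "((\<lambda>t. exp (- C * t) * d t) has_real_derivative exp (- C * t) * (d' t - C * d t)) (at t)"
    proof -
      have "((\<lambda>t. exp (- C * t)) has_real_derivative - C * exp (- C * t)) (at t)"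
        by (auto intro!: derivative_eq_intros)
      from DERIV_mult[OF this dd[OF t]] show ?thesis by (simp add: algebra_simps)
    qed
    moreover have "exp (- C * t) * (d' t - C * d t) \<le> 0" using d'le[OF t] by (simp add: mult_le_0_iff)
    ultimately show "\<exists>y. ((\<lambda>t. exp (- C * t) * d t) has_real_derivative y) (at t) \<and> y \<le> 0" by blast
  next
    show "continuous_on {0..T} (\<lambda>t. exp (- C * t) * d t)"
      unfolding d_def x_def by (intro continuous_intros a b)
  qed
  moreover have "d 0 = 0" using init by (simp add: d_def x_def)
  ultimately have "d T \<le> 0" by (simp add: mult_le_0_iff)
  moreover have "(x k T)\<^sup>2 \<le> d T" unfolding d_def using k by (intro member_le_sum) auto
  ultimately have "(x k T)\<^sup>2 \<le> 0" by linarith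
  then show ?thesis by (simp add: x_def)
qed (use init k in simp)

section \<open>Locally Lipschitz families of fields\<close>

text \<open>For small \<open>p\<close> the power itself is not Lipschitz near 0, so its increment is
  never estimated alone: after splitting off \<open>norm b powr p *\<^sub>R (a - b)\<close>, it
  comes multiplied by the smaller norm. The product is at most an increment of the power
  \<open>p + 1\<close>, to which the mean value theorem applies.\<close>

lemma norm_scaleR_powr_diff:
  fixes a b :: "'a::real_normed_vector"
  assumes p: "p \<ge> 0" and B: "norm a \<le> B" "norm b \<le> B"
  shows "norm (norm a powr p *\<^sub>R a - norm b powr p *\<^sub>R b) \<le> (p + 2) * B powr p * norm (a - b)"
proof -
  have key: "norm (norm a powr p *\<^sub>R a - norm b powr p *\<^sub>R b) \<le> (p + 2) * B powr p * norm (a - b)"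
    if le: "norm a \<le> norm b" "norm a \<le> B" "norm b \<le> B" for a b :: 'a
  proof (cases "norm a = norm b")
    case True
    then have "norm (norm a powr p *\<^sub>R a - norm b powr p *\<^sub>R b) = norm b powr p * norm (a - b)"
      by (simp flip: scaleR_diff_right)
    also have "\<dots> \<le> B powr p * norm (a - b)"
      using le p by (intro mult_right_mono powr_mono2) auto
    also have "\<dots> \<le> (p + 2) * B powr p * norm (a - b)"
      using p by (intro mult_right_mono) (auto simp: mult_le_cancel_right1)
    finally show ?thesis .
  next
    case False
    then have ab: "norm a < norm b" using le by simp
    have nb: "norm b > 0" using ab norm_ge_zero le_less_trans by blast
    have "norm a powr p *\<^sub>R a - norm b powr p *\<^sub>R b = norm b powr p *\<^sub>R (a - b) - (norm b powr p - norm a powr p) *\<^sub>R a"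
      by (simp add: algebra_simps)
    then have "norm (norm a powr p *\<^sub>R a - norm b powr p *\<^sub>R b) \<le> norm b powr p * norm (a - b) + \<bar>norm b powr p - norm a powr p\<bar> * norm a"
      using norm_triangle_ineq4[of "norm b powr p *\<^sub>R (a - b)" "(norm b powr p - norm a powr p) *\<^sub>R a"] by simp
    also have "\<bar>norm b powr p - norm a powr p\<bar> * norm a \<le> (p + 1) * B powr p * norm (a - b)"
    proof (cases "a = 0")
      case False
      then have na: "norm a > 0" by simp
      have m: "norm a powr p \<le> norm b powr p" using le p by (intro powr_mono2) auto
      \<comment> \<open>The case \<open>a = 0\<close> is excluded so that the power is
        differentiable on the whole interval.\<close>
      have "\<exists>z. norm a < z \<and> z < norm b \<and> norm b powr (p + 1) - norm a powr (p + 1) = (norm b - norm a) * ((p + 1) * z powr p)"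
      proof (rule MVT2[OF ab])
        fix x assume "norm a \<le> x" "x \<le> norm b"
        then have "x > 0" using na by linarith
        then show "((\<lambda>x. x powr (p + 1)) has_real_derivative (p + 1) * x powr p) (at x)"
          by (auto intro!: derivative_eq_intros)
      qed
      then obtain z where z: "norm a < z" "z < norm b" "norm b powr (p + 1) - norm a powr (p + 1) = (norm b - norm a) * ((p + 1) * z powr p)"
        by blast
      have z0: "0 \<le> z" using na z(1) by linarith
      have "\<bar>norm b powr p - norm a powr p\<bar> * norm a = norm b powr p * norm a - norm a powr (p + 1)"
        using m na by (simp add: left_diff_distrib powr_add)
      also have "\<dots> \<le> norm b powr (p + 1) - norm a powr (p + 1)"
        using le nb by (simp add: powr_add mult_left_mono)
      also have "\<dots> = (norm b - norm a) * ((p + 1) * z powr p)" by (rule z)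
      also have "\<dots> \<le> norm (a - b) * ((p + 1) * B powr p)"
      proof (intro mult_mono mult_left_mono)
        show "norm b - norm a \<le> norm (a - b)"
          using norm_triangle_ineq2[of b a] by (simp add: norm_minus_commute)
        show "z powr p \<le> B powr p"
          by (rule powr_mono2) (use p z0 z(2) le in linarith)+
      qed (use p in auto)
      finally show ?thesis by (simp add: mult_ac)
    qed (use p in auto)
    also have "norm b powr p * norm (a - b) \<le> B powr p * norm (a - b)"
      using le p by (intro mult_right_mono powr_mono2) auto
    finally show ?thesis by (simp add: algebra_simps)
  qed
  show ?thesis
    using key[of a b] key[of b a] B by (cases "norm a \<le> norm b") (auto simp: norm_minus_commute)
qed

text \<open>The bilinear form behind the quadratic advection term, which makes the dependence on the
  coefficients polynomial.\<close>

definition adv2 :: "real \<Rightarrow> 'n::finite vfield \<Rightarrow> 'n vfield \<Rightarrow> 'n vfield" where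
  "adv2 L u v = (\<lambda>x. \<Sum>i\<in>UNIV. (u x $ i) *\<^sub>R wpartial L i v x)"

lemma advection_adv2: "advection L y = adv2 L y y"
  by (simp add: advection_def adv2_def)

lemma Lp2_mult_bounded:
  assumes u: "periodic_on L UNIV u" "u \<in> borel_measurable (torus L)" "AE x in torus L. norm (u x) \<le> B"
    and g: "g \<in> Lp L 2"
  shows "(\<lambda>x. (u x $ i) *\<^sub>R g x) \<in> Lp L 2"
proof -
  have [measurable]: "g \<in> borel_measurable (torus L)" "u \<in> borel_measurable (torus L)" using g u by (auto simp: Lp2_iff)
  have [measurable]: "(\<lambda>x. u x $ i) \<in> borel_measurable (torus L)"
    using borel_measurable_inner[OF u(2) borel_measurable_const, of "axis i 1"] by (simp add: inner_axis)
  have "integrable (torus L) (\<lambda>x. (norm ((u x $ i) *\<^sub>R g x))\<^sup>2)"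
  proof (rule Bochner_Integration.integrable_bound)
    show "integrable (torus L) (\<lambda>x. B\<^sup>2 * (norm (g x))\<^sup>2)" using g by (simp add: Lp2_iff)
    show "AE x in torus L. norm ((norm ((u x $ i) *\<^sub>R g x))\<^sup>2) \<le> norm (B\<^sup>2 * (norm (g x))\<^sup>2)"
      using u(3)
    proof eventually_elim
      case (elim x)
      have "\<bar>u x $ i\<bar> \<le> B" using component_le_norm_cart[of "u x" i] elim by linarith
      then have "(u x $ i)\<^sup>2 \<le> B\<^sup>2" by (metis abs_ge_zero power2_abs power_mono)
      then show ?case by (simp add: power_mult_distrib mult_right_mono)
    qed
  qed measurable
  then show ?thesis using u(1) g by (simp add: Lp2_iff periodic_on_def)
qed

lemma adv2_Lp2:
  assumes "periodic_on L UNIV u" "u \<in> borel_measurable (torus L)" "AE x in torus L. norm (u x) \<le> B" "v \<in> H1 L"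
  shows "adv2 L u v \<in> Lp L 2"
  unfolding adv2_def by (intro Lp2_sum Lp2_mult_bounded[OF assms(1-3)] H1_wpartial assms)

lemma absorption_Lp2:
  assumes u: "u \<in> Lp L 2" "AE x in torus L. norm (u x) \<le> B" and p: "p \<ge> 1"
  shows "absorption p u \<in> Lp L 2"
proof (rule Lp2_bounded)
  have [measurable]: "u \<in> borel_measurable (torus L)" using u by (auto simp: Lp2_iff)
  show "absorption p u \<in> borel_measurable (torus L)" unfolding absorption_def by measurable
  show "periodic_on L UNIV (absorption p u)" using u by (simp add: Lp2_iff periodic_on_def absorption_def)
  show "AE x in torus L. norm (absorption p u x) \<le> B powr (p - 1) * B"
    using u(2)
  proof eventually_elim
    case (elim x)
    then show ?case using p by (auto simp: absorption_def intro!: mult_mono powr_mono2)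
  qed
qed

lemma norm_Lp2_le_bound:
  assumes f: "f \<in> Lp L 2" and g: "g \<in> Lp L 2" and C: "C \<ge> 0" and le: "AE x in torus L. norm (f x) \<le> C * norm (g x)"
  shows "norm_Lp L 2 f \<le> C * norm_Lp L 2 g"
proof (rule power2_le_imp_le)
  have "ip L f f \<le> (LINT x|torus L. C\<^sup>2 * (norm (g x))\<^sup>2)"
    unfolding ip_def dot_square_norm
  proof (rule integral_mono_AE)
    show "AE x in torus L. (norm (f x))\<^sup>2 \<le> C\<^sup>2 * (norm (g x))\<^sup>2"
      using le by eventually_elim (simp add: power_mono flip: power_mult_distrib)
  qed (use f g in \<open>auto simp: Lp2_iff\<close>)
  then show "(norm_Lp L 2 f)\<^sup>2 \<le> (C * norm_Lp L 2 g)\<^sup>2"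
    by (simp add: ip_self[symmetric] power_mult_distrib ip_def dot_square_norm)
qed (intro mult_nonneg_nonneg C norm_Lp_nonneg)

text \<open>The counterpart of \<open>locally_lipschitz_coeffs\<close> for families of fields. Its
  closure rules assemble the nonlinearity from fixed fields, and taking inner products leads to the
  coefficients.\<close>

definition L2_locally_lipschitz :: "real \<Rightarrow> nat \<Rightarrow> ((nat \<Rightarrow> real) \<Rightarrow> 'n::finite vfield) \<Rightarrow> bool" where
  "L2_locally_lipschitz L n F \<longleftrightarrow> (\<forall>a. F a \<in> Lp L 2) \<and>
     (\<forall>M. \<exists>\<Lambda>\<ge>0. \<forall>a b. (\<forall>j\<in>{1..n}. \<bar>a j\<bar> \<le> M \<and> \<bar>b j\<bar> \<le> M) \<longrightarrow>
       norm_Lp L 2 (\<lambda>x. F a x - F b x) \<le> \<Lambda> * (\<Sum>j=1..n. \<bar>a j - b j\<bar>))"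

lemma L2_locally_lipschitzI:
  assumes "\<And>a. F a \<in> Lp L 2"
    and "\<And>M. \<exists>\<Lambda>\<ge>0. \<forall>a b. (\<forall>j\<in>{1..n}. \<bar>a j\<bar> \<le> M \<and> \<bar>b j\<bar> \<le> M) \<longrightarrow>
       norm_Lp L 2 (\<lambda>x. F a x - F b x) \<le> \<Lambda> * (\<Sum>j=1..n. \<bar>a j - b j\<bar>)"
  shows "L2_locally_lipschitz L n F"
  using assms by (simp add: L2_locally_lipschitz_def)

lemma L2_locally_lipschitzD:
  assumes "L2_locally_lipschitz L n F"
  shows "F a \<in> Lp L 2"
    and "\<exists>\<Lambda>\<ge>0. \<forall>a b. (\<forall>j\<in>{1..n}. \<bar>a j\<bar> \<le> M \<and> \<bar>b j\<bar> \<le> M) \<longrightarrow>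
       norm_Lp L 2 (\<lambda>x. F a x - F b x) \<le> \<Lambda> * (\<Sum>j=1..n. \<bar>a j - b j\<bar>)"
  using assms by (simp_all add: L2_locally_lipschitz_def)

lemma L2_locally_lipschitz_const: "f \<in> Lp L 2 \<Longrightarrow> L2_locally_lipschitz L n (\<lambda>a. f)"
  by (intro L2_locally_lipschitzI) (auto intro!: exI[of _ 0] simp: norm_Lp2_eq ip_zero_left)

lemma L2_locally_lipschitz_add:
  assumes F: "L2_locally_lipschitz L n F" and G: "L2_locally_lipschitz L n G"
  shows "L2_locally_lipschitz L n (\<lambda>a x. F a x + G a x)"
proof (rule L2_locally_lipschitzI)
  note m = L2_locally_lipschitzD(1)[OF F] L2_locally_lipschitzD(1)[OF G]
  show "(\<lambda>x. F a x + G a x) \<in> Lp L 2" for a by (intro Lp2_add m)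
  fix M
  obtain \<Lambda>1 \<Lambda>2 where *: "\<Lambda>1 \<ge> 0" "\<Lambda>2 \<ge> 0"
    "\<And>a b. (\<forall>j\<in>{1..n}. \<bar>a j\<bar> \<le> M \<and> \<bar>b j\<bar> \<le> M) \<Longrightarrow> norm_Lp L 2 (\<lambda>x. F a x - F b x) \<le> \<Lambda>1 * (\<Sum>j=1..n. \<bar>a j - b j\<bar>)"
    "\<And>a b. (\<forall>j\<in>{1..n}. \<bar>a j\<bar> \<le> M \<and> \<bar>b j\<bar> \<le> M) \<Longrightarrow> norm_Lp L 2 (\<lambda>x. G a x - G b x) \<le> \<Lambda>2 * (\<Sum>j=1..n. \<bar>a j - b j\<bar>)"
    using L2_locally_lipschitzD(2)[OF F, of M] L2_locally_lipschitzD(2)[OF G, of M] by blast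
  show "\<exists>\<Lambda>\<ge>0. \<forall>a b. (\<forall>j\<in>{1..n}. \<bar>a j\<bar> \<le> M \<and> \<bar>b j\<bar> \<le> M) \<longrightarrow>
       norm_Lp L 2 (\<lambda>x. (F a x + G a x) - (F b x + G b x)) \<le> \<Lambda> * (\<Sum>j=1..n. \<bar>a j - b j\<bar>)"
  proof (intro exI[of _ "\<Lambda>1 + \<Lambda>2"] conjI allI impI)
    fix a b assume ab: "\<forall>j\<in>{1..n}. \<bar>a j\<bar> \<le> M \<and> \<bar>b j\<bar> \<le> M"
    have "norm_Lp L 2 (\<lambda>x. (F a x - F b x) + (G a x - G b x)) \<le> norm_Lp L 2 (\<lambda>x. F a x - F b x) + norm_Lp L 2 (\<lambda>x. G a x - G b x)"
      by (intro norm_Lp2_triangle Lp2_diff m)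
    then show "norm_Lp L 2 (\<lambda>x. (F a x + G a x) - (F b x + G b x)) \<le> (\<Lambda>1 + \<Lambda>2) * (\<Sum>j=1..n. \<bar>a j - b j\<bar>)"
      using *(3,4)[OF ab] by (simp add: add_diff_add distrib_right)
  qed (use * in auto)
qed

lemma L2_locally_lipschitz_scaleR:
  assumes F: "L2_locally_lipschitz L n F"
  shows "L2_locally_lipschitz L n (\<lambda>a x. c *\<^sub>R F a x)"
proof (rule L2_locally_lipschitzI)
  show "(\<lambda>x. c *\<^sub>R F a x) \<in> Lp L 2" for a by (intro Lp2_scaleR L2_locally_lipschitzD(1)[OF F])
  fix M
  obtain \<Lambda> where *: "\<Lambda> \<ge> 0"
    "\<And>a b. (\<forall>j\<in>{1..n}. \<bar>a j\<bar> \<le> M \<and> \<bar>b j\<bar> \<le> M) \<Longrightarrow> norm_Lp L 2 (\<lambda>x. F a x - F b x) \<le> \<Lambda> * (\<Sum>j=1..n. \<bar>a j - b j\<bar>)"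
    using L2_locally_lipschitzD(2)[OF F, of M] by blast
  show "\<exists>\<Lambda>\<ge>0. \<forall>a b. (\<forall>j\<in>{1..n}. \<bar>a j\<bar> \<le> M \<and> \<bar>b j\<bar> \<le> M) \<longrightarrow>
       norm_Lp L 2 (\<lambda>x. c *\<^sub>R F a x - c *\<^sub>R F b x) \<le> \<Lambda> * (\<Sum>j=1..n. \<bar>a j - b j\<bar>)"
    unfolding scaleR_diff_right[symmetric] norm_Lp2_scaleR
    using * by (intro exI[of _ "\<bar>c\<bar> * \<Lambda>"]) (auto simp: mult.assoc intro!: mult_left_mono)
qed

lemma L2_locally_lipschitz_sum:
  "(\<And>i. i \<in> I \<Longrightarrow> L2_locally_lipschitz L n (F i)) \<Longrightarrow> L2_locally_lipschitz L n (\<lambda>a x. \<Sum>i\<in>I. F i a x)"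
  by (induction I rule: infinite_finite_induct) (auto intro: L2_locally_lipschitz_add L2_locally_lipschitz_const Lp2_zero)

text \<open>A product of two locally Lipschitz maps: on each ball the factor \<open>F b\<close> is
  bounded because it can be compared with \<open>F\<close> at 0.\<close>

lemma L2_locally_lipschitz_coord:
  assumes F: "L2_locally_lipschitz L n F" and j: "j \<in> {1..n}"
  shows "L2_locally_lipschitz L n (\<lambda>a x. a j *\<^sub>R F a x)"
proof (rule L2_locally_lipschitzI)
  note m = L2_locally_lipschitzD(1)[OF F]
  show "(\<lambda>x. a j *\<^sub>R F a x) \<in> Lp L 2" for a by (intro Lp2_scaleR m)
  fix M
  obtain \<Lambda> where *: "\<Lambda> \<ge> 0"
    "\<And>a b. (\<forall>j\<in>{1..n}. \<bar>a j\<bar> \<le> M \<and> \<bar>b j\<bar> \<le> M) \<Longrightarrow> norm_Lp L 2 (\<lambda>x. F a x - F b x) \<le> \<Lambda> * (\<Sum>j=1..n. \<bar>a j - b j\<bar>)"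
    using L2_locally_lipschitzD(2)[OF F, of M] by blast
  define D where "D = norm_Lp L 2 (F (\<lambda>_. 0)) + \<Lambda> * (n * M)"
  have bd: "norm_Lp L 2 (F b) \<le> D" if b: "\<forall>j\<in>{1..n}. \<bar>b j\<bar> \<le> M" for b
  proof -
    have M: "M \<ge> 0" using b j by force
    have "norm_Lp L 2 (\<lambda>x. F b x - F (\<lambda>_. 0) x) \<le> \<Lambda> * (\<Sum>j=1..n. \<bar>b j - 0\<bar>)"
      using b M by (intro *(2)) auto
    also have "\<dots> \<le> \<Lambda> * (\<Sum>j=1..n. M)" using b * by (intro mult_left_mono sum_mono) auto
    finally show ?thesis
      using norm_Lp2_triangle[OF Lp2_diff[OF m[of b] m[of "\<lambda>_. 0"]] m[of "\<lambda>_. 0"]] by (simp add: D_def)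
  qed
  show "\<exists>\<Lambda>\<ge>0. \<forall>a b. (\<forall>j\<in>{1..n}. \<bar>a j\<bar> \<le> M \<and> \<bar>b j\<bar> \<le> M) \<longrightarrow>
       norm_Lp L 2 (\<lambda>x. a j *\<^sub>R F a x - b j *\<^sub>R F b x) \<le> \<Lambda> * (\<Sum>j=1..n. \<bar>a j - b j\<bar>)"
  proof (intro exI[of _ "\<bar>M\<bar> * \<Lambda> + \<bar>D\<bar>"] conjI allI impI)
    fix a b assume ab: "\<forall>j\<in>{1..n}. \<bar>a j\<bar> \<le> M \<and> \<bar>b j\<bar> \<le> M"
    have eq: "(\<lambda>x. a j *\<^sub>R F a x - b j *\<^sub>R F b x) = (\<lambda>x. a j *\<^sub>R (F a x - F b x) + (a j - b j) *\<^sub>R F b x)"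
      by (simp add: algebra_simps)
    have "norm_Lp L 2 (\<lambda>x. a j *\<^sub>R F a x - b j *\<^sub>R F b x) \<le> \<bar>a j\<bar> * norm_Lp L 2 (\<lambda>x. F a x - F b x) + \<bar>a j - b j\<bar> * norm_Lp L 2 (F b)"
      unfolding eq by (rule order_trans[OF norm_Lp2_triangle]) (auto intro!: Lp2_scaleR Lp2_diff m simp: norm_Lp2_scaleR)
    also have "\<dots> \<le> \<bar>M\<bar> * (\<Lambda> * (\<Sum>j=1..n. \<bar>a j - b j\<bar>)) + (\<Sum>j=1..n. \<bar>a j - b j\<bar>) * \<bar>D\<bar>"
    proof (intro add_mono mult_mono)
      show "\<bar>a j\<bar> \<le> \<bar>M\<bar>" using ab j by force
      show "norm_Lp L 2 (\<lambda>x. F a x - F b x) \<le> \<Lambda> * (\<Sum>j=1..n. \<bar>a j - b j\<bar>)" using * ab by blast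
      show "norm_Lp L 2 (F b) \<le> \<bar>D\<bar>" using bd[of b] ab by force
      show "\<bar>a j - b j\<bar> \<le> (\<Sum>j=1..n. \<bar>a j - b j\<bar>)"
        using j member_le_sum[of j "{1..n}" "\<lambda>j. \<bar>a j - b j\<bar>"] by simp
    qed (auto intro!: norm_Lp_nonneg sum_nonneg mult_nonneg_nonneg *)
    finally show "norm_Lp L 2 (\<lambda>x. a j *\<^sub>R F a x - b j *\<^sub>R F b x) \<le> (\<bar>M\<bar> * \<Lambda> + \<bar>D\<bar>) * (\<Sum>j=1..n. \<bar>a j - b j\<bar>)"
      by (simp add: algebra_simps)
  qed (use * in auto)
qed

lemma norm_Lp2_cong_AE:
  assumes "f \<in> borel_measurable (torus L)" "g \<in> borel_measurable (torus L)" "AE x in torus L. f x = g x"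
  shows "norm_Lp L 2 f = norm_Lp L 2 g"
  unfolding norm_Lp2_eq by (subst ip_cong_AE[OF assms(1,2,1,2,3,3)]) simp

lemma L2_locally_lipschitz_cong_AE:
  assumes F: "L2_locally_lipschitz L n F" and F': "\<And>a. F' a \<in> Lp L 2" and AE: "\<And>a. AE x in torus L. F a x = F' a x"
  shows "L2_locally_lipschitz L n F'"
proof (rule L2_locally_lipschitzI[OF F'])
  fix M
  have "norm_Lp L 2 (\<lambda>x. F a x - F b x) = norm_Lp L 2 (\<lambda>x. F' a x - F' b x)" for a b
  proof (rule norm_Lp2_cong_AE)
    show "(\<lambda>x. F a x - F b x) \<in> borel_measurable (torus L)" "(\<lambda>x. F' a x - F' b x) \<in> borel_measurable (torus L)"
      using Lp2_diff[OF L2_locally_lipschitzD(1)[OF F] L2_locally_lipschitzD(1)[OF F]] Lp2_diff[OF F' F'] by (auto simp: Lp2_iff)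
    show "AE x in torus L. F a x - F b x = F' a x - F' b x" using AE[of a] AE[of b] by eventually_elim simp
  qed
  then show "\<exists>\<Lambda>\<ge>0. \<forall>a b. (\<forall>j\<in>{1..n}. \<bar>a j\<bar> \<le> M \<and> \<bar>b j\<bar> \<le> M) \<longrightarrow>
       norm_Lp L 2 (\<lambda>x. F' a x - F' b x) \<le> \<Lambda> * (\<Sum>j=1..n. \<bar>a j - b j\<bar>)"
    using L2_locally_lipschitzD(2)[OF F, of M] by simp
qed

section \<open>The Galerkin space\<close>

lemma solenoidal_smooth_H1: "L > 0 \<Longrightarrow> f \<in> solenoidal_smooth L \<Longrightarrow> f \<in> H1 L"
  by (intro H1_smooth solenoidal_smoothD(1,2))

lemma norm_H1_zero:
  assumes L: "L > 0"
  shows "norm_H1 L (\<lambda>x. 0 :: real^'n) = 0"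
proof -
  have z: "(\<lambda>x. 0) \<in> H1 L" by (rule H1I[OF Lp2_zero Lp2_zero has_weak_partial_zero])
  have "norm_Lp L 2 (wpartial L i (\<lambda>x. 0 :: real^'n)) = 0" for i
    using wpartial_AE_eq[OF L z Lp2_zero has_weak_partial_zero, of i] H1_wpartial(1)[OF z, of i]
    by (simp add: norm_Lp2_zero_iff)
  moreover have "norm_Lp L 2 (\<lambda>x. 0 :: real^'n) = 0" by (simp add: norm_Lp2_eq ip_zero_left)
  ultimately show ?thesis by (simp add: norm_H1_def)
qed

lemma solenoidal_smooth_Vsp: "L > 0 \<Longrightarrow> f \<in> solenoidal_smooth L \<Longrightarrow> f \<in> Vsp L"
  unfolding Vsp_def closure_wrt_def
  by (auto intro!: solenoidal_smooth_H1 exI[of _ "\<lambda>_. f"] simp: norm_H1_zero)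

lemma solenoidal_smooth_Lpsp:
  assumes f: "f \<in> solenoidal_smooth L" and p: "p > 0"
  shows "f \<in> Lpsp L p"
proof -
  have cf: "continuous_on UNIV (\<lambda>x. norm (f x) powr p)"
    by (intro continuous_on_powr' continuous_intros smooth_continuous solenoidal_smoothD(1)[OF f]) (use p in auto)
  have "f \<in> Lp L p"
    unfolding Lp_on_def using solenoidal_smoothD[OF f] integrable_torus_continuous[OF cf]
    by (auto simp: Lp2_iff)
  moreover have "norm_Lp L p (\<lambda>x. f x - f x) = 0"
    using p by (simp add: norm_Lp_on_def)
  ultimately show ?thesis
    using f by (auto simp: Lpsp_def closure_wrt_def intro!: exI[of _ "\<lambda>_. f"])
qed

declare One_nat_def [simp del]

text \<open>The situation after the eigenfunctions have been replaced by trigonometric fields. The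
  stationary field enters through first weak derivatives and an essential bound, which is what puts
  the advection and absorption of \<open>Z a + ye\<close> into \<open>L2\<close>.\<close>

locale galerkin =
  fixes L :: real and n :: nat and W :: "nat \<Rightarrow> 'n::finite vfield" and \<kappa> :: "nat \<Rightarrow> real"
    and ye :: "'n vfield" and Be :: real
  assumes L: "L > 0"
    and W_trig: "\<And>k. k \<in> {1..n} \<Longrightarrow> rtp L (W k)"
    and W_sol: "\<And>k. k \<in> {1..n} \<Longrightarrow> W k \<in> solenoidal_smooth L"
    and W_orth: "\<And>j k. j \<in> {1..n} \<Longrightarrow> k \<in> {1..n} \<Longrightarrow> ip L (W j) (W k) = (if j = k then 1 else 0)"
    and W_grad: "\<And>k v. k \<in> {1..n} \<Longrightarrow> v \<in> solenoidal_smooth L \<Longrightarrow> grad_ip L (W k) v = \<kappa> k * ip L (W k) v"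
    and ye_H1: "ye \<in> H1 L" and ye_bounded: "AE x in torus L. norm (ye x) \<le> Be"
begin

abbreviation "K \<equiv> span_H L W n"

definition Z :: "(nat \<Rightarrow> real) \<Rightarrow> 'n vfield" where
  "Z a x = (\<Sum>j=1..n. a j *\<^sub>R W j x)"

definition coef :: "'n vfield \<Rightarrow> nat \<Rightarrow> real" where
  "coef u k = ip L u (W k)"

lemma W_Lp2: "k \<in> {1..n} \<Longrightarrow> W k \<in> Lp L 2"
  using W_sol by (rule solenoidal_smoothD(3))

lemma W_H1: "k \<in> {1..n} \<Longrightarrow> W k \<in> H1 L"
  using W_sol solenoidal_smooth_H1[OF L] by blast

lemma W_Hsp: "k \<in> {1..n} \<Longrightarrow> W k \<in> Hsp L"
  using W_sol by (rule solenoidal_smooth_Hsp)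

lemma norm_W: "k \<in> {1..n} \<Longrightarrow> norm_Lp L 2 (W k) = 1"
  by (simp add: norm_Lp2_eq W_orth)

lemma Z_solenoidal: "Z a \<in> solenoidal_smooth L"
proof -
  have "Z a = (\<lambda>x. \<Sum>j=1..n. a j *\<^sub>R W j x)" by (simp add: Z_def fun_eq_iff)
  then show ?thesis using W_sol by (auto intro!: solenoidal_smooth_sum solenoidal_smooth_scaleR)
qed

lemma Z_Lp2: "Z a \<in> Lp L 2" and Z_Hsp: "Z a \<in> Hsp L" and Z_H1: "Z a \<in> H1 L"
  using Z_solenoidal by (auto intro: solenoidal_smoothD(3) solenoidal_smooth_Hsp solenoidal_smooth_H1 L)

lemma Z_in_K: "Z a \<in> K"
  by (auto simp: span_H_def Z_Hsp Z_def intro!: exI[of _ a])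

lemma Z_zero: "Z (\<lambda>_. 0) = (\<lambda>x. 0)"
  by (simp add: Z_def fun_eq_iff)

lemma Z_cong: "(\<And>j. j \<in> {1..n} \<Longrightarrow> a j = b j) \<Longrightarrow> Z a = Z b"
  by (auto simp: Z_def fun_eq_iff intro!: sum.cong)

lemma Z_add: "Z a x + Z b x = Z (\<lambda>j. a j + b j) x"
  and Z_diff: "Z a x - Z b x = Z (\<lambda>j. a j - b j) x"
  and Z_scaleR: "c *\<^sub>R Z a x = Z (\<lambda>j. c * a j) x"
  by (simp_all add: Z_def sum.distrib sum_subtractf scaleR_add_left scaleR_diff_left scaleR_sum_right)

lemma ip_Z_left: "v \<in> Lp L 2 \<Longrightarrow> ip L (Z a) v = (\<Sum>j=1..n. a j * ip L (W j) v)"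
proof -
  assume v: "v \<in> Lp L 2"
  have "Z a = (\<lambda>x. \<Sum>j=1..n. a j *\<^sub>R W j x)" by (simp add: Z_def fun_eq_iff)
  then show ?thesis using v
    by (simp only:) (subst ip_sum_left, auto intro!: Lp2_scaleR W_Lp2 simp: ip_scaleR_left)
qed

lemma coef_Z: "k \<in> {1..n} \<Longrightarrow> coef (Z a) k = a k"
  unfolding coef_def by (simp add: ip_Z_left W_Lp2 W_orth if_distrib cong: if_cong)

lemma norm_Z: "norm_Lp L 2 (Z a) = sqrt (\<Sum>j=1..n. (a j)\<^sup>2)"
proof -
  have "ip L (Z a) (Z a) = (\<Sum>j=1..n. a j * coef (Z a) j)"
    by (simp add: ip_Z_left Z_Lp2 coef_def ip_commute)
  then show ?thesis by (simp add: norm_Lp2_eq coef_Z power2_eq_square)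
qed

lemma K_Hsp: "u \<in> K \<Longrightarrow> u \<in> Hsp L" and K_Lp2: "u \<in> K \<Longrightarrow> u \<in> Lp L 2"
  by (auto simp: span_H_def Hsp_Lp2)

text \<open>Membership in \<open>K\<close> provides some coefficients, valid almost everywhere;
  orthonormality identifies them as \<open>coef u\<close>.\<close>

lemma K_AE: "u \<in> K \<Longrightarrow> AE x in torus L. u x = Z (coef u) x"
proof -
  assume u: "u \<in> K"
  then obtain c where c: "AE x in torus L. u x = Z c x" by (auto simp: span_H_def Z_def)
  have "coef u k = c k" if k: "k \<in> {1..n}" for k
  proof -
    have "coef u k = coef (Z c) k"
      unfolding coef_def by (rule ip_cong_AE) (use c K_Lp2[OF u] W_Lp2[OF k] Z_Lp2 in \<open>auto simp: Lp2_iff\<close>)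
    then show ?thesis by (simp add: coef_Z[OF k])
  qed
  then have "Z c = Z (coef u)" by (intro Z_cong) simp
  then show ?thesis using c by simp
qed

lemma K_I: "u \<in> Hsp L \<Longrightarrow> AE x in torus L. u x = Z c x \<Longrightarrow> u \<in> K"
  by (auto simp: span_H_def Z_def)

lemma wpartial_Z: "AE x in torus L. wpartial L i (Z a) x = (\<Sum>j=1..n. a j *\<^sub>R wpartial L i (W j) x)"
proof (rule wpartial_AE_eq[OF L Z_H1])
  show "(\<lambda>x. \<Sum>j=1..n. a j *\<^sub>R wpartial L i (W j) x) \<in> Lp L 2"
    by (intro Lp2_sum Lp2_scaleR H1_wpartial W_H1)
  have "Z a = (\<lambda>x. \<Sum>j=1..n. a j *\<^sub>R W j x)" by (simp add: Z_def fun_eq_iff)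
  then show "has_weak_partial L i (Z a) (\<lambda>x. \<Sum>j=1..n. a j *\<^sub>R wpartial L i (W j) x)"
    by (auto intro!: has_weak_partial_sum W_Lp2 H1_wpartial W_H1)
qed

lemma grad_ip_Z:
  assumes v: "v \<in> solenoidal_smooth L"
  shows "grad_ip L (Z a) v = (\<Sum>j=1..n. a j * \<kappa> j * ip L (W j) v)"
proof -
  have vH: "v \<in> H1 L" by (rule solenoidal_smooth_H1[OF L v])
  have "ip L (wpartial L i (Z a)) (wpartial L i v) = (\<Sum>j=1..n. a j * ip L (wpartial L i (W j)) (wpartial L i v))" for i
  proof -
    have m: "(\<lambda>x. \<Sum>j=1..n. a j *\<^sub>R wpartial L i (W j) x) \<in> Lp L 2"
      by (intro Lp2_sum Lp2_scaleR H1_wpartial W_H1)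
    have "ip L (wpartial L i (Z a)) (wpartial L i v) = ip L (\<lambda>x. \<Sum>j=1..n. a j *\<^sub>R wpartial L i (W j) x) (wpartial L i v)"
      by (rule ip_cong_AE) (use wpartial_Z m H1_wpartial(1)[OF Z_H1] H1_wpartial(1)[OF vH] in \<open>auto simp: Lp2_iff\<close>)
    also have "\<dots> = (\<Sum>j=1..n. ip L (\<lambda>x. a j *\<^sub>R wpartial L i (W j) x) (wpartial L i v))"
      by (rule ip_sum_left) (auto intro!: Lp2_scaleR H1_wpartial W_H1 vH)
    finally show ?thesis by (simp add: ip_scaleR_left)
  qed
  then have "grad_ip L (Z a) v = (\<Sum>i\<in>UNIV. \<Sum>j=1..n. a j * ip L (wpartial L i (W j)) (wpartial L i v))"
    by (simp add: grad_ip_def)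
  also have "\<dots> = (\<Sum>j=1..n. a j * grad_ip L (W j) v)"
    by (subst sum.swap) (simp add: grad_ip_def sum_distrib_left)
  finally show ?thesis using v by (simp add: W_grad mult.assoc)
qed

lemma W_bounded: "\<exists>B. \<forall>k\<in>{1..n}. \<forall>x\<in>cell L. norm (W k x) \<le> B"
proof -
  have "\<exists>B. \<forall>x\<in>cell L. norm (W k x) \<le> B" if "k \<in> {1..n}" for k
    using continuous_bounded_on_cell[OF smooth_continuous[OF solenoidal_smoothD(1)[OF W_sol[OF that]]]] by metis
  then obtain B where B: "\<And>k x. k \<in> {1..n} \<Longrightarrow> x \<in> cell L \<Longrightarrow> norm (W k x) \<le> B k" by metis
  have "norm (W k x) \<le> (\<Sum>k=1..n. \<bar>B k\<bar>)" if k: "k \<in> {1..n}" and x: "x \<in> cell L" for k x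
  proof -
    have "\<bar>B k\<bar> \<le> (\<Sum>k=1..n. \<bar>B k\<bar>)" using k by (intro member_le_sum) auto
    then show ?thesis using B[OF k x] by linarith
  qed
  then show ?thesis by blast
qed

lemma ye_Lp2: "ye \<in> Lp L 2"
  by (rule H1_Lp2[OF ye_H1])

lemma Z_bounded:
  obtains B :: real where "B \<ge> 0" "\<And>a x (M::real). x \<in> cell L \<Longrightarrow> (\<And>j. j \<in> {1..n} \<Longrightarrow> \<bar>a j\<bar> \<le> M) \<Longrightarrow> norm (Z a x) \<le> real n * M * B"
proof -
  obtain B where B: "\<And>k x. k \<in> {1..n} \<Longrightarrow> x \<in> cell L \<Longrightarrow> norm (W k x) \<le> B" using W_bounded by blast
  have "norm (Z a x) \<le> real n * M * \<bar>B\<bar>" if x: "x \<in> cell L" and a: "\<And>j. j \<in> {1..n} \<Longrightarrow> \<bar>a j\<bar> \<le> M" for a x M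
  proof -
    have "norm (Z a x) \<le> (\<Sum>j=1..n. \<bar>a j\<bar> * norm (W j x))"
      unfolding Z_def by (rule order_trans[OF norm_sum]) simp
    also have "\<dots> \<le> (\<Sum>j=1..n. M * \<bar>B\<bar>)"
    proof (rule sum_mono)
      fix j assume j: "j \<in> {1..n}"
      have "norm (W j x) \<le> \<bar>B\<bar>" "0 \<le> M" using B[OF j x] a[OF j] by linarith+
      then show "\<bar>a j\<bar> * norm (W j x) \<le> M * \<bar>B\<bar>" using a[OF j] by (intro mult_mono) auto
    qed
    finally show ?thesis by (simp add: mult.assoc)
  qed
  then show ?thesis using that[of "\<bar>B\<bar>"] by auto
qed

lemma Zye_bounded: "\<exists>B. AE x in torus L. norm (Z a x + ye x) \<le> B"
proof -
  obtain B :: real where B: "\<And>a x (M::real). x \<in> cell L \<Longrightarrow> (\<And>j. j \<in> {1..n} \<Longrightarrow> \<bar>a j\<bar> \<le> M) \<Longrightarrow> norm (Z a x) \<le> real n * M * B"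
    using Z_bounded by metis
  define M where "M = (\<Sum>j=1..n. \<bar>a j\<bar>)"
  have M: "\<bar>a j\<bar> \<le> M" if "j \<in> {1..n}" for j
    unfolding M_def using that member_le_sum[of j "{1..n}" "\<lambda>j. \<bar>a j\<bar>"] by simp
  have "AE x :: real^'n in torus L. x \<in> cell L" using AE_space[of "torus L :: (real^'n) measure"] by simp
  then have "AE x in torus L. norm (Z a x + ye x) \<le> real n * M * B + Be"
    using ye_bounded by eventually_elim (intro norm_triangle_mono B M)
  then show ?thesis by blast
qed

lemma Zye_Lp2: "(\<lambda>x. Z a x + ye x) \<in> Lp L 2"
  by (intro Lp2_add Z_Lp2 ye_Lp2)

lemma Zye_H1: "(\<lambda>x. Z a x + ye x) \<in> H1 L"
  by (rule H1I[of _ _ "\<lambda>i x. wpartial L i (Z a) x + wpartial L i ye x"])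
    (intro Lp2_add has_weak_partial_add Z_Lp2 ye_Lp2 H1_wpartial Z_H1 ye_H1)+

lemma adv2_bounded_Lp2: "u \<in> Lp L 2 \<Longrightarrow> \<exists>B. AE x in torus L. norm (u x) \<le> B \<Longrightarrow> v \<in> H1 L \<Longrightarrow> adv2 L u v \<in> Lp L 2"
  by (elim exE) (rule adv2_Lp2, auto simp: Lp2_iff)

lemma advection_Zye_Lp2: "advection L (\<lambda>x. Z a x + ye x) \<in> Lp L 2"
  unfolding advection_adv2 by (intro adv2_bounded_Lp2 Zye_Lp2 Zye_bounded Zye_H1)

lemma absorption_Zye_Lp2: "p \<ge> 1 \<Longrightarrow> absorption p (\<lambda>x. Z a x + ye x) \<in> Lp L 2"
  using Zye_bounded[of a] absorption_Lp2[OF Zye_Lp2] by blast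

text \<open>Expanded with \<open>adv2\<close>, the advection is a polynomial of degree 2 in the
  coefficients, with fixed \<open>L2\<close> fields as factors. The expansion holds only almost
  everywhere, since \<open>wpartial\<close> is additive only up to null sets.\<close>

lemma L2_locally_lipschitz_advection:
  "L2_locally_lipschitz L n (\<lambda>a. advection L (\<lambda>x. Z a x + ye x))"
proof (rule L2_locally_lipschitz_cong_AE[OF _ advection_Zye_Lp2])
  let ?F = "\<lambda>a x. (\<Sum>j=1..n. a j *\<^sub>R (\<Sum>l=1..n. a l *\<^sub>R adv2 L (W j) (W l) x)) +
     (\<Sum>j=1..n. a j *\<^sub>R (adv2 L (W j) ye x + adv2 L ye (W j) x)) + adv2 L ye ye x"
  have Wb: "\<exists>B. AE x in torus L. norm (W j x) \<le> B" if "j \<in> {1..n}" for j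
  proof -
    obtain B where "\<forall>k\<in>{1..n}. \<forall>x\<in>cell L. norm (W k x) \<le> B" using W_bounded by blast
    then show ?thesis using that by (intro exI[of _ B] AE_I2) simp
  qed
  have yb: "\<exists>B. AE x in torus L. norm (ye x) \<le> B" using ye_bounded by blast
  show "L2_locally_lipschitz L n ?F"
    by (intro L2_locally_lipschitz_add L2_locally_lipschitz_sum L2_locally_lipschitz_coord L2_locally_lipschitz_const
      adv2_bounded_Lp2 W_Lp2 ye_Lp2 Wb yb W_H1 ye_H1)
  fix a
  have wp: "AE x in torus L. wpartial L i (\<lambda>x. Z a x + ye x) x = (\<Sum>l=1..n. a l *\<^sub>R wpartial L i (W l) x) + wpartial L i ye x" for i
  proof -
    have "AE x in torus L. wpartial L i (\<lambda>x. Z a x + ye x) x = wpartial L i (Z a) x + wpartial L i ye x"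
      by (rule wpartial_AE_eq[OF L Zye_H1]) (intro Lp2_add has_weak_partial_add Z_Lp2 ye_Lp2 H1_wpartial Z_H1 ye_H1)+
    with wpartial_Z[of i a] show ?thesis by eventually_elim simp
  qed
  then have "AE x in torus L. \<forall>i. wpartial L i (\<lambda>x. Z a x + ye x) x = (\<Sum>l=1..n. a l *\<^sub>R wpartial L i (W l) x) + wpartial L i ye x"
    by (simp add: AE_all_countable)
  then show "AE x in torus L. ?F a x = advection L (\<lambda>x. Z a x + ye x) x"
  proof eventually_elim
    case (elim x)
    let ?Q = "\<lambda>i. \<Sum>l=1..n. a l *\<^sub>R wpartial L i (W l) x" and ?q = "\<lambda>i. wpartial L i ye x"
    have h1: "(\<Sum>i\<in>UNIV. (\<Sum>j=1..n. a j * W j x $ i) *\<^sub>R q i) = (\<Sum>j=1..n. a j *\<^sub>R (\<Sum>i\<in>UNIV. (W j x $ i) *\<^sub>R q i))" for q :: "'n \<Rightarrow> real^'n"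
      by (simp add: scaleR_sum_left scaleR_sum_right) (rule sum.swap)
    have h2: "(\<Sum>i\<in>UNIV. y i *\<^sub>R ?Q i) = (\<Sum>l=1..n. a l *\<^sub>R (\<Sum>i\<in>UNIV. y i *\<^sub>R wpartial L i (W l) x))" for y :: "'n \<Rightarrow> real"
      by (simp add: scaleR_sum_left scaleR_sum_right mult.commute) (rule sum.swap)
    have Zi: "Z a x $ i = (\<Sum>j=1..n. a j * W j x $ i)" for i by (simp add: Z_def sum_component)
    have "advection L (\<lambda>x. Z a x + ye x) x = (\<Sum>i\<in>UNIV. (Z a x $ i + ye x $ i) *\<^sub>R (?Q i + ?q i))"
      using elim by (simp add: advection_def)
    also have "\<dots> = (\<Sum>i\<in>UNIV. (Z a x $ i) *\<^sub>R ?Q i) + ((\<Sum>i\<in>UNIV. (Z a x $ i) *\<^sub>R ?q i) + (\<Sum>i\<in>UNIV. (ye x $ i) *\<^sub>R ?Q i)) + (\<Sum>i\<in>UNIV. (ye x $ i) *\<^sub>R ?q i)"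
      by (simp add: scaleR_add_left scaleR_add_right sum.distrib)
    also have "\<dots> = ?F a x"
      unfolding Zi h1 h2 adv2_def by (simp add: scaleR_add_right sum.distrib)
    finally show ?case by simp
  qed
qed

lemma L2_locally_lipschitz_Z: "L2_locally_lipschitz L n Z"
proof -
  have "L2_locally_lipschitz L n (\<lambda>a x. \<Sum>j=1..n. a j *\<^sub>R W j x)"
    by (intro L2_locally_lipschitz_sum L2_locally_lipschitz_coord L2_locally_lipschitz_const W_Lp2)
  moreover have "(\<lambda>a x. \<Sum>j=1..n. a j *\<^sub>R W j x) = Z" by (simp add: Z_def fun_eq_iff)
  ultimately show ?thesis by simp
qed

text \<open>A pointwise estimate suffices: for coefficients in a ball, both fields are bounded by
  one constant, thanks to the essential bound for \<open>ye\<close>.\<close>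

lemma L2_locally_lipschitz_absorption:
  assumes p: "p \<ge> 1"
  shows "L2_locally_lipschitz L n (\<lambda>a. absorption p (\<lambda>x. Z a x + ye x))"
proof (rule L2_locally_lipschitzI[OF absorption_Zye_Lp2[OF p]])
  fix M
  obtain B :: real where B: "\<And>a x (M::real). x \<in> cell L \<Longrightarrow> (\<And>j. j \<in> {1..n} \<Longrightarrow> \<bar>a j\<bar> \<le> M) \<Longrightarrow> norm (Z a x) \<le> real n * M * B"
    using Z_bounded by metis
  obtain \<Lambda> where \<Lambda>: "\<Lambda> \<ge> 0"
    "\<And>a b. (\<forall>j\<in>{1..n}. \<bar>a j\<bar> \<le> M \<and> \<bar>b j\<bar> \<le> M) \<Longrightarrow> norm_Lp L 2 (\<lambda>x. Z a x - Z b x) \<le> \<Lambda> * (\<Sum>j=1..n. \<bar>a j - b j\<bar>)"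
    using L2_locally_lipschitzD(2)[OF L2_locally_lipschitz_Z, of M] by blast
  \<comment> \<open>The constant of \<open>norm_scaleR_powr_diff\<close> with exponent
    \<open>p - 1\<close>, for a radius that bounds both fields.\<close>
  define C where "C = (p - 1 + 2) * (n * M * B + Be) powr (p - 1)"
  have C: "C \<ge> 0" using p by (simp add: C_def)
  show "\<exists>\<Lambda>\<ge>0. \<forall>a b. (\<forall>j\<in>{1..n}. \<bar>a j\<bar> \<le> M \<and> \<bar>b j\<bar> \<le> M) \<longrightarrow>
       norm_Lp L 2 (\<lambda>x. absorption p (\<lambda>x. Z a x + ye x) x - absorption p (\<lambda>x. Z b x + ye x) x) \<le> \<Lambda> * (\<Sum>j=1..n. \<bar>a j - b j\<bar>)"
  proof (intro exI[of _ "C * \<Lambda>"] conjI allI impI)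
    fix a b assume ab: "\<forall>j\<in>{1..n}. \<bar>a j\<bar> \<le> M \<and> \<bar>b j\<bar> \<le> M"
    have "norm_Lp L 2 (\<lambda>x. absorption p (\<lambda>x. Z a x + ye x) x - absorption p (\<lambda>x. Z b x + ye x) x) \<le> C * norm_Lp L 2 (\<lambda>x. Z a x - Z b x)"
    proof (rule norm_Lp2_le_bound)
      have "AE x :: real^'n in torus L. x \<in> cell L" using AE_space[of "torus L :: (real^'n) measure"] by simp
      then show "AE x in torus L. norm (absorption p (\<lambda>x. Z a x + ye x) x - absorption p (\<lambda>x. Z b x + ye x) x) \<le> C * norm (Z a x - Z b x)"
        using ye_bounded
      proof eventually_elim
        case (elim x)
        have "norm (Z a x + ye x) \<le> real n * M * B + Be" "norm (Z b x + ye x) \<le> real n * M * B + Be"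
          using elim ab by (auto intro!: norm_triangle_mono B)
        from norm_scaleR_powr_diff[OF _ this, of "p - 1"] p show ?case by (simp add: absorption_def C_def)
      qed
    qed (intro Lp2_diff absorption_Zye_Lp2 p Z_Lp2 C)+
    also have "\<dots> \<le> C * (\<Lambda> * (\<Sum>j=1..n. \<bar>a j - b j\<bar>))"
      using C \<Lambda> ab by (intro mult_left_mono) auto
    finally show "norm_Lp L 2 (\<lambda>x. absorption p (\<lambda>x. Z a x + ye x) x - absorption p (\<lambda>x. Z b x + ye x) x) \<le> C * \<Lambda> * (\<Sum>j=1..n. \<bar>a j - b j\<bar>)"
      by (simp add: mult.assoc)
  qed (use C \<Lambda> in auto)
qed

end

section \<open>The feedback\<close>

lemma periodic_set_shift1:
  assumes S: "periodic_set L S"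
  shows "x + axis i (L * of_int k) \<in> S \<longleftrightarrow> x \<in> S"
proof -
  have nat: "x + axis i (L * real m) \<in> S \<longleftrightarrow> x \<in> S" for m :: nat and x
  proof (induction m)
    case (Suc m)
    have eq: "x + axis i (L * real (Suc m)) = (x + axis i (L * real m)) + axis i L"
      by (simp add: vec_eq_iff axis_def algebra_simps)
    show ?case using S Suc unfolding eq periodic_set_def by blast
  qed (simp add: axis_def flip: zero_vec_def)
  show ?thesis
  proof (cases "k \<ge> 0")
    case True
    then show ?thesis using nat[of x "nat k"] by simp
  next
    case False
    have eq: "(x + axis i (L * of_int k)) + axis i (L * real (nat (- k))) = x"
      using False by (simp add: vec_eq_iff axis_def)
    show ?thesis using nat[of "x + axis i (L * of_int k)" "nat (- k)"] unfolding eq by simp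
  qed
qed

lemma periodic_set_shift:
  fixes k :: "'n::finite \<Rightarrow> int"
  assumes S: "periodic_set L S"
  shows "x + (\<chi> i. L * of_int (k i)) \<in> S \<longleftrightarrow> x \<in> S"
proof -
  have "x + (\<Sum>i\<in>I. axis i (L * of_int (k i))) \<in> S \<longleftrightarrow> x \<in> S" for I :: "'n set" and x
  proof (induction I arbitrary: x rule: infinite_finite_induct)
    case (insert i I)
    have eq: "x + (\<Sum>i\<in>insert i I. axis i (L * of_int (k i))) = (x + (\<Sum>i\<in>I. axis i (L * of_int (k i)))) + axis i (L * of_int (k i))"
      using insert by simp
    show ?case unfolding eq periodic_set_shift1[OF S] by (rule insert.IH)
  qed auto
  moreover have "(\<chi> i. L * of_int (k i)) = (\<Sum>i\<in>UNIV. axis i (L * of_int (k i)))"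
    by (simp add: vec_eq_iff sum_component axis_def if_distrib cong: if_cong)
  ultimately show ?thesis by simp
qed

text \<open>Translation by multiples of \<open>L\<close> brings a point of the set into the
  half-open cell, where some coordinates may be 0. Openness allows a small diagonal shift that moves
  it into the open cell.\<close>

lemma periodic_open_meets_box:
  fixes \<omega> :: "(real^'n) set"
  assumes L: "L > 0" and \<omega>: "open \<omega>" "\<omega> \<noteq> {}" "periodic_set L \<omega>"
  shows "\<omega> \<inter> box 0 (\<chi> i. L) \<noteq> {}"
proof -
  obtain x where x: "x \<in> \<omega>" using \<omega> by blast
  define y where "y = x + (\<chi> i. L * of_int (- \<lfloor>x $ i / L\<rfloor>))"
  have y\<omega>: "y \<in> \<omega>" unfolding y_def periodic_set_shift[OF \<omega>(3)] by (rule x)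
  have y: "0 \<le> y $ i" "y $ i < L" for i
  proof -
    have "y $ i = L * (x $ i / L - of_int \<lfloor>x $ i / L\<rfloor>)" using L by (simp add: y_def algebra_simps)
    moreover have "0 \<le> x $ i / L - of_int \<lfloor>x $ i / L\<rfloor>" "x $ i / L - of_int \<lfloor>x $ i / L\<rfloor> < 1" by linarith+
    ultimately show "0 \<le> y $ i" "y $ i < L" using L by (simp_all add: mult_less_cancel_left2)
  qed
  obtain e where e: "e > 0" "ball y e \<subseteq> \<omega>" using \<omega>(1) y\<omega> openE by blast
  define m where "m = Min (range (\<lambda>i. L - y $ i))"
  have m: "m > 0" "m \<le> L - y $ i" for i unfolding m_def using y by auto
  \<comment> \<open>\<open>m\<close> is the smallest distance to the upper faces, and
    \<open>CARD('n)\<close> times \<open>t\<close> bounds the length of the diagonal shift; the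
    shifted point stays below the faces and inside the ball of radius \<open>e\<close>.\<close>
  define t where "t = min (m / 2) (e / (2 * CARD('n)))"
  have t: "t > 0" "t < m" "t * CARD('n) < e"
    using m(1) e(1) by (auto simp: t_def min_def field_simps)
  define z where "z = y + (\<chi> i. t)"
  have "norm (\<chi> i::'n. t) \<le> (\<Sum>i\<in>(UNIV::'n set). \<bar>t\<bar>)"
    using norm_le_l1_cart[of "\<chi> i::'n. t"] by simp
  then have "norm (\<chi> i::'n. t) < e" using t by (simp add: mult.commute)
  then have "z \<in> ball y e" by (simp add: z_def dist_norm norm_minus_commute)
  moreover have "z \<in> box 0 (\<chi> i. L)"
    unfolding mem_box_cart
  proof
    fix i
    show "0 $ i < z $ i \<and> z $ i < (\<chi> i. L) $ i"
      using y(1)[of i] m(2)[of i] t(1,2) by (simp add: z_def)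
  qed
  ultimately show ?thesis using e(2) by blast
qed

lemma ext_zero_Lp2:
  assumes \<omega>: "open \<omega>" "periodic_set L \<omega>" and f: "f \<in> Lp L 2"
  shows "ext_zero \<omega> f \<in> Lp L 2"
  unfolding Lp2_iff
proof (intro conjI)
  have [measurable]: "f \<in> borel_measurable (torus L)" using f by (simp add: Lp2_iff)
  have "(\<lambda>x. indicator \<omega> x *\<^sub>R f x) \<in> borel_measurable (torus L)"
  proof (rule borel_measurable_scaleR)
    show "indicator \<omega> \<in> borel_measurable (torus L)"
      unfolding torus_eq using \<omega>(1) by (intro measurable_restrict_space1 borel_measurable_indicator) auto
  qed measurable
  moreover have "(\<lambda>x. indicator \<omega> x *\<^sub>R f x) = ext_zero \<omega> f" by (auto simp: ext_zero_def indicator_def)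
  ultimately show m: "ext_zero \<omega> f \<in> borel_measurable (torus L)" by simp
  show "periodic_on L UNIV (ext_zero \<omega> f)"
    using \<omega>(2) f by (simp add: periodic_on_def periodic_set_def ext_zero_def Lp2_iff)
  show "integrable (torus L) (\<lambda>x. (norm (ext_zero \<omega> f x))\<^sup>2)"
  proof (rule Bochner_Integration.integrable_bound)
    show "integrable (torus L) (\<lambda>x. (norm (f x))\<^sup>2)" using f by (simp add: Lp2_iff)
    show "(\<lambda>x. (norm (ext_zero \<omega> f x))\<^sup>2) \<in> borel_measurable (torus L)" using m by measurable
  qed (auto simp: ext_zero_def)
qed

lemma norm_Lp_on_ext_zero:
  fixes f :: "'n::finite vfield"
  assumes \<omega>: "open \<omega>" and p: "p > 0"
  shows "norm_Lp_on L \<omega> p f = norm_Lp L p (ext_zero \<omega> f)"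
proof -
  have s: "\<omega> \<in> sets lebesgue" using \<omega> by auto
  have "(LINT x|tmeas L \<omega>. norm (f x) powr p) = (LINT x|lebesgue. indicator (cell L \<inter> \<omega>) x *\<^sub>R (norm (f x) powr p))"
    unfolding tmeas_def by (rule integral_restrict_space) (use s in auto)
  also have "\<dots> = (LINT x|lebesgue. indicator (cell L) x *\<^sub>R (norm (ext_zero \<omega> f x) powr p))"
    using p by (intro Bochner_Integration.integral_cong) (auto simp: indicator_def ext_zero_def)
  also have "\<dots> = (LINT x|torus L. norm (ext_zero \<omega> f x) powr p)"
    unfolding torus_eq by (rule integral_restrict_space[symmetric]) auto
  finally show ?thesis by (simp add: norm_Lp_on_def)
qed

lemma Lp_on_restrict:
  fixes f :: "'n::finite vfield"
  assumes \<omega>: "open \<omega>" and f: "continuous_on UNIV f" "periodic_on L UNIV f"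
  shows "f \<in> Lp_on L \<omega> 2"
proof -
  have s: "cell L \<inter> \<omega> \<in> lmeasurable"
    by (rule fmeasurable_Int_fmeasurable) (use \<omega> in auto)
  have fin: "finite_measure (tmeas L \<omega> :: (real^'n) measure)"
    unfolding tmeas_def by (rule finite_measure_lebesgue_on[OF s])
  have m: "g \<in> borel_measurable (tmeas L \<omega>)" if "continuous_on UNIV g" for g :: "real^'n \<Rightarrow> 'b::euclidean_space"
    unfolding tmeas_def using s
    by (intro continuous_imp_measurable_on_sets_lebesgue continuous_on_subset[OF that]) auto
  obtain B where B: "\<And>x. x \<in> cell L \<Longrightarrow> norm (f x) \<le> B" using continuous_bounded_on_cell[OF f(1)] by metis
  have "integrable (tmeas L \<omega>) (\<lambda>x. (norm (f x))\<^sup>2)"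
  proof (rule finite_measure.integrable_const_bound[OF fin])
    show "AE x in tmeas L \<omega>. norm ((norm (f x))\<^sup>2) \<le> B\<^sup>2"
      using B by (intro AE_I2) (auto simp: tmeas_def intro!: power_mono)
    show "(\<lambda>x. (norm (f x))\<^sup>2) \<in> borel_measurable (tmeas L \<omega>)" by (intro m continuous_intros f)
  qed
  then show ?thesis using m[OF f(1)] f(2) by (auto simp: Lp_on_def periodic_on_def)
qed

context galerkin
begin

text \<open>Restriction to \<open>\<omega>\<close> is injective on the Galerkin space. This is where
  unique continuation is used, and it makes the Gram form on \<open>\<omega>\<close> positive
  definite.\<close>

lemma Z_eq_0_on_open:
  assumes \<omega>: "open \<omega>" "\<omega> \<noteq> {}" "periodic_set L \<omega>"
    and AE: "AE x in torus L. ext_zero \<omega> (Z a) x = 0" and k: "k \<in> {1..n}"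
  shows "a k = 0"
proof -
  let ?U = "\<omega> \<inter> box 0 (\<chi> i. L)"
  have cZ: "continuous_on UNIV (Z a)" by (rule smooth_continuous[OF solenoidal_smoothD(1)[OF Z_solenoidal]])
  have oU: "open ?U" using \<omega> by auto
  have o: "open (?U \<inter> Z a -` (- {0}))"
    using continuous_open_preimage[OF continuous_on_subset[OF cZ subset_UNIV] oU, of "- {0}"] by auto
  have "negligible (?U \<inter> Z a -` (- {0}))"
  proof -
    have "AE x in lebesgue. x \<notin> ?U \<inter> Z a -` (- {0})"
      by (rule AE_mp[OF AE[unfolded AE_torus_iff]], rule AE_I2)
        (use box_subset_cbox[of 0 "(\<chi> i. L) :: real^'n"] in \<open>auto simp: ext_zero_def\<close>)
    then show ?thesis
      unfolding negligible_iff_null_sets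
      by (subst AE_iff_null_sets) (intro sets_completionI_sets, simp add: o)
  qed
  then have "?U \<inter> Z a -` (- {0}) = {}" using o open_not_negligible by blast
  then have 0: "\<And>x. x \<in> ?U \<Longrightarrow> Z a x = 0" by blast
  have "Z a = (\<lambda>x. \<Sum>j=1..n. a j *\<^sub>R W j x)" by (simp add: Z_def fun_eq_iff)
  then have "rtp L (Z a)" by (auto intro!: rtp_sum rtp_scaleR W_trig)
  then have tp: "tp L (\<lambda>x. complex_of_real (Z a x $ i))" for i by (simp add: rtp_vec rtp_real)
  have "complex_of_real (Z a x $ i) = 0" for i x
    by (rule tp_unique_continuation[OF tp oU periodic_open_meets_box[OF L \<omega>]]) (simp add: 0)
  then have "Z a = (\<lambda>x. 0)" by (simp add: fun_eq_iff vec_eq_iff)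
  then have "coef (Z a) k = 0" by (simp add: coef_def ip_zero_left)
  then show ?thesis by (simp add: coef_Z[OF k])
qed

text \<open>\<open>B a l\<close> is the Gram form of the basis on \<open>\<omega>\<close>. Its
  inverse is obtained by elimination, adding one orthogonality condition at a time, in place of an
  argument with matrices.\<close>

lemma dual_basis:
  assumes \<omega>: "open \<omega>" "\<omega> \<noteq> {}" "periodic_set L \<omega>"
  obtains b where "\<And>k l. k \<in> {1..n} \<Longrightarrow> l \<in> {1..n} \<Longrightarrow> ip L (ext_zero \<omega> (Z (b k))) (W l) = (if k = l then 1 else 0)"
proof -
  define B where "B a l = ip L (ext_zero \<omega> (Z a)) (W l)" for a l
  have ez: "ext_zero \<omega> (Z a) \<in> Lp L 2" for a by (rule ext_zero_Lp2[OF \<omega>(1,3) Z_Lp2])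
  have Bdiff: "B (\<lambda>j. a j - t * c j) l = B a l - t * B c l" if l: "l \<in> {1..n}" for a c t l
  proof -
    have "ext_zero \<omega> (Z (\<lambda>j. a j - t * c j)) = (\<lambda>x. ext_zero \<omega> (Z a) x - t *\<^sub>R ext_zero \<omega> (Z c) x)"
      by (auto simp: ext_zero_def fun_eq_iff Z_scaleR Z_diff)
    then show ?thesis unfolding B_def by (simp add: ip_diff_left ez Lp2_scaleR W_Lp2[OF l] ip_scaleR_left)
  qed
  have Bself: "(\<Sum>l=1..n. a l * B a l) = ip L (ext_zero \<omega> (Z a)) (ext_zero \<omega> (Z a))" for a
  proof -
    have "ip L (ext_zero \<omega> (Z a)) (ext_zero \<omega> (Z a)) = ip L (Z a) (ext_zero \<omega> (Z a))"
      unfolding ip_def by (intro Bochner_Integration.integral_cong) (auto simp: ext_zero_def)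
    also have "\<dots> = (\<Sum>l=1..n. a l * ip L (W l) (ext_zero \<omega> (Z a)))"
      by (rule ip_Z_left[OF ez])
    finally show ?thesis by (simp add: B_def ip_commute)
  qed
  \<comment> \<open>\<open>q\<close> is the basis vector \<open>k\<close> corrected by vectors with
    indices in \<open>S\<close> so that it becomes orthogonal to all of \<open>S\<close> on
    \<open>\<omega>\<close>. Taking for \<open>S\<close> all indices other than \<open>k\<close>
    yields the dual vector up to a factor.\<close>
  have ex: "\<exists>q. q k = 1 \<and> (\<forall>j. j \<notin> insert k S \<longrightarrow> q j = 0) \<and> (\<forall>l\<in>S. B q l = 0) \<and> B q k \<noteq> 0"
    if "finite S" "S \<subseteq> {1..n}" "k \<in> {1..n}" "k \<notin> S" for S k
    using that
  proof (induction S arbitrary: k rule: finite_induct)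
    \<comment> \<open>If \<open>B q k\<close> vanished as well, all products
      \<open>q l * B q l\<close> would be 0. Their sum is the squared norm of \<open>Z q\<close> on
      \<open>\<omega>\<close>, so \<open>q\<close> would vanish on 1 to \<open>n\<close>, contrary
      to \<open>q k = 1\<close>.\<close>
    have nz: "B q k \<noteq> 0" if q: "q k = 1" "\<forall>j. j \<notin> insert k S \<longrightarrow> q j = 0" "\<forall>l\<in>S. B q l = 0" "k \<in> {1..n}" for q k S
    proof
      assume "B q k = 0"
      then have "q l * B q l = 0" for l using q by (cases "l \<in> S"; cases "l = k") auto
      then have "ip L (ext_zero \<omega> (Z q)) (ext_zero \<omega> (Z q)) = 0" unfolding Bself[symmetric] by (intro sum.neutral) auto
      then have "AE x in torus L. ext_zero \<omega> (Z q) x = 0"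
        unfolding ip_self using norm_Lp2_zero_iff[OF ez] by simp
      from Z_eq_0_on_open[OF \<omega> this q(4)] q(1) show False by simp
    qed
    {
      case (empty k)
      have "B (\<lambda>j. if j = k then 1 else 0) k \<noteq> 0"
        by (rule nz[of _ _ "{}"]) (use empty in auto)
      then show ?case by (intro exI[of _ "\<lambda>j. if j = k then 1 else 0"]) auto
    next
      case (insert m S k)
      obtain q where q: "q k = 1" "\<forall>j. j \<notin> insert k S \<longrightarrow> q j = 0" "\<forall>l\<in>S. B q l = 0"
        using insert.IH[of k] insert.prems by auto
      obtain p where p: "p m = 1" "\<forall>j. j \<notin> insert m S \<longrightarrow> p j = 0" "\<forall>l\<in>S. B p l = 0" "B p m \<noteq> 0"
        using insert.IH[of m] insert.prems insert.hyps by auto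
      \<comment> \<open>Chosen so that subtracting \<open>t\<close> times \<open>p\<close> clears
        the condition at \<open>m\<close>; the conditions on \<open>S\<close> are kept because
        \<open>p\<close> already satisfies them.\<close>
      define t where "t = B q m / B p m"
      let ?r = "\<lambda>j. q j - t * p j"
      have r: "?r k = 1" "\<forall>j. j \<notin> insert k (insert m S) \<longrightarrow> ?r j = 0"
        using q(1,2) p(2) insert.prems by auto
      have "B ?r l = 0" if "l \<in> insert m S" for l
      proof -
        have "l \<in> {1..n}" using that insert.prems by auto
        then have e: "B ?r l = B q l - t * B p l" by (rule Bdiff)
        show ?thesis unfolding e using that q(3) p(3,4) by (auto simp: t_def)
      qed
      then have r3: "\<forall>l\<in>insert m S. B ?r l = 0" by blast
      from nz[OF r r3 insert.prems(2)] r r3 show ?case by (intro exI[of _ ?r]) blast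
    }
  qed
  have "\<exists>b. \<forall>l\<in>{1..n}. B b l = (if k = l then 1 else 0)" if k: "k \<in> {1..n}" for k
  proof -
    obtain q where q: "\<forall>l\<in>{1..n} - {k}. B q l = 0" "B q k \<noteq> 0"
      using ex[of "{1..n} - {k}" k] k by auto
    have "B (\<lambda>j. q j / B q k) l = B q l / B q k" if "l \<in> {1..n}" for l
    proof -
      have z: "B (\<lambda>j. 0) l = 0"
      proof -
        have "ext_zero \<omega> (Z (\<lambda>_. 0)) = (\<lambda>x. 0)" by (simp add: Z_zero ext_zero_def fun_eq_iff)
        then show ?thesis by (simp add: B_def ip_zero_left)
      qed
      show ?thesis using Bdiff[OF that, of "\<lambda>j. 0" "- (1 / B q k)" q] by (simp add: z)
    qed
    then show ?thesis using q by (intro exI[of _ "\<lambda>j. q j / B q k"]) auto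
  qed
  then obtain b where "\<And>k l. k \<in> {1..n} \<Longrightarrow> l \<in> {1..n} \<Longrightarrow> B (b k) l = (if k = l then 1 else 0)" by metis
  then show ?thesis using that unfolding B_def by blast
qed

end

locale galerkin_feedback = galerkin L n W \<kappa> ye Be
  for L n and W :: "nat \<Rightarrow> 'n::finite vfield" and \<kappa> ye Be +
  fixes \<omega> :: "(real^'n) set" and b :: "nat \<Rightarrow> nat \<Rightarrow> real" and \<eta> :: real
  assumes \<omega>: "open \<omega>" "periodic_set L \<omega>"
    and dual: "\<And>k l. k \<in> {1..n} \<Longrightarrow> l \<in> {1..n} \<Longrightarrow> ip L (ext_zero \<omega> (Z (b k))) (W l) = (if k = l then 1 else 0)"
begin

text \<open>The feedback field, extended by zero, as a function of the coefficients. By duality its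
  coefficient at \<open>l\<close> is \<open>- \<eta> * a l\<close>; the feedback enters the equation
  with a minus sign, so the net effect is damping.\<close>

definition E :: "(nat \<Rightarrow> real) \<Rightarrow> 'n vfield" where
  "E a x = (\<Sum>k=1..n. (- \<eta> * a k) *\<^sub>R ext_zero \<omega> (Z (b k)) x)"

text \<open>The value is a field on the whole space, of which only the restriction to
  \<open>\<omega>\<close> counts; \<open>ext_zero\<close> removes the rest.\<close>

definition R :: "'n vfield \<Rightarrow> 'n vfield" where
  "R u x = (\<Sum>k=1..n. (- \<eta> * coef u k) *\<^sub>R Z (b k) x)"

lemma ext_zero_Z_Lp2: "ext_zero \<omega> (Z a) \<in> Lp L 2"
  by (rule ext_zero_Lp2[OF \<omega> Z_Lp2])

lemma E_eq: "E a = (\<lambda>x. \<Sum>k=1..n. (- \<eta> * a k) *\<^sub>R ext_zero \<omega> (Z (b k)) x)"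
  by (simp add: E_def fun_eq_iff)

lemma E_Lp2: "E a \<in> Lp L 2"
  unfolding E_eq by (intro Lp2_sum Lp2_scaleR ext_zero_Z_Lp2)

lemma ip_E_W: "l \<in> {1..n} \<Longrightarrow> ip L (E a) (W l) = - \<eta> * a l"
proof -
  assume l: "l \<in> {1..n}"
  have "ip L (E a) (W l) = (\<Sum>k=1..n. ip L (\<lambda>x. (- \<eta> * a k) *\<^sub>R ext_zero \<omega> (Z (b k)) x) (W l))"
    unfolding E_eq by (rule ip_sum_left) (intro Lp2_scaleR ext_zero_Z_Lp2 W_Lp2 l)+
  also have "\<dots> = (\<Sum>k=1..n. if k = l then - \<eta> * a k else 0)"
    using l by (intro sum.cong refl) (simp add: ip_scaleR_left dual ip_minus_left)
  also have "\<dots> = - \<eta> * a l" using l by simp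
  finally show ?thesis .
qed

lemma L2_locally_lipschitz_E: "L2_locally_lipschitz L n E"
proof -
  have "L2_locally_lipschitz L n (\<lambda>a x. \<Sum>k=1..n. a k *\<^sub>R ((- \<eta>) *\<^sub>R ext_zero \<omega> (Z (b k)) x))"
    by (intro L2_locally_lipschitz_sum L2_locally_lipschitz_coord L2_locally_lipschitz_const Lp2_scaleR ext_zero_Z_Lp2)
  moreover have "(\<lambda>a x. \<Sum>k=1..n. a k *\<^sub>R ((- \<eta>) *\<^sub>R ext_zero \<omega> (Z (b k)) x)) = E"
    by (simp add: E_def fun_eq_iff mult.commute)
  ultimately show ?thesis by simp
qed

lemma ext_zero_R: "ext_zero \<omega> (R u) = E (coef u)"
  by (auto simp: ext_zero_def R_def E_def fun_eq_iff)

lemma coef_linear: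
  assumes "u \<in> Lp L 2" "v \<in> Lp L 2" "k \<in> {1..n}"
  shows "coef (\<lambda>s. c *\<^sub>R u s + d *\<^sub>R v s) k = c * coef u k + d * coef v k"
  unfolding coef_def using assms by (simp add: ip_add_left Lp2_scaleR W_Lp2 ip_scaleR_left)

lemma abs_coef_le: "u \<in> Lp L 2 \<Longrightarrow> k \<in> {1..n} \<Longrightarrow> \<bar>coef u k\<bar> \<le> norm_Lp L 2 u"
  using Lp2_integrable_ip(2)[of u L "W k"] by (simp add: coef_def norm_W W_Lp2)

lemma feedback_continuous_linear: "continuous_linear_feedback L \<omega> K R"
  unfolding continuous_linear_feedback_def
proof (intro conjI ballI allI)
  fix u assume u: "u \<in> K"
  have "R u = (\<lambda>x. \<Sum>k=1..n. (- \<eta> * coef u k) *\<^sub>R Z (b k) x)" by (simp add: R_def fun_eq_iff)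
  then have "R u \<in> solenoidal_smooth L"
    by (simp only:) (intro solenoidal_smooth_sum solenoidal_smooth_scaleR Z_solenoidal)
  then show "R u \<in> Lp_on L \<omega> 2"
    by (intro Lp_on_restrict \<omega> smooth_continuous solenoidal_smoothD)
next
  fix u v c d assume uv: "u \<in> K" "v \<in> K"
  have "R (\<lambda>s. c *\<^sub>R u s + d *\<^sub>R v s) x = c *\<^sub>R R u x + d *\<^sub>R R v x" for x
  proof -
    have "R (\<lambda>s. c *\<^sub>R u s + d *\<^sub>R v s) x = (\<Sum>k=1..n. (- \<eta> * (c * coef u k + d * coef v k)) *\<^sub>R Z (b k) x)"
      unfolding R_def by (intro sum.cong refl) (simp only: coef_linear[OF K_Lp2[OF uv(1)] K_Lp2[OF uv(2)]])
    also have "\<dots> = c *\<^sub>R R u x + d *\<^sub>R R v x"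
      unfolding R_def scaleR_sum_right sum.distrib[symmetric]
      by (intro sum.cong refl) (simp add: algebra_simps)
    finally show ?thesis .
  qed
  then show "AE x in tmeas L \<omega>. R (\<lambda>s. c *\<^sub>R u s + d *\<^sub>R v s) x = c *\<^sub>R R u x + d *\<^sub>R R v x" by simp
next
  show "\<exists>C. \<forall>u\<in>K. norm_Lp_on L \<omega> 2 (R u) \<le> C * norm_Lp L 2 u"
  proof (intro exI ballI)
    fix u assume u: "u \<in> K"
    have "norm_Lp_on L \<omega> 2 (R u) = norm_Lp L 2 (E (coef u))"
      by (simp add: norm_Lp_on_ext_zero[OF \<omega>(1)] ext_zero_R)
    also have "\<dots> \<le> (\<Sum>k=1..n. norm_Lp L 2 (\<lambda>x. (- \<eta> * coef u k) *\<^sub>R ext_zero \<omega> (Z (b k)) x))"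
      unfolding E_eq by (rule norm_Lp2_sum) (intro Lp2_scaleR ext_zero_Z_Lp2)
    also have "\<dots> = (\<Sum>k=1..n. \<bar>coef u k\<bar> * (\<bar>\<eta>\<bar> * norm_Lp L 2 (ext_zero \<omega> (Z (b k)))))"
      by (simp only: norm_Lp2_scaleR abs_mult abs_minus_cancel mult_ac)
    also have "\<dots> \<le> (\<Sum>k=1..n. norm_Lp L 2 u * (\<bar>\<eta>\<bar> * norm_Lp L 2 (ext_zero \<omega> (Z (b k)))))"
      by (intro sum_mono mult_right_mono abs_coef_le K_Lp2 u mult_nonneg_nonneg norm_Lp_nonneg) auto
    finally show "norm_Lp_on L \<omega> 2 (R u) \<le> (\<Sum>k=1..n. \<bar>\<eta>\<bar> * norm_Lp L 2 (ext_zero \<omega> (Z (b k)))) * norm_Lp L 2 u"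
      by (simp only: sum_distrib_right sum_distrib_left mult_ac)
  qed
qed

text \<open>\<open>orth_proj\<close> is some representative in \<open>K\<close> chosen by
  \<open>SOME\<close>. It has the same coefficients as \<open>u\<close>, and the feedback reads
  nothing else.\<close>

lemma feedback_term_eq:
  assumes u: "u \<in> Lp L 2"
  shows "feedback_term L \<omega> K R u = (\<lambda>x. - leray L (E (coef u)) x)"
proof -
  have "Z (coef u) \<in> K \<and> (\<forall>v\<in>K. ip L (\<lambda>x. u x - Z (coef u) x) v = 0)"
  proof (intro conjI ballI Z_in_K)
    fix v assume v: "v \<in> K"
    have uZ: "(\<lambda>x. u x - Z (coef u) x) \<in> Lp L 2" by (intro Lp2_diff u Z_Lp2)
    have "ip L (\<lambda>x. u x - Z (coef u) x) v = ip L (\<lambda>x. u x - Z (coef u) x) (Z (coef v))"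
      by (rule ip_cong_AE) (use K_AE[OF v] uZ K_Lp2[OF v] Z_Lp2[of "coef v"] in \<open>auto simp: Lp2_iff\<close>)
    also have "\<dots> = (\<Sum>j=1..n. coef v j * (coef u j - coef (Z (coef u)) j))"
      unfolding ip_commute[of L _ "Z (coef v)"] ip_Z_left[OF uZ] coef_def
      by (intro sum.cong refl) (simp add: ip_commute[of L "W _"] ip_diff_left u Z_Lp2 W_Lp2)
    also have "\<dots> = 0" by (intro sum.neutral ballI) (simp add: coef_Z)
    finally show "ip L (\<lambda>x. u x - Z (coef u) x) v = 0" .
  qed
  then have "\<exists>h. h \<in> K \<and> (\<forall>v\<in>K. ip L (\<lambda>x. u x - h x) v = 0)" by blast
  from someI_ex[OF this] have h: "orth_proj L K u \<in> K" "\<And>v. v \<in> K \<Longrightarrow> ip L (\<lambda>x. u x - orth_proj L K u x) v = 0"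
    by (auto simp: orth_proj_def)
  have WK: "W k \<in> K" if "k \<in> {1..n}" for k
  proof (rule K_I[OF W_Hsp[OF that], of "\<lambda>j. if j = k then 1 else 0"])
    show "AE x in torus L. W k x = Z (\<lambda>j. if j = k then 1 else 0) x"
      using that by (simp add: Z_def if_distrib[of "\<lambda>c. c *\<^sub>R _"] cong: if_cong)
  qed
  have "coef (orth_proj L K u) k = coef u k" if "k \<in> {1..n}" for k
    using h(2)[OF WK[OF that]] unfolding coef_def by (simp add: ip_diff_left u K_Lp2[OF h(1)] W_Lp2[OF that])
  then have "E (coef (orth_proj L K u)) = E (coef u)" by (auto simp: E_def fun_eq_iff intro!: sum.cong)
  then show ?thesis by (simp add: feedback_term_def ext_zero_R)
qed

lemma ip_feedback_term:
  assumes "u \<in> Lp L 2" "v \<in> Hsp L"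
  shows "ip L (feedback_term L \<omega> K R u) v = - ip L (E (coef u)) v"
  unfolding feedback_term_eq[OF assms(1)] ip_minus_left using ip_leray[OF E_Lp2 assms(2)] by simp

end

section \<open>Time-dependent fields\<close>

definition L2_continuous_on :: "real \<Rightarrow> real set \<Rightarrow> (real \<Rightarrow> 'n::finite vfield) \<Rightarrow> bool" where
  "L2_continuous_on L S f \<longleftrightarrow> (\<forall>t\<in>S. f t \<in> Lp L 2 \<and> ((\<lambda>s. norm_Lp L 2 (\<lambda>x. f s x - f t x)) \<longlongrightarrow> 0) (at t within S))"

lemma L2_continuous_onD:
  assumes "L2_continuous_on L S f" "t \<in> S"
  shows "f t \<in> Lp L 2" "((\<lambda>s. norm_Lp L 2 (\<lambda>x. f s x - f t x)) \<longlongrightarrow> 0) (at t within S)"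
  using assms by (auto simp: L2_continuous_on_def)

lemma L2_continuous_on_const: "f \<in> Lp L 2 \<Longrightarrow> L2_continuous_on L S (\<lambda>t. f)"
  by (simp add: L2_continuous_on_def norm_Lp2_eq ip_zero_left)

lemma continuous_on_ip:
  assumes f: "L2_continuous_on L S f" and g: "L2_continuous_on L S g"
  shows "continuous_on S (\<lambda>t. ip L (f t) (g t))"
  unfolding continuous_on_def
proof
  fix t assume t: "t \<in> S"
  let ?F = "\<lambda>s. norm_Lp L 2 (\<lambda>x. f s x - f t x)" and ?G = "\<lambda>s. norm_Lp L 2 (\<lambda>x. g s x - g t x)"
  note ft = L2_continuous_onD(1)[OF f] and gt = L2_continuous_onD(1)[OF g]
  have "((\<lambda>s. ip L (f s) (g s) - ip L (f t) (g t)) \<longlongrightarrow> 0) (at t within S)"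
  proof (rule Lim_null_comparison)
    have "norm (ip L (f s) (g s) - ip L (f t) (g t)) \<le> ?F s * ?G s + ?F s * norm_Lp L 2 (g t) + norm_Lp L 2 (f t) * ?G s"
      if s: "s \<in> S" for s
    proof -
      have df: "(\<lambda>x. f s x - f t x) \<in> Lp L 2" and dg: "(\<lambda>x. g s x - g t x) \<in> Lp L 2"
        by (intro Lp2_diff ft gt s t)+
      have "ip L (f s) (g s) - ip L (f t) (g t) =
        ip L (\<lambda>x. f s x - f t x) (\<lambda>x. g s x - g t x) + ip L (\<lambda>x. f s x - f t x) (g t) + ip L (f t) (\<lambda>x. g s x - g t x)"
        using ft[OF s] ft[OF t] gt[OF s] gt[OF t] dg by (simp add: ip_diff_left ip_diff_right)
      then show ?thesis
        using Lp2_integrable_ip(2)[OF df dg] Lp2_integrable_ip(2)[OF df gt[OF t]] Lp2_integrable_ip(2)[OF ft[OF t] dg]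
        unfolding real_norm_def by linarith
    qed
    then show "\<forall>\<^sub>F s in at t within S. norm (ip L (f s) (g s) - ip L (f t) (g t)) \<le> ?F s * ?G s + ?F s * norm_Lp L 2 (g t) + norm_Lp L 2 (f t) * ?G s"
      by (auto simp: eventually_at_filter intro!: always_eventually)
    have "((\<lambda>s. ?F s * ?G s + ?F s * norm_Lp L 2 (g t) + norm_Lp L 2 (f t) * ?G s) \<longlongrightarrow>
       0 * 0 + 0 * norm_Lp L 2 (g t) + norm_Lp L 2 (f t) * 0) (at t within S)"
      by (intro tendsto_intros L2_continuous_onD f g t)
    then show "((\<lambda>s. ?F s * ?G s + ?F s * norm_Lp L 2 (g t) + norm_Lp L 2 (f t) * ?G s) \<longlongrightarrow> 0) (at t within S)" by simp
  qed
  then show "((\<lambda>s. ip L (f s) (g s)) \<longlongrightarrow> ip L (f t) (g t)) (at t within S)" by (rule LIM_zero_cancel)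
qed

lemma L2_continuous_on_lipschitz:
  assumes F: "L2_locally_lipschitz L n F" and c: "\<And>j. j \<in> {1..n} \<Longrightarrow> continuous_on S (c j)"
  shows "L2_continuous_on L S (\<lambda>t. F (\<lambda>j. c j t))"
  unfolding L2_continuous_on_def
proof (intro ballI conjI L2_locally_lipschitzD(1)[OF F])
  fix t assume t: "t \<in> S"
  \<comment> \<open>The extra 1 leaves room for nearby times, whose coefficients then lie in the
    same ball.\<close>
  define M where "M = (\<Sum>j=1..n. \<bar>c j t\<bar>) + 1"
  have M: "\<bar>c j t\<bar> + 1 \<le> M" if "j \<in> {1..n}" for j
    unfolding M_def using that member_le_sum[of j "{1..n}" "\<lambda>j. \<bar>c j t\<bar>"] by simp
  obtain \<Lambda> where \<Lambda>: "\<Lambda> \<ge> 0" "\<And>a b. (\<forall>j\<in>{1..n}. \<bar>a j\<bar> \<le> M \<and> \<bar>b j\<bar> \<le> M) \<Longrightarrow>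
      norm_Lp L 2 (\<lambda>x. F a x - F b x) \<le> \<Lambda> * (\<Sum>j=1..n. \<bar>a j - b j\<bar>)"
    using L2_locally_lipschitzD(2)[OF F, of M] by blast
  have lim: "((\<lambda>s. c j s) \<longlongrightarrow> c j t) (at t within S)" if "j \<in> {1..n}" for j
    using c[OF that] t by (auto simp: continuous_on_def)
  have "\<forall>\<^sub>F s in at t within S. \<bar>c j s - c j t\<bar> < 1" if "j \<in> {1..n}" for j
    using tendstoD[OF lim[OF that], of 1] by (simp add: dist_real_def)
  then have ev: "\<forall>\<^sub>F s in at t within S. \<forall>j\<in>{1..n}. \<bar>c j s - c j t\<bar> < 1"
    by (intro eventually_ball_finite) auto
  show "((\<lambda>s. norm_Lp L 2 (\<lambda>x. F (\<lambda>j. c j s) x - F (\<lambda>j. c j t) x)) \<longlongrightarrow> 0) (at t within S)"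
  proof (rule Lim_null_comparison)
    show "\<forall>\<^sub>F s in at t within S. norm (norm_Lp L 2 (\<lambda>x. F (\<lambda>j. c j s) x - F (\<lambda>j. c j t) x)) \<le> \<Lambda> * (\<Sum>j=1..n. \<bar>c j s - c j t\<bar>)"
      using ev
    proof eventually_elim
      case (elim s)
      have "\<forall>j\<in>{1..n}. \<bar>c j s\<bar> \<le> M \<and> \<bar>c j t\<bar> \<le> M"
      proof
        fix j assume j: "j \<in> {1..n}"
        show "\<bar>c j s\<bar> \<le> M \<and> \<bar>c j t\<bar> \<le> M" using bspec[OF elim j] M[OF j] by linarith
      qed
      from \<Lambda>(2)[OF this] show ?case by (simp add: norm_Lp_nonneg)
    qed
    have "((\<lambda>s. \<Lambda> * (\<Sum>j=1..n. \<bar>c j s - c j t\<bar>)) \<longlongrightarrow> \<Lambda> * (\<Sum>j=1..n. \<bar>c j t - c j t\<bar>)) (at t within S)"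
      by (intro tendsto_intros lim)
    then show "((\<lambda>s. \<Lambda> * (\<Sum>j=1..n. \<bar>c j s - c j t\<bar>)) \<longlongrightarrow> 0) (at t within S)" by simp
  qed
qed

lemma set_lebesgue_integral_continuous:
  fixes h :: "real \<Rightarrow> real"
  assumes "continuous_on {a..b} h"
  shows "set_integrable lebesgue {a..b} h" "(LINT s:{a..b}|lebesgue. h s) = integral {a..b} h"
  using absolutely_integrable_continuous_real[OF assms] by (auto intro: set_lebesgue_integral_eq_integral)

text \<open>The time derivative is the derivative of the jointly smooth field in direction (1, 0),
  so its joint continuity is part of smoothness; both are one-sided at the end points of the
  interval.\<close>

lemma solenoidal_test_facts:
  fixes v :: "real \<Rightarrow> 'n::finite vfield"
  assumes v: "solenoidal_test L a b v" and ab: "a < b"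
  defines "v' \<equiv> (\<lambda>s x. vector_derivative (\<lambda>\<sigma>. v \<sigma> x) (at s within {a..b}))"
  shows "continuous_on ({a..b} \<times> UNIV) (\<lambda>(s, x). v s x)"
    "continuous_on ({a..b} \<times> UNIV) (\<lambda>(s, x). v' s x)"
    "s \<in> {a..b} \<Longrightarrow> ((\<lambda>\<sigma>. v \<sigma> x) has_vector_derivative v' s x) (at s within {a..b})"
proof -
  let ?S = "{a..b} \<times> (UNIV :: (real^'n) set)" and ?f = "\<lambda>(s, x). v s x"
  have sm: "Ck_on (Suc 0) ?S ?f" "Ck_on 0 ?S ?f" using v by (auto simp: solenoidal_test_def smooth_on_def simp del: Ck_on.simps)
  show "continuous_on ?S ?f" using sm(2) by simp
  let ?D = "\<lambda>p. frechet_derivative ?f (at p within ?S) (1, 0)"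
  have B: "(1, 0) \<in> (Basis :: (real \<times> (real^'n)) set)" by (simp add: Basis_prod_def)
  have cD: "continuous_on ?S ?D" using sm(1) B by simp
  have hv: "((\<lambda>\<sigma>. v \<sigma> x) has_vector_derivative ?D (s, x)) (at s within {a..b})" if s: "s \<in> {a..b}" for s x
  proof -
    have "?f differentiable (at (s, x) within ?S)" using sm(1) s by (auto simp: differentiable_on_def)
    then have d: "(?f has_derivative frechet_derivative ?f (at (s, x) within ?S)) (at (s, x) within ?S)"
      by (simp add: frechet_derivative_works)
    have g: "((\<lambda>\<sigma>. (\<sigma>, x)) has_derivative (\<lambda>h. (h, 0))) (at s within {a..b})"
      by (auto intro!: derivative_eq_intros)
    have im: "(\<lambda>\<sigma>. (\<sigma>, x)) ` {a..b} \<subseteq> ?S" by auto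
    have 1: "((\<lambda>\<sigma>. ?f (\<sigma>, x)) has_derivative (\<lambda>h. frechet_derivative ?f (at (s, x) within ?S) (h, 0))) (at s within {a..b})"
      by (rule has_derivative_in_compose[OF g has_derivative_subset[OF d im]])
    have "frechet_derivative ?f (at (s, x) within ?S) (h, 0) = h *\<^sub>R ?D (s, x)" for h
      using linear_cmul[OF has_derivative_linear[OF d], of h "(1, 0)"] by simp
    then have 2: "(\<lambda>h. frechet_derivative ?f (at (s, x) within ?S) (h, 0)) = (\<lambda>h. h *\<^sub>R ?D (s, x))"
      by (rule ext)
    show ?thesis
      using 1 unfolding 2 has_vector_derivative_def by (simp only: prod.case)
  qed
  have v'D: "v' s x = ?D (s, x)" if "s \<in> {a..b}" for s x
    unfolding v'_def by (rule vector_derivative_within_closed_interval[OF ab that hv[OF that]])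
  show "((\<lambda>\<sigma>. v \<sigma> x) has_vector_derivative v' s x) (at s within {a..b})" if "s \<in> {a..b}"
    using hv[OF that] v'D[OF that] by simp
  show "continuous_on ?S (\<lambda>(s, x). v' s x)"
    using cD by (rule continuous_on_eq) (auto simp: v'D)
qed

lemma L2_continuous_on_jointly:
  fixes v :: "real \<Rightarrow> 'n::finite vfield"
  assumes c: "continuous_on ({a..b} \<times> UNIV) (\<lambda>(s, x). v s x)" and per: "\<And>s. s \<in> {a..b} \<Longrightarrow> periodic_on L UNIV (v s)"
  shows "L2_continuous_on L {a..b} v"
  unfolding L2_continuous_on_def
proof (intro ballI conjI)
  have cs: "continuous_on UNIV (v s)" if "s \<in> {a..b}" for s
    by (rule continuous_on_compose2[OF c, of UNIV "\<lambda>x. (s, x)", simplified]) (use that in \<open>auto intro!: continuous_intros\<close>)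
  fix t assume t: "t \<in> {a..b}"
  show "v t \<in> Lp L 2" by (intro Lp2_continuous per cs t)
  have "continuous_on {a..b} (\<lambda>s. integral (cell L) (\<lambda>x. (norm (v s x - v t x))\<^sup>2))"
  proof (rule integral_continuous_on_param)
    have 1: "continuous_on ({a..b} \<times> cell L) (\<lambda>p. case p of (s, x) \<Rightarrow> v s x)"
      by (rule continuous_on_subset[OF c]) auto
    have 2: "continuous_on ({a..b} \<times> cell L) (\<lambda>p. v t (snd p))"
      by (rule continuous_on_compose2[OF cs[OF t] continuous_on_snd[OF continuous_on_id]]) auto
    have "continuous_on ({a..b} \<times> cell L) (\<lambda>p. (norm ((case p of (s, x) \<Rightarrow> v s x) - v t (snd p)))\<^sup>2)"
      by (intro continuous_intros 1 2)
    then show "continuous_on ({a..b} \<times> cell L) (\<lambda>(s, x). (norm (v s x - v t x))\<^sup>2)"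
      by (simp add: case_prod_beta')
  qed
  then have "((\<lambda>s. integral (cell L) (\<lambda>x. (norm (v s x - v t x))\<^sup>2)) \<longlongrightarrow> integral (cell L) (\<lambda>x. (norm (v t x - v t x))\<^sup>2)) (at t within {a..b})"
    using t unfolding continuous_on_def by blast
  then have "((\<lambda>s. sqrt (integral (cell L) (\<lambda>x. (norm (v s x - v t x))\<^sup>2))) \<longlongrightarrow> sqrt (integral (cell L) (\<lambda>x. (norm (v t x - v t x))\<^sup>2))) (at t within {a..b})"
    by (rule tendsto_real_sqrt)
  then have lim: "((\<lambda>s. sqrt (integral (cell L) (\<lambda>x. (norm (v s x - v t x))\<^sup>2))) \<longlongrightarrow> 0) (at t within {a..b})" by simp
  have eq: "sqrt (integral (cell L) (\<lambda>x. (norm (v s x - v t x))\<^sup>2)) = norm_Lp L 2 (\<lambda>x. v s x - v t x)" if s: "s \<in> {a..b}" for s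
  proof -
    have "continuous_on UNIV (\<lambda>x. (norm (v s x - v t x))\<^sup>2)" by (intro continuous_intros cs s t)
    from integral_torus_eq_integral[OF integrable_torus_continuous[OF this]]
    show ?thesis by (simp add: norm_Lp2_eq ip_def dot_square_norm)
  qed
  show "((\<lambda>s. norm_Lp L 2 (\<lambda>x. v s x - v t x)) \<longlongrightarrow> 0) (at t within {a..b})"
    using lim by (rule Lim_transform_eventually) (auto simp: eventually_at_filter eq intro!: always_eventually)
qed

lemma solenoidal_test_L2:
  fixes v :: "real \<Rightarrow> 'n::finite vfield"
  assumes v: "solenoidal_test L a b v" and ab: "a < b"
  defines "v' \<equiv> (\<lambda>s x. vector_derivative (\<lambda>\<sigma>. v \<sigma> x) (at s within {a..b}))"
  shows "L2_continuous_on L {a..b} v" "L2_continuous_on L {a..b} v'"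
    and "\<And>w s. w \<in> solenoidal_smooth L \<Longrightarrow> s \<in> {a..b} \<Longrightarrow> ((\<lambda>s. ip L w (v s)) has_real_derivative ip L w (v' s)) (at s within {a..b})"
proof -
  have facts: "continuous_on ({a..b} \<times> UNIV) (\<lambda>(s, x). v s x)"
    "continuous_on ({a..b} \<times> UNIV) (\<lambda>(s, x). v' s x)"
    "\<And>s x. s \<in> {a..b} \<Longrightarrow> ((\<lambda>\<sigma>. v \<sigma> x) has_vector_derivative v' s x) (at s within {a..b})"
    unfolding v'_def by (rule solenoidal_test_facts[OF v ab]; assumption)+
  have vs: "v s \<in> solenoidal_smooth L" if "s \<in> {a..b}" for s using v that by (auto simp: solenoidal_test_def)
  show vc: "L2_continuous_on L {a..b} v" by (intro L2_continuous_on_jointly facts solenoidal_smoothD(2) vs)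
  have per': "periodic_on L UNIV (v' s)" if "s \<in> {a..b}" for s
    unfolding periodic_on_def
  proof (intro ballI allI)
    fix x and i :: 'n
    have "((\<lambda>\<sigma>. v \<sigma> (x + axis i L)) has_vector_derivative v' s x) (at s within {a..b})"
      by (rule has_vector_derivative_transform[OF that _ facts(3)[OF that, of x]])
        (use solenoidal_smoothD(2)[OF vs] in \<open>auto simp: periodic_on_def\<close>)
    then show "v' s (x + axis i L) = v' s x"
      using vector_derivative_within_closed_interval[OF ab that] unfolding v'_def by blast
  qed
  show v'c: "L2_continuous_on L {a..b} v'" by (intro L2_continuous_on_jointly facts per')
  fix w :: "'n vfield" and s assume w: "w \<in> solenoidal_smooth L" and s: "s \<in> {a..b}"
  have cw: "continuous_on UNIV w" by (rule smooth_continuous[OF solenoidal_smoothD(1)[OF w]])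
  have cs: "continuous_on UNIV (g s)" if "s \<in> {a..b}" "continuous_on ({a..b} \<times> UNIV) (\<lambda>(s, x). g s x)" for s and g :: "real \<Rightarrow> 'n vfield"
    by (rule continuous_on_compose2[OF that(2), of UNIV "\<lambda>x. (s, x)", simplified]) (use that(1) in \<open>auto intro!: continuous_intros\<close>)
  have ipI: "ip L w (g s) = integral (cell L) (\<lambda>x. w x \<bullet> g s x)" if "s \<in> {a..b}" "continuous_on ({a..b} \<times> UNIV) (\<lambda>(s, x). g s x)" for s and g :: "real \<Rightarrow> 'n vfield"
    unfolding ip_def
    by (intro integral_torus_eq_integral integrable_torus_continuous continuous_on_inner cw cs[OF that])
  have "((\<lambda>s. integral (cell L) (\<lambda>x. w x \<bullet> v s x)) has_real_derivative integral (cell L) (\<lambda>x. w x \<bullet> v' s x)) (at s within {a..b})"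
  proof (rule leibniz_rule_field_derivative)
    show "((\<lambda>s. w x \<bullet> v s x) has_field_derivative w x \<bullet> v' s x) (at s within {a..b})" if "s \<in> {a..b}" for s x
      using bounded_linear.has_vector_derivative[OF bounded_linear_inner_right facts(3)[OF that, of x]]
      by (simp add: has_real_derivative_iff_has_vector_derivative)
    show "(\<lambda>x. w x \<bullet> v s x) integrable_on cell L" if "s \<in> {a..b}" for s
    proof -
      have "continuous_on UNIV (\<lambda>x. w x \<bullet> v s x)" by (intro continuous_on_inner cw cs[OF that facts(1)])
      then show ?thesis by (intro integrable_continuous) (rule continuous_on_subset, auto)
    qed
    have 1: "continuous_on ({a..b} \<times> cell L) (\<lambda>p. case p of (s, x) \<Rightarrow> v' s x)"
      by (rule continuous_on_subset[OF facts(2)]) auto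
    have 2: "continuous_on ({a..b} \<times> cell L) (\<lambda>p. w (snd p))"
      by (rule continuous_on_compose2[OF cw continuous_on_snd[OF continuous_on_id]]) auto
    have "continuous_on ({a..b} \<times> cell L) (\<lambda>p. w (snd p) \<bullet> (case p of (s, x) \<Rightarrow> v' s x))"
      by (intro continuous_intros 1 2)
    then show "continuous_on ({a..b} \<times> cell L) (\<lambda>(s, x). w x \<bullet> v' s x)"
      by (simp add: case_prod_beta')
  qed (use s in auto)
  then have d: "((\<lambda>s. integral (cell L) (\<lambda>x. w x \<bullet> v s x)) has_real_derivative ip L w (v' s)) (at s within {a..b})"
    by (simp add: ipI[OF s facts(2)])
  show "((\<lambda>s. ip L w (v s)) has_real_derivative ip L w (v' s)) (at s within {a..b})"
    unfolding has_field_derivative_def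
    by (rule has_derivative_transform[OF s _ d[unfolded has_field_derivative_def]]) (simp add: ipI[OF _ facts(1)])
qed

locale galerkin_problem = galerkin_feedback L n W \<kappa> ye Be \<omega> b \<eta>
  for L n and W :: "nat \<Rightarrow> 'n::finite vfield" and \<kappa> ye Be \<omega> b \<eta> +
  fixes \<mu> \<alpha> \<beta> \<gamma> r q :: real
  assumes r1: "r \<ge> 1" and q1: "q \<ge> 1"
begin

lemma ye_terms_Lp2: "advection L ye \<in> Lp L 2" "absorption r ye \<in> Lp L 2" "absorption q ye \<in> Lp L 2"
  using advection_Zye_Lp2[of "\<lambda>_. 0"] absorption_Zye_Lp2[OF r1, of "\<lambda>_. 0"] absorption_Zye_Lp2[OF q1, of "\<lambda>_. 0"]
  by (simp_all add: Z_zero)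

definition N :: "(nat \<Rightarrow> real) \<Rightarrow> 'n vfield" where
  "N a x = (advection L (\<lambda>x. Z a x + ye x) x - advection L ye x)
    + (\<beta> *\<^sub>R (absorption r (\<lambda>x. Z a x + ye x) x - absorption r ye x)
    + \<gamma> *\<^sub>R (absorption q (\<lambda>x. Z a x + ye x) x - absorption q ye x))"

text \<open>The coefficients of the equation on \<open>K\<close> without the feedback. The gain does
  not occur here, so the Lipschitz constant of \<open>G\<close> is available before the gain is
  chosen.\<close>

definition G :: "(nat \<Rightarrow> real) \<Rightarrow> nat \<Rightarrow> real" where
  "G a k = (\<mu> * \<kappa> k + \<alpha>) * a k + ip L (N a) (W k)"

lemma L2_locally_lipschitz_N: "L2_locally_lipschitz L n N"
proof -
  have diff: "L2_locally_lipschitz L n (\<lambda>a x. F a x - f x)" if "L2_locally_lipschitz L n F" "f \<in> Lp L 2" for F f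
    using L2_locally_lipschitz_add[OF that(1) L2_locally_lipschitz_const[OF Lp2_minus[OF that(2)]]] by simp
  have "N = (\<lambda>a x. (advection L (\<lambda>x. Z a x + ye x) x - advection L ye x)
    + (\<beta> *\<^sub>R (absorption r (\<lambda>x. Z a x + ye x) x - absorption r ye x)
    + \<gamma> *\<^sub>R (absorption q (\<lambda>x. Z a x + ye x) x - absorption q ye x)))"
    by (simp add: N_def fun_eq_iff)
  then show ?thesis
    by (simp only:) (intro L2_locally_lipschitz_add L2_locally_lipschitz_scaleR diff L2_locally_lipschitz_advection
      L2_locally_lipschitz_absorption r1 q1 ye_terms_Lp2)
qed

lemma N_Lp2: "N a \<in> Lp L 2"
  by (rule L2_locally_lipschitzD(1)[OF L2_locally_lipschitz_N])

lemma ip_N: "v \<in> Lp L 2 \<Longrightarrow> ip L (N a) v =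
    ip L (advection L (\<lambda>x. Z a x + ye x)) v - ip L (advection L ye) v
    + \<beta> * (ip L (absorption r (\<lambda>x. Z a x + ye x)) v - ip L (absorption r ye) v)
    + \<gamma> * (ip L (absorption q (\<lambda>x. Z a x + ye x)) v - ip L (absorption q ye) v)"
proof -
  assume v: "v \<in> Lp L 2"
  let ?A = "\<lambda>x. advection L (\<lambda>x. Z a x + ye x) x - advection L ye x"
  let ?B = "\<lambda>x. absorption r (\<lambda>x. Z a x + ye x) x - absorption r ye x"
  let ?C = "\<lambda>x. absorption q (\<lambda>x. Z a x + ye x) x - absorption q ye x"
  note m = advection_Zye_Lp2[of a] absorption_Zye_Lp2[OF r1, of a] absorption_Zye_Lp2[OF q1, of a] ye_terms_Lp2
  have m2: "?A \<in> Lp L 2" "?B \<in> Lp L 2" "?C \<in> Lp L 2" by (intro Lp2_diff m)+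
  have "N a = (\<lambda>x. ?A x + (\<beta> *\<^sub>R ?B x + \<gamma> *\<^sub>R ?C x))" by (simp add: N_def fun_eq_iff)
  then have "ip L (N a) v = ip L (\<lambda>x. ?A x + (\<beta> *\<^sub>R ?B x + \<gamma> *\<^sub>R ?C x)) v" by simp
  also have "\<dots> = ip L ?A v + (ip L (\<lambda>x. \<beta> *\<^sub>R ?B x) v + ip L (\<lambda>x. \<gamma> *\<^sub>R ?C x) v)"
    by (subst ip_add_left, intro m2, intro Lp2_add Lp2_scaleR m2, rule v, subst ip_add_left, (intro Lp2_scaleR m2 v)+, rule refl)
  finally show ?thesis using m v by (simp add: ip_scaleR_left ip_diff_left)
qed

lemma G_zero: "G (\<lambda>_. 0) k = 0"
proof -
  have "N (\<lambda>_. 0) = (\<lambda>x. 0)" by (simp add: N_def Z_zero fun_eq_iff)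
  then show ?thesis by (simp add: G_def ip_zero_left)
qed

lemma locally_lipschitz_G: "locally_lipschitz_coeffs n G"
  unfolding locally_lipschitz_coeffs_def
proof
  fix M
  obtain \<Lambda> where \<Lambda>: "\<Lambda> \<ge> 0" "\<And>a b. (\<forall>j\<in>{1..n}. \<bar>a j\<bar> \<le> M \<and> \<bar>b j\<bar> \<le> M) \<Longrightarrow>
      norm_Lp L 2 (\<lambda>x. N a x - N b x) \<le> \<Lambda> * (\<Sum>j=1..n. \<bar>a j - b j\<bar>)"
    using L2_locally_lipschitzD(2)[OF L2_locally_lipschitz_N, of M] by blast
  define m where "m = (\<Sum>j=1..n. \<bar>\<mu> * \<kappa> j + \<alpha>\<bar>)"
  have m: "\<bar>\<mu> * \<kappa> k + \<alpha>\<bar> \<le> m" if "k \<in> {1..n}" for k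
    unfolding m_def using that member_le_sum[of k "{1..n}" "\<lambda>j. \<bar>\<mu> * \<kappa> j + \<alpha>\<bar>"] by simp
  have m0: "m \<ge> 0" unfolding m_def by (intro sum_nonneg) auto
  show "\<exists>\<Lambda>\<ge>0. \<forall>a b. (\<forall>j\<in>{1..n}. \<bar>a j\<bar> \<le> M \<and> \<bar>b j\<bar> \<le> M) \<longrightarrow>
     (\<forall>k\<in>{1..n}. \<bar>G a k - G b k\<bar> \<le> \<Lambda> * (\<Sum>j=1..n. \<bar>a j - b j\<bar>))"
  proof (intro exI[of _ "m + \<Lambda>"] conjI allI impI ballI)
    fix a b k assume ab: "\<forall>j\<in>{1..n}. \<bar>a j\<bar> \<le> M \<and> \<bar>b j\<bar> \<le> M" and k: "k \<in> {1..n}"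
    have "\<bar>ip L (N a) (W k) - ip L (N b) (W k)\<bar> \<le> norm_Lp L 2 (\<lambda>x. N a x - N b x) * norm_Lp L 2 (W k)"
      using Lp2_integrable_ip(2)[OF Lp2_diff[OF N_Lp2 N_Lp2] W_Lp2[OF k]] by (simp add: ip_diff_left N_Lp2 W_Lp2[OF k])
    then have 1: "\<bar>ip L (N a) (W k) - ip L (N b) (W k)\<bar> \<le> \<Lambda> * (\<Sum>j=1..n. \<bar>a j - b j\<bar>)"
      using \<Lambda>(2)[OF ab] by (simp add: norm_W[OF k])
    have "\<bar>a k - b k\<bar> \<le> (\<Sum>j=1..n. \<bar>a j - b j\<bar>)"
      using k member_le_sum[of k "{1..n}" "\<lambda>j. \<bar>a j - b j\<bar>"] by simp
    then have 2: "\<bar>(\<mu> * \<kappa> k + \<alpha>) * (a k - b k)\<bar> \<le> m * (\<Sum>j=1..n. \<bar>a j - b j\<bar>)"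
      unfolding abs_mult using m[OF k] m0 by (intro mult_mono) auto
    have "G a k - G b k = (\<mu> * \<kappa> k + \<alpha>) * (a k - b k) + (ip L (N a) (W k) - ip L (N b) (W k))"
      by (simp add: G_def algebra_simps)
    then show "\<bar>G a k - G b k\<bar> \<le> (m + \<Lambda>) * (\<Sum>j=1..n. \<bar>a j - b j\<bar>)"
      using 1 2 unfolding distrib_right by linarith
  qed (use m0 \<Lambda> in auto)
qed

end

section \<open>The Galerkin solution\<close>

context galerkin_problem
begin

text \<open>All terms of the equation except the time derivative, the feedback and the
  subdifferential; on \<open>K\<close> the Stokes operator acts through the eigenvalues.\<close>

definition Res :: "(nat \<Rightarrow> real) \<Rightarrow> 'n vfield" where
  "Res a x = N a x + Z (\<lambda>j. (\<mu> * \<kappa> j + \<alpha>) * a j) x"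

text \<open>The selection of the subdifferential: the component of the negative residual orthogonal to \<open>K\<close>,
where \<open>G a k + \<eta> a k\<close> are the coefficients of the residual on \<open>K\<close>.\<close>

definition Xi :: "(nat \<Rightarrow> real) \<Rightarrow> 'n vfield" where
  "Xi a x = leray L (\<lambda>x. E a x - Res a x) x + Z (\<lambda>k. G a k + \<eta> * a k) x"

lemma Res_Lp2: "Res a \<in> Lp L 2"
proof -
  have "Res a = (\<lambda>x. N a x + Z (\<lambda>j. (\<mu> * \<kappa> j + \<alpha>) * a j) x)" by (simp add: Res_def fun_eq_iff)
  then show ?thesis by (simp add: Lp2_add N_Lp2 Z_Lp2)
qed

lemma ip_Res: "v \<in> Lp L 2 \<Longrightarrow> ip L (Res a) v = ip L (N a) v + (\<Sum>j=1..n. (\<mu> * \<kappa> j + \<alpha>) * a j * ip L (W j) v)"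
proof -
  assume v: "v \<in> Lp L 2"
  have "Res a = (\<lambda>x. N a x + Z (\<lambda>j. (\<mu> * \<kappa> j + \<alpha>) * a j) x)" by (simp add: Res_def fun_eq_iff)
  then have "ip L (Res a) v = ip L (N a) v + ip L (Z (\<lambda>j. (\<mu> * \<kappa> j + \<alpha>) * a j)) v"
    using ip_add_left[OF N_Lp2 Z_Lp2 v] by simp
  then show ?thesis by (simp add: ip_Z_left v)
qed

lemma Xi_Hsp: "Xi a \<in> Hsp L"
proof -
  have "Xi a = (\<lambda>x. leray L (\<lambda>x. E a x - Res a x) x + Z (\<lambda>k. G a k + \<eta> * a k) x)" by (simp add: Xi_def fun_eq_iff)
  then show ?thesis by (auto intro!: Hsp_add leray_Hsp Lp2_diff E_Lp2 Res_Lp2 Z_Hsp)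
qed

lemma ip_Xi:
  assumes v: "v \<in> Hsp L"
  shows "ip L (Xi a) v = ip L (E a) v - ip L (Res a) v + (\<Sum>j=1..n. (G a j + \<eta> * a j) * ip L (W j) v)"
proof -
  have ER: "(\<lambda>x. E a x - Res a x) \<in> Lp L 2" by (intro Lp2_diff E_Lp2 Res_Lp2)
  have v2: "v \<in> Lp L 2" using v by (rule Hsp_Lp2)
  have "Xi a = (\<lambda>x. leray L (\<lambda>x. E a x - Res a x) x + Z (\<lambda>k. G a k + \<eta> * a k) x)" by (simp add: Xi_def fun_eq_iff)
  then have "ip L (Xi a) v = ip L (leray L (\<lambda>x. E a x - Res a x)) v + ip L (Z (\<lambda>k. G a k + \<eta> * a k)) v"
    using ip_add_left[OF Hsp_Lp2[OF leray_Hsp[OF ER]] Z_Lp2 v2] by simp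
  then show ?thesis by (simp add: ip_leray[OF ER v] ip_diff_left E_Lp2 Res_Lp2 v2 ip_Z_left)
qed

lemma ip_Xi_W: "k \<in> {1..n} \<Longrightarrow> ip L (Xi a) (W k) = 0"
proof -
  assume k: "k \<in> {1..n}"
  have s: "(\<Sum>j=1..n. h j * ip L (W j) (W k)) = h k" for h :: "nat \<Rightarrow> real"
  proof -
    have "(\<Sum>j=1..n. h j * ip L (W j) (W k)) = (\<Sum>j=1..n. if j = k then h j else 0)"
      by (intro sum.cong refl) (auto simp: W_orth[OF _ k])
    then show ?thesis using k by simp
  qed
  show ?thesis
    unfolding ip_Xi[OF W_Hsp[OF k]] ip_Res[OF W_Lp2[OF k]] ip_E_W[OF k] s[of "\<lambda>j. (\<mu> * \<kappa> j + \<alpha>) * a j"] s[of "\<lambda>j. G a j + \<eta> * a j"]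
    by (simp add: G_def)
qed

lemma ip_Hsp_Z_zero:
  assumes x: "x \<in> Lp L 2" and o: "\<And>k. k \<in> {1..n} \<Longrightarrow> ip L x (W k) = 0"
  shows "ip L x (Z a) = 0"
  unfolding ip_commute[of L x] ip_Z_left[OF x] using o by (simp add: ip_commute[of L _ x])

lemma Xi_subdiff: "Xi a \<in> subdiff_ind L K (Z a)"
proof -
  have "ip L (Xi a) (\<lambda>s. Z a s - u s) = 0" if u: "u \<in> K" for u
  proof -
    have "ip L (Xi a) (\<lambda>s. Z a s - u s) = ip L (Xi a) (Z (\<lambda>j. a j - coef u j))"
    proof (rule ip_cong_AE)
      show "AE x in torus L. Z a x - u x = Z (\<lambda>j. a j - coef u j) x"
        using K_AE[OF u] by eventually_elim (simp add: Z_diff)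
      show "(\<lambda>s. Z a s - u s) \<in> borel_measurable (torus L)"
        using Lp2_diff[OF Z_Lp2 K_Lp2[OF u]] by (simp add: Lp2_iff)
    qed (use Hsp_Lp2[OF Xi_Hsp] Z_Lp2 in \<open>auto simp: Lp2_iff\<close>)
    then show ?thesis using ip_Hsp_Z_zero[OF Hsp_Lp2[OF Xi_Hsp] ip_Xi_W] by simp
  qed
  then show ?thesis by (simp add: subdiff_ind_def Z_in_K Xi_Hsp)
qed

lemma E_coef_Z: "E (coef (Z a)) = E a"
  by (auto simp: E_def fun_eq_iff coef_Z intro!: sum.cong)

text \<open>All terms are continuous in time, so it suffices to balance them pointwise against the
  derivative of the pairing of the curve with \<open>v\<close>. The term with \<open>Xi\<close>
  supplies the balance in directions outside \<open>K\<close>.\<close>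

lemma weak_identity_galerkin:
  assumes ab: "\<tau> < T"
    and dc: "\<And>k t. k \<in> {1..n} \<Longrightarrow> t \<in> {\<tau>..T} \<Longrightarrow> (c k has_real_derivative (- G (\<lambda>j. c j t) k - \<eta> * c k t)) (at t within {\<tau>..T})"
  shows "weak_identity L \<mu> \<alpha> \<beta> \<gamma> r q \<omega> K R ye \<tau> T (\<lambda>t. Z (\<lambda>j. c j t)) (\<lambda>t. Xi (\<lambda>j. c j t))"
  unfolding weak_identity_def
proof (intro allI impI)
  fix v :: "real \<Rightarrow> 'n vfield" assume v: "solenoidal_test L \<tau> T v"
  let ?I = "{\<tau>..T}"
  have vs: "v s \<in> solenoidal_smooth L" if "s \<in> ?I" for s using v that by (simp add: solenoidal_test_def)
  define v' where "v' s x = vector_derivative (\<lambda>\<sigma>. v \<sigma> x) (at s within ?I)" for s x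
  have v': "(\<lambda>x. vector_derivative (\<lambda>\<sigma>. v \<sigma> x) (at s within ?I)) = v' s" for s by (simp add: v'_def fun_eq_iff)
  have vc: "L2_continuous_on L ?I v" and v'c: "L2_continuous_on L ?I v'"
    and dW: "\<And>w s. w \<in> solenoidal_smooth L \<Longrightarrow> s \<in> ?I \<Longrightarrow> ((\<lambda>s. ip L w (v s)) has_real_derivative ip L w (v' s)) (at s within ?I)"
    using solenoidal_test_L2[OF v ab] unfolding v' by (auto simp: v'_def[abs_def])
  have cc: "continuous_on ?I (c j)" if "j \<in> {1..n}" for j
    by (rule DERIV_continuous_on) (rule dc[OF that])
  define a where "a s = (\<lambda>j. c j s)" for s
  have LL: "L2_continuous_on L ?I (\<lambda>s. F (a s))" if "L2_locally_lipschitz L n F" for F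
    unfolding a_def by (rule L2_continuous_on_lipschitz[OF that cc])
  have W1: "continuous_on ?I (\<lambda>s. ip L (W j) (v s))" if "j \<in> {1..n}" for j
    by (rule continuous_on_ip[OF L2_continuous_on_const[OF W_Lp2[OF that]] vc])
  have cG: "continuous_on ?I (\<lambda>s. ip L (N (a s)) (v s))"
    by (rule continuous_on_ip[OF LL[OF L2_locally_lipschitz_N] vc])
  have cGk: "continuous_on ?I (\<lambda>s. G (a s) j)" if "j \<in> {1..n}" for j
    unfolding G_def a_def
    by (intro continuous_intros cc that continuous_on_ip[OF L2_continuous_on_lipschitz[OF L2_locally_lipschitz_N cc] L2_continuous_on_const[OF W_Lp2[OF that]]])
  define A0 A1 A2 A3 A4 A5 A6 A7 B3 B4 B5 where
    A: "A0 = (\<lambda>s. ip L (Z (a s)) (v' s))" "A1 = (\<lambda>s. grad_ip L (Z (a s)) (v s))" "A2 = (\<lambda>s. ip L (Z (a s)) (v s))"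
      "A3 = (\<lambda>s. ip L (advection L (\<lambda>x. Z (a s) x + ye x)) (v s))"
      "A4 = (\<lambda>s. ip L (absorption r (\<lambda>x. Z (a s) x + ye x)) (v s))"
      "A5 = (\<lambda>s. ip L (absorption q (\<lambda>x. Z (a s) x + ye x)) (v s))"
      "A6 = (\<lambda>s. ip L (feedback_term L \<omega> K R (Z (a s))) (v s))"
      "A7 = (\<lambda>s. ip L (Xi (a s)) (v s))"
      "B3 = (\<lambda>s. ip L (advection L ye) (v s))" "B4 = (\<lambda>s. ip L (absorption r ye) (v s))" "B5 = (\<lambda>s. ip L (absorption q ye) (v s))"
  define C7 where "C7 s = ip L (E (a s)) (v s) - (ip L (N (a s)) (v s) + (\<Sum>j=1..n. (\<mu> * \<kappa> j + \<alpha>) * a s j * ip L (W j) (v s)))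
    + (\<Sum>j=1..n. (G (a s) j + \<eta> * a s j) * ip L (W j) (v s))" for s
  have A7eq: "A7 s = C7 s" if "s \<in> ?I" for s
    using vs[OF that] by (simp add: A C7_def ip_Xi ip_Res solenoidal_smooth_Hsp solenoidal_smoothD(3))
  have A6eq: "A6 s = - ip L (E (a s)) (v s)" if "s \<in> ?I" for s
    unfolding A using ip_feedback_term[OF Z_Lp2 solenoidal_smooth_Hsp[OF vs[OF that]]] by (simp add: E_coef_Z)
  have A1eq: "A1 s = (\<Sum>j=1..n. a s j * \<kappa> j * ip L (W j) (v s))" if "s \<in> ?I" for s
    unfolding A by (rule grad_ip_Z[OF vs[OF that]])
  have A2eq: "A2 s = (\<Sum>j=1..n. a s j * ip L (W j) (v s))" if "s \<in> ?I" for s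
    unfolding A by (rule ip_Z_left[OF solenoidal_smoothD(3)[OF vs[OF that]]])
  have A0eq: "A0 s = (\<Sum>j=1..n. a s j * ip L (W j) (v' s))" if "s \<in> ?I" for s
    unfolding A by (rule ip_Z_left[OF L2_continuous_onD(1)[OF v'c that]])
  have ca: "continuous_on ?I (\<lambda>s. a s j)" if "j \<in> {1..n}" for j using cc[OF that] by (simp add: a_def)
  have c0: "continuous_on ?I A0" unfolding A by (rule continuous_on_ip[OF LL[OF L2_locally_lipschitz_Z] v'c])
  have c1: "continuous_on ?I A1"
    by (rule continuous_on_eq[OF _ A1eq[symmetric]]) (intro continuous_intros ca W1)
  have c2: "continuous_on ?I A2" unfolding A by (rule continuous_on_ip[OF LL[OF L2_locally_lipschitz_Z] vc])
  have c3: "continuous_on ?I A3" unfolding A by (rule continuous_on_ip[OF LL[OF L2_locally_lipschitz_advection] vc])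
  have c4: "continuous_on ?I A4" unfolding A by (rule continuous_on_ip[OF LL[OF L2_locally_lipschitz_absorption[OF r1]] vc])
  have c5: "continuous_on ?I A5" unfolding A by (rule continuous_on_ip[OF LL[OF L2_locally_lipschitz_absorption[OF q1]] vc])
  have cE: "continuous_on ?I (\<lambda>s. ip L (E (a s)) (v s))" by (rule continuous_on_ip[OF LL[OF L2_locally_lipschitz_E] vc])
  have c6: "continuous_on ?I A6"
    by (rule continuous_on_eq[OF _ A6eq[symmetric]]) (intro continuous_intros cE)
  have c7: "continuous_on ?I A7"
    by (rule continuous_on_eq[OF _ A7eq[symmetric]]) (unfold C7_def, intro continuous_intros cE cG ca cGk W1)
  have b3: "continuous_on ?I B3" and b4: "continuous_on ?I B4" and b5: "continuous_on ?I B5"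
    unfolding A by (intro continuous_on_ip[OF L2_continuous_on_const vc] ye_terms_Lp2)+
  \<comment> \<open>The product rule for the pairing \<open>A2\<close>, with the differential
    equation inserted for the derivatives of the coefficients.\<close>
  define P' where "P' s = A0 s + (\<Sum>j=1..n. (- G (a s) j - \<eta> * a s j) * ip L (W j) (v s))" for s
  have dA2: "(A2 has_real_derivative P' s) (at s within ?I)" if s: "s \<in> ?I" for s
  proof -
    have "((\<lambda>s. a s j * ip L (W j) (v s)) has_real_derivative (- G (a s) j - \<eta> * a s j) * ip L (W j) (v s) + ip L (W j) (v' s) * a s j) (at s within ?I)"
      if j: "j \<in> {1..n}" for j
      using DERIV_mult[OF dc[OF j s] dW[OF W_sol[OF j] s]] by (simp add: a_def)
    then have "((\<lambda>s. \<Sum>j=1..n. a s j * ip L (W j) (v s)) has_real_derivative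
        (\<Sum>j=1..n. (- G (a s) j - \<eta> * a s j) * ip L (W j) (v s) + ip L (W j) (v' s) * a s j)) (at s within ?I)"
      by (intro DERIV_sum) auto
    moreover have "(\<Sum>j=1..n. (- G (a s) j - \<eta> * a s j) * ip L (W j) (v s) + ip L (W j) (v' s) * a s j) = P' s"
      unfolding P'_def A0eq[OF s] by (simp add: sum.distrib mult.commute)
    ultimately have d: "((\<lambda>s. \<Sum>j=1..n. a s j * ip L (W j) (v s)) has_real_derivative P' s) (at s within ?I)" by simp
    show ?thesis
      unfolding has_field_derivative_def
      by (rule has_derivative_transform[OF s A2eq d[unfolded has_field_derivative_def]])
  qed
  \<comment> \<open>\<open>A6 + A7\<close> equals minus the pairing with the residual plus the sum
    with factors \<open>G + \<eta> a\<close>. The linear terms and the nonlinear differences add up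
    to the residual and cancel; what is left is minus \<open>P'\<close>.\<close>
  have key: "- A0 s + \<mu> * A1 s + \<alpha> * A2 s + A3 s + \<beta> * A4 s + \<gamma> * A5 s + A6 s + A7 s - B3 s - \<beta> * B4 s - \<gamma> * B5 s = - P' s"
    if s: "s \<in> ?I" for s
  proof -
    have 1: "\<mu> * A1 s + \<alpha> * A2 s = (\<Sum>j=1..n. (\<mu> * \<kappa> j + \<alpha>) * a s j * ip L (W j) (v s))"
      unfolding A1eq[OF s] A2eq[OF s] sum_distrib_left sum.distrib[symmetric]
      by (intro sum.cong refl) (simp add: algebra_simps)
    have 2: "A3 s - B3 s + \<beta> * (A4 s - B4 s) + \<gamma> * (A5 s - B5 s) = ip L (N (a s)) (v s)"
      unfolding A by (rule ip_N[OF solenoidal_smoothD(3)[OF vs[OF s]], symmetric])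
    have 3: "(\<Sum>j=1..n. (- G (a s) j - \<eta> * a s j) * ip L (W j) (v s)) = - (\<Sum>j=1..n. (G (a s) j + \<eta> * a s j) * ip L (W j) (v s))"
      unfolding sum_negf[symmetric] by (intro sum.cong refl) (simp add: algebra_simps)
    show ?thesis
      using 1 2 unfolding P'_def 3 A6eq[OF s] A7eq[OF s] C7_def by (simp add: right_diff_distrib)
  qed
  have int7: "set_integrable lebesgue ?I A7" by (rule set_lebesgue_integral_continuous(1)[OF c7])
  have id: "- (LINT s:{\<tau>..t}|lebesgue. A0 s) + \<mu> * (LINT s:{\<tau>..t}|lebesgue. A1 s) + \<alpha> * (LINT s:{\<tau>..t}|lebesgue. A2 s)
     + (LINT s:{\<tau>..t}|lebesgue. A3 s) + \<beta> * (LINT s:{\<tau>..t}|lebesgue. A4 s) + \<gamma> * (LINT s:{\<tau>..t}|lebesgue. A5 s)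
     + (LINT s:{\<tau>..t}|lebesgue. A6 s) + (LINT s:{\<tau>..t}|lebesgue. A7 s)
     = - A2 t + A2 \<tau> + (LINT s:{\<tau>..t}|lebesgue. B3 s) + \<beta> * (LINT s:{\<tau>..t}|lebesgue. B4 s) + \<gamma> * (LINT s:{\<tau>..t}|lebesgue. B5 s)"
    if t: "t \<in> ?I" for t
  proof -
    have sub: "{\<tau>..t} \<subseteq> ?I" using t by auto
    have hi: "(h has_integral (LINT s:{\<tau>..t}|lebesgue. h s)) {\<tau>..t}" if "continuous_on ?I h" for h :: "real \<Rightarrow> real"
      using set_lebesgue_integral_continuous(2)[OF continuous_on_subset[OF that sub]]
        integrable_continuous_real[OF continuous_on_subset[OF that sub]] by (simp add: integrable_integral)
    have "((\<lambda>s. - A0 s + \<mu> * A1 s + \<alpha> * A2 s + A3 s + \<beta> * A4 s + \<gamma> * A5 s + A6 s + A7 s - B3 s - \<beta> * B4 s - \<gamma> * B5 s) has_integral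
      (- (LINT s:{\<tau>..t}|lebesgue. A0 s) + \<mu> * (LINT s:{\<tau>..t}|lebesgue. A1 s) + \<alpha> * (LINT s:{\<tau>..t}|lebesgue. A2 s)
     + (LINT s:{\<tau>..t}|lebesgue. A3 s) + \<beta> * (LINT s:{\<tau>..t}|lebesgue. A4 s) + \<gamma> * (LINT s:{\<tau>..t}|lebesgue. A5 s)
     + (LINT s:{\<tau>..t}|lebesgue. A6 s) + (LINT s:{\<tau>..t}|lebesgue. A7 s)
     - (LINT s:{\<tau>..t}|lebesgue. B3 s) - \<beta> * (LINT s:{\<tau>..t}|lebesgue. B4 s) - \<gamma> * (LINT s:{\<tau>..t}|lebesgue. B5 s))) {\<tau>..t}"
      by (intro has_integral_add has_integral_diff has_integral_neg has_integral_mult_right hi c0 c1 c2 c3 c4 c5 c6 c7 b3 b4 b5)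
    moreover have "((\<lambda>s. - A0 s + \<mu> * A1 s + \<alpha> * A2 s + A3 s + \<beta> * A4 s + \<gamma> * A5 s + A6 s + A7 s - B3 s - \<beta> * B4 s - \<gamma> * B5 s) has_integral - (A2 t - A2 \<tau>)) {\<tau>..t}"
    proof (rule has_integral_eq)
      show "((\<lambda>s. - P' s) has_integral - (A2 t - A2 \<tau>)) {\<tau>..t}"
      proof (intro has_integral_neg fundamental_theorem_of_calculus)
        fix s assume "s \<in> {\<tau>..t}"
        then show "(A2 has_vector_derivative P' s) (at s within {\<tau>..t})"
          using dA2[of s] sub has_field_derivative_subset[OF _ sub] unfolding has_real_derivative_iff_has_vector_derivative[symmetric] by blast
      qed (use t in simp)
      show "- P' s = - A0 s + \<mu> * A1 s + \<alpha> * A2 s + A3 s + \<beta> * A4 s + \<gamma> * A5 s + A6 s + A7 s - B3 s - \<beta> * B4 s - \<gamma> * B5 s"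
        if "s \<in> {\<tau>..t}" for s using key[of s] that sub by auto
    qed
    ultimately have "- (A2 t - A2 \<tau>) = - (LINT s:{\<tau>..t}|lebesgue. A0 s) + \<mu> * (LINT s:{\<tau>..t}|lebesgue. A1 s) + \<alpha> * (LINT s:{\<tau>..t}|lebesgue. A2 s)
     + (LINT s:{\<tau>..t}|lebesgue. A3 s) + \<beta> * (LINT s:{\<tau>..t}|lebesgue. A4 s) + \<gamma> * (LINT s:{\<tau>..t}|lebesgue. A5 s)
     + (LINT s:{\<tau>..t}|lebesgue. A6 s) + (LINT s:{\<tau>..t}|lebesgue. A7 s)
     - (LINT s:{\<tau>..t}|lebesgue. B3 s) - \<beta> * (LINT s:{\<tau>..t}|lebesgue. B4 s) - \<gamma> * (LINT s:{\<tau>..t}|lebesgue. B5 s)"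
      using has_integral_unique by blast
    then show ?thesis by linarith
  qed
  show "set_integrable lebesgue {\<tau>..T} (\<lambda>s. ip L (Xi (\<lambda>j. c j s)) (v s)) \<and>
    (\<forall>t\<in>{\<tau>..T}. - (LINT s:{\<tau>..t}|lebesgue. ip L (Z (\<lambda>j. c j s)) (\<lambda>x. vector_derivative (\<lambda>\<sigma>. v \<sigma> x) (at s within {\<tau>..T})))
           + \<mu> * (LINT s:{\<tau>..t}|lebesgue. grad_ip L (Z (\<lambda>j. c j s)) (v s))
           + \<alpha> * (LINT s:{\<tau>..t}|lebesgue. ip L (Z (\<lambda>j. c j s)) (v s))
           + (LINT s:{\<tau>..t}|lebesgue. ip L (advection L (\<lambda>x. Z (\<lambda>j. c j s) x + ye x)) (v s))
           + \<beta> * (LINT s:{\<tau>..t}|lebesgue. ip L (absorption r (\<lambda>x. Z (\<lambda>j. c j s) x + ye x)) (v s))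
           + \<gamma> * (LINT s:{\<tau>..t}|lebesgue. ip L (absorption q (\<lambda>x. Z (\<lambda>j. c j s) x + ye x)) (v s))
           + (LINT s:{\<tau>..t}|lebesgue. ip L (feedback_term L \<omega> K R (Z (\<lambda>j. c j s))) (v s))
           + (LINT s:{\<tau>..t}|lebesgue. ip L (Xi (\<lambda>j. c j s)) (v s))
           = - ip L (Z (\<lambda>j. c j t)) (v t) + ip L (Z (\<lambda>j. c j \<tau>)) (v \<tau>)
           + (LINT s:{\<tau>..t}|lebesgue. ip L (advection L ye) (v s))
           + \<beta> * (LINT s:{\<tau>..t}|lebesgue. ip L (absorption r ye) (v s))
           + \<gamma> * (LINT s:{\<tau>..t}|lebesgue. ip L (absorption q ye) (v s)))"
    using int7 id unfolding A a_def v' by blast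
qed

end

text \<open>The space \<open>X\<close> and the norm \<open>N\<close> are kept abstract so that one
  proof serves \<open>Vsp\<close>, \<open>Lpsp\<close>, \<open>Hsp\<close> and the dual of
  \<open>Vsp\<close>. Strong measurability comes from freezing the curve at the points of finer and
  finer grids.\<close>

lemma Lp_time_curve:
  fixes \<Phi> :: "(nat \<Rightarrow> real) \<Rightarrow> 'x \<Rightarrow> 'y::real_normed_vector" and c :: "nat \<Rightarrow> real \<Rightarrow> real"
  assumes ab: "a < b" and p: "p > 0" and c: "\<And>j. j \<in> {1..n} \<Longrightarrow> continuous_on {a..b} (c j)"
    and X: "\<And>e. \<Phi> e \<in> X" and diff: "\<And>e f x. \<Phi> e x - \<Phi> f x = \<Phi> (\<lambda>j. e j - f j) x"
    and cont: "\<And>e S. (\<And>j. j \<in> {1..n} \<Longrightarrow> continuous_on S (e j)) \<Longrightarrow> continuous_on S (\<lambda>t::real. N (\<Phi> (\<lambda>j. e j t)))"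
    and N0: "N (\<Phi> (\<lambda>_. 0)) = 0" and Nn: "\<And>e. N (\<Phi> e) \<ge> 0"
  shows "(\<lambda>t. \<Phi> (\<lambda>j. c j t)) \<in> Lp_time a b p X N"
  unfolding Lp_time_def mem_Collect_eq
proof (intro conjI AE_I2 X)
  define i where "i k t = \<lfloor>real (Suc k) * ((t - a) / (b - a))\<rfloor>" for k and t :: real
  define y where "y k m = a + (b - a) * (real_of_int m / real (Suc k))" for k and m :: int
  have it: "0 \<le> i k t \<and> i k t \<le> int (Suc k)" if "t \<in> {a<..<b}" for k t
  proof -
    have "0 \<le> (t - a) / (b - a)" "(t - a) / (b - a) \<le> 1" using that ab by auto
    then have "0 \<le> real (Suc k) * ((t - a) / (b - a))" "real (Suc k) * ((t - a) / (b - a)) \<le> real (Suc k) * 1"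
      by (intro mult_nonneg_nonneg mult_left_mono; simp)+
    moreover have "0 \<le> \<lfloor>x\<rfloor> \<and> \<lfloor>x\<rfloor> \<le> int m" if "0 \<le> x" "x \<le> real m * 1" for x m
      using that by (simp add: floor_le_iff)
    ultimately show ?thesis unfolding i_def by blast
  qed
  have y_in: "y k (i k t) \<in> {a..b}" if "t \<in> {a<..<b}" for k t
  proof -
    have "0 \<le> real_of_int (i k t) / real (Suc k)" "real_of_int (i k t) / real (Suc k) \<le> 1"
      using it[OF that, of k] by (auto simp: field_simps)
    then have "0 \<le> (b - a) * (real_of_int (i k t) / real (Suc k))" "(b - a) * (real_of_int (i k t) / real (Suc k)) \<le> (b - a) * 1"
      using ab by (intro mult_nonneg_nonneg mult_left_mono; simp)+
    then show ?thesis by (simp add: y_def)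
  qed
  have y_lim: "(\<lambda>k. y k (i k t)) \<longlonglongrightarrow> t" for t
  proof -
    let ?u = "(t - a) / (b - a)"
    have bd: "\<bar>real_of_int (i k t) / real (Suc k) - ?u\<bar> \<le> 1 / real (Suc k)" for k
    proof -
      have "\<bar>real_of_int (i k t) - real (Suc k) * ?u\<bar> \<le> 1" unfolding i_def by linarith
      then have "\<bar>real_of_int (i k t) - real (Suc k) * ?u\<bar> / real (Suc k) \<le> 1 / real (Suc k)"
        by (intro divide_right_mono) auto
      moreover have "\<bar>real_of_int (i k t) - real (Suc k) * ?u\<bar> / real (Suc k) = \<bar>real_of_int (i k t) / real (Suc k) - ?u\<bar>"
        by (subst abs_div_pos) (auto simp: diff_divide_distrib)
      ultimately show ?thesis by simp
    qed
    have "(\<lambda>k. real_of_int (i k t) / real (Suc k) - ?u) \<longlonglongrightarrow> 0"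
    proof (rule Lim_null_comparison)
      show "\<forall>\<^sub>F k in sequentially. norm (real_of_int (i k t) / real (Suc k) - ?u) \<le> inverse (real (Suc k))"
        using bd by (simp add: inverse_eq_divide)
      show "(\<lambda>k. inverse (real (Suc k))) \<longlonglongrightarrow> 0" by (rule LIMSEQ_inverse_real_of_nat)
    qed
    then have "(\<lambda>k. real_of_int (i k t) / real (Suc k)) \<longlonglongrightarrow> ?u" by (rule LIM_zero_cancel)
    then have "(\<lambda>k. y k (i k t)) \<longlonglongrightarrow> a + (b - a) * ?u"
      unfolding y_def by (intro tendsto_add tendsto_const tendsto_mult_left)
    then show ?thesis using ab by simp
  qed
  define s where "s k t = \<Phi> (\<lambda>j. c j (y k (i k t)))" for k t
  show "\<exists>s. (\<forall>k::nat. simple_function (lebesgue_on {a<..<b}) (s k) \<and> (\<forall>t. s k t \<in> X)) \<and>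
          (AE t in lebesgue_on {a<..<b}. (\<lambda>k. N (\<lambda>x. \<Phi> (\<lambda>j. c j t) x - s k t x)) \<longlonglongrightarrow> 0)"
  proof (intro exI[of _ s] conjI allI AE_I2)
    fix k
    have "simple_function (lebesgue_on {a<..<b}) (i k)"
      unfolding simple_function_def
    proof (intro conjI ballI)
      show "finite (i k ` space (lebesgue_on {a<..<b}))"
        by (rule finite_subset[of _ "{0..int (Suc k)}"]) (use it[of _ k] in auto)
      fix m
      have "i k \<in> measurable borel (count_space UNIV)" unfolding i_def by measurable
      then have "i k -` {m} \<inter> space borel \<in> sets borel" by (rule measurable_sets) auto
      then have "i k -` {m} \<in> sets lebesgue" by (intro sets_completionI_sets) simp
      then show "i k -` {m} \<inter> space (lebesgue_on {a<..<b}) \<in> sets (lebesgue_on {a<..<b})"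
        by (auto simp: sets_restrict_space)
    qed
    then have "simple_function (lebesgue_on {a<..<b}) ((\<lambda>m. \<Phi> (\<lambda>j. c j (y k m))) \<circ> i k)" by (rule simple_function_compose)
    then show "simple_function (lebesgue_on {a<..<b}) (s k)" by (simp add: s_def[abs_def] o_def)
    show "s k t \<in> X" for t unfolding s_def by (rule X)
  next
    fix t assume "t \<in> space (lebesgue_on {a<..<b})"
    then have t: "t \<in> {a<..<b}" by simp
    define g where "g u = N (\<Phi> (\<lambda>j. c j t - c j u))" for u
    have "continuous_on {a..b} g" unfolding g_def by (rule cont) (intro continuous_intros c)
    then have "(\<lambda>k. g (y k (i k t))) \<longlonglongrightarrow> g t"
      using y_in[OF t] y_lim[of t] t unfolding continuous_on_sequentially by (auto simp: o_def)
    then show "(\<lambda>k. N (\<lambda>x. \<Phi> (\<lambda>j. c j t) x - s k t x)) \<longlonglongrightarrow> 0"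
      unfolding s_def diff g_def by (simp add: N0)
  qed
  have "continuous_on {a..b} (\<lambda>t. N (\<Phi> (\<lambda>j. c j t)) powr p)"
    by (intro continuous_on_powr' cont c continuous_on_const) (use Nn p in auto)
  then have "set_integrable lebesgue {a..b} (\<lambda>t. N (\<Phi> (\<lambda>j. c j t)) powr p)"
    by (rule set_lebesgue_integral_continuous(1))
  then have "set_integrable lebesgue {a<..<b} (\<lambda>t. N (\<Phi> (\<lambda>j. c j t)) powr p)"
    by (rule set_integrable_subset) auto
  then show "integrable (lebesgue_on {a<..<b}) (\<lambda>t. N (\<Phi> (\<lambda>j. c j t)) powr p)"
    by (simp add: integrable_restrict_space set_integrable_def)
qed

lemma integral_by_parts_compact_support:
  fixes \<phi> f f' :: "real \<Rightarrow> real"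
  assumes ab: "a < b" and \<phi>: "smooth_on UNIV \<phi>" "a < c" "d < b" "\<And>s. s \<notin> {c..d} \<Longrightarrow> \<phi> s = 0"
    and f: "\<And>s. s \<in> {a..b} \<Longrightarrow> (f has_real_derivative f' s) (at s within {a..b})" and f': "continuous_on {a..b} f'"
  shows "(LINT s:{a..b}|lebesgue. deriv \<phi> s * f s) = - (LINT s:{a..b}|lebesgue. \<phi> s * f' s)"
proof -
  have d\<phi>: "(\<phi> has_real_derivative frechet_derivative \<phi> (at s) 1) (at s)" for s
  proof -
    have "frechet_derivative \<phi> (at s) h = frechet_derivative \<phi> (at s) 1 * h" for h
      using linear_cmul[OF has_derivative_linear[OF smooth_has_derivative[OF \<phi>(1), of s]], of h 1] by (simp add: mult.commute)
    then have "frechet_derivative \<phi> (at s) = (*) (frechet_derivative \<phi> (at s) 1)" by (rule ext)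
    then show ?thesis using smooth_has_derivative[OF \<phi>(1), of s] unfolding has_field_derivative_def by metis
  qed
  have de: "deriv \<phi> s = frechet_derivative \<phi> (at s) 1" for s by (rule DERIV_imp_deriv[OF d\<phi>])
  have cd: "continuous_on S (deriv \<phi>)" for S
    unfolding de[abs_def] by (rule smooth_continuous[OF smooth_partial[OF \<phi>(1)]]) simp
  have c\<phi>: "continuous_on S \<phi>" for S by (rule smooth_continuous[OF \<phi>(1)])
  have cf: "continuous_on {a..b} f" by (rule DERIV_continuous_on) (rule f)
  have "((\<lambda>s. deriv \<phi> s * f s + \<phi> s * f' s) has_integral (\<phi> b * f b - \<phi> a * f a)) {a..b}"
  proof (rule fundamental_theorem_of_calculus)
    fix s assume s: "s \<in> {a..b}"
    have "((\<lambda>s. \<phi> s * f s) has_real_derivative deriv \<phi> s * f s + f' s * \<phi> s) (at s within {a..b})"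
      using DERIV_mult[OF has_field_derivative_at_within[OF d\<phi>] f[OF s]] by (simp add: de)
    then show "((\<lambda>s. \<phi> s * f s) has_vector_derivative deriv \<phi> s * f s + \<phi> s * f' s) (at s within {a..b})"
      by (simp add: has_real_derivative_iff_has_vector_derivative mult.commute)
  qed (use ab in simp)
  moreover have "\<phi> a = 0" "\<phi> b = 0" using \<phi> by auto
  ultimately have z: "integral {a..b} (\<lambda>s. deriv \<phi> s * f s + \<phi> s * f' s) = 0" by (simp add: integral_unique)
  have c1: "continuous_on {a..b} (\<lambda>s. deriv \<phi> s * f s)" and c2: "continuous_on {a..b} (\<lambda>s. \<phi> s * f' s)"
    by (intro continuous_intros cd c\<phi> cf f')+
  have "integral {a..b} (\<lambda>s. deriv \<phi> s * f s + \<phi> s * f' s) = integral {a..b} (\<lambda>s. deriv \<phi> s * f s) + integral {a..b} (\<lambda>s. \<phi> s * f' s)"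
    by (intro Henstock_Kurzweil_Integration.integral_add integrable_continuous_real c1 c2)
  then show ?thesis using z by (simp add: set_lebesgue_integral_continuous(2)[OF c1] set_lebesgue_integral_continuous(2)[OF c2])
qed

section \<open>Regularity and time derivatives of curves in the Galerkin space\<close>

context galerkin
begin

lemma norm_Lp2_le_H1: "norm_Lp L 2 g \<le> norm_H1 L g"
  unfolding norm_H1_def by (intro real_le_rsqrt) (auto intro: sum_nonneg)

lemma continuous_norm_Z:
  "(\<And>j. j \<in> {1..n} \<Longrightarrow> continuous_on S (e j)) \<Longrightarrow> continuous_on S (\<lambda>t::real. norm_Lp L 2 (Z (\<lambda>j. e j t)))"
  unfolding norm_Z by (intro continuous_intros) auto

text \<open>The squared \<open>L2\<close> norm of each weak derivative of \<open>Z a\<close> is a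
  quadratic form in the coefficients.\<close>

lemma continuous_norm_H1_Z:
  assumes e: "\<And>j. j \<in> {1..n} \<Longrightarrow> continuous_on S (e j)"
  shows "continuous_on S (\<lambda>t::real. norm_H1 L (Z (\<lambda>j. e j t)))"
proof -
  let ?w = "\<lambda>i j. wpartial L i (W j)"
  have "(norm_Lp L 2 (wpartial L i (Z a)))\<^sup>2 = (\<Sum>j=1..n. a j * (\<Sum>l=1..n. a l * ip L (?w i j) (?w i l)))" for a i
  proof -
    have wm: "?w i j \<in> Lp L 2" if "j \<in> {1..n}" for j by (rule H1_wpartial(1)[OF W_H1[OF that]])
    have m: "(\<lambda>x. \<Sum>j=1..n. a j *\<^sub>R ?w i j x) \<in> Lp L 2" by (intro Lp2_sum Lp2_scaleR wm)
    have "norm_Lp L 2 (wpartial L i (Z a)) = norm_Lp L 2 (\<lambda>x. \<Sum>j=1..n. a j *\<^sub>R ?w i j x)"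
      by (rule norm_Lp2_cong_AE) (use m H1_wpartial(1)[OF Z_H1] wpartial_Z in \<open>auto simp: Lp2_iff\<close>)
    then have "(norm_Lp L 2 (wpartial L i (Z a)))\<^sup>2 = ip L (\<lambda>x. \<Sum>j=1..n. a j *\<^sub>R ?w i j x) (\<lambda>x. \<Sum>l=1..n. a l *\<^sub>R ?w i l x)"
      by (simp add: ip_self)
    also have "\<dots> = (\<Sum>j=1..n. ip L (\<lambda>x. a j *\<^sub>R ?w i j x) (\<lambda>x. \<Sum>l=1..n. a l *\<^sub>R ?w i l x))"
      by (rule ip_sum_left) (intro Lp2_scaleR wm, assumption, rule m)
    also have "\<dots> = (\<Sum>j=1..n. a j * (\<Sum>l=1..n. ip L (?w i j) (\<lambda>x. a l *\<^sub>R ?w i l x)))"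
    proof (rule sum.cong[OF refl])
      fix j assume j: "j \<in> {1..n}"
      have "ip L (?w i j) (\<lambda>x. \<Sum>l=1..n. a l *\<^sub>R ?w i l x) = (\<Sum>l=1..n. ip L (?w i j) (\<lambda>x. a l *\<^sub>R ?w i l x))"
        by (rule ip_sum_right) (intro Lp2_scaleR wm, assumption, rule wm[OF j])
      then show "ip L (\<lambda>x. a j *\<^sub>R ?w i j x) (\<lambda>x. \<Sum>l=1..n. a l *\<^sub>R ?w i l x) = a j * (\<Sum>l=1..n. ip L (?w i j) (\<lambda>x. a l *\<^sub>R ?w i l x))"
        by (simp add: ip_scaleR_left)
    qed
    finally show ?thesis by (simp add: ip_scaleR_right)
  qed
  then show ?thesis
    unfolding norm_H1_def by (simp only:) (intro continuous_intros e continuous_norm_Z)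
qed

lemma continuous_norm_Lp_Z:
  assumes p: "p > 0" and e: "\<And>j. j \<in> {1..n} \<Longrightarrow> continuous_on S (e j)"
  shows "continuous_on S (\<lambda>t::real. norm_Lp L p (Z (\<lambda>j. e j t)))"
proof -
  have cW: "continuous_on UNIV (W j)" if "j \<in> {1..n}" for j
    by (rule smooth_continuous[OF solenoidal_smoothD(1)[OF W_sol[OF that]]])
  have 1: "continuous_on (S \<times> cell L) (\<lambda>p. e j (fst p))" if "j \<in> {1..n}" for j
    by (rule continuous_on_compose2[OF e[OF that] continuous_on_fst[OF continuous_on_id]]) auto
  have 2: "continuous_on (S \<times> cell L) (\<lambda>p. W j (snd p))" if "j \<in> {1..n}" for j
    by (rule continuous_on_compose2[OF cW[OF that] continuous_on_snd[OF continuous_on_id]]) auto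
  have "continuous_on (S \<times> cell L) (\<lambda>q. norm (Z (\<lambda>j. e j (fst q)) (snd q)) powr p)"
    unfolding Z_def by (intro continuous_on_powr' continuous_intros 1 2) (use p in auto)
  then have "continuous_on S (\<lambda>t. integral (cell L) (\<lambda>x. norm (Z (\<lambda>j. e j t) x) powr p))"
    by (intro integral_continuous_on_param) (simp add: case_prod_beta')
  moreover have "(LINT x|torus L. norm (Z a x) powr p) = integral (cell L) (\<lambda>x. norm (Z a x) powr p)" for a
  proof (rule integral_torus_eq_integral[OF integrable_torus_continuous])
    show "continuous_on UNIV (\<lambda>x. norm (Z a x) powr p)"
      by (intro continuous_on_powr' continuous_intros smooth_continuous[OF solenoidal_smoothD(1)[OF Z_solenoidal]]) (use p in auto)
  qed
  ultimately have c: "continuous_on S (\<lambda>t. LINT x|torus L. norm (Z (\<lambda>j. e j t) x) powr p)" by simp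
  show ?thesis
    unfolding norm_Lp_on_def by (intro continuous_on_powr' c continuous_on_const) (use p in \<open>auto intro!: integral_nonneg_AE\<close>)
qed

text \<open>The functional given by pairing with \<open>Z a\<close>. Written as a sum, it is linear
  in \<open>a\<close> at every argument, also at fields outside \<open>L2\<close>, as the rule for
  differences in \<open>Lp_time_curve\<close> demands.\<close>

definition dual_Z :: "(nat \<Rightarrow> real) \<Rightarrow> 'n vfield \<Rightarrow> real" where
  "dual_Z a v = (\<Sum>j=1..n. a j * ip L (W j) v)"

lemma Vsp_Lp2: "u \<in> Vsp L \<Longrightarrow> u \<in> Lp L 2"
  by (rule Hsp_Lp2[OF Vsp_Hsp])

lemma dual_Z_le:
  assumes u: "u \<in> Vsp L"
  shows "\<bar>dual_Z a u\<bar> \<le> (\<Sum>j=1..n. \<bar>a j\<bar>) * norm_H1 L u"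
proof -
  have "\<bar>dual_Z a u\<bar> \<le> (\<Sum>j=1..n. \<bar>a j\<bar> * \<bar>ip L (W j) u\<bar>)"
    unfolding dual_Z_def by (rule order_trans[OF sum_abs]) (simp add: abs_mult)
  also have "\<dots> \<le> (\<Sum>j=1..n. \<bar>a j\<bar> * norm_H1 L u)"
  proof (intro sum_mono mult_left_mono)
    fix j assume j: "j \<in> {1..n}"
    show "\<bar>ip L (W j) u\<bar> \<le> norm_H1 L u"
      using Lp2_integrable_ip(2)[OF W_Lp2[OF j] Vsp_Lp2[OF u]] norm_Lp2_le_H1[of u] by (simp add: norm_W[OF j])
  qed simp
  finally show ?thesis by (simp add: sum_distrib_right)
qed

lemma dual_Z_Vdual: "dual_Z a \<in> Vdual L"
  unfolding Vdual_def mem_Collect_eq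
proof (intro conjI ballI allI)
  fix u v :: "'n vfield" and c d assume uv: "u \<in> Vsp L" "v \<in> Vsp L"
  have "ip L (W j) (\<lambda>x. c *\<^sub>R u x + d *\<^sub>R v x) = c * ip L (W j) u + d * ip L (W j) v" if "j \<in> {1..n}" for j
    using uv that by (simp add: ip_add_right Lp2_scaleR Vsp_Lp2 W_Lp2 ip_scaleR_right)
  then have "dual_Z a (\<lambda>x. c *\<^sub>R u x + d *\<^sub>R v x) = (\<Sum>j=1..n. a j * (c * ip L (W j) u + d * ip L (W j) v))"
    unfolding dual_Z_def by (intro sum.cong refl) simp
  then show "dual_Z a (\<lambda>x. c *\<^sub>R u x + d *\<^sub>R v x) = c * dual_Z a u + d * dual_Z a v"
    by (simp add: dual_Z_def distrib_left sum.distrib sum_distrib_left mult_ac)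
next
  show "\<exists>C. \<forall>u\<in>Vsp L. \<bar>dual_Z a u\<bar> \<le> C * norm_H1 L u" using dual_Z_le by blast
qed

lemma zero_in_unit_ball: "(\<lambda>x. 0 :: real^'n) \<in> {u \<in> Vsp L. norm_H1 L u \<le> 1}"
  by (simp add: solenoidal_smooth_Vsp[OF L solenoidal_smooth_zero] norm_H1_zero[OF L])

lemma dual_Z_unit: "u \<in> {u \<in> Vsp L. norm_H1 L u \<le> 1} \<Longrightarrow> \<bar>dual_Z a u\<bar> \<le> (\<Sum>j=1..n. \<bar>a j\<bar>)"
  using dual_Z_le[of u a] mult_left_mono[of "norm_H1 L u" 1 "\<Sum>j=1..n. \<bar>a j\<bar>"] by (simp add: sum_nonneg)

text \<open>The real supremum in \<open>norm_Vdual\<close> is meaningful only for a bounded nonempty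
  set; the zero field provides the nonemptiness.\<close>

lemma norm_Vdual_bdd: "bdd_above ((\<lambda>u. \<bar>dual_Z a u\<bar>) ` {u \<in> Vsp L. norm_H1 L u \<le> 1})"
  using dual_Z_unit by (intro bdd_aboveI2)

lemma norm_Vdual_nonneg: "norm_Vdual L (dual_Z a) \<ge> 0"
  unfolding norm_Vdual_def by (rule cSUP_upper2[OF norm_Vdual_bdd zero_in_unit_ball]) simp

lemma norm_Vdual_diff: "norm_Vdual L (dual_Z a) \<le> norm_Vdual L (dual_Z b) + (\<Sum>j=1..n. \<bar>a j - b j\<bar>)"
  unfolding norm_Vdual_def[of L "dual_Z a"]
proof (rule cSUP_least)
  fix u :: "'n vfield" assume u: "u \<in> {u \<in> Vsp L. norm_H1 L u \<le> 1}"
  have "dual_Z a u = dual_Z b u + dual_Z (\<lambda>j. a j - b j) u"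
    by (simp add: dual_Z_def left_diff_distrib sum_subtractf)
  then have "\<bar>dual_Z a u\<bar> \<le> \<bar>dual_Z b u\<bar> + \<bar>dual_Z (\<lambda>j. a j - b j) u\<bar>" by simp
  moreover have "\<bar>dual_Z b u\<bar> \<le> norm_Vdual L (dual_Z b)"
    unfolding norm_Vdual_def by (rule cSUP_upper[OF u norm_Vdual_bdd])
  moreover have "\<bar>dual_Z (\<lambda>j. a j - b j) u\<bar> \<le> (\<Sum>j=1..n. \<bar>a j - b j\<bar>)" by (rule dual_Z_unit[OF u])
  ultimately show "\<bar>dual_Z a u\<bar> \<le> norm_Vdual L (dual_Z b) + (\<Sum>j=1..n. \<bar>a j - b j\<bar>)" by linarith
qed (use zero_in_unit_ball in blast)

lemma continuous_norm_Vdual: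
  assumes e: "\<And>j. j \<in> {1..n} \<Longrightarrow> continuous_on S (e j)"
  shows "continuous_on S (\<lambda>t::real. norm_Vdual L (dual_Z (\<lambda>j. e j t)))"
  unfolding continuous_on_def
proof
  fix t assume t: "t \<in> S"
  have "((\<lambda>s. norm_Vdual L (dual_Z (\<lambda>j. e j s)) - norm_Vdual L (dual_Z (\<lambda>j. e j t))) \<longlongrightarrow> 0) (at t within S)"
  proof (rule Lim_null_comparison)
    have "norm (norm_Vdual L (dual_Z (\<lambda>j. e j s)) - norm_Vdual L (dual_Z (\<lambda>j. e j t))) \<le> (\<Sum>j=1..n. \<bar>e j s - e j t\<bar>)" for s
      using norm_Vdual_diff[of "\<lambda>j. e j s" "\<lambda>j. e j t"] norm_Vdual_diff[of "\<lambda>j. e j t" "\<lambda>j. e j s"]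
      by (simp add: abs_minus_commute abs_le_iff)
    then show "\<forall>\<^sub>F s in at t within S. norm (norm_Vdual L (dual_Z (\<lambda>j. e j s)) - norm_Vdual L (dual_Z (\<lambda>j. e j t))) \<le> (\<Sum>j=1..n. \<bar>e j s - e j t\<bar>)"
      by simp
    have "((\<lambda>s. \<Sum>j=1..n. \<bar>e j s - e j t\<bar>) \<longlongrightarrow> (\<Sum>j=1..n. \<bar>e j t - e j t\<bar>)) (at t within S)"
      using e t by (intro tendsto_intros) (auto simp: continuous_on_def)
    then show "((\<lambda>s. \<Sum>j=1..n. \<bar>e j s - e j t\<bar>) \<longlongrightarrow> 0) (at t within S)" by simp
  qed
  then show "((\<lambda>s. norm_Vdual L (dual_Z (\<lambda>j. e j s))) \<longlongrightarrow> norm_Vdual L (dual_Z (\<lambda>j. e j t))) (at t within S)" by (rule LIM_zero_cancel)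
qed

lemma curve_regularity:
  assumes T: "T > 0" and p: "r \<ge> 1" and c: "\<And>j. j \<in> {1..n} \<Longrightarrow> continuous_on {0..T} (c j)"
  shows "regularity_class L r T (\<lambda>t. Z (\<lambda>j. c j t))"
  unfolding regularity_class_def
proof (intro conjI)
  show "(\<lambda>t. Z (\<lambda>j. c j t)) \<in> C_time T (Hsp L) (norm_Lp L 2)"
    using L2_continuous_on_lipschitz[OF L2_locally_lipschitz_Z c]
    by (auto simp: C_time_def L2_continuous_on_def Z_Hsp)
  show "(\<lambda>t. Z (\<lambda>j. c j t)) \<in> Lp_time 0 T 2 (Vsp L) (norm_H1 L)"
    by (rule Lp_time_curve[OF T _ c])
      (auto intro!: solenoidal_smooth_Vsp L Z_solenoidal continuous_norm_H1_Z order_trans[OF norm_Lp_nonneg norm_Lp2_le_H1]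
        simp: Z_diff Z_zero norm_H1_zero[OF L])
  have N0: "norm_Lp L (r + 1) (\<lambda>x. 0 :: real^'n) = 0" using p by (simp add: norm_Lp_on_def)
  show "(\<lambda>t. Z (\<lambda>j. c j t)) \<in> Lp_time 0 T (r + 1) (Lpsp L (r + 1)) (norm_Lp L (r + 1))"
    by (rule Lp_time_curve[OF T _ c])
      (use p in \<open>auto intro!: solenoidal_smooth_Lpsp Z_solenoidal continuous_norm_Lp_Z norm_Lp_nonneg simp: Z_diff Z_zero N0\<close>)
qed

lemma curve_time_derivative:
  assumes ab: "a < b" and p: "p > 0"
    and dc: "\<And>k t. k \<in> {1..n} \<Longrightarrow> t \<in> {a..b} \<Longrightarrow> (c k has_real_derivative c' k t) (at t within {a..b})"
    and cc': "\<And>k. k \<in> {1..n} \<Longrightarrow> continuous_on {a..b} (c' k)"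
  shows "time_derivative_in_Lp_H L a b p (\<lambda>t. Z (\<lambda>j. c j t))"
    and "time_derivative_in_Lp_Vdual L a b p (\<lambda>t. Z (\<lambda>j. c j t))"
proof -
  have parts: "(LINT s:{a..b}|lebesgue. deriv \<phi> s * ip L (Z (\<lambda>j. c j s)) v) = - (LINT s:{a..b}|lebesgue. \<phi> s * dual_Z (\<lambda>j. c' j s) v)"
    if v: "v \<in> Lp L 2" and \<phi>: "smooth_on UNIV \<phi>" "\<exists>c d. a < c \<and> d < b \<and> (\<forall>s. s \<notin> {c..d} \<longrightarrow> \<phi> s = 0)" for v :: "'n vfield" and \<phi> :: "real \<Rightarrow> real"
  proof -
    obtain x y where xy: "a < x" "y < b" "\<And>s. s \<notin> {x..y} \<Longrightarrow> \<phi> s = 0" using \<phi>(2) by blast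
    show ?thesis unfolding ip_Z_left[OF v] dual_Z_def
    proof (rule integral_by_parts_compact_support[OF ab \<phi>(1) xy])
      show "((\<lambda>s. \<Sum>j=1..n. c j s * ip L (W j) v) has_real_derivative (\<Sum>j=1..n. c' j s * ip L (W j) v)) (at s within {a..b})" if "s \<in> {a..b}" for s
        using dc that by (intro DERIV_sum DERIV_cmult_right) auto
      show "continuous_on {a..b} (\<lambda>s. \<Sum>j=1..n. c' j s * ip L (W j) v)" by (intro continuous_intros cc')
    qed
  qed
  show "time_derivative_in_Lp_H L a b p (\<lambda>t. Z (\<lambda>j. c j t))"
    unfolding time_derivative_in_Lp_H_def has_weak_time_derivative_def
  proof (intro bexI[of _ "\<lambda>t. Z (\<lambda>j. c' j t)"] ballI allI impI)
    show "(\<lambda>t. Z (\<lambda>j. c' j t)) \<in> Lp_time a b p (Hsp L) (norm_Lp L 2)"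
      by (rule Lp_time_curve[OF ab p cc'])
        (auto intro!: Z_Hsp continuous_norm_Z[unfolded norm_Z] simp: Z_diff norm_Z sum_nonneg)
    fix v :: "'n vfield" and \<phi> :: "real \<Rightarrow> real" assume v: "v \<in> Hsp L" and \<phi>: "smooth_on UNIV \<phi> \<and> (\<exists>c d. a < c \<and> d < b \<and> (\<forall>s. s \<notin> {c..d} \<longrightarrow> \<phi> s = 0))"
    show "(LINT s:{a..b}|lebesgue. deriv \<phi> s * ip L (Z (\<lambda>j. c j s)) v) = - (LINT s:{a..b}|lebesgue. \<phi> s * ip L (Z (\<lambda>j. c' j s)) v)"
      using parts[OF Hsp_Lp2[OF v]] \<phi> by (simp add: ip_Z_left[OF Hsp_Lp2[OF v]] dual_Z_def)
  qed
  show "time_derivative_in_Lp_Vdual L a b p (\<lambda>t. Z (\<lambda>j. c j t))"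
    unfolding time_derivative_in_Lp_Vdual_def has_weak_time_derivative_def
  proof (intro bexI[of _ "\<lambda>t. dual_Z (\<lambda>j. c' j t)"] ballI allI impI)
    have "dual_Z (\<lambda>_. 0) = (\<lambda>v. 0)" by (simp add: dual_Z_def fun_eq_iff)
    then have N0: "norm_Vdual L (dual_Z (\<lambda>_. 0)) = 0"
      using norm_Vdual_nonneg[of "\<lambda>_. 0"] zero_in_unit_ball by (auto simp: norm_Vdual_def intro!: cSUP_const)
    have dZ: "dual_Z e v - dual_Z f v = dual_Z (\<lambda>j. e j - f j) v" for e f v
      by (simp add: dual_Z_def left_diff_distrib sum_subtractf)
    show "(\<lambda>t. dual_Z (\<lambda>j. c' j t)) \<in> Lp_time a b p (Vdual L) (norm_Vdual L)"
      by (rule Lp_time_curve[OF ab p cc'])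
        (auto intro!: dual_Z_Vdual continuous_norm_Vdual norm_Vdual_nonneg simp: dZ N0)
    fix v :: "'n vfield" and \<phi> :: "real \<Rightarrow> real" assume v: "v \<in> Vsp L" and \<phi>: "smooth_on UNIV \<phi> \<and> (\<exists>c d. a < c \<and> d < b \<and> (\<forall>s. s \<notin> {c..d} \<longrightarrow> \<phi> s = 0))"
    show "(LINT s:{a..b}|lebesgue. deriv \<phi> s * ip L (Z (\<lambda>j. c j s)) v) = - (LINT s:{a..b}|lebesgue. \<phi> s * dual_Z (\<lambda>j. c' j s) v)"
      using parts[OF Vsp_Lp2[OF v]] \<phi> by blast
  qed
qed

end

section \<open>Uniqueness of weak solutions\<close>

lemma continuous_AE_zero_Icc:
  fixes h :: "real \<Rightarrow> real"
  assumes ab: "a < b" and c: "continuous_on {a..b} h" and nn: "\<And>t. t \<in> {a..b} \<Longrightarrow> h t \<ge> 0"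
    and AE: "AE t in lebesgue_on {a..b}. h t = 0" and t: "t \<in> {a..b}"
  shows "h t = 0"
proof -
  have "integral {a..b} h = (LINT s|lebesgue_on {a..b}. h s)"
    using set_lebesgue_integral_continuous[OF c]
    by (simp add: set_lebesgue_integral_def integral_restrict_space)
  also have "\<dots> = 0" by (rule integral_eq_zero_AE[OF AE])
  finally have "integral (cbox a b) h = 0" by simp
  then show ?thesis
    using integral_cbox_eq_0_iff[of a b h] c nn t ab by (auto simp: box_real)
qed

context galerkin_problem
begin

lemma grad_ip_cong_AE:
  assumes "u \<in> Lp L 2" "u' \<in> Lp L 2" "AE x in torus L. u x = u' x"
  shows "grad_ip L u v = grad_ip L u' v"
  unfolding grad_ip_def using wpartial_cong_AE(2)[of u L u'] assms by (simp add: Lp2_iff)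

text \<open>A competing weak solution has the form \<open>Z a\<close> only almost everywhere. This
  transfers the nonlinear terms, the weak derivatives agreeing exactly by
  \<open>wpartial_cong_AE\<close>.\<close>

lemma ip_terms_cong_AE:
  assumes u: "u \<in> Lp L 2" and AE: "AE x in torus L. u x = Z a x" and v: "v \<in> Lp L 2"
  shows "ip L (advection L (\<lambda>x. u x + ye x)) v = ip L (advection L (\<lambda>x. Z a x + ye x)) v"
    and "ip L (absorption p (\<lambda>x. u x + ye x)) v = ip L (absorption p (\<lambda>x. Z a x + ye x)) v"
proof -
  have uy: "(\<lambda>x. u x + ye x) \<in> Lp L 2" by (intro Lp2_add u ye_Lp2)
  have AEy: "AE x in torus L. u x + ye x = Z a x + ye x" using AE by eventually_elim simp
  have [measurable]: "(\<lambda>x. u x + ye x) \<in> borel_measurable (torus L)" "(\<lambda>x. Z a x + ye x) \<in> borel_measurable (torus L)"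
    "v \<in> borel_measurable (torus L)" using uy Zye_Lp2 v by (auto simp: Lp2_iff)
  have wp: "wpartial L i (\<lambda>x. u x + ye x) = wpartial L i (\<lambda>x. Z a x + ye x)" for i
    by (rule wpartial_cong_AE(2)) (use AEy in measurable)
  have comp: "(\<lambda>x. (u x + ye x) $ i) \<in> borel_measurable (torus L)" for i
    using borel_measurable_inner[of "\<lambda>x. u x + ye x" "torus L" "\<lambda>x. axis i 1"] by (simp add: inner_axis)
  have [measurable]: "wpartial L i (\<lambda>x. Z a x + ye x) \<in> borel_measurable (torus L)" for i
    using H1_wpartial(1)[OF Zye_H1] by (simp add: Lp2_iff)
  show "ip L (advection L (\<lambda>x. u x + ye x)) v = ip L (advection L (\<lambda>x. Z a x + ye x)) v"
  proof (rule ip_cong_AE)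
    show "advection L (\<lambda>x. u x + ye x) \<in> borel_measurable (torus L)"
      unfolding advection_def wp by (intro borel_measurable_sum borel_measurable_scaleR comp) measurable
    show "AE x in torus L. advection L (\<lambda>x. u x + ye x) x = advection L (\<lambda>x. Z a x + ye x) x"
      using AE by eventually_elim (simp add: advection_def wp)
  qed (use advection_Zye_Lp2 v in \<open>auto simp: Lp2_iff\<close>)
  show "ip L (absorption p (\<lambda>x. u x + ye x)) v = ip L (absorption p (\<lambda>x. Z a x + ye x)) v"
  proof (rule ip_cong_AE)
    show "absorption p (\<lambda>x. u x + ye x) \<in> borel_measurable (torus L)" "absorption p (\<lambda>x. Z a x + ye x) \<in> borel_measurable (torus L)"
      unfolding absorption_def by measurable
    show "AE x in torus L. absorption p (\<lambda>x. u x + ye x) x = absorption p (\<lambda>x. Z a x + ye x) x"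
      using AE by eventually_elim (simp add: absorption_def)
  qed (use v in \<open>auto simp: Lp2_iff\<close>)
qed

text \<open>\<open>K\<close> is a linear space, so the variational inequality may be tested with
  \<open>u + c W k\<close> for both signs of \<open>c\<close>, which turns it into an
  equality.\<close>

lemma subdiff_orthogonal:
  assumes \<xi>: "\<xi> \<in> subdiff_ind L K u" and k: "k \<in> {1..n}"
  shows "u \<in> K" "ip L \<xi> (W k) = 0"
proof -
  show u: "u \<in> K" using \<xi> by (auto simp: subdiff_ind_def split: if_splits)
  have \<xi>': "\<xi> \<in> Hsp L" "\<And>y. y \<in> K \<Longrightarrow> ip L \<xi> (\<lambda>s. u s - y s) \<ge> 0"
    using \<xi> u by (auto simp: subdiff_ind_def)
  have mem: "(\<lambda>x. u x + c *\<^sub>R W k x) \<in> K" for c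
  proof (rule K_I)
    show "(\<lambda>x. u x + c *\<^sub>R W k x) \<in> Hsp L" by (intro Hsp_add Hsp_scaleR K_Hsp u W_Hsp k)
    have Wk: "c *\<^sub>R W k x = Z (\<lambda>j. if j = k then c else 0) x" for x
      using k by (simp add: Z_def if_distrib[of "\<lambda>c. c *\<^sub>R _"] cong: if_cong)
    show "AE x in torus L. u x + c *\<^sub>R W k x = Z (\<lambda>j. coef u j + (if j = k then c else 0)) x"
      using K_AE[OF u] by eventually_elim (simp add: Wk Z_add)
  qed
  have "ip L \<xi> (\<lambda>s. u s - (u s + c *\<^sub>R W k s)) = - c * ip L \<xi> (W k)" for c
    using ip_scaleR_right[of L \<xi> "- c" "W k"] by simp
  then have "- c * ip L \<xi> (W k) \<ge> 0" for c using \<xi>'(2)[OF mem[of c]] by simp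
  from this[of 1] this[of "-1"] show "ip L \<xi> (W k) = 0" by simp
qed

text \<open>The inclusion puts \<open>z\<close> into \<open>K\<close> at almost every time, and
  continuity extends this to all times. The coefficients then satisfy the reduced system in
  integrated form.\<close>

lemma weak_solution_coefficients:
  assumes ws: "weak_solution L \<mu> \<alpha> \<beta> \<gamma> r q \<omega> K R ye y0 z" and T: "T > 0"
  shows "L2_continuous_on L {0..T} z"
    and "\<And>t. t \<in> {0..T} \<Longrightarrow> AE x in torus L. z t x = Z (coef (z t)) x"
    and "\<And>k \<tau> t. k \<in> {1..n} \<Longrightarrow> 0 < \<tau> \<Longrightarrow> \<tau> < T \<Longrightarrow> t \<in> {\<tau>..T} \<Longrightarrow>
      coef (z t) k = coef (z \<tau>) k - integral {\<tau>..t} (\<lambda>s. G (coef (z s)) k + \<eta> * coef (z s) k)"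
proof -
  have "regularity_class L r T z" using ws T by (auto simp: weak_solution_def)
  then show zc: "L2_continuous_on L {0..T} z"
    by (auto simp: regularity_class_def C_time_def L2_continuous_on_def Hsp_Lp2)
  note zL = L2_continuous_onD(1)[OF zc]
  have dc: "continuous_on {0..T} (\<lambda>t. coef (z t) k)" if "k \<in> {1..n}" for k
    unfolding coef_def by (rule continuous_on_ip[OF zc L2_continuous_on_const[OF W_Lp2[OF that]]])
  \<comment> \<open>The squared distance of \<open>z t\<close> from \<open>Z (coef (z t))\<close>,
    written through inner products so that its continuity in time is visible.\<close>
  define m where "m t = ip L (z t) (z t) - (\<Sum>k=1..n. (coef (z t) k)\<^sup>2)" for t
  have m_eq: "m t = (norm_Lp L 2 (\<lambda>x. z t x - Z (coef (z t)) x))\<^sup>2" if "t \<in> {0..T}" for t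
  proof -
    have 1: "ip L (z t) (Z (coef (z t))) = (\<Sum>k=1..n. (coef (z t) k)\<^sup>2)"
      unfolding ip_commute[of L "z t"] ip_Z_left[OF zL[OF that]]
      by (simp add: power2_eq_square coef_def ip_commute)
    have 2: "ip L (Z (coef (z t))) (Z (coef (z t))) = (\<Sum>k=1..n. (coef (z t) k)\<^sup>2)"
      unfolding ip_self norm_Z by (simp add: sum_nonneg)
    show ?thesis unfolding ip_self[symmetric] ip_diff_self[OF zL[OF that] Z_Lp2] m_def 1 2 by simp
  qed
  have mc: "continuous_on {0..T} m" unfolding m_def by (intro continuous_intros continuous_on_ip zc dc)
  have sub: "\<exists>\<xi>. (AE t in lebesgue_on {\<tau>..T}. \<xi> t \<in> subdiff_ind L K (z t)) \<and>
      weak_identity L \<mu> \<alpha> \<beta> \<gamma> r q \<omega> K R ye \<tau> T z \<xi>" if "0 < \<tau>" "\<tau> < T" for \<tau>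
    using ws T that by (auto simp: weak_solution_def)
  have mpos: "m t = 0" if t: "0 < t" "t \<le> T" for t
  proof (rule continuous_AE_zero_Icc[of "t/2" T m t])
    obtain \<xi> where "AE s in lebesgue_on {t/2..T}. \<xi> s \<in> subdiff_ind L K (z s)" using sub[of "t/2"] t by auto
    moreover have "AE s in lebesgue_on {t/2..T}. s \<in> {t/2..T}"
      using AE_space[of "lebesgue_on {t/2..T}"] by simp
    ultimately show "AE s in lebesgue_on {t/2..T}. m s = 0"
    proof eventually_elim
      case (elim s)
      have s: "s \<in> {0..T}" using elim(2) t by auto
      have "z s \<in> K" using elim(1) by (auto simp: subdiff_ind_def split: if_splits)
      then have "AE x in torus L. z s x - Z (coef (z s)) x = 0" using K_AE by simp
      then show ?case unfolding m_eq[OF s] using norm_Lp2_zero_iff[OF Lp2_diff[OF zL[OF s] Z_Lp2]] by simp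
    qed
    show "continuous_on {t/2..T} m" by (rule continuous_on_subset[OF mc]) (use t in auto)
    show "m s \<ge> 0" if "s \<in> {t/2..T}" for s using m_eq[of s] that t by auto
  qed (use t in auto)
  \<comment> \<open>The inclusion is available only on intervals with a positive left end point, so
    time 0 is reached by continuity.\<close>
  have m0: "m 0 = 0"
  proof -
    have "(m \<longlongrightarrow> m 0) (at 0 within {0..T})" using mc T by (auto simp: continuous_on_def)
    moreover have "(m \<longlongrightarrow> 0) (at 0 within {0..T})"
      by (rule tendsto_eventually) (auto simp: eventually_at_filter mpos intro!: always_eventually)
    moreover have "at 0 within {0..T} \<noteq> bot" using T by (simp add: at_within_Icc_at_right)
    ultimately show ?thesis using tendsto_unique by blast
  qed
  show AE: "AE x in torus L. z t x = Z (coef (z t)) x" if t: "t \<in> {0..T}" for t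
  proof -
    have "m t = 0" using mpos[of t] m0 t by (cases "t = 0") auto
    then show ?thesis using norm_Lp2_zero_iff[OF Lp2_diff[OF zL[OF t] Z_Lp2]] unfolding m_eq[OF t] by simp
  qed
  fix k \<tau> t assume k: "k \<in> {1..n}" and \<tau>: "0 < \<tau>" "\<tau> < T" and t: "t \<in> {\<tau>..T}"
  obtain \<xi> where \<xi>: "AE t in lebesgue_on {\<tau>..T}. \<xi> t \<in> subdiff_ind L K (z t)"
    "weak_identity L \<mu> \<alpha> \<beta> \<gamma> r q \<omega> K R ye \<tau> T z \<xi>" using sub[OF \<tau>] by blast
  \<comment> \<open>A test field constant in time: the term with its time derivative vanishes, and
    the multiplier drops out because it is orthogonal to \<open>W k\<close>.\<close>
  have test: "solenoidal_test L \<tau> T (\<lambda>s. W k)"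
    using smooth_on_rtp_time[OF W_trig[OF k] \<tau>(2)] W_sol[OF k] by (simp add: solenoidal_test_def)
  let ?I = "{\<tau>..t}"
  have sub0: "s \<in> {0..T}" if "s \<in> ?I" for s using that t \<tau> by auto
  have subI: "?I \<subseteq> {0..T}" using sub0 by blast
  define d where "d s = coef (z s)" for s
  have cong: "(LINT s:?I|lebesgue. f s) = integral ?I g" if "\<And>s. s \<in> ?I \<Longrightarrow> f s = g s" "continuous_on ?I g" for f g :: "real \<Rightarrow> real"
  proof -
    have "(LINT s:?I|lebesgue. f s) = (LINT s:?I|lebesgue. g s)"
      by (rule set_lebesgue_integral_cong) (use that(1) in auto)
    then show ?thesis by (simp add: set_lebesgue_integral_continuous(2)[OF that(2)])
  qed
  note Wk = W_Lp2[OF k]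
  have cd: "continuous_on ?I (\<lambda>s. d s j)" if "j \<in> {1..n}" for j
    unfolding d_def by (rule continuous_on_subset[OF dc[OF that] subI])
  have LL: "continuous_on ?I (\<lambda>s. ip L (F (d s)) (W k))" if "L2_locally_lipschitz L n F" for F
    by (rule continuous_on_ip[OF L2_continuous_on_lipschitz[OF that cd] L2_continuous_on_const[OF Wk]])
  have t0: "(LINT s:?I|lebesgue. ip L (z s) (\<lambda>x. vector_derivative (\<lambda>\<sigma>. W k x) (at s within {\<tau>..T}))) = 0"
  proof -
    have "vector_derivative (\<lambda>\<sigma>. W k x) (at s within {\<tau>..T}) = 0" if "s \<in> ?I" for s x
      by (rule vector_derivative_within_closed_interval[OF \<tau>(2)]) (use that t in auto)
    then have "(LINT s:?I|lebesgue. ip L (z s) (\<lambda>x. vector_derivative (\<lambda>\<sigma>. W k x) (at s within {\<tau>..T}))) = integral ?I (\<lambda>s. 0)"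
      by (intro cong) (auto simp: ip_def)
    then show ?thesis by simp
  qed
  have t1: "(LINT s:?I|lebesgue. grad_ip L (z s) (W k)) = integral ?I (\<lambda>s. \<kappa> k * d s k)"
  proof (rule cong)
    fix s assume s: "s \<in> ?I"
    have "grad_ip L (z s) (W k) = grad_ip L (Z (d s)) (W k)"
      unfolding d_def by (rule grad_ip_cong_AE[OF zL[OF sub0[OF s]] Z_Lp2 AE[OF sub0[OF s]]])
    also have "\<dots> = (\<Sum>j=1..n. if j = k then d s j * \<kappa> j else 0)"
      unfolding grad_ip_Z[OF W_sol[OF k]] by (intro sum.cong refl) (auto simp: W_orth[OF _ k])
    finally show "grad_ip L (z s) (W k) = \<kappa> k * d s k" using k by (simp add: mult.commute)
  qed (intro continuous_intros cd k)
  have t2: "(LINT s:?I|lebesgue. ip L (z s) (W k)) = integral ?I (\<lambda>s. d s k)"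
    by (rule cong) (auto simp: d_def coef_def intro: cd[OF k, unfolded d_def coef_def])
  note tc = ip_terms_cong_AE[OF zL[OF sub0] AE[OF sub0] Wk, folded d_def]
  have t3: "(LINT s:?I|lebesgue. ip L (advection L (\<lambda>x. z s x + ye x)) (W k)) = integral ?I (\<lambda>s. ip L (advection L (\<lambda>x. Z (d s) x + ye x)) (W k))"
    by (rule cong[OF tc(1)]) (auto intro: LL[OF L2_locally_lipschitz_advection])
  have t4: "(LINT s:?I|lebesgue. ip L (absorption r (\<lambda>x. z s x + ye x)) (W k)) = integral ?I (\<lambda>s. ip L (absorption r (\<lambda>x. Z (d s) x + ye x)) (W k))"
    by (rule cong[OF tc(2)]) (auto intro: LL[OF L2_locally_lipschitz_absorption[OF r1]])
  have t5: "(LINT s:?I|lebesgue. ip L (absorption q (\<lambda>x. z s x + ye x)) (W k)) = integral ?I (\<lambda>s. ip L (absorption q (\<lambda>x. Z (d s) x + ye x)) (W k))"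
    by (rule cong[OF tc(2)]) (auto intro: LL[OF L2_locally_lipschitz_absorption[OF q1]])
  have t6: "(LINT s:?I|lebesgue. ip L (feedback_term L \<omega> K R (z s)) (W k)) = integral ?I (\<lambda>s. \<eta> * d s k)"
  proof (rule cong)
    fix s assume s: "s \<in> ?I"
    show "ip L (feedback_term L \<omega> K R (z s)) (W k) = \<eta> * d s k"
      unfolding ip_feedback_term[OF zL[OF sub0[OF s]] W_Hsp[OF k]] ip_E_W[OF k] d_def by simp
  qed (intro continuous_intros cd k)
  have t7: "(LINT s:?I|lebesgue. ip L (\<xi> s) (W k)) = 0"
  proof -
    have "AE s in lebesgue. s \<in> {\<tau>..T} \<longrightarrow> \<xi> s \<in> subdiff_ind L K (z s)"
      using \<xi>(1) by (simp add: AE_restrict_space_iff)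
    then have "AE s in lebesgue. indicator ?I s *\<^sub>R ip L (\<xi> s) (W k) = 0"
      by eventually_elim (use t subdiff_orthogonal(2)[OF _ k] in \<open>auto simp: indicator_def\<close>)
    then show ?thesis unfolding set_lebesgue_integral_def by (rule integral_eq_zero_AE)
  qed
  have cst: "(LINT s:?I|lebesgue. c) = integral ?I (\<lambda>s. c)" for c :: real by (rule cong) auto
  have id: "\<mu> * integral ?I (\<lambda>s. \<kappa> k * d s k) + \<alpha> * integral ?I (\<lambda>s. d s k)
      + integral ?I (\<lambda>s. ip L (advection L (\<lambda>x. Z (d s) x + ye x)) (W k))
      + \<beta> * integral ?I (\<lambda>s. ip L (absorption r (\<lambda>x. Z (d s) x + ye x)) (W k))
      + \<gamma> * integral ?I (\<lambda>s. ip L (absorption q (\<lambda>x. Z (d s) x + ye x)) (W k))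
      + integral ?I (\<lambda>s. \<eta> * d s k)
      = - d t k + d \<tau> k + integral ?I (\<lambda>s. ip L (advection L ye) (W k))
       + \<beta> * integral ?I (\<lambda>s. ip L (absorption r ye) (W k)) + \<gamma> * integral ?I (\<lambda>s. ip L (absorption q ye) (W k))"
  proof -
    note wi = \<xi>(2)[unfolded weak_identity_def, rule_format, OF test, THEN conjunct2, rule_format, OF t]
    show ?thesis
      using wi unfolding t0 t1 t2 t3 t4 t5 t6 t7 cst d_def coef_def by simp
  qed
  have hi: "(h has_integral integral ?I h) ?I" if "continuous_on ?I h" for h :: "real \<Rightarrow> real"
    by (rule integrable_integral[OF integrable_continuous_real[OF that]])
  have "((\<lambda>s. \<mu> * (\<kappa> k * d s k) + \<alpha> * d s k + ip L (advection L (\<lambda>x. Z (d s) x + ye x)) (W k)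
      + \<beta> * ip L (absorption r (\<lambda>x. Z (d s) x + ye x)) (W k)
      + \<gamma> * ip L (absorption q (\<lambda>x. Z (d s) x + ye x)) (W k) + \<eta> * d s k
      - ip L (advection L ye) (W k) - \<beta> * ip L (absorption r ye) (W k) - \<gamma> * ip L (absorption q ye) (W k))
    has_integral (\<mu> * integral ?I (\<lambda>s. \<kappa> k * d s k) + \<alpha> * integral ?I (\<lambda>s. d s k)
      + integral ?I (\<lambda>s. ip L (advection L (\<lambda>x. Z (d s) x + ye x)) (W k))
      + \<beta> * integral ?I (\<lambda>s. ip L (absorption r (\<lambda>x. Z (d s) x + ye x)) (W k))
      + \<gamma> * integral ?I (\<lambda>s. ip L (absorption q (\<lambda>x. Z (d s) x + ye x)) (W k))
      + integral ?I (\<lambda>s. \<eta> * d s k) - integral ?I (\<lambda>s. ip L (advection L ye) (W k))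
      - \<beta> * integral ?I (\<lambda>s. ip L (absorption r ye) (W k)) - \<gamma> * integral ?I (\<lambda>s. ip L (absorption q ye) (W k)))) ?I"
    by (intro has_integral_add has_integral_diff has_integral_mult_right hi continuous_on_mult continuous_on_const cd k
      LL[OF L2_locally_lipschitz_advection] LL[OF L2_locally_lipschitz_absorption[OF r1]] LL[OF L2_locally_lipschitz_absorption[OF q1]])
  moreover have "\<mu> * (\<kappa> k * d s k) + \<alpha> * d s k + ip L (advection L (\<lambda>x. Z (d s) x + ye x)) (W k)
      + \<beta> * ip L (absorption r (\<lambda>x. Z (d s) x + ye x)) (W k)
      + \<gamma> * ip L (absorption q (\<lambda>x. Z (d s) x + ye x)) (W k) + \<eta> * d s k
      - ip L (advection L ye) (W k) - \<beta> * ip L (absorption r ye) (W k) - \<gamma> * ip L (absorption q ye) (W k) = G (d s) k + \<eta> * d s k" for s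
    unfolding G_def ip_N[OF Wk] by (simp add: algebra_simps)
  ultimately have "integral ?I (\<lambda>s. G (d s) k + \<eta> * d s k) = d \<tau> k - d t k"
    using id by (simp add: integral_unique)
  then show "coef (z t) k = coef (z \<tau>) k - integral {\<tau>..t} (\<lambda>s. G (coef (z s)) k + \<eta> * coef (z s) k)"
    by (simp add: d_def)
qed

text \<open>The integral equation makes the coefficients of any weak solution differentiable at
  positive times, with the same equation and the same initial values as \<open>c\<close>, so
  uniqueness for the reduced system applies.\<close>

lemma weak_solution_unique:
  assumes ws: "weak_solution L \<mu> \<alpha> \<beta> \<gamma> r q \<omega> K R ye y0 z" and z0: "(\<lambda>x. y0 x - ye x) \<in> K"
    and c0: "\<And>k. k \<in> {1..n} \<Longrightarrow> c k 0 = coef (\<lambda>x. y0 x - ye x) k"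
    and dc: "\<And>k t. k \<in> {1..n} \<Longrightarrow> t \<ge> 0 \<Longrightarrow> (c k has_real_derivative (- G (\<lambda>j. c j t) k - \<eta> * c k t)) (at t within {0..})"
    and T: "T \<ge> 0"
  shows "AE x in torus L. z T x = Z (\<lambda>j. c j T) x"
proof -
  \<comment> \<open>The facts about weak solutions ask for an interval of positive length; working
    up to \<open>T + 1\<close> includes the case \<open>T = 0\<close>.\<close>
  have S: "T + 1 > 0" using T by simp
  note zc = weak_solution_coefficients(1)[OF ws S] and AE = weak_solution_coefficients(2)[OF ws S]
    and int = weak_solution_coefficients(3)[OF ws S]
  define d where "d k t = coef (z t) k" for k t
  have cd: "continuous_on {0..T+1} (d k)" if "k \<in> {1..n}" for k
    unfolding d_def coef_def by (rule continuous_on_ip[OF zc L2_continuous_on_const[OF W_Lp2[OF that]]])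
  have cG: "continuous_on {0..T+1} (\<lambda>s. G (\<lambda>j. d j s) k)" if "k \<in> {1..n}" for k
    unfolding G_def
    by (intro continuous_intros cd that continuous_on_ip[OF L2_continuous_on_lipschitz[OF L2_locally_lipschitz_N cd] L2_continuous_on_const[OF W_Lp2[OF that]]])
  have dd: "(d k has_real_derivative - G (\<lambda>j. d j t) k - \<eta> * d k t) (at t)" if k: "k \<in> {1..n}" and t: "0 < t" "t < T" for k t
  proof -
    let ?h = "\<lambda>s. G (\<lambda>j. d j s) k + \<eta> * d k s"
    \<comment> \<open>The integral equation holds only from positive starting times, so it is
      started at \<open>t/2\<close>.\<close>
    have ch: "continuous_on {t/2..T+1} ?h"
      by (rule continuous_on_subset[of "{0..T+1}"]) (use t in \<open>auto intro!: continuous_intros cG cd k\<close>)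
    have "((\<lambda>u. integral {t/2..u} ?h) has_real_derivative ?h t) (at t within {t/2..T+1})"
      by (rule integral_has_real_derivative[OF ch]) (use t in auto)
    then have D: "((\<lambda>u. d k (t/2) - integral {t/2..u} ?h) has_real_derivative 0 - ?h t) (at t within {t/2..T+1})"
      by (intro DERIV_diff DERIV_const)
    have "(d k has_real_derivative 0 - ?h t) (at t within {t/2..T+1})"
      unfolding has_field_derivative_def
    proof (rule has_derivative_transform[OF _ _ D[unfolded has_field_derivative_def]])
      show "t \<in> {t/2..T+1}" using t by simp
      show "d k u = d k (t/2) - integral {t/2..u} ?h" if "u \<in> {t/2..T+1}" for u
        unfolding d_def by (rule int[OF k _ _ that]) (use t in auto)
    qed
    then have "(d k has_real_derivative 0 - ?h t) (at t)"
      using t by (subst (asm) at_within_interior) auto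
    then show ?thesis by simp
  qed
  have init: "d k 0 = c k 0" if k: "k \<in> {1..n}" for k
  proof -
    let ?z0 = "\<lambda>x. y0 x - ye x"
    have z0L: "?z0 \<in> Lp L 2" by (rule K_Lp2[OF z0])
    have zL: "z \<tau> \<in> Lp L 2" if "\<tau> \<in> {0..T+1}" for \<tau> by (rule L2_continuous_onD(1)[OF zc that])
    \<comment> \<open>The initial value is prescribed only as a right limit. Together with the
      continuity of \<open>z\<close> at 0 it determines the coefficients there.\<close>
    have lim: "((\<lambda>\<tau>. norm_Lp L 2 (\<lambda>x. z \<tau> x - ?z0 x)) \<longlongrightarrow> 0) (at_right 0)"
      using ws by (simp add: weak_solution_def)
    have ev: "\<forall>\<^sub>F \<tau> in at_right 0. \<tau> \<in> {0<..<T+1}"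
      using S by (rule eventually_at_right_real)
    have "((\<lambda>\<tau>. coef (z \<tau>) k - coef ?z0 k) \<longlongrightarrow> 0) (at_right 0)"
    proof (rule Lim_null_comparison[OF _ lim])
      show "\<forall>\<^sub>F \<tau> in at_right 0. norm (coef (z \<tau>) k - coef ?z0 k) \<le> norm_Lp L 2 (\<lambda>x. z \<tau> x - ?z0 x)"
        using ev
      proof eventually_elim
        case (elim \<tau>)
        then have m: "z \<tau> \<in> Lp L 2" by (intro zL) auto
        have "coef (z \<tau>) k - coef ?z0 k = coef (\<lambda>x. z \<tau> x - ?z0 x) k"
          unfolding coef_def by (rule ip_diff_left[OF m z0L W_Lp2[OF k], symmetric])
        then show ?case using abs_coef_le[OF Lp2_diff[OF m z0L] k] by simp
      qed
    qed
    then have 1: "(d k \<longlongrightarrow> coef ?z0 k) (at_right 0)" unfolding d_def[abs_def] by (rule LIM_zero_cancel)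
    have "(d k \<longlongrightarrow> d k 0) (at 0 within {0..T+1})" using cd[OF k] S by (auto simp: continuous_on_def)
    then have 2: "(d k \<longlongrightarrow> d k 0) (at_right 0)" using S by (simp add: at_within_Icc_at_right)
    show ?thesis using tendsto_unique[OF _ 2 1] c0[OF k] by simp
  qed
  have "d k T = c k T" if k: "k \<in> {1..n}" for k
  proof (rule damped_ode_unique[where a = d and b = c, OF locally_lipschitz_G T _ _ _ _ init k])
    show "continuous_on {0..T} (d k)" if "k \<in> {1..n}" for k
      by (rule continuous_on_subset[OF cd[OF that]]) auto
    show "continuous_on {0..T} (c k)" if "k \<in> {1..n}" for k
    proof -
      have "continuous_on {0..} (c k)" by (rule DERIV_continuous_on) (rule dc[OF that], simp)
      then show ?thesis by (rule continuous_on_subset) auto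
    qed
    show "(d k has_real_derivative - G (\<lambda>j. d j t) k - \<eta> * d k t) (at t)" if "k \<in> {1..n}" "0 < t" "t < T" for k t
      by (rule dd[OF that])
    show "(c k has_real_derivative - G (\<lambda>j. c j t) k - \<eta> * c k t) (at t)" if "k \<in> {1..n}" "0 < t" "t < T" for k t
      using dc[OF that(1), of t] that at_within_interior[of t "{0..}"] by simp
  qed
  then have "Z (coef (z T)) = Z (\<lambda>j. c j T)" by (intro Z_cong) (simp add: d_def)
  then show ?thesis using AE[of T] T by simp
qed

end

section \<open>Stabilization\<close>

context galerkin_problem
begin

lemma curve_time_derivatives:
  assumes ab: "0 \<le> \<tau>" "\<tau> < T"
    and dc: "\<And>k t. k \<in> {1..n} \<Longrightarrow> t \<ge> 0 \<Longrightarrow> (c k has_real_derivative (- G (\<lambda>j. c j t) k - \<eta> * c k t)) (at t within {0..})"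
  shows "time_derivative_in_Lp_H L \<tau> T ((r + 1) / r) (\<lambda>t. Z (\<lambda>j. c j t))"
    and "time_derivative_in_Lp_Vdual L \<tau> T ((r + 1) / r) (\<lambda>t. Z (\<lambda>j. c j t))"
proof -
  have p: "(r + 1) / r > 0" using r1 by simp
  have d: "(c k has_real_derivative (- G (\<lambda>j. c j t) k - \<eta> * c k t)) (at t within {\<tau>..T})" if "k \<in> {1..n}" "t \<in> {\<tau>..T}" for k t
    by (rule DERIV_subset[OF dc[OF that(1)]]) (use that ab in auto)
  have cc: "continuous_on {\<tau>..T} (c k)" if "k \<in> {1..n}" for k
    by (rule DERIV_continuous_on[OF d[OF that]])
  have "continuous_on {\<tau>..T} (\<lambda>t. - G (\<lambda>j. c j t) k - \<eta> * c k t)" if "k \<in> {1..n}" for k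
    unfolding G_def
    by (intro continuous_intros cc that continuous_on_ip[OF L2_continuous_on_lipschitz[OF L2_locally_lipschitz_N cc] L2_continuous_on_const[OF W_Lp2[OF that]]])
  note * = curve_time_derivative[OF ab(2) p d this]
  show "time_derivative_in_Lp_H L \<tau> T ((r + 1) / r) (\<lambda>t. Z (\<lambda>j. c j t))"
    "time_derivative_in_Lp_Vdual L \<tau> T ((r + 1) / r) (\<lambda>t. Z (\<lambda>j. c j t))"
    by (rule *; assumption)+
qed

lemma weak_solution_galerkin:
  assumes z0: "(\<lambda>x. y0 x - ye x) \<in> K"
    and c0: "\<And>k. k \<in> {1..n} \<Longrightarrow> c k 0 = coef (\<lambda>x. y0 x - ye x) k"
    and dc: "\<And>k t. k \<in> {1..n} \<Longrightarrow> t \<ge> 0 \<Longrightarrow> (c k has_real_derivative (- G (\<lambda>j. c j t) k - \<eta> * c k t)) (at t within {0..})"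
  shows "weak_solution L \<mu> \<alpha> \<beta> \<gamma> r q \<omega> K R ye y0 (\<lambda>t. Z (\<lambda>j. c j t))"
  unfolding weak_solution_def
proof (intro conjI allI impI)
  have cc0: "continuous_on {0..} (c k)" if "k \<in> {1..n}" for k
    by (rule DERIV_continuous_on) (rule dc[OF that], simp)
  fix T :: real assume T: "T > 0"
  show "regularity_class L r T (\<lambda>t. Z (\<lambda>j. c j t))"
    by (rule curve_regularity[OF T r1]) (rule continuous_on_subset[OF cc0], auto)
next
  fix T \<tau> :: real assume \<tau>: "0 < \<tau> \<and> \<tau> < T"
  show "time_derivative_in_Lp_H L \<tau> T ((r + 1) / r) (\<lambda>t. Z (\<lambda>j. c j t))"
    by (rule curve_time_derivatives(1)[OF _ _ dc]) (use \<tau> in auto)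
  show "\<exists>\<xi>. (AE t in lebesgue_on {\<tau>..T}. \<xi> t \<in> subdiff_ind L K (Z (\<lambda>j. c j t))) \<and>
      weak_identity L \<mu> \<alpha> \<beta> \<gamma> r q \<omega> K R ye \<tau> T (\<lambda>t. Z (\<lambda>j. c j t)) \<xi>"
  proof (intro exI[of _ "\<lambda>t. Xi (\<lambda>j. c j t)"] conjI AE_I2 Xi_subdiff weak_identity_galerkin)
    show "(c k has_real_derivative (- G (\<lambda>j. c j t) k - \<eta> * c k t)) (at t within {\<tau>..T})" if "k \<in> {1..n}" "t \<in> {\<tau>..T}" for k t
      by (rule DERIV_subset[OF dc[OF that(1)]]) (use that \<tau> in auto)
  qed (use \<tau> in auto)
next
  have "continuous_on {0..} (c k)" if "k \<in> {1..n}" for k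
    by (rule DERIV_continuous_on) (rule dc[OF that], simp)
  then have lim: "((\<lambda>\<tau>. norm_Lp L 2 (\<lambda>x. Z (\<lambda>j. c j \<tau>) x - Z (\<lambda>j. c j 0) x)) \<longlongrightarrow> 0) (at 0 within {0..})"
    by (intro L2_continuous_onD(2)[OF L2_continuous_on_lipschitz[OF L2_locally_lipschitz_Z]]) auto
  have "Z (\<lambda>j. c j 0) = Z (coef (\<lambda>x. y0 x - ye x))" by (intro Z_cong c0)
  then have AE: "AE x in torus L. y0 x - ye x = Z (\<lambda>j. c j 0) x" using K_AE[OF z0] by simp
  have "norm_Lp L 2 (\<lambda>x. Z a x - (y0 x - ye x)) = norm_Lp L 2 (\<lambda>x. Z a x - Z (\<lambda>j. c j 0) x)" for a
  proof (rule norm_Lp2_cong_AE)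
    show "AE x in torus L. Z a x - (y0 x - ye x) = Z a x - Z (\<lambda>j. c j 0) x"
      using AE by eventually_elim simp
  qed (use Lp2_diff[OF Z_Lp2 K_Lp2[OF z0]] Lp2_diff[OF Z_Lp2 Z_Lp2] in \<open>auto simp: Lp2_iff\<close>)
  then show "((\<lambda>\<tau>. norm_Lp L 2 (\<lambda>x. Z (\<lambda>j. c j \<tau>) x - (y0 x - ye x))) \<longlongrightarrow> 0) (at_right 0)"
    using tendsto_within_subset[OF lim, of "{0<..}"] by (simp add: subset_iff)
qed

text \<open>The gap between the rates turns an exponential bound into convergence of the weighted
  norm.\<close>

lemma norm_Z_decay:
  assumes \<delta>: "\<delta> < \<theta>" and c: "\<And>k t. k \<in> {1..n} \<Longrightarrow> t \<ge> 0 \<Longrightarrow> \<bar>c k t\<bar> \<le> C * exp (- \<theta> * t)"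
  shows "((\<lambda>t. exp (\<delta> * t) * norm_Lp L 2 (Z (\<lambda>j. c j t))) \<longlongrightarrow> 0) at_top"
proof (rule Lim_null_comparison)
  show "\<forall>\<^sub>F t in at_top. norm (exp (\<delta> * t) * norm_Lp L 2 (Z (\<lambda>j. c j t))) \<le> real n * C * exp (- ((\<theta> - \<delta>) * t))"
    using eventually_ge_at_top[of 0]
  proof eventually_elim
    case (elim t)
    have "norm_Lp L 2 (Z (\<lambda>j. c j t)) \<le> (\<Sum>j=1..n. \<bar>c j t\<bar>)"
      unfolding norm_Z using L2_set_le_sum_abs[of "\<lambda>j. c j t" "{1..n}"] by (simp add: L2_set_def)
    also have "\<dots> \<le> (\<Sum>j=1..n. C * exp (- \<theta> * t))" by (intro sum_mono c elim)
    finally have "exp (\<delta> * t) * norm_Lp L 2 (Z (\<lambda>j. c j t)) \<le> exp (\<delta> * t) * (real n * (C * exp (- \<theta> * t)))" by simp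
    also have "\<dots> = real n * C * exp (- ((\<theta> - \<delta>) * t))" by (simp add: exp_add[symmetric] algebra_simps)
    finally show ?case by (simp add: abs_of_nonneg[OF mult_nonneg_nonneg[OF _ norm_Lp_nonneg]])
  qed
  have "filterlim (\<lambda>t. (\<theta> - \<delta>) * t) at_top at_top"
    by (rule filterlim_tendsto_pos_mult_at_top[OF tendsto_const _ filterlim_ident]) (use \<delta> in simp)
  then have "((\<lambda>t. exp (- ((\<theta> - \<delta>) * t))) \<longlongrightarrow> 0) at_top"
    by (intro filterlim_compose[OF exp_at_bot]) (simp add: filterlim_uminus_at_bot)
  then show "((\<lambda>t. real n * C * exp (- ((\<theta> - \<delta>) * t))) \<longlongrightarrow> 0) at_top"
    by (rule tendsto_mult_right_zero)
qed

end

lemma span_H_cong_AE: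
  assumes "\<And>k. k \<in> {1..n} \<Longrightarrow> AE x in torus L. w k x = W k x"
  shows "span_H L w n = span_H L W n"
proof -
  have "AE x in torus L. \<forall>k\<in>{1..n}. w k x = W k x"
    by (rule AE_finite_allI) (use assms in auto)
  then have eq: "AE x in torus L. (\<Sum>k=1..n. c k *\<^sub>R w k x) = (\<Sum>k=1..n. c k *\<^sub>R W k x)" for c
    by eventually_elim (auto intro!: sum.cong)
  have "(AE x in torus L. u x = (\<Sum>k=1..n. c k *\<^sub>R w k x)) \<longleftrightarrow> (AE x in torus L. u x = (\<Sum>k=1..n. c k *\<^sub>R W k x))" for u c
    using eq[of c] by (auto elim!: AE_mp)
  then show ?thesis by (simp add: span_H_def)
qed

theorem theorem5p2:
  fixes L \<mu> \<alpha> \<beta> \<gamma> r q \<rho> \<delta> :: real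
    and n :: nat
    and \<omega> :: "(real^'n) set"
    and w :: "nat \<Rightarrow> real^'n \<Rightarrow> real^'n"
    and fe ye y0 :: "real^'n \<Rightarrow> real^'n"
    and K :: "(real^'n \<Rightarrow> real^'n) set"
  assumes "L > 0" and "\<mu> > 0" and "\<alpha> > 0" and "\<beta> > 0"
    and "r \<ge> 1" and "q \<ge> 1" and "r > q"
    and cases_i_ii:
      "(CARD('n) \<in> {2, 3} \<and> r > 3 \<and> 3 \<le> q \<and> q < r \<and> \<gamma> < 0) \<or>
       (CARD('n) = 3 \<and> r = 3 \<and> \<gamma> = 0 \<and> 2 * \<beta> * \<mu> > 1)"
    and omega: "open \<omega>" "\<omega> \<noteq> {}" "periodic_set L \<omega>"
    and basis: "orthonormal_basis_H L w"
    and eigen: "\<And>k. k \<in> {1..n} \<Longrightarrow> stokes_eigenfunction L (w k)"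
    and K: "K = span_H L w n"
    and fe: "fe \<in> Hsp L"
    and ye: "ye \<in> stokes_dom L" "stationary_solution L \<mu> \<alpha> \<beta> \<gamma> r q fe ye"
    and z0: "(\<lambda>x. y0 x - ye x) \<in> K"
    and rho: "\<rho> > 0" "norm_Lp L 2 (\<lambda>x. y0 x - ye x) < \<rho>"
    and delta: "\<delta> > 0"
  shows "\<exists>R. continuous_linear_feedback L \<omega> K R \<and>
    (\<exists>z. weak_solution L \<mu> \<alpha> \<beta> \<gamma> r q \<omega> K R ye y0 z \<and>
         (\<forall>z'. weak_solution L \<mu> \<alpha> \<beta> \<gamma> r q \<omega> K R ye y0 z' \<longrightarrow>
            (\<forall>t\<ge>0. AE x in torus L. z' t x = z t x)) \<and>
         (\<forall>T>0. regularity_class L r T z \<and>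
            (\<forall>\<tau>. 0 < \<tau> \<and> \<tau> < T \<longrightarrow>
               time_derivative_in_Lp_Vdual L \<tau> T ((r + 1) / r) z)) \<and>
         ((\<lambda>t. exp (\<delta> * t) * norm_Lp L 2 (z t)) \<longlongrightarrow> 0) at_top \<and>
         (\<forall>T>0. \<forall>t\<in>{0..T}. z t \<in> K))"
proof -
  note L = \<open>L > 0\<close>
  have "CARD('n) \<le> 3" using cases_i_ii by auto
  then obtain Be where Be: "AE x in torus L. norm (ye x) \<le> Be"
    using H2_bounded[OF L _ stokes_dom_H2[OF ye(1)]] by blast
  have ye_H1: "ye \<in> H1 L" using stokes_dom_H2[OF ye(1)] by (simp add: H2_def)
  \<comment> \<open>One predicate for the pair of trigonometric representative and eigenvalue, so
    that a single choice over \<open>k\<close> yields both.\<close>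
  define trig where "trig k V \<nu> \<longleftrightarrow> rtp L V \<and> V \<in> solenoidal_smooth L \<and> (AE x in torus L. w k x = V x) \<and>
      (\<forall>v. smooth_on UNIV v \<longrightarrow> periodic_on L UNIV v \<longrightarrow> v \<in> Hsp L \<longrightarrow> grad_ip L (w k) v = \<nu> * ip L (w k) v)" for k V \<nu>
  have "\<exists>p. trig k (fst p) (snd p)" if k: "k \<in> {1..n}" for k
  proof (rule stokes_eigenfunction_trig[OF L eigen[OF k]])
    fix V \<nu>
    assume "rtp L V" "V \<in> solenoidal_smooth L" "AE x in torus L. w k x = V x"
      "\<And>v. smooth_on UNIV v \<Longrightarrow> periodic_on L UNIV v \<Longrightarrow> v \<in> Hsp L \<Longrightarrow> grad_ip L (w k) v = \<nu> * ip L (w k) v"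
    then have "trig k (fst (V, \<nu>)) (snd (V, \<nu>))" unfolding trig_def by simp
    then show ?thesis by (rule exI)
  qed
  then obtain p where p: "\<And>k. k \<in> {1..n} \<Longrightarrow> trig k (fst (p k)) (snd (p k))" by metis
  define W \<kappa> where "W k = fst (p k)" and "\<kappa> k = snd (p k)" for k
  have W: "rtp L (W k)" "W k \<in> solenoidal_smooth L" "AE x in torus L. w k x = W k x"
    and grad: "\<And>v. smooth_on UNIV v \<Longrightarrow> periodic_on L UNIV v \<Longrightarrow> v \<in> Hsp L \<Longrightarrow> grad_ip L (w k) v = \<kappa> k * ip L (w k) v"
    if "k \<in> {1..n}" for k
    using p[OF that] unfolding trig_def W_def \<kappa>_def by blast+
  have w2: "w k \<in> Lp L 2" if "k \<in> {1..n}" for k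
    using basis that by (auto simp: orthonormal_basis_H_def Hsp_Lp2)
  have W2: "W k \<in> Lp L 2" if "k \<in> {1..n}" for k by (rule solenoidal_smoothD(3)[OF W(2)[OF that]])
  have meas: "w k \<in> borel_measurable (torus L)" "W k \<in> borel_measurable (torus L)" if "k \<in> {1..n}" for k
    using w2[OF that] W2[OF that] by (simp_all add: Lp2_iff)
  \<comment> \<open>Orthonormality and the gradient identity are given for \<open>w k\<close>; they
    pass to \<open>W k\<close> because the two agree almost everywhere.\<close>
  interpret galerkin L n W \<kappa> ye Be
  proof unfold_locales
    show "ip L (W j) (W k) = (if j = k then 1 else 0)" if jk: "j \<in> {1..n}" "k \<in> {1..n}" for j k
    proof -
      have "ip L (w j) (w k) = ip L (W j) (W k)"
        by (intro ip_cong_AE meas W(3) jk)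
      moreover have "j \<ge> 1" "k \<ge> 1" using jk by auto
      ultimately show ?thesis using basis by (auto simp: orthonormal_basis_H_def)
    qed
    show "grad_ip L (W k) v = \<kappa> k * ip L (W k) v" if k: "k \<in> {1..n}" and v: "v \<in> solenoidal_smooth L" for k v
    proof -
      have "grad_ip L (W k) v = grad_ip L (w k) v"
        unfolding grad_ip_def wpartial_cong_AE(2)[OF meas[OF k] W(3)[OF k]] ..
      also have "\<dots> = \<kappa> k * ip L (w k) v"
        by (intro grad k solenoidal_smoothD[OF v] solenoidal_smooth_Hsp v)
      also have "ip L (w k) v = ip L (W k) v"
        by (rule ip_cong_AE) (use meas[OF k] W(3)[OF k] solenoidal_smoothD(3)[OF v] in \<open>auto simp: Lp2_iff\<close>)
      finally show ?thesis .
    qed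
  qed (use L W ye_H1 Be in auto)
  obtain b where b: "\<And>k l. k \<in> {1..n} \<Longrightarrow> l \<in> {1..n} \<Longrightarrow> ip L (ext_zero \<omega> (Z (b k))) (W l) = (if k = l then 1 else 0)"
    using dual_basis[OF omega] by metis
  have KW: "K = span_H L W n" unfolding K by (rule span_H_cong_AE[OF W(3)])
  \<comment> \<open>The assumptions of the locale do not mention the gain, so this one fact
    justifies both interpretations below.\<close>
  have gp: "galerkin_problem L n W \<kappa> ye Be \<omega> b r q"
    by unfold_locales (use omega b \<open>r \<ge> 1\<close> \<open>q \<ge> 1\<close> in auto)
  \<comment> \<open>The gain 0 is a placeholder: it gives access to \<open>G\<close>, from which the
    actual gain is then determined.\<close>
  interpret P0: galerkin_problem L n W \<kappa> ye Be \<omega> b 0 \<mu> \<alpha> \<beta> \<gamma> r q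
    by (rule gp)
  define c0 where "c0 = coef (\<lambda>x. y0 x - ye x)"
  \<comment> \<open>A rate larger than \<open>\<delta>\<close>, so that the weighted norm tends to 0
    and is not merely bounded.\<close>
  have \<theta>: "\<delta> + 1 > 0" using delta by simp
  obtain \<eta> c C where c: "\<And>k. k \<in> {1..n} \<Longrightarrow> c k 0 = c0 k"
    "\<And>k t. k \<in> {1..n} \<Longrightarrow> t \<ge> 0 \<Longrightarrow> (c k has_real_derivative (- P0.G (\<lambda>j. c j t) k - \<eta> * c k t)) (at t within {0..})"
    "\<And>k t. k \<in> {1..n} \<Longrightarrow> t \<ge> 0 \<Longrightarrow> \<bar>c k t\<bar> \<le> C * exp (- (\<delta> + 1) * t)"
    using damped_ode_exists[OF P0.locally_lipschitz_G P0.G_zero \<theta>, of c0] by metis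
  interpret P: galerkin_problem L n W \<kappa> ye Be \<omega> b \<eta> \<mu> \<alpha> \<beta> \<gamma> r q
    by (rule gp)
  have z0': "(\<lambda>x. y0 x - ye x) \<in> span_H L W n" using z0 KW by simp
  define z where "z t = Z (\<lambda>j. c j t)" for t
  note c' = c(1,2)[unfolded c0_def]
  have ws: "weak_solution L \<mu> \<alpha> \<beta> \<gamma> r q \<omega> K P.R ye y0 z"
    unfolding KW z_def[abs_def] by (rule P.weak_solution_galerkin[OF z0' c'])
  show ?thesis
  proof (intro exI[of _ P.R] exI[of _ z] conjI allI impI ballI)
    show "continuous_linear_feedback L \<omega> K P.R" unfolding KW by (rule P.feedback_continuous_linear)
    show "weak_solution L \<mu> \<alpha> \<beta> \<gamma> r q \<omega> K P.R ye y0 z" by (rule ws)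
    show "AE x in torus L. z' t x = z t x" if "weak_solution L \<mu> \<alpha> \<beta> \<gamma> r q \<omega> K P.R ye y0 z'" "t \<ge> 0" for z' t
      unfolding z_def by (rule P.weak_solution_unique[OF that(1)[unfolded KW] z0' c' that(2)])
    show "regularity_class L r T z" if "T > 0" for T
      using ws that by (simp add: weak_solution_def)
    show "time_derivative_in_Lp_Vdual L \<tau> T ((r + 1) / r) z" if "0 < \<tau> \<and> \<tau> < T" for \<tau> T
      unfolding z_def[abs_def] by (rule P.curve_time_derivatives(2)[OF _ _ c(2)]) (use that in auto)
    show "((\<lambda>t. exp (\<delta> * t) * norm_Lp L 2 (z t)) \<longlongrightarrow> 0) at_top"
      unfolding z_def by (rule P.norm_Z_decay[OF _ c(3)]) simp_all
    show "z t \<in> K" for t unfolding z_def KW by (rule Z_in_K)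
  qed
qed

end
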